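(* Let $\lambda\in\mathbb{R}$, let $s\ge 0$ and $2\le p<\infty$, let $p'$ be defined by $\frac1p+\frac1{p'}=1$, and set $\gamma_p=\frac32+\frac1p\in(\frac32,2]$. Let $\xi\in H^{s,p'}(\mathbb{T})$ be a real-valued potential on $\mathbb{T}=(-\pi,\pi)$. Then the Cauchy problem $$i\partial_t u+\partial_{xx}u+\xi u=\lambda|u|^2u\quad (x\in\mathbb{T},\ t>0),\qquad u(0,x)=u_0(x),$$ is locally well-posed in $H^{s+\gamma_p}(\mathbb{T})$.
   Context: $\mathbb{T}=(-\pi,\pi)$ is the one-dimensional torus (periodic boundary conditions); $u(t,x)$ is complex-valued. For $s\ge0$, $1\le r\le\infty$, $H^{s,r}(\mathbb{T})=\{f:\ \|f\|_{L^r(\mathbb{T})}+\|(-\partial_x^2)^{s/2}f\|_{L^r(\mathbb{T})}<\infty\}$. $H^\sigma(\mathbb{T})$ is the usual $L^2$-based Sobolev space. Solutions (strong solutions) are understood through Duhamel's formula $u(t)=e^{it\partial_x^2}u_0+i\int_0^te^{i(t-\rho)\partial_x^2}\big(\xi u(\rho)-\lambda|u(\rho)|^2u(\rho)\big)\,d\rho$. Local well-posedness in a space $X_0$ means: (1) there is unconditional uniqueness in $C_t(I;X_0)$, i.e. two solutions in $C_t(I;X_0)$ with the same initial data coincide; (2) for every $u_0\in X_0$ there exists a strong solution $u[u_0]\in C_t(I;X_0)$ defined on a maximal time interval $I=[0,T_{\max})$, $T_{\max}\in(0,+\infty]$; (3) the solution map $u_0\mapsto u[u_0]$ is continuous from $X_0$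 to $X_0$ (i.e. $u_0\mapsto u[u_0](t)$ is continuous in $X_0$ at each time $t$ of existence). *)

theory Defs
  imports "HOL-Analysis.Analysis"
begin

text \<open>Functions on the torus are functions of type \<^typ>\<open>real \<Rightarrow> complex\<close>, of which only
  the restriction to the period cell matters, and that only up to null sets.\<close>

abbreviation torus :: "real measure" where
  "torus \<equiv> lebesgue_on {-pi<..<pi}"

text \<open>The Lebesgue spaces of finite exponent.\<close>

definition Lebesgue_space :: "real \<Rightarrow> (real \<Rightarrow> complex) set" where
  "Lebesgue_space r =
     {f \<in> borel_measurable torus. integrable torus (\<lambda>x. norm (f x) powr r)}"

definition fourier_coeff :: "(real \<Rightarrow> complex) \<Rightarrow> int \<Rightarrow> complex" where
  "fourier_coeff f k = (1 / (2 * pi)) * (\<integral>x. f x * cis (- (of_int k * x)) \<partial>torus)"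

text \<open>The Fourier symbol of \<open>(-\<partial>\<^sub>x\<^sup>2)\<^bsup>s/2\<^esup>\<close>. The case \<open>s = 0\<close>, the identity
  operator, is separated because \<open>0 powr 0 = 0\<close> in HOL.\<close>

definition frac_laplace_symbol :: "real \<Rightarrow> int \<Rightarrow> real" where
  "frac_laplace_symbol s k = (if s = 0 then 1 else \<bar>of_int k\<bar> powr s)"

text \<open>\<open>H\<^bsup>s,r\<^esup>\<close> for finite \<open>r\<close>: the periodic distribution \<open>(-\<partial>\<^sub>x\<^sup>2)\<^bsup>s/2\<^esup> f\<close> is
  represented by some \<open>g \<in> L\<^sup>r\<close>, i.e. \<open>g\<close> has its Fourier coefficients.\<close>

definition Sobolev_space_Lr :: "real \<Rightarrow> real \<Rightarrow> (real \<Rightarrow> complex) set" where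
  "Sobolev_space_Lr s r =
     {f \<in> Lebesgue_space r. \<exists>g \<in> Lebesgue_space r.
        \<forall>k. fourier_coeff g k = of_real (frac_laplace_symbol s k) * fourier_coeff f k}"

definition Sobolev_space :: "real \<Rightarrow> (real \<Rightarrow> complex) set" where
  "Sobolev_space \<sigma> =
     {f \<in> Lebesgue_space 2.
        (\<lambda>k::int. (1 + (of_int k)\<^sup>2) powr \<sigma> * (norm (fourier_coeff f k))\<^sup>2) summable_on UNIV}"

definition Sobolev_norm :: "real \<Rightarrow> (real \<Rightarrow> complex) \<Rightarrow> real" where
  "Sobolev_norm \<sigma> f =
     sqrt (\<Sum>\<^sub>\<infinity>k::int. (1 + (of_int k)\<^sup>2) powr \<sigma> * (norm (fourier_coeff f k))\<^sup>2)"

abbreviation Sobolev_dist :: "real \<Rightarrow> (real \<Rightarrow> complex) \<Rightarrow> (real \<Rightarrow> complex) \<Rightarrow> real" where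
  "Sobolev_dist \<sigma> f g \<equiv> Sobolev_norm \<sigma> (\<lambda>x. f x - g x)"

definition Ct_Sobolev :: "real set \<Rightarrow> real \<Rightarrow> (real \<Rightarrow> real \<Rightarrow> complex) set" where
  "Ct_Sobolev I \<sigma> =
     {u. \<forall>t\<in>I. u t \<in> Sobolev_space \<sigma> \<and>
               ((\<lambda>\<tau>. Sobolev_dist \<sigma> (u \<tau>) (u t)) \<longlongrightarrow> 0) (at t within I)}"

text \<open>Periodic distributions are given by their Fourier coefficients. On these,
  \<open>e\<^bsup>it\<partial>\<^sub>x\<^sub>x\<^esup>\<close> is multiplication by \<open>e\<^bsup>-itk\<^sup>2\<^esup>\<close>.\<close>

definition schroedinger_group :: "real \<Rightarrow> (int \<Rightarrow> complex) \<Rightarrow> int \<Rightarrow> complex" where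
  "schroedinger_group t a k = cis (- (t * (of_int k)\<^sup>2)) * a k"

definition nls_rhs :: "(real \<Rightarrow> real) \<Rightarrow> real \<Rightarrow> (real \<Rightarrow> complex) \<Rightarrow> real \<Rightarrow> complex" where
  "nls_rhs \<xi> lam w x =
     of_real (\<xi> x) * w x - of_real lam * of_real ((norm (w x))\<^sup>2) * w x"

text \<open>Duhamel's formula at time \<open>t\<close>, as an identity of periodic distributions. For
  \<open>\<xi> \<in> L\<^bsup>r\<^esup>\<close> with \<open>r < 2\<close> the integrand takes values in a Sobolev space of negative
  order, so that neither it nor its time integral need be function-valued a priori; the
  integral is the weak one, computed on each Fourier mode.\<close>

definition duhamel ::
  "(real \<Rightarrow> real) \<Rightarrow> real \<Rightarrow> (real \<Rightarrow> complex) \<Rightarrow> (real \<Rightarrow> real \<Rightarrow> complex) \<Rightarrow> real \<Rightarrow> bool" where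
  "duhamel \<xi> lam u0 u t \<longleftrightarrow>
     (\<forall>k. (\<lambda>\<rho>. schroedinger_group (t - \<rho>) (fourier_coeff (nls_rhs \<xi> lam (u \<rho>))) k)
             absolutely_integrable_on {0..t} \<and>
          fourier_coeff (u t) k =
            schroedinger_group t (fourier_coeff u0) k +
            \<i> * integral {0..t}
                  (\<lambda>\<rho>. schroedinger_group (t - \<rho>)
                         (fourier_coeff (nls_rhs \<xi> lam (u \<rho>))) k))"

definition strong_solution ::
  "(real \<Rightarrow> real) \<Rightarrow> real \<Rightarrow> real \<Rightarrow> (real \<Rightarrow> complex) \<Rightarrow> real set
     \<Rightarrow> (real \<Rightarrow> real \<Rightarrow> complex) \<Rightarrow> bool" where
  "strong_solution \<xi> lam \<sigma> u0 I u \<longleftrightarrow>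
     u \<in> Ct_Sobolev I \<sigma> \<and> (\<forall>t\<in>I. duhamel \<xi> lam u0 u t)"

definition time_interval :: "real set \<Rightarrow> bool" where
  "time_interval I \<longleftrightarrow> is_interval I \<and> 0 \<in> I \<and> I \<subseteq> {0..}"

definition unconditional_uniqueness :: "(real \<Rightarrow> real) \<Rightarrow> real \<Rightarrow> real \<Rightarrow> bool" where
  "unconditional_uniqueness \<xi> lam \<sigma> \<longleftrightarrow>
     (\<forall>u0 \<in> Sobolev_space \<sigma>. \<forall>I u v.
        time_interval I \<and> strong_solution \<xi> lam \<sigma> u0 I u \<and> strong_solution \<xi> lam \<sigma> u0 I v
        \<longrightarrow> (\<forall>t\<in>I. AE x in torus. u t x = v t x))"

definition existence_interval :: "ereal \<Rightarrow> real set" where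
  "existence_interval T = {t. 0 \<le> t \<and> ereal t < T}"

text \<open>\<open>U u0\<close> is a solution on \<open>[0, Tmax u0)\<close>, and no solution with datum \<open>u0\<close> lives on an
  interval that is not contained in this one.\<close>

definition maximal_solution_map ::
  "(real \<Rightarrow> real) \<Rightarrow> real \<Rightarrow> real \<Rightarrow> ((real \<Rightarrow> complex) \<Rightarrow> ereal)
     \<Rightarrow> ((real \<Rightarrow> complex) \<Rightarrow> real \<Rightarrow> real \<Rightarrow> complex) \<Rightarrow> bool" where
  "maximal_solution_map \<xi> lam \<sigma> Tmax U \<longleftrightarrow>
     (\<forall>u0 \<in> Sobolev_space \<sigma>.
        0 < Tmax u0 \<and>
        strong_solution \<xi> lam \<sigma> u0 (existence_interval (Tmax u0)) (U u0) \<and>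
        (\<forall>I v. time_interval I \<and> strong_solution \<xi> lam \<sigma> u0 I v
           \<longrightarrow> I \<subseteq> existence_interval (Tmax u0)))"

text \<open>Continuity of \<open>u0 \<mapsto> U u0 t\<close> at every datum whose solution exists at time \<open>t\<close>;
  this includes that the solutions of nearby data exist at time \<open>t\<close>.\<close>

definition continuous_solution_map ::
  "real \<Rightarrow> ((real \<Rightarrow> complex) \<Rightarrow> ereal) \<Rightarrow> ((real \<Rightarrow> complex) \<Rightarrow> real \<Rightarrow> real \<Rightarrow> complex)
     \<Rightarrow> bool" where
  "continuous_solution_map \<sigma> Tmax U \<longleftrightarrow>
     (\<forall>u0 \<in> Sobolev_space \<sigma>. \<forall>t \<in> existence_interval (Tmax u0). \<forall>\<epsilon>>0. \<exists>\<delta>>0.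
        \<forall>v0 \<in> Sobolev_space \<sigma>. Sobolev_dist \<sigma> v0 u0 < \<delta> \<longrightarrow>
          t \<in> existence_interval (Tmax v0) \<and> Sobolev_dist \<sigma> (U v0 t) (U u0 t) < \<epsilon>)"

definition locally_well_posed :: "(real \<Rightarrow> real) \<Rightarrow> real \<Rightarrow> real \<Rightarrow> bool" where
  "locally_well_posed \<xi> lam \<sigma> \<longleftrightarrow>
     unconditional_uniqueness \<xi> lam \<sigma> \<and>
     (\<exists>Tmax U. maximal_solution_map \<xi> lam \<sigma> Tmax U \<and> continuous_solution_map \<sigma> Tmax U)"

end

theory Submission imports Defs begin

text \<open>Put \<open>\<sigma> = s + \<gamma>\<close> and \<open>\<tau> = \<sigma> - 2 = s - (1/2 - 1/p) > - 1/2\<close>. By the embedding of \<open>L\<^bsup>p'\<^esup>\<close> into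
  \<open>H\<^bsup>-(1/2-1/p)\<^esup>\<close>, dual to the Sobolev embedding, the potential lies in \<open>H\<^sup>\<tau>\<close>. Multiplication by \<open>\<xi>\<close>
  maps \<open>H\<^sup>\<sigma>\<close> only into \<open>H\<^sup>\<tau>\<close>, a loss of two derivatives. The equation is therefore considered for
  \<open>v = (M - \<partial>\<^sub>x\<^sub>x - \<xi>) u\<close>, which lies in \<open>H\<^sup>\<tau>\<close>, and there a normal form transformation removes the
  entries \<open>\<xi> (k - j)\<close> with \<open>\<bar>k\<^sup>2 - j\<^sup>2\<bar> \<ge> L\<close> at the cost of a bounded operator. So \<open>\<partial>\<^sub>x\<^sub>x + \<xi>\<close> on \<open>H\<^sup>\<sigma>\<close> is
  similar to a bounded perturbation of \<open>\<partial>\<^sub>x\<^sub>x\<close>, and as \<open>H\<^sup>\<sigma>\<close> is an algebra, existence and continuous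
  dependence follow from Picard iteration. Since \<open>\<xi>\<close> is real, unconditional uniqueness is a Gronwall
  argument for the \<open>L\<^sup>2\<close> norm of the difference of two solutions.\<close>

section \<open>The Hilbert space of square summable families\<close>

text \<open>The passage to \<open>v\<close> is forced by the normal form. Let K have the entries
  \<xi>(k - j) / (k^2 - j^2). On H^\<sigma> the two lost derivatives use up the whole gain of K,
  already in the column j = 0, and the remainder \<xi> K produced by the transformation would again
  lie only in H^\<tau>. On H^\<tau> the same K reaches some H^a with a > 1/2 and a \<ge> \<tau>,
  from where multiplication by \<xi> leads back into H^\<tau>, so that \<xi> K is bounded. As M -
  d^2/dx^2 - \<xi> commutes with the linear evolution, v solves the same linear equation as u. The
  time derivative of a solution does not take values in the space of the solution. The equation is
  therefore integrated in time, mode by mode (\<open>mode_solution\<close>), and the conjugation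
  identity is applied to time integrals. The transformation serves only to construct solutions, with
  the nonlinearity cut off outside a ball. The equation of an arbitrary solution is never
  transformed: uniqueness identifies that solution with a truncated flow, which also makes flows
  with different radii consistent and yields maximality.\<close>

typedef 'a ell2 = "{f :: 'a \<Rightarrow> complex. (\<lambda>i. (norm (f i))\<^sup>2) summable_on UNIV}"
  morphisms ell2_nth Abs_ell2
  by (rule exI[of _ "\<lambda>_. 0"]) simp

setup_lifting type_definition_ell2

lemma ell2_nth_summable: "(\<lambda>i. (norm (ell2_nth x i))\<^sup>2) summable_on UNIV"
  using ell2_nth[of x] by simp

lemma ell2_eqI: "(\<And>i. ell2_nth x i = ell2_nth y i) \<Longrightarrow> x = y"
  by (meson ell2_nth_inject ext)

lemma sq_summable_add:
  fixes f g :: "'a \<Rightarrow> complex"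
  assumes "(\<lambda>i. (norm (f i))\<^sup>2) summable_on UNIV" "(\<lambda>i. (norm (g i))\<^sup>2) summable_on UNIV"
  shows "(\<lambda>i. (norm (f i + g i))\<^sup>2) summable_on UNIV"
proof (rule summable_on_comparison_test)
  show "(\<lambda>i. 2 * (norm (f i))\<^sup>2 + 2 * (norm (g i))\<^sup>2) summable_on UNIV"
    by (intro summable_on_add summable_on_cmult_right assms)
  fix i
  have "(norm (f i + g i))\<^sup>2 \<le> (norm (f i) + norm (g i))\<^sup>2"
    by (intro power_mono norm_triangle_ineq) auto
  also have "\<dots> \<le> 2 * (norm (f i))\<^sup>2 + 2 * (norm (g i))\<^sup>2"
    using sum_squares_bound[of "norm (f i)" "norm (g i)"] by (simp add: power2_sum)
  finally show "(norm (f i + g i))\<^sup>2 \<le> 2 * (norm (f i))\<^sup>2 + 2 * (norm (g i))\<^sup>2" .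
qed auto

lemma sq_summable_mult:
  fixes f g :: "'a \<Rightarrow> complex"
  assumes "(\<lambda>i. (norm (f i))\<^sup>2) summable_on UNIV" "(\<lambda>i. (norm (g i))\<^sup>2) summable_on UNIV"
  shows "(\<lambda>i. norm (cnj (f i) * g i)) summable_on UNIV"
proof (rule summable_on_comparison_test)
  show "(\<lambda>i. (norm (f i))\<^sup>2 + (norm (g i))\<^sup>2) summable_on UNIV"
    by (intro summable_on_add assms)
  fix i
  have "2 * (norm (f i) * norm (g i)) \<le> (norm (f i))\<^sup>2 + (norm (g i))\<^sup>2"
    using sum_squares_bound[of "norm (f i)" "norm (g i)"] by simp
  moreover have "0 \<le> norm (f i) * norm (g i)" by simp
  ultimately show "norm (cnj (f i) * g i) \<le> (norm (f i))\<^sup>2 + (norm (g i))\<^sup>2"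
    by (simp only: norm_mult complex_mod_cnj)
qed auto

lemma sq_summable_scale:
  fixes f :: "'a \<Rightarrow> complex"
  assumes "(\<lambda>i. (norm (f i))\<^sup>2) summable_on UNIV" "\<And>i. norm (g i) \<le> C * norm (f i)"
  shows "(\<lambda>i. (norm (g i :: complex))\<^sup>2) summable_on UNIV"
proof (rule summable_on_comparison_test)
  show "(\<lambda>i. C\<^sup>2 * (norm (f i))\<^sup>2) summable_on UNIV"
    by (intro summable_on_cmult_right assms)
  show "(norm (g i))\<^sup>2 \<le> C\<^sup>2 * (norm (f i))\<^sup>2" for i
    using power_mono[OF assms(2)[of i], of 2] by (simp add: power_mult_distrib)
qed auto

instantiation ell2 :: (type) real_vector
begin

lift_definition zero_ell2 :: "'a ell2" is "\<lambda>_. 0" by simp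
lift_definition plus_ell2 :: "'a ell2 \<Rightarrow> 'a ell2 \<Rightarrow> 'a ell2" is "\<lambda>f g i. f i + g i"
  by (auto intro: sq_summable_add)
lift_definition uminus_ell2 :: "'a ell2 \<Rightarrow> 'a ell2" is "\<lambda>f i. - f i" by simp
lift_definition minus_ell2 :: "'a ell2 \<Rightarrow> 'a ell2 \<Rightarrow> 'a ell2" is "\<lambda>f g i. f i - g i"
proof -
  fix f g :: "'a \<Rightarrow> complex"
  assume "(\<lambda>i. (norm (f i))\<^sup>2) summable_on UNIV" "(\<lambda>i. (norm (g i))\<^sup>2) summable_on UNIV"
  thus "(\<lambda>i. (norm (f i - g i))\<^sup>2) summable_on UNIV"
    using sq_summable_add[of f "\<lambda>i. - g i"] by simp
qed
lift_definition scaleR_ell2 :: "real \<Rightarrow> 'a ell2 \<Rightarrow> 'a ell2" is "\<lambda>r f i. r *\<^sub>R f i"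
  by (simp add: power_mult_distrib summable_on_cmult_right)

instance by (intro_classes; transfer) (simp_all add: fun_eq_iff scaleR_add_right scaleR_add_left add.assoc add.commute)

end

instantiation ell2 :: (type) real_inner
begin

lift_definition inner_ell2 :: "'a ell2 \<Rightarrow> 'a ell2 \<Rightarrow> real"
  is "\<lambda>f g. Re (\<Sum>\<^sub>\<infinity>i. cnj (f i) * g i)" .

definition norm_ell2 :: "'a ell2 \<Rightarrow> real" where "norm_ell2 x = sqrt (inner x x)"
definition sgn_ell2 :: "'a ell2 \<Rightarrow> 'a ell2" where "sgn_ell2 x = x /\<^sub>R norm x"
definition dist_ell2 :: "'a ell2 \<Rightarrow> 'a ell2 \<Rightarrow> real" where "dist_ell2 x y = norm (x - y)"
definition uniformity_ell2 :: "('a ell2 \<times> 'a ell2) filter" where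
  "uniformity_ell2 = (INF e\<in>{0 <..}. principal {(x, y). dist x y < e})"
definition open_ell2 :: "'a ell2 set \<Rightarrow> bool" where
  "open_ell2 U \<longleftrightarrow> (\<forall>x\<in>U. eventually (\<lambda>(x', y). x' = x \<longrightarrow> y \<in> U) uniformity)"

lemma ell2_mult_summable: "(\<lambda>i. cnj (ell2_nth x i) * ell2_nth y i) summable_on UNIV"
  by (rule abs_summable_summable, rule sq_summable_mult; rule ell2_nth_summable)

lemma inner_ell2_self: "inner x x = (\<Sum>\<^sub>\<infinity>i. (norm (ell2_nth x i))\<^sup>2)"
proof -
  have "cnj z * z = of_real ((norm z)\<^sup>2)" for z
    by (metis complex_norm_square mult.commute)
  hence "inner x x = Re (\<Sum>\<^sub>\<infinity>i. of_real ((norm (ell2_nth x i))\<^sup>2))"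
    unfolding inner_ell2.rep_eq by presburger
  also have "\<dots> = (\<Sum>\<^sub>\<infinity>i. Re (of_real ((norm (ell2_nth x i))\<^sup>2)))"
    by (rule infsum_Re[symmetric], rule summable_on_of_real, rule ell2_nth_summable)
  finally show ?thesis by simp
qed

instance
proof
  fix x y z :: "'a ell2" and r :: real
  show "inner x y = inner y x"
  proof -
    have "(\<Sum>\<^sub>\<infinity>i. cnj (ell2_nth y i) * ell2_nth x i) = (\<Sum>\<^sub>\<infinity>i. cnj (cnj (ell2_nth x i) * ell2_nth y i))"
      by (simp add: mult.commute)
    also have "\<dots> = cnj (\<Sum>\<^sub>\<infinity>i. cnj (ell2_nth x i) * ell2_nth y i)" by (rule infsum_cnj)
    finally show ?thesis by (simp add: inner_ell2.rep_eq)
  qed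
  show "inner (x + y) z = inner x z + inner y z"
    unfolding inner_ell2.rep_eq plus_ell2.rep_eq complex_cnj_add distrib_right
    by (subst infsum_add[OF ell2_mult_summable ell2_mult_summable]) simp
  show "inner (r *\<^sub>R x) y = r * inner x y"
    by (simp add: inner_ell2.rep_eq scaleR_ell2.rep_eq scaleR_conv_of_real mult.assoc infsum_cmult_right')
  show "0 \<le> inner x x" unfolding inner_ell2_self by (intro infsum_nonneg) auto
  show "(inner x x = 0) = (x = 0)"
  proof
    assume "inner x x = 0"
    hence "(norm (ell2_nth x i))\<^sup>2 = 0" for i
      unfolding inner_ell2_self
      by (intro nonneg_infsum_le_0D[OF _ ell2_nth_summable[of x]]) auto
    thus "x = 0" by (intro ell2_eqI) (simp add: zero_ell2.rep_eq)
  qed (simp add: inner_ell2.rep_eq zero_ell2.rep_eq)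
qed (simp_all add: norm_ell2_def sgn_ell2_def dist_ell2_def uniformity_ell2_def open_ell2_def)

end

lemmas ell2_nth_simps [simp] =
  zero_ell2.rep_eq plus_ell2.rep_eq minus_ell2.rep_eq uminus_ell2.rep_eq scaleR_ell2.rep_eq

lemma norm_ell2_sq: "(norm x)\<^sup>2 = (\<Sum>\<^sub>\<infinity>i. (norm (ell2_nth x i))\<^sup>2)"
  by (simp add: norm_ell2_def inner_ell2_self infsum_nonneg)

lemma sum_le_norm_ell2_sq: "finite F \<Longrightarrow> (\<Sum>i\<in>F. (norm (ell2_nth x i))\<^sup>2) \<le> (norm x)\<^sup>2"
  unfolding norm_ell2_sq by (rule finite_sum_le_infsum[OF ell2_nth_summable]) auto

lemma norm_ell2_leI:
  assumes "0 \<le> C" "\<And>F. finite F \<Longrightarrow> (\<Sum>i\<in>F. (norm (ell2_nth x i))\<^sup>2) \<le> C\<^sup>2"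
  shows "norm x \<le> C"
proof -
  have "(norm x)\<^sup>2 \<le> C\<^sup>2" unfolding norm_ell2_sq
    by (rule infsum_le_finite_sums[OF ell2_nth_summable]) (use assms in auto)
  thus ?thesis using assms(1) power2_le_imp_le by blast
qed

lemma norm_ell2_nth_le: "norm (ell2_nth x i) \<le> norm x"
  by (rule power2_le_imp_le) (use sum_le_norm_ell2_sq[of "{i}" x] in auto)

lemma bounded_linear_ell2_nth: "bounded_linear (\<lambda>x. ell2_nth x i)"
  by (rule bounded_linear_intro[where K = 1]) (auto simp: norm_ell2_nth_le)

text \<open>The default \<open>0\<close> makes the map total. Every operator below is defined
  through it, so a formula for its coordinates always rests on a proof of square summability via
  \<open>ell2_nth_to_ell2\<close>.\<close>

definition to_ell2 :: "('a \<Rightarrow> complex) \<Rightarrow> 'a ell2" where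
  "to_ell2 f = (if (\<lambda>i. (norm (f i))\<^sup>2) summable_on UNIV then Abs_ell2 f else 0)"

lemma ell2_nth_to_ell2: "(\<lambda>i. (norm (f i))\<^sup>2) summable_on UNIV \<Longrightarrow> ell2_nth (to_ell2 f) = f"
  by (simp add: to_ell2_def Abs_ell2_inverse)

lemma sq_summable_finite_bound:
  fixes f :: "'a \<Rightarrow> complex"
  assumes "\<And>F. finite F \<Longrightarrow> (\<Sum>i\<in>F. (norm (f i))\<^sup>2) \<le> C"
  shows "(\<lambda>i. (norm (f i))\<^sup>2) summable_on UNIV"
  by (rule nonneg_bounded_partial_sums_imp_summable_on[of _ _ C]) (use assms in auto)

text \<open>Limits are taken in each coordinate. The Cauchy bound survives on every finite set of
  coordinates with a constant independent of the set, which gives both membership of the limit and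
  convergence in norm.\<close>

instance ell2 :: (type) banach
proof
  fix X :: "nat \<Rightarrow> 'a ell2"
  assume X: "Cauchy X"
  have "Cauchy (\<lambda>n. ell2_nth (X n) i)" for i
    using bounded_linear.Cauchy[OF bounded_linear_ell2_nth X] .
  hence "\<exists>L. \<forall>i. (\<lambda>n. ell2_nth (X n) i) \<longlonglongrightarrow> L i"
    unfolding Cauchy_convergent_iff convergent_def by (rule choice[OF allI])
  then obtain L where L: "\<And>i. (\<lambda>n. ell2_nth (X n) i) \<longlonglongrightarrow> L i"
    by blast
  have *: "\<exists>N. \<forall>n\<ge>N. \<forall>F. finite F \<longrightarrow> (\<Sum>i\<in>F. (norm (L i - ell2_nth (X n) i))\<^sup>2) \<le> e\<^sup>2" if e: "e > 0" for e
  proof -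
    obtain N where N: "\<And>m n. m \<ge> N \<Longrightarrow> n \<ge> N \<Longrightarrow> norm (X m - X n) < e"
      using X e unfolding Cauchy_def dist_norm by blast
    have "(\<Sum>i\<in>F. (norm (L i - ell2_nth (X n) i))\<^sup>2) \<le> e\<^sup>2" if n: "n \<ge> N" and F: "finite F" for n F
    proof (rule LIMSEQ_le_const2)
      show "(\<lambda>m. \<Sum>i\<in>F. (norm (ell2_nth (X m) i - ell2_nth (X n) i))\<^sup>2)
              \<longlonglongrightarrow> (\<Sum>i\<in>F. (norm (L i - ell2_nth (X n) i))\<^sup>2)"
        by (intro tendsto_intros L)
      have "(\<Sum>i\<in>F. (norm (ell2_nth (X m) i - ell2_nth (X n) i))\<^sup>2) \<le> e\<^sup>2" if "m \<ge> N" for m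
      proof -
        have "(\<Sum>i\<in>F. (norm (ell2_nth (X m) i - ell2_nth (X n) i))\<^sup>2) \<le> (norm (X m - X n))\<^sup>2"
          using sum_le_norm_ell2_sq[OF F, of "X m - X n"] by simp
        also have "\<dots> \<le> e\<^sup>2" using N[OF that n] by (intro power_mono) auto
        finally show ?thesis .
      qed
      thus "\<exists>N. \<forall>m\<ge>N. (\<Sum>i\<in>F. (norm (ell2_nth (X m) i - ell2_nth (X n) i))\<^sup>2) \<le> e\<^sup>2" by blast
    qed
    thus ?thesis by blast
  qed
  obtain N where N: "\<And>F. finite F \<Longrightarrow> (\<Sum>i\<in>F. (norm (L i - ell2_nth (X N) i))\<^sup>2) \<le> 1\<^sup>2"
    using *[OF zero_less_one] by blast
  have "(\<lambda>i. (norm (L i - ell2_nth (X N) i))\<^sup>2) summable_on UNIV"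
    using N by (rule sq_summable_finite_bound)
  from sq_summable_add[OF this ell2_nth_summable[of "X N"]]
  have nth: "ell2_nth (to_ell2 L) = L" by (intro ell2_nth_to_ell2) simp
  have "X \<longlonglongrightarrow> to_ell2 L"
  proof (rule metric_LIMSEQ_I)
    fix e :: real assume e: "e > 0"
    hence "e / 2 > 0" by simp
    from *[OF this] obtain N where
      N: "\<And>n F. n \<ge> N \<Longrightarrow> finite F \<Longrightarrow> (\<Sum>i\<in>F. (norm (L i - ell2_nth (X n) i))\<^sup>2) \<le> (e/2)\<^sup>2"
      by blast
    have "dist (X n) (to_ell2 L) < e" if "n \<ge> N" for n
    proof -
      have "norm (to_ell2 L - X n) \<le> e/2"
        using e N[OF that] by (intro norm_ell2_leI) (auto simp: nth)
      thus ?thesis using e by (simp add: dist_norm norm_minus_commute)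
    qed
    thus "\<exists>N. \<forall>n\<ge>N. dist (X n) (to_ell2 L) < e" by blast
  qed
  thus "convergent X" by (auto simp: convergent_def)
qed

section \<open>Matrix operators\<close>

text \<open>This bounds the matrix of absolute values, tested on nonnegative finite families. It is
  stronger than boundedness on square summable sequences, but it is monotone in the absolute values
  of the entries and makes all row series converge absolutely, so weights can be estimated entry by
  entry.\<close>

definition mat_bounded :: "('a \<Rightarrow> 'a \<Rightarrow> complex) \<Rightarrow> real \<Rightarrow> bool" where
  "mat_bounded A C \<longleftrightarrow> 0 \<le> C \<and>
     (\<forall>F x y. finite F \<longrightarrow> (\<forall>i. 0 \<le> x i) \<longrightarrow> (\<forall>i. 0 \<le> y i) \<longrightarrow>
        (\<Sum>k\<in>F. \<Sum>j\<in>F. norm (A k j) * x j * y k) \<le> C * L2_set x F * L2_set y F)"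

definition mat_op :: "('a \<Rightarrow> 'a \<Rightarrow> complex) \<Rightarrow> 'a ell2 \<Rightarrow> 'a ell2" where
  "mat_op A x = to_ell2 (\<lambda>k. \<Sum>\<^sub>\<infinity>j. A k j * ell2_nth x j)"

lemma mat_boundedD:
  assumes "mat_bounded A C" "finite F" "\<And>i. 0 \<le> x i" "\<And>i. 0 \<le> y i"
  shows "(\<Sum>k\<in>F. \<Sum>j\<in>F. norm (A k j) * x j * y k) \<le> C * L2_set x F * L2_set y F"
  using assms unfolding mat_bounded_def by blast

lemma mat_bounded_nonneg: "mat_bounded A C \<Longrightarrow> 0 \<le> C"
  by (simp add: mat_bounded_def)

lemma L2_set_le_norm_ell2: "finite F \<Longrightarrow> L2_set (\<lambda>i. norm (ell2_nth x i)) F \<le> norm x"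
  unfolding L2_set_def by (rule real_le_lsqrt) (auto intro: sum_nonneg sum_le_norm_ell2_sq)

text \<open>Both test families are extended by zero to \<open>K \<union> J\<close>. Different sets
  for rows and columns are needed when a single row, or a finite set of rows with all columns, is
  considered.\<close>

lemma mat_bounded_rect:
  assumes A: "mat_bounded A C" and fin: "finite K" "finite J"
    and nn: "\<And>i. 0 \<le> x i" "\<And>i. 0 \<le> y i"
  shows "(\<Sum>k\<in>K. \<Sum>j\<in>J. norm (A k j) * x j * y k) \<le> C * L2_set x J * L2_set y K"
proof -
  let ?F = "K \<union> J"
  let ?x = "\<lambda>j. if j \<in> J then x j else 0" and ?y = "\<lambda>k. if k \<in> K then y k else 0"
  have "(\<Sum>k\<in>K. \<Sum>j\<in>J. norm (A k j) * x j * y k) = (\<Sum>k\<in>?F. \<Sum>j\<in>?F. norm (A k j) * ?x j * ?y k)"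
    using fin by (intro sum.mono_neutral_cong_left) (auto intro!: sum.mono_neutral_cong_left)
  also have "\<dots> \<le> C * L2_set ?x ?F * L2_set ?y ?F"
    by (rule mat_boundedD[OF A]) (use fin nn in auto)
  also have "L2_set ?x ?F = L2_set x J"
    unfolding L2_set_def using fin
    by (intro arg_cong[where f = sqrt] sum.mono_neutral_cong_right) auto
  also have "L2_set ?y ?F = L2_set y K"
    unfolding L2_set_def using fin
    by (intro arg_cong[where f = sqrt] sum.mono_neutral_cong_right) auto
  finally show ?thesis .
qed

lemma mat_row_abs_summable:
  fixes A :: "'a \<Rightarrow> 'a \<Rightarrow> complex"
  assumes A: "mat_bounded A C"
  shows "(\<lambda>j. norm (A k j * ell2_nth x j)) summable_on UNIV"
proof (rule nonneg_bounded_partial_sums_imp_summable_on)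
  show "\<forall>\<^sub>F J in finite_subsets_at_top UNIV. (\<Sum>j\<in>J. norm (A k j * ell2_nth x j)) \<le> C * norm x"
  proof (rule eventually_finite_subsets_at_top_weakI)
    fix J :: "'a set" assume J: "finite J"
    have "(\<Sum>k'\<in>{k}. \<Sum>j\<in>J. norm (A k' j) * norm (ell2_nth x j) * 1)
            \<le> C * L2_set (\<lambda>j. norm (ell2_nth x j)) J * L2_set (\<lambda>_. 1) {k}"
      by (rule mat_bounded_rect[OF A]) (use J in auto)
    also have "\<dots> \<le> C * norm x"
      using L2_set_le_norm_ell2[OF J, of x] mat_bounded_nonneg[OF A]
      by (auto simp: mult_left_mono)
    finally show "(\<Sum>j\<in>J. norm (A k j * ell2_nth x j)) \<le> C * norm x"
      by (simp add: norm_mult)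
  qed
qed auto

lemma mat_row_summable:
  "mat_bounded A C \<Longrightarrow> (\<lambda>j. A k j * ell2_nth x j) summable_on UNIV"
  by (rule abs_summable_summable, rule mat_row_abs_summable)

lemma mat_op_partial:
  fixes A :: "'a \<Rightarrow> 'a \<Rightarrow> complex"
  assumes A: "mat_bounded A C" and K: "finite K"
  shows "(\<Sum>k\<in>K. (norm (\<Sum>\<^sub>\<infinity>j. A k j * ell2_nth x j))\<^sup>2) \<le> (C * norm x)\<^sup>2"
proof (rule tendsto_upperbound)
  show "((\<lambda>J. \<Sum>k\<in>K. (norm (\<Sum>j\<in>J. A k j * ell2_nth x j))\<^sup>2) \<longlongrightarrow>
          (\<Sum>k\<in>K. (norm (\<Sum>\<^sub>\<infinity>j. A k j * ell2_nth x j))\<^sup>2)) (finite_subsets_at_top UNIV)"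
    by (intro tendsto_intros infsum_tendsto mat_row_summable[OF A])
  show "\<forall>\<^sub>F J in finite_subsets_at_top UNIV.
          (\<Sum>k\<in>K. (norm (\<Sum>j\<in>J. A k j * ell2_nth x j))\<^sup>2) \<le> (C * norm x)\<^sup>2"
  proof (rule eventually_finite_subsets_at_top_weakI)
    fix J :: "'a set" assume J: "finite J"
    \<comment> \<open>Duality: the rows are tested against their own absolute values, which gives
      \<open>S * S \<le> C * norm x * S\<close>. The infinite rows are then reached as limits over
      finite \<open>J\<close>.\<close>
    define y where "y k = norm (\<Sum>j\<in>J. A k j * ell2_nth x j)" for k
    define S where "S = L2_set y K"
    have C: "C \<ge> 0" by (rule mat_bounded_nonneg[OF A])
    have S0: "S \<ge> 0" by (simp add: S_def)
    have S2: "S\<^sup>2 = (\<Sum>k\<in>K. (y k)\<^sup>2)" by (simp add: S_def L2_set_def sum_nonneg)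
    have "(\<Sum>k\<in>K. (y k)\<^sup>2) \<le> (\<Sum>k\<in>K. \<Sum>j\<in>J. norm (A k j) * norm (ell2_nth x j) * y k)"
    proof (rule sum_mono)
      fix k
      have "(y k)\<^sup>2 = y k * y k" by (simp add: power2_eq_square)
      also have "\<dots> \<le> (\<Sum>j\<in>J. norm (A k j) * norm (ell2_nth x j)) * y k"
        unfolding y_def by (intro mult_right_mono) (auto intro!: norm_sum[THEN order_trans] simp: norm_mult)
      finally show "(y k)\<^sup>2 \<le> (\<Sum>j\<in>J. norm (A k j) * norm (ell2_nth x j) * y k)"
        by (simp add: sum_distrib_right)
    qed
    also have "\<dots> \<le> C * L2_set (\<lambda>j. norm (ell2_nth x j)) J * S"
      unfolding S_def by (rule mat_bounded_rect[OF A K J]) (auto simp: y_def)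
    also have "\<dots> \<le> C * norm x * S"
      using L2_set_le_norm_ell2[OF J, of x] C S0 by (intro mult_right_mono mult_left_mono) auto
    finally have "S * S \<le> (C * norm x) * S" unfolding S2[symmetric] by (simp add: power2_eq_square)
    hence "S \<le> C * norm x" using S0 C by (cases "S = 0") auto
    hence "S\<^sup>2 \<le> (C * norm x)\<^sup>2" using S0 by (intro power_mono)
    thus "(\<Sum>k\<in>K. (norm (\<Sum>j\<in>J. A k j * ell2_nth x j))\<^sup>2) \<le> (C * norm x)\<^sup>2"
      by (simp add: S2 y_def)
  qed
qed simp

lemma mat_op_nth:
  assumes "mat_bounded A C"
  shows "ell2_nth (mat_op A x) k = (\<Sum>\<^sub>\<infinity>j. A k j * ell2_nth x j)"
  unfolding mat_op_def
  by (subst ell2_nth_to_ell2, rule sq_summable_finite_bound, rule mat_op_partial[OF assms]) auto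

lemma mat_op_norm_le:
  assumes "mat_bounded A C"
  shows "norm (mat_op A x) \<le> C * norm x"
  by (rule norm_ell2_leI)
     (use mat_bounded_nonneg[OF assms] mat_op_partial[OF assms] in \<open>auto simp: mat_op_nth[OF assms]\<close>)

lemma bounded_linear_mat_op:
  assumes "mat_bounded A C"
  shows "bounded_linear (mat_op A)"
proof (rule bounded_linear_intro)
  fix x y and r :: real
  show "mat_op A (x + y) = mat_op A x + mat_op A y"
    by (rule ell2_eqI)
       (simp add: mat_op_nth[OF assms] distrib_left infsum_add[OF mat_row_summable[OF assms] mat_row_summable[OF assms]])
  show "mat_op A (r *\<^sub>R x) = r *\<^sub>R mat_op A x"
    by (rule ell2_eqI)
       (simp add: mat_op_nth[OF assms] infsum_scaleR_right)
  show "norm (mat_op A x) \<le> norm x * C"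
    using mat_op_norm_le[OF assms] by (simp add: mult.commute)
qed

lemma mat_bounded_mono:
  fixes A B :: "'a \<Rightarrow> 'a \<Rightarrow> complex"
  assumes "mat_bounded B C" "\<And>k j. norm (A k j) \<le> norm (B k j)"
  shows "mat_bounded A C"
  unfolding mat_bounded_def
proof (intro conjI allI impI mat_bounded_nonneg[OF assms(1)])
  fix F :: "'a set" and x y :: "'a \<Rightarrow> real"
  assume *: "finite F" "\<forall>i. 0 \<le> x i" "\<forall>i. 0 \<le> y i"
  have "(\<Sum>k\<in>F. \<Sum>j\<in>F. norm (A k j) * x j * y k) \<le> (\<Sum>k\<in>F. \<Sum>j\<in>F. norm (B k j) * x j * y k)"
    by (intro sum_mono mult_right_mono assms(2)) (use * in auto)
  also have "\<dots> \<le> C * L2_set x F * L2_set y F"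
    by (rule mat_boundedD[OF assms(1)]) (use * in auto)
  finally show "(\<Sum>k\<in>F. \<Sum>j\<in>F. norm (A k j) * x j * y k) \<le> C * L2_set x F * L2_set y F" .
qed

lemma mat_bounded_add:
  fixes A B :: "'a \<Rightarrow> 'a \<Rightarrow> complex"
  assumes "mat_bounded A C" "mat_bounded B D"
    and "\<And>k j. norm (E k j) \<le> norm (A k j) + norm (B k j)"
  shows "mat_bounded E (C + D)"
  unfolding mat_bounded_def
proof (intro conjI allI impI)
  show "0 \<le> C + D" using assms(1,2)[THEN mat_bounded_nonneg] by simp
  fix F :: "'a set" and x y :: "'a \<Rightarrow> real"
  assume *: "finite F" "\<forall>i. 0 \<le> x i" "\<forall>i. 0 \<le> y i"
  have "(\<Sum>k\<in>F. \<Sum>j\<in>F. norm (E k j) * x j * y k)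
          \<le> (\<Sum>k\<in>F. \<Sum>j\<in>F. (norm (A k j) + norm (B k j)) * x j * y k)"
    by (intro sum_mono mult_right_mono assms(3)) (use * in auto)
  also have "\<dots> = (\<Sum>k\<in>F. \<Sum>j\<in>F. norm (A k j) * x j * y k) + (\<Sum>k\<in>F. \<Sum>j\<in>F. norm (B k j) * x j * y k)"
    by (simp add: algebra_simps sum.distrib)
  also have "\<dots> \<le> C * L2_set x F * L2_set y F + D * L2_set x F * L2_set y F"
    by (intro add_mono mat_boundedD assms(1,2)) (use * in auto)
  finally show "(\<Sum>k\<in>F. \<Sum>j\<in>F. norm (E k j) * x j * y k) \<le> (C + D) * L2_set x F * L2_set y F"
    by (simp add: algebra_simps)
qed

lemma mat_bounded_scale:
  fixes A B :: "'a \<Rightarrow> 'a \<Rightarrow> complex"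
  assumes "mat_bounded A C" "0 \<le> r" "\<And>k j. norm (B k j) \<le> r * norm (A k j)"
  shows "mat_bounded B (r * C)"
  unfolding mat_bounded_def
proof (intro conjI allI impI)
  show "0 \<le> r * C" using assms(2) mat_bounded_nonneg[OF assms(1)] by simp
  fix F :: "'a set" and x y :: "'a \<Rightarrow> real"
  assume *: "finite F" "\<forall>i. 0 \<le> x i" "\<forall>i. 0 \<le> y i"
  have "(\<Sum>k\<in>F. \<Sum>j\<in>F. norm (B k j) * x j * y k) \<le> (\<Sum>k\<in>F. \<Sum>j\<in>F. r * norm (A k j) * x j * y k)"
    by (intro sum_mono mult_right_mono assms(3)) (use * in auto)
  also have "\<dots> = r * (\<Sum>k\<in>F. \<Sum>j\<in>F. norm (A k j) * x j * y k)"
    by (simp add: sum_distrib_left mult.assoc)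
  also have "\<dots> \<le> r * (C * L2_set x F * L2_set y F)"
    by (intro mult_left_mono mat_boundedD assms) (use * in auto)
  finally show "(\<Sum>k\<in>F. \<Sum>j\<in>F. norm (B k j) * x j * y k) \<le> r * C * L2_set x F * L2_set y F"
    by (simp add: mult.assoc)
qed

section \<open>Boundedness tests for matrices, by Cauchy-Schwarz\<close>

lemma sum_product_CS:
  fixes f g :: "'a \<Rightarrow> 'a \<Rightarrow> real"
  assumes "(\<Sum>k\<in>F. \<Sum>j\<in>F. (f k j)\<^sup>2) \<le> a\<^sup>2" "(\<Sum>k\<in>F. \<Sum>j\<in>F. (g k j)\<^sup>2) \<le> b\<^sup>2"
    and "0 \<le> a" "0 \<le> b"
  shows "(\<Sum>k\<in>F. \<Sum>j\<in>F. f k j * g k j) \<le> a * b"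
proof -
  let ?f = "\<lambda>(k, j). f k j" and ?g = "\<lambda>(k, j). g k j"
  have sq: "L2_set (\<lambda>(k, j). h k j) (F \<times> F) = sqrt (\<Sum>k\<in>F. \<Sum>j\<in>F. (h k j)\<^sup>2)" for h :: "'a \<Rightarrow> 'a \<Rightarrow> real"
    by (simp add: L2_set_def sum.cartesian_product case_prod_unfold)
  have "(\<Sum>k\<in>F. \<Sum>j\<in>F. f k j * g k j) = (\<Sum>z\<in>F \<times> F. ?f z * ?g z)"
    by (simp add: sum.cartesian_product case_prod_unfold)
  also have "\<dots> \<le> (\<Sum>z\<in>F \<times> F. \<bar>?f z\<bar> * \<bar>?g z\<bar>)"
    by (intro sum_mono) (simp flip: abs_mult)
  also have "\<dots> \<le> L2_set ?f (F \<times> F) * L2_set ?g (F \<times> F)"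
    by (rule L2_set_mult_ineq)
  also have "\<dots> \<le> a * b"
    unfolding sq by (intro mult_mono real_le_lsqrt real_sqrt_ge_zero sum_nonneg assms zero_le_power2)
  finally show ?thesis .
qed

lemma L2_set_sq: "(L2_set x F)\<^sup>2 = (\<Sum>i\<in>F. (x i)\<^sup>2)"
  by (simp add: L2_set_def sum_nonneg)

text \<open>The square root of each entry is given to either test family; the row sums then control
  one factor and the column sums the other.\<close>

lemma Schur_test:
  fixes A :: "'a \<Rightarrow> 'a \<Rightarrow> complex"
  assumes C: "0 \<le> C"
    and row: "\<And>k J. finite J \<Longrightarrow> (\<Sum>j\<in>J. norm (A k j)) \<le> C"
    and col: "\<And>j K. finite K \<Longrightarrow> (\<Sum>k\<in>K. norm (A k j)) \<le> C"
  shows "mat_bounded A C"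
  unfolding mat_bounded_def
proof (intro conjI allI impI C)
  fix F :: "'a set" and x y :: "'a \<Rightarrow> real"
  assume *: "finite F" "\<forall>i. 0 \<le> x i" "\<forall>i. 0 \<le> y i"
  have "(\<Sum>k\<in>F. \<Sum>j\<in>F. norm (A k j) * x j * y k)
      = (\<Sum>k\<in>F. \<Sum>j\<in>F. (sqrt (norm (A k j)) * x j) * (sqrt (norm (A k j)) * y k))"
    by (intro sum.cong) (auto simp: algebra_simps)
  also have "\<dots> \<le> (sqrt C * L2_set x F) * (sqrt C * L2_set y F)"
  proof (rule sum_product_CS)
    have "(\<Sum>k\<in>F. \<Sum>j\<in>F. (sqrt (norm (A k j)) * x j)\<^sup>2) = (\<Sum>j\<in>F. (\<Sum>k\<in>F. norm (A k j)) * (x j)\<^sup>2)"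
      by (subst sum.swap) (simp add: power_mult_distrib sum_distrib_right)
    also have "\<dots> \<le> (\<Sum>j\<in>F. C * (x j)\<^sup>2)" by (intro sum_mono mult_right_mono col *) auto
    finally show "(\<Sum>k\<in>F. \<Sum>j\<in>F. (sqrt (norm (A k j)) * x j)\<^sup>2) \<le> (sqrt C * L2_set x F)\<^sup>2"
      using C by (simp add: power_mult_distrib L2_set_sq sum_distrib_left)
    have "(\<Sum>k\<in>F. \<Sum>j\<in>F. (sqrt (norm (A k j)) * y k)\<^sup>2) = (\<Sum>k\<in>F. (\<Sum>j\<in>F. norm (A k j)) * (y k)\<^sup>2)"
      by (simp add: power_mult_distrib sum_distrib_right)
    also have "\<dots> \<le> (\<Sum>k\<in>F. C * (y k)\<^sup>2)" by (intro sum_mono mult_right_mono row *) auto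
    finally show "(\<Sum>k\<in>F. \<Sum>j\<in>F. (sqrt (norm (A k j)) * y k)\<^sup>2) \<le> (sqrt C * L2_set y F)\<^sup>2"
      using C by (simp add: power_mult_distrib L2_set_sq sum_distrib_left)
  qed (use C in auto)
  also have "\<dots> = (sqrt C * sqrt C) * L2_set x F * L2_set y F"
    by (simp only: mult_ac)
  finally show "(\<Sum>k\<in>F. \<Sum>j\<in>F. norm (A k j) * x j * y k) \<le> C * L2_set x F * L2_set y F"
    using C by simp
qed

lemma sum_shift_le:
  fixes X :: "int \<Rightarrow> real"
  assumes "\<And>G. finite G \<Longrightarrow> (\<Sum>m\<in>G. X m) \<le> C" "finite F" "inj_on h F"
  shows "(\<Sum>j\<in>F. X (h j)) \<le> C"
  using assms(1)[of "h ` F"] assms(2,3) by (simp add: sum.reindex)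

text \<open>Cauchy-Schwarz pairs \<open>W k j * x j\<close> with \<open>X (k - j) * y k\<close>. The
  first is summed over \<open>k\<close> in a column, the second over \<open>j\<close> in a row,
  where the sequence \<open>X\<close> merely gets shifted.\<close>

lemma mat_bounded_columns:
  fixes A :: "int \<Rightarrow> int \<Rightarrow> complex"
  assumes A: "\<And>k j. norm (A k j) \<le> X (k - j) * W k j"
    and X: "\<And>G. finite G \<Longrightarrow> (\<Sum>m\<in>G. (X m)\<^sup>2) \<le> C\<^sup>2"
    and W: "\<And>j K. finite K \<Longrightarrow> (\<Sum>k\<in>K. (W k j)\<^sup>2) \<le> D\<^sup>2"
    and nn: "0 \<le> C" "0 \<le> D"
  shows "mat_bounded A (C * D)"
  unfolding mat_bounded_def
proof (intro conjI allI impI)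
  fix F :: "int set" and x y :: "int \<Rightarrow> real"
  assume *: "finite F" "\<forall>i. 0 \<le> x i" "\<forall>i. 0 \<le> y i"
  have "(\<Sum>k\<in>F. \<Sum>j\<in>F. norm (A k j) * x j * y k)
      \<le> (\<Sum>k\<in>F. \<Sum>j\<in>F. (X (k - j) * W k j) * x j * y k)"
    by (intro sum_mono mult_right_mono A) (use * in auto)
  also have "\<dots> = (\<Sum>k\<in>F. \<Sum>j\<in>F. (W k j * x j) * (X (k - j) * y k))"
    by (intro sum.cong) (auto simp: algebra_simps)
  also have "\<dots> \<le> (D * L2_set x F) * (C * L2_set y F)"
  proof (rule sum_product_CS)
    have "(\<Sum>k\<in>F. \<Sum>j\<in>F. (W k j * x j)\<^sup>2) = (\<Sum>j\<in>F. (\<Sum>k\<in>F. (W k j)\<^sup>2) * (x j)\<^sup>2)"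
      by (subst sum.swap) (simp add: power_mult_distrib sum_distrib_right)
    also have "\<dots> \<le> (\<Sum>j\<in>F. D\<^sup>2 * (x j)\<^sup>2)" by (intro sum_mono mult_right_mono W *) auto
    finally show "(\<Sum>k\<in>F. \<Sum>j\<in>F. (W k j * x j)\<^sup>2) \<le> (D * L2_set x F)\<^sup>2"
      by (simp add: power_mult_distrib L2_set_sq sum_distrib_left)
    have "(\<Sum>k\<in>F. \<Sum>j\<in>F. (X (k - j) * y k)\<^sup>2) = (\<Sum>k\<in>F. (\<Sum>j\<in>F. (X (k - j))\<^sup>2) * (y k)\<^sup>2)"
      by (simp add: power_mult_distrib sum_distrib_right)
    also have "\<dots> \<le> (\<Sum>k\<in>F. C\<^sup>2 * (y k)\<^sup>2)"
    proof (rule sum_mono, rule mult_right_mono)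
      show "(\<Sum>j\<in>F. (X (k - j))\<^sup>2) \<le> C\<^sup>2" for k
        by (rule sum_shift_le[where X = "\<lambda>m. (X m)\<^sup>2"]) (use X *(1) in \<open>auto simp: inj_on_def\<close>)
    qed simp
    finally show "(\<Sum>k\<in>F. \<Sum>j\<in>F. (X (k - j) * y k)\<^sup>2) \<le> (C * L2_set y F)\<^sup>2"
      by (simp add: power_mult_distrib L2_set_sq sum_distrib_left)
  qed (use nn in auto)
  finally show "(\<Sum>k\<in>F. \<Sum>j\<in>F. norm (A k j) * x j * y k) \<le> C * D * L2_set x F * L2_set y F"
    by (simp add: algebra_simps)
qed (use nn in auto)

lemma mat_bounded_rows:
  fixes A :: "int \<Rightarrow> int \<Rightarrow> complex"
  assumes A: "\<And>k j. norm (A k j) \<le> X (k - j) * W k j"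
    and X: "\<And>G. finite G \<Longrightarrow> (\<Sum>m\<in>G. (X m)\<^sup>2) \<le> C\<^sup>2"
    and W: "\<And>k J. finite J \<Longrightarrow> (\<Sum>j\<in>J. (W k j)\<^sup>2) \<le> D\<^sup>2"
    and nn: "0 \<le> C" "0 \<le> D"
  shows "mat_bounded A (C * D)"
proof -
  have "mat_bounded (\<lambda>k j. A j k) (C * D)"
  proof (rule mat_bounded_columns[where X = "\<lambda>m. X (- m)" and W = "\<lambda>k j. W j k"])
    show "norm (A j k) \<le> X (- (k - j)) * W j k" for k j using A[of j k] by simp
    show "finite G \<Longrightarrow> (\<Sum>m\<in>G. (X (- m))\<^sup>2) \<le> C\<^sup>2" for G
      by (rule sum_shift_le[where X = "\<lambda>m. (X m)\<^sup>2"]) (use X in \<open>auto simp: inj_on_def\<close>)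
  qed (use assms in auto)
  hence "(\<Sum>k\<in>F. \<Sum>j\<in>F. norm (A k j) * x j * y k) \<le> C * D * L2_set x F * L2_set y F"
    if "finite F" "\<forall>i. 0 \<le> x i" "\<forall>i. 0 \<le> y i" for F and x y :: "int \<Rightarrow> real"
    using mat_boundedD[of "\<lambda>k j. A j k" "C * D" F y x] that
    by (subst sum.swap) (simp add: mult.assoc mult.commute mult.left_commute)
  thus ?thesis using nn unfolding mat_bounded_def by auto
qed

text \<open>Such a matrix is Hilbert-Schmidt: its entries are summed along the diagonals
  \<open>k - j = m\<close>, where \<open>X\<close> is constant, and then over
  \<open>m\<close>.\<close>

lemma mat_bounded_diagonals:
  fixes A :: "int \<Rightarrow> int \<Rightarrow> complex"
  assumes A: "\<And>k j. norm (A k j) \<le> X (k - j) * W k j"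
    and X: "\<And>G. finite G \<Longrightarrow> (\<Sum>m\<in>G. (X m)\<^sup>2) \<le> C\<^sup>2"
    and W: "\<And>m K. finite K \<Longrightarrow> (\<Sum>k\<in>K. (W k (k - m))\<^sup>2) \<le> D\<^sup>2"
    and nn: "0 \<le> C" "0 \<le> D"
  shows "mat_bounded A (C * D)"
  unfolding mat_bounded_def
proof (intro conjI allI impI)
  fix F :: "int set" and x y :: "int \<Rightarrow> real"
  assume *: "finite F" "\<forall>i. 0 \<le> x i" "\<forall>i. 0 \<le> y i"
  have "(\<Sum>k\<in>F. \<Sum>j\<in>F. norm (A k j) * x j * y k)
      \<le> (\<Sum>k\<in>F. \<Sum>j\<in>F. (X (k - j) * W k j) * x j * y k)"
    by (intro sum_mono mult_right_mono A) (use * in auto)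
  also have "\<dots> = (\<Sum>k\<in>F. \<Sum>j\<in>F. (X (k - j) * W k j) * (x j * y k))"
    by (intro sum.cong) (auto simp: algebra_simps)
  also have "\<dots> \<le> (C * D) * (L2_set x F * L2_set y F)"
  proof (rule sum_product_CS)
    let ?G = "(\<lambda>(k, j). k - j) ` (F \<times> F)"
    have "(\<Sum>k\<in>F. \<Sum>j\<in>F. (X (k - j) * W k j)\<^sup>2)
        = (\<Sum>k\<in>F. \<Sum>m\<in>(\<lambda>j. k - j) ` F. (X m * W k (k - m))\<^sup>2)"
      by (rule sum.cong[OF refl]) (simp add: sum.reindex inj_on_def)
    also have "\<dots> \<le> (\<Sum>k\<in>F. \<Sum>m\<in>?G. (X m * W k (k - m))\<^sup>2)"
      by (intro sum_mono sum_mono2) (use * in auto)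
    also have "\<dots> = (\<Sum>m\<in>?G. (X m)\<^sup>2 * (\<Sum>k\<in>F. (W k (k - m))\<^sup>2))"
      by (subst sum.swap) (simp add: power_mult_distrib sum_distrib_left)
    also have "\<dots> \<le> (\<Sum>m\<in>?G. (X m)\<^sup>2 * D\<^sup>2)"
      by (intro sum_mono mult_left_mono W *) auto
    also have "\<dots> \<le> C\<^sup>2 * D\<^sup>2"
      unfolding sum_distrib_right[symmetric] by (intro mult_right_mono X) (use * in auto)
    finally show "(\<Sum>k\<in>F. \<Sum>j\<in>F. (X (k - j) * W k j)\<^sup>2) \<le> (C * D)\<^sup>2"
      by (simp add: power_mult_distrib)
    have "(\<Sum>k\<in>F. \<Sum>j\<in>F. (x j * y k)\<^sup>2) = (\<Sum>j\<in>F. \<Sum>k\<in>F. (x j)\<^sup>2 * (y k)\<^sup>2)"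
      by (subst sum.swap) (simp add: power_mult_distrib)
    thus "(\<Sum>k\<in>F. \<Sum>j\<in>F. (x j * y k)\<^sup>2) \<le> (L2_set x F * L2_set y F)\<^sup>2"
      by (simp only: power_mult_distrib L2_set_sq sum_product order_refl)
  qed (use nn in auto)
  finally show "(\<Sum>k\<in>F. \<Sum>j\<in>F. norm (A k j) * x j * y k) \<le> C * D * L2_set x F * L2_set y F"
    by (simp add: algebra_simps)
qed (use nn in auto)

text \<open>The inverse of 1 - K is found as the fixed point of the contraction
  \<open>x \<mapsto> z + K x\<close>. Linearity of \<open>L\<close> follows from the injectivity of
  1 - K.\<close>

lemma Neumann_inverse:
  fixes K :: "'a::banach \<Rightarrow> 'a"
  assumes K: "bounded_linear K" "\<And>x. norm (K x) \<le> norm x / 2"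
  obtains L where "bounded_linear L" "\<And>x. L (x - K x) = x" "\<And>x. L x - K (L x) = x"
proof -
  interpret K: bounded_linear K by fact
  have inj: "x = y" if "x - K x = y - K y" for x y
  proof -
    have "K (x - y) = x - y" using that by (simp add: K.diff algebra_simps)
    hence "norm (x - y) \<le> norm (x - y) / 2" using K(2)[of "x - y"] by simp
    thus ?thesis by simp
  qed
  have "\<exists>!x. z + K x = x" for z
  proof -
    show ?thesis
    proof (rule banach_fix_type[of "1/2"])
      show "\<forall>x y. dist (z + K x) (z + K y) \<le> 1/2 * dist x y"
        using K(2) by (auto simp: dist_norm simp flip: K.diff)
    qed auto
  qed
  hence "\<exists>L. \<forall>z. z + K (L z) = L z" by (intro choice allI) blast
  then obtain L where L: "\<And>z. z + K (L z) = L z" by blast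
  have L2: "L z - K (L z) = z" for z using L[of z] by (simp add: diff_eq_eq)
  have L1: "L (x - K x) = x" for x by (rule inj) (rule L2)
  have "bounded_linear L"
  proof (rule bounded_linear_intro)
    show "L (x + y) = L x + L y" for x y
    proof (rule inj)
      have "L x + L y - K (L x + L y) = (L x - K (L x)) + (L y - K (L y))" by (simp add: K.add)
      thus "L (x + y) - K (L (x + y)) = L x + L y - K (L x + L y)" by (simp add: L2)
    qed
    show "L (r *\<^sub>R x) = r *\<^sub>R L x" for r x
      by (rule inj) (simp add: L2 K.scaleR flip: scaleR_diff_right)
    show "norm (L x) \<le> norm x * 2" for x
    proof -
      have "norm (L x) \<le> norm x + norm (K (L x))" using norm_triangle_ineq[of x "K (L x)"] by (simp add: L)
      with K(2)[of "L x"] show ?thesis by simp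
    qed
  qed
  with L1 L2 that show ?thesis by blast
qed

section \<open>Weights and convolution estimates\<close>

text \<open>The Japanese bracket.\<close>

definition jb :: "int \<Rightarrow> real" where "jb k = sqrt (1 + (of_int k)\<^sup>2)"

lemma jb_ge1 [simp]: "1 \<le> jb k" by (simp add: jb_def)
lemma jb_pos [simp]: "0 < jb k" using jb_ge1[of k] by linarith
lemma jb_nonneg [simp]: "0 \<le> jb k" using jb_pos[of k] by linarith
lemma jb_nonzero [simp]: "jb k \<noteq> 0" using jb_pos[of k] by linarith
lemma jb_minus [simp]: "jb (- k) = jb k" by (simp add: jb_def)
lemma jb_diff_commute: "jb (k - j) = jb (j - k)" using jb_minus[of "k - j"] by simp
lemma jb_sq: "(jb k)\<^sup>2 = 1 + (of_int k)\<^sup>2" by (simp add: jb_def)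

lemma jb_powr2: "(1 + (of_int k)\<^sup>2) powr s = (jb k powr s)\<^sup>2"
proof -
  have "(jb k)\<^sup>2 powr s = (jb k powr s)\<^sup>2" by (simp add: power2_eq_square powr_mult)
  thus ?thesis by (simp add: jb_sq)
qed

lemma abs_le_jb: "\<bar>of_int k\<bar> \<le> jb k"
  unfolding jb_def by (rule real_le_rsqrt) simp

lemma jb_triangle: "jb (k + j) \<le> jb k + jb j"
proof -
  have "jb (k + j) \<le> jb k + \<bar>of_int j\<bar>"
    using real_sqrt_sum_squares_triangle_ineq[of 1 0 "of_int k" "of_int j"] by (simp add: jb_def)
  thus ?thesis using abs_le_jb[of j] by linarith
qed

lemma jb_le_of_abs_le: "\<bar>k\<bar> \<le> \<bar>j\<bar> \<Longrightarrow> jb k \<le> jb j"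
  unfolding jb_def by (intro real_sqrt_le_mono add_left_mono)
    (simp add: abs_le_square_iff[symmetric] flip: of_int_abs)

text \<open>One of k - j and k + j arises from k by a step away from zero. Hence a large output
  frequency always forces one factor of k^2 - j^2 to be large.\<close>

lemma jb_le_max: "jb k \<le> max (jb (k - j)) (jb (k + j))"
proof -
  have "\<bar>k\<bar> \<le> \<bar>k - j\<bar> \<or> \<bar>k\<bar> \<le> \<bar>k + j\<bar>" by linarith
  thus ?thesis using jb_le_of_abs_le by (metis max.coboundedI1 max.coboundedI2)
qed

lemma jb_le_max': "jb j \<le> max (jb (k - j)) (jb (k + j))"
  using jb_le_max[of j k] by (simp add: jb_diff_commute add.commute)

lemma jb_le_2abs: "k \<noteq> 0 \<Longrightarrow> jb k \<le> 2 * \<bar>of_int k\<bar>"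
proof -
  assume "k \<noteq> 0"
  hence "1 \<le> \<bar>of_int k :: real\<bar>" by linarith
  hence "1 \<le> (of_int k :: real)\<^sup>2" using abs_le_square_iff[of 1 "of_int k :: real"] by simp
  thus ?thesis unfolding jb_def by (intro real_le_lsqrt) (auto simp: power_mult_distrib)
qed

lemma powr_add_le:
  fixes x y s :: real
  assumes "0 < x" "0 < y" "0 \<le> s"
  shows "(x + y) powr s \<le> 2 powr s * (x powr s + y powr s)"
proof -
  have "(x + y) powr s \<le> (2 * max x y) powr s"
    by (rule powr_mono2) (use assms in auto)
  also have "\<dots> = 2 powr s * max x y powr s" by (rule powr_mult)
  also have "\<dots> \<le> 2 powr s * (x powr s + y powr s)"
    by (rule mult_left_mono) (auto simp: max_def)
  finally show ?thesis .
qed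

lemma jb_powr_add_le:
  assumes "0 \<le> s" "k = i + j"
  shows "jb k powr s \<le> 2 powr s * (jb i powr s + jb j powr s)"
proof -
  have "jb k powr s \<le> (jb i + jb j) powr s"
    by (rule powr_mono2) (use assms jb_triangle in auto)
  also have "\<dots> \<le> 2 powr s * (jb i powr s + jb j powr s)"
    by (rule powr_add_le) (use assms in auto)
  finally show ?thesis .
qed

text \<open>The smaller of the two bases can carry the whole exponent p + q, so a product of weights
  is controlled by weights in a single variable.\<close>

lemma powr_min_le:
  fixes x y p q :: real
  assumes "1 \<le> x" "1 \<le> y" "0 \<le> p" "0 \<le> q"
  shows "x powr - p * y powr - q \<le> x powr - (p + q) + y powr - (p + q)"
proof (cases "x \<le> y")
  case True
  have "y powr - q \<le> x powr - q" by (rule powr_mono2') (use assms True in auto)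
  hence "x powr - p * y powr - q \<le> x powr - p * x powr - q" by (rule mult_left_mono) auto
  also have "\<dots> = x powr - (p + q)" by (simp flip: powr_add)
  finally show ?thesis by (simp add: add_increasing add_increasing2)
next
  case False
  have "x powr - p \<le> y powr - p" by (rule powr_mono2') (use assms False in auto)
  hence "x powr - p * y powr - q \<le> y powr - p * y powr - q" by (rule mult_right_mono) auto
  also have "\<dots> = y powr - (p + q)" by (simp flip: powr_add)
  finally show ?thesis by (simp add: add_increasing add_increasing2)
qed

lemma summable_on_int:
  fixes f :: "int \<Rightarrow> real"
  assumes "(\<lambda>n. f (int n)) summable_on UNIV" "(\<lambda>n. f (- int n)) summable_on UNIV"
    and nn: "\<And>k. 0 \<le> f k"
  shows "f summable_on UNIV"
proof -
  have "f summable_on range int" "f summable_on range (\<lambda>n. - int n)"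
    using assms by (subst summable_on_reindex; simp add: inj_def o_def)+
  hence "f summable_on range int \<union> (range (\<lambda>n. - int n) - range int)"
    by (intro summable_on_Un_disjoint) (auto intro: summable_on_subset_banach)
  also have "range int \<union> (range (\<lambda>n. - int n) - range int) = UNIV"
  proof -
    have "k \<in> range int \<or> k \<in> range (\<lambda>n. - int n)" for k
      by (cases k rule: int_cases2) auto
    thus ?thesis by blast
  qed
  finally show ?thesis .
qed

lemma jb_summable:
  assumes "1 < q"
  shows "(\<lambda>k. jb k powr - q) summable_on UNIV"
proof (rule summable_on_int)
  have "summable (\<lambda>n. real n powr - q)" using assms by (simp add: summable_real_powr_iff)
  hence "summable (\<lambda>n. real (Suc n) powr - q)" by (subst summable_Suc_iff)
  hence "summable (\<lambda>n. 2 powr q * real (Suc n) powr - q)" by (rule summable_mult)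
  hence s: "(\<lambda>n. 2 powr q * real (Suc n) powr - q) summable_on UNIV"
    by (subst summable_on_UNIV_nonneg_real_iff) auto
  have le: "jb (int n) powr - q \<le> 2 powr q * real (Suc n) powr - q" for n
  proof -
    have "real (Suc n) / 2 \<le> jb (int n)"
      using jb_ge1[of "int n"] abs_le_jb[of "int n"] by (simp del: jb_ge1)
    hence "jb (int n) powr - q \<le> (real (Suc n) / 2) powr - q"
      by (intro powr_mono2') (use assms in auto)
    also have "\<dots> = 2 powr q * real (Suc n) powr - q"
      by (simp add: powr_divide powr_minus field_simps)
    finally show ?thesis .
  qed
  show "(\<lambda>n. jb (int n) powr - q) summable_on UNIV"
    by (rule summable_on_comparison_test[OF s]) (use le in auto)
  thus "(\<lambda>n. jb (- int n) powr - q) summable_on UNIV" by simp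
qed auto

lemma jb_sum_bound:
  assumes "1 < q"
  obtains Z where "0 \<le> Z" "\<And>F. finite F \<Longrightarrow> (\<Sum>k\<in>F. jb k powr - q) \<le> Z"
proof
  show "0 \<le> (\<Sum>\<^sub>\<infinity>k. jb k powr - q)" by (intro infsum_nonneg) auto
  show "finite F \<Longrightarrow> (\<Sum>k\<in>F. jb k powr - q) \<le> (\<Sum>\<^sub>\<infinity>k. jb k powr - q)" for F
    by (rule finite_sum_le_infsum[OF jb_summable[OF assms]]) auto
qed

lemma powr_sq: "(x powr s)\<^sup>2 = x powr (2 * s)" for x s :: real
  by (simp add: power2_eq_square flip: powr_add)

text \<open>By \<open>powr_min_le\<close> only the total exponent 2 (p + q) > 1 counts. The constant
  is uniform in the injections \<open>g\<close> and \<open>h\<close>, since these will be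
  reflections, shifts and the map k to 2 k - m, depending on the row, column or diagonal.\<close>

lemma jb_sum_bound2:
  assumes "0 \<le> p" "0 \<le> q" "1 < 2 * (p + q)"
  shows "\<exists>Z. 0 \<le> Z \<and> (\<forall>F g h. finite (F :: int set) \<longrightarrow> inj_on g F \<longrightarrow> inj_on h F \<longrightarrow>
     (\<Sum>k\<in>F. (jb (g k) powr - p * jb (h k) powr - q)\<^sup>2) \<le> Z\<^sup>2)"
proof -
  obtain Z where Z: "0 \<le> Z" "\<And>F. finite F \<Longrightarrow> (\<Sum>k\<in>F. jb k powr - (2 * (p + q))) \<le> Z"
    using jb_sum_bound[OF assms(3)] by blast
  have bound: "(\<Sum>k\<in>F. (jb (g k) powr - p * jb (h k) powr - q)\<^sup>2) \<le> (sqrt (2 * Z))\<^sup>2"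
    if F: "finite F" "inj_on g F" "inj_on h F" for F :: "int set" and g h
  proof -
    have "(jb (g k) powr - p * jb (h k) powr - q)\<^sup>2
        \<le> jb (g k) powr - (2 * (p + q)) + jb (h k) powr - (2 * (p + q))" for k
    proof -
      have "(jb (g k) powr - p * jb (h k) powr - q)\<^sup>2 = jb (g k) powr - (2 * p) * jb (h k) powr - (2 * q)"
        by (simp add: power_mult_distrib powr_sq)
      also have "\<dots> \<le> jb (g k) powr - (2 * p + 2 * q) + jb (h k) powr - (2 * p + 2 * q)"
        by (rule powr_min_le) (use assms in auto)
      finally show ?thesis by (simp add: distrib_left)
    qed
    hence "(\<Sum>k\<in>F. (jb (g k) powr - p * jb (h k) powr - q)\<^sup>2)
        \<le> (\<Sum>k\<in>F. jb (g k) powr - (2 * (p + q))) + (\<Sum>k\<in>F. jb (h k) powr - (2 * (p + q)))"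
      by (subst sum.distrib[symmetric]) (rule sum_mono)
    also have "\<dots> \<le> Z + Z"
      using sum_shift_le[where X = "\<lambda>k. jb k powr - (2 * (p + q))", OF Z(2)] F by (intro add_mono) auto
    finally show ?thesis using Z(1) by simp
  qed
  show ?thesis
  proof (rule exI, intro conjI allI impI)
    show "0 \<le> sqrt (2 * Z)" using Z(1) by simp
    fix F :: "int set" and g h :: "int \<Rightarrow> int"
    assume F: "finite F" and g: "inj_on g F" and h: "inj_on h F"
    show "(\<Sum>k\<in>F. (jb (g k) powr - p * jb (h k) powr - q)\<^sup>2) \<le> (sqrt (2 * Z))\<^sup>2"
      by (rule bound[OF F g h])
  qed
qed

section \<open>Kernels composed of a square summable sequence in k - j and of weights\<close>

definition l2_bounded :: "(int \<Rightarrow> real) \<Rightarrow> bool" where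
  "l2_bounded X \<longleftrightarrow> (\<forall>m. 0 \<le> X m) \<and> (\<exists>C\<ge>0. \<forall>G. finite G \<longrightarrow> (\<Sum>m\<in>G. (X m)\<^sup>2) \<le> C\<^sup>2)"

definition ker_bounded :: "(int \<Rightarrow> int \<Rightarrow> real) \<Rightarrow> bool" where
  "ker_bounded A \<longleftrightarrow> (\<exists>C. mat_bounded (\<lambda>k j. of_real (A k j)) C)"

lemma ker_bounded_mono:
  assumes "ker_bounded B" "\<And>k j. \<bar>A k j\<bar> \<le> r * \<bar>B k j\<bar>" "0 \<le> r"
  shows "ker_bounded A"
proof -
  obtain C where "mat_bounded (\<lambda>k j. of_real (B k j)) C" using assms(1) unfolding ker_bounded_def by blast
  from mat_bounded_scale[OF this assms(3), of "\<lambda>k j. of_real (A k j)"] show ?thesis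
    unfolding ker_bounded_def using assms(2) by auto
qed

lemma ker_bounded_add:
  assumes "ker_bounded A" "ker_bounded B" "\<And>k j. \<bar>E k j\<bar> \<le> r * (\<bar>A k j\<bar> + \<bar>B k j\<bar>)" "0 \<le> r"
  shows "ker_bounded E"
proof -
  obtain C D where "mat_bounded (\<lambda>k j. of_real (A k j)) C" "mat_bounded (\<lambda>k j. of_real (B k j)) D"
    using assms(1,2) unfolding ker_bounded_def by blast
  hence "mat_bounded (\<lambda>k j. of_real (\<bar>A k j\<bar> + \<bar>B k j\<bar>)) (C + D)"
    by (rule mat_bounded_add) (simp only: norm_of_real)
  hence "ker_bounded (\<lambda>k j. \<bar>A k j\<bar> + \<bar>B k j\<bar>)" unfolding ker_bounded_def by blast
  thus ?thesis by (rule ker_bounded_mono[where r = r]) (use assms in auto)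
qed

lemma ker_bounded_rows:
  assumes X: "l2_bounded X" and pq: "0 \<le> p" "0 \<le> q" "1 < 2 * (p + q)"
  shows "ker_bounded (\<lambda>k j. X (k - j) * (jb j powr - p * jb (k - j) powr - q))"
proof -
  obtain C where C: "0 \<le> C" "\<And>G. finite G \<Longrightarrow> (\<Sum>m\<in>G. (X m)\<^sup>2) \<le> C\<^sup>2" and X0: "\<And>m. 0 \<le> X m"
    using X unfolding l2_bounded_def by auto
  obtain Z where Z: "0 \<le> Z" "\<forall>F g h. finite (F :: int set) \<longrightarrow> inj_on g F \<longrightarrow> inj_on h F \<longrightarrow>
     (\<Sum>k\<in>F. (jb (g k) powr - p * jb (h k) powr - q)\<^sup>2) \<le> Z\<^sup>2"
    using jb_sum_bound2[OF pq] by (elim exE conjE)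
  show ?thesis unfolding ker_bounded_def
  proof (rule exI, rule mat_bounded_rows[OF _ C(2) _ C(1) Z(1)])
    show "finite J \<Longrightarrow> (\<Sum>j\<in>J. (jb j powr - p * jb (k - j) powr - q)\<^sup>2) \<le> Z\<^sup>2" for k J
      by (rule Z(2)[rule_format, of J "\<lambda>j. j" "\<lambda>j. k - j"]) (auto simp: inj_on_def)
  qed (use X0 in \<open>auto simp: norm_mult abs_mult\<close>)
qed

lemma ker_bounded_columns:
  assumes X: "l2_bounded X" and pq: "0 \<le> p" "0 \<le> q" "1 < 2 * (p + q)"
  shows "ker_bounded (\<lambda>k j. X (k - j) * (jb k powr - p * jb (k - j) powr - q))"
proof -
  obtain C where C: "0 \<le> C" "\<And>G. finite G \<Longrightarrow> (\<Sum>m\<in>G. (X m)\<^sup>2) \<le> C\<^sup>2" and X0: "\<And>m. 0 \<le> X m"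
    using X unfolding l2_bounded_def by auto
  obtain Z where Z: "0 \<le> Z" "\<forall>F g h. finite (F :: int set) \<longrightarrow> inj_on g F \<longrightarrow> inj_on h F \<longrightarrow>
     (\<Sum>k\<in>F. (jb (g k) powr - p * jb (h k) powr - q)\<^sup>2) \<le> Z\<^sup>2"
    using jb_sum_bound2[OF pq] by (elim exE conjE)
  show ?thesis unfolding ker_bounded_def
  proof (rule exI, rule mat_bounded_columns[OF _ C(2) _ C(1) Z(1)])
    show "finite K \<Longrightarrow> (\<Sum>k\<in>K. (jb k powr - p * jb (k - j) powr - q)\<^sup>2) \<le> Z\<^sup>2" for j K
      by (rule Z(2)[rule_format, of K "\<lambda>k. k" "\<lambda>k. k - j"]) (auto simp: inj_on_def)
  qed (use X0 in \<open>auto simp: norm_mult abs_mult\<close>)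
qed

text \<open>On the diagonal k - j = m both j = k - m and k + j = 2 k - m are injective functions of
  k, so \<open>jb_sum_bound2\<close> applies to either weight.\<close>

lemma ker_bounded_diagonals:
  assumes X: "l2_bounded X" and pq: "0 \<le> p" "0 \<le> q" "1 < 2 * (p + q)"
  shows "ker_bounded (\<lambda>k j. X (k - j) * (jb k powr - p * jb j powr - q))"
    and "ker_bounded (\<lambda>k j. X (k - j) * (jb k powr - p * jb (k + j) powr - q))"
proof -
  obtain C where C: "0 \<le> C" "\<And>G. finite G \<Longrightarrow> (\<Sum>m\<in>G. (X m)\<^sup>2) \<le> C\<^sup>2" and X0: "\<And>m. 0 \<le> X m"
    using X unfolding l2_bounded_def by auto
  obtain Z where Z: "0 \<le> Z" "\<forall>F g h. finite (F :: int set) \<longrightarrow> inj_on g F \<longrightarrow> inj_on h F \<longrightarrow>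
     (\<Sum>k\<in>F. (jb (g k) powr - p * jb (h k) powr - q)\<^sup>2) \<le> Z\<^sup>2"
    using jb_sum_bound2[OF pq] by (elim exE conjE)
  show "ker_bounded (\<lambda>k j. X (k - j) * (jb k powr - p * jb j powr - q))" unfolding ker_bounded_def
  proof (rule exI, rule mat_bounded_diagonals[OF _ C(2) _ C(1) Z(1)])
    show "finite K \<Longrightarrow> (\<Sum>k\<in>K. (jb k powr - p * jb (k - m) powr - q)\<^sup>2) \<le> Z\<^sup>2" for m K
      by (rule Z(2)[rule_format, of K "\<lambda>k. k" "\<lambda>k. k - m"]) (auto simp: inj_on_def)
  qed (use X0 in \<open>auto simp: norm_mult abs_mult\<close>)
  show "ker_bounded (\<lambda>k j. X (k - j) * (jb k powr - p * jb (k + j) powr - q))" unfolding ker_bounded_def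
  proof (rule exI, rule mat_bounded_diagonals[OF _ C(2) _ C(1) Z(1)])
    show "finite K \<Longrightarrow> (\<Sum>k\<in>K. (jb k powr - p * jb (k + (k - m)) powr - q)\<^sup>2) \<le> Z\<^sup>2" for m K
      by (rule Z(2)[rule_format, of K "\<lambda>k. k" "\<lambda>k. k + (k - m)"]) (auto simp: inj_on_def)
  qed (use X0 in \<open>auto simp: norm_mult abs_mult\<close>)
qed

text \<open>A kernel in k + j alone satisfies the Schur test as soon as it is summable. It serves
  where \<xi> enters only through a bound for its coefficients.\<close>

lemma ker_bounded_reflection:
  assumes q: "1 < q"
  shows "ker_bounded (\<lambda>k j. jb (k + j) powr - q)"
proof -
  obtain Z where Z: "0 \<le> Z" "\<And>F. finite F \<Longrightarrow> (\<Sum>k\<in>F. jb k powr - q) \<le> Z"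
    using jb_sum_bound[OF q] by blast
  show ?thesis unfolding ker_bounded_def
  proof (rule exI, rule Schur_test[OF Z(1)])
    show "finite J \<Longrightarrow> (\<Sum>j\<in>J. norm (complex_of_real (jb (k + j) powr - q))) \<le> Z" for k J
      using sum_shift_le[where X = "\<lambda>k. jb k powr - q", OF Z(2), of J "\<lambda>j. k + j"] by (simp add: inj_on_def)
    show "finite K \<Longrightarrow> (\<Sum>k\<in>K. norm (complex_of_real (jb (k + j) powr - q))) \<le> Z" for j K
      using sum_shift_le[where X = "\<lambda>k. jb k powr - q", OF Z(2), of K "\<lambda>k. k + j"] by (simp add: inj_on_def)
  qed
qed

text \<open>This is the product estimate: a function in H^\<tau> times one in H^a lies in H^\<tau>.
  For \<tau> \<ge> 0 the output weight is distributed over k = (k - j) + j. For \<tau> < 0 the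
  weight of k - j is distributed over k and j instead, and \<tau> > - 1/2 keeps the exponent a +
  \<tau> that is left on j nonnegative.\<close>

lemma mult_ker_bounded:
  assumes X: "l2_bounded X" and \<tau>: "- 1/2 < \<tau>" and a: "1/2 < a" "\<tau> \<le> a"
  shows "ker_bounded (\<lambda>k j. X (k - j) * (jb k powr \<tau> * jb (k - j) powr - \<tau> * jb j powr - a))"
proof (cases "0 \<le> \<tau>")
  case True
  have X0: "0 \<le> X m" for m using X by (simp add: l2_bounded_def)
  show ?thesis
  proof (rule ker_bounded_add)
    show "ker_bounded (\<lambda>k j. X (k - j) * (jb j powr - a * jb (k - j) powr - 0))"
      by (rule ker_bounded_rows[OF X]) (use a in auto)
    show "ker_bounded (\<lambda>k j. X (k - j) * (jb j powr - (a - \<tau>) * jb (k - j) powr - \<tau>))"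
      by (rule ker_bounded_rows[OF X]) (use a True in auto)
    fix k j
    have "jb k powr \<tau> * jb (k - j) powr - \<tau> * jb j powr - a
        \<le> (2 powr \<tau> * (jb (k - j) powr \<tau> + jb j powr \<tau>)) * jb (k - j) powr - \<tau> * jb j powr - a"
      by (intro mult_right_mono jb_powr_add_le True) auto
    also have "\<dots> = 2 powr \<tau> * (jb j powr - a * jb (k - j) powr - 0 + jb j powr - (a - \<tau>) * jb (k - j) powr - \<tau>)"
      by (simp add: field_simps powr_add powr_minus powr_diff)
    finally have *: "jb k powr \<tau> * jb (k - j) powr - \<tau> * jb j powr - a
      \<le> 2 powr \<tau> * (jb j powr - a * jb (k - j) powr - 0 + jb j powr - (a - \<tau>) * jb (k - j) powr - \<tau>)" .
    show "\<bar>X (k - j) * (jb k powr \<tau> * jb (k - j) powr - \<tau> * jb j powr - a)\<bar>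
      \<le> 2 powr \<tau> * (\<bar>X (k - j) * (jb j powr - a * jb (k - j) powr - 0)\<bar> +
          \<bar>X (k - j) * (jb j powr - (a - \<tau>) * jb (k - j) powr - \<tau>)\<bar>)"
      using mult_left_mono[OF * X0[of "k - j"]] X0[of "k - j"] by (simp add: abs_mult algebra_simps)
  qed auto
next
  case False
  have X0: "0 \<le> X m" for m using X by (simp add: l2_bounded_def)
  define \<rho> where "\<rho> = - \<tau>"
  have \<rho>: "0 \<le> \<rho>" "\<rho> < 1/2" using False \<tau> by (auto simp: \<rho>_def)
  show ?thesis
  proof (rule ker_bounded_add)
    show "ker_bounded (\<lambda>k j. X (k - j) * (jb k powr - 0 * jb j powr - a))"
      by (rule ker_bounded_diagonals(1)[OF X]) (use a in auto)
    show "ker_bounded (\<lambda>k j. X (k - j) * (jb k powr - \<rho> * jb j powr - (a - \<rho>)))"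
      by (rule ker_bounded_diagonals(1)[OF X]) (use a \<rho> in auto)
    fix k j
    have "jb (k - j) powr \<rho> \<le> 2 powr \<rho> * (jb k powr \<rho> + jb (- j) powr \<rho>)"
      by (rule jb_powr_add_le) (use \<rho> in auto)
    hence "jb (k - j) powr \<rho> * (jb k powr - \<rho> * jb j powr - a)
        \<le> (2 powr \<rho> * (jb k powr \<rho> + jb j powr \<rho>)) * (jb k powr - \<rho> * jb j powr - a)"
      by (intro mult_right_mono) auto
    also have "\<dots> = 2 powr \<rho> * (jb k powr - 0 * jb j powr - a + jb k powr - \<rho> * jb j powr - (a - \<rho>))"
      by (simp add: field_simps powr_add powr_minus powr_diff)
    finally have *: "jb k powr \<tau> * jb (k - j) powr - \<tau> * jb j powr - a
      \<le> 2 powr \<rho> * (jb k powr - 0 * jb j powr - a + jb k powr - \<rho> * jb j powr - (a - \<rho>))"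
      by (simp add: \<rho>_def mult_ac)
    show "\<bar>X (k - j) * (jb k powr \<tau> * jb (k - j) powr - \<tau> * jb j powr - a)\<bar>
      \<le> 2 powr \<rho> * (\<bar>X (k - j) * (jb k powr - 0 * jb j powr - a)\<bar> +
          \<bar>X (k - j) * (jb k powr - \<rho> * jb j powr - (a - \<rho>))\<bar>)"
      using mult_left_mono[OF * X0[of "k - j"]] X0[of "k - j"] by (simp add: abs_mult algebra_simps)
  qed auto
qed

section \<open>Pointwise bounds for the weights of the normal form kernel\<close>

lemma powr_le_1: "1 \<le> x \<Longrightarrow> s \<le> 0 \<Longrightarrow> x powr s \<le> 1" for x s :: real
  using powr_mono[of s 0 x] by simp

text \<open>\<open>K\<close>, \<open>J\<close>, \<open>M\<close>, \<open>N\<close> stand for the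
  brackets of k, j, k - j, k + j, with a = \<tau> + 5/8 and \<theta> = 7/8. If N \<le> M, then M
  absorbs all powers of K. Otherwise N absorbs the power 5/8, and K powr \<tau> is split between J
  and M. In both cases a decay of order 7/8 > 1/2 remains.\<close>

lemma weight_bound_nonneg:
  fixes K J M N \<tau> :: real
  assumes ge: "1 \<le> K" "1 \<le> J" "1 \<le> M" "1 \<le> N" and \<tau>: "0 \<le> \<tau>"
    and K: "K \<le> max M N" "K \<le> M + J"
  shows "K powr (\<tau> + 5/8) * J powr - \<tau> * M powr - \<tau> * M powr - (7/8) * N powr - (7/8)
     \<le> 2 * 2 powr \<tau> * (N powr - (7/8) + M powr - (7/8))"
proof (cases "N \<le> M")
  case True
  have "K powr (\<tau> + 5/8) * J powr - \<tau> \<le> M powr (\<tau> + 5/8) * 1"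
    by (intro mult_mono powr_mono2 powr_le_1) (use K True ge \<tau> in auto)
  hence "K powr (\<tau> + 5/8) * J powr - \<tau> * (M powr - \<tau> * M powr - (7/8)) \<le> M powr (\<tau> + 5/8) * (M powr - \<tau> * M powr - (7/8))"
    by (intro mult_right_mono) auto
  also have "\<dots> = M powr (- (1/4))" by (simp flip: powr_add)
  also have "\<dots> \<le> 1" by (rule powr_le_1) (use ge in auto)
  finally have "K powr (\<tau> + 5/8) * J powr - \<tau> * (M powr - \<tau> * M powr - (7/8)) * N powr - (7/8) \<le> 1 * N powr - (7/8)"
    by (intro mult_right_mono) auto
  also have "\<dots> \<le> (2 * 2 powr \<tau>) * (N powr - (7/8) + M powr - (7/8))"
    using ge_one_powr_ge_zero[of 2 \<tau>] \<tau> by (intro mult_mono) auto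
  finally show ?thesis by (simp add: mult.assoc)
next
  case False
  have "K powr \<tau> \<le> (M + J) powr \<tau>" by (rule powr_mono2) (use ge K \<tau> in auto)
  also have "\<dots> \<le> 2 powr \<tau> * (M powr \<tau> + J powr \<tau>)" by (rule powr_add_le) (use ge \<tau> in auto)
  finally have 1: "K powr \<tau> \<le> 2 powr \<tau> * (M powr \<tau> + J powr \<tau>)" .
  have "K powr (5/8) * N powr - (7/8) \<le> N powr (5/8) * N powr - (7/8)"
    by (intro mult_right_mono powr_mono2) (use False K ge in auto)
  also have "\<dots> = N powr - (1/4)" by (simp flip: powr_add)
  also have "\<dots> \<le> 1" by (rule powr_le_1) (use ge in auto)
  finally have 2: "K powr (5/8) * N powr - (7/8) \<le> 1" .
  have "(M powr \<tau> + J powr \<tau>) * (J powr - \<tau> * M powr - \<tau>) = J powr - \<tau> + M powr - \<tau>"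
    using ge by (simp add: field_simps powr_minus)
  also have "\<dots> \<le> 1 + 1" by (intro add_mono powr_le_1) (use ge \<tau> in auto)
  finally have 3: "(M powr \<tau> + J powr \<tau>) * (J powr - \<tau> * M powr - \<tau>) \<le> 2" by simp
  have "K powr \<tau> * (J powr - \<tau> * M powr - \<tau>) \<le> 2 powr \<tau> * (M powr \<tau> + J powr \<tau>) * (J powr - \<tau> * M powr - \<tau>)"
    using 1 by (intro mult_right_mono) auto
  also have "\<dots> \<le> 2 powr \<tau> * 2"
    unfolding mult.assoc using 3 by (intro mult_left_mono) (auto simp: mult.assoc)
  finally have 4: "K powr \<tau> * (J powr - \<tau> * M powr - \<tau>) \<le> 2 powr \<tau> * 2" .
  have "K powr (\<tau> + 5/8) * J powr - \<tau> * M powr - \<tau> * M powr - (7/8) * N powr - (7/8)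
      = (K powr \<tau> * (J powr - \<tau> * M powr - \<tau>)) * (K powr (5/8) * N powr - (7/8)) * M powr - (7/8)"
    by (simp add: powr_add mult_ac)
  also have "\<dots> \<le> (2 powr \<tau> * 2) * 1 * M powr - (7/8)"
    by (intro mult_right_mono mult_mono 4 2) auto
  also have "\<dots> \<le> 2 * 2 powr \<tau> * (N powr - (7/8) + M powr - (7/8))" by simp
  finally show ?thesis .
qed

text \<open>Here \<rho> = - \<tau> and k - j dominates all the other frequencies. Its surplus decay
  is handed over to k + j, whose exponent 9/8 - \<rho>/4 then exceeds 1, enough for the Schur test
  without any decay of \<xi>.\<close>

lemma weight_bound_neg1:
  fixes K J M N \<rho> :: real
  assumes ge: "1 \<le> K" "1 \<le> J" "1 \<le> M" "1 \<le> N" and \<rho>: "0 \<le> \<rho>" "\<rho> < 1/2"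
    and K: "K \<le> M" "J \<le> M" "N \<le> M"
  shows "K powr (5/8 - \<rho>/4) * J powr \<rho> * M powr - (7/8 + \<rho>/4) * N powr - (7/8 + \<rho>/4) \<le> N powr - (9/8 - \<rho>/4)"
proof -
  have "K powr (5/8 - \<rho>/4) * J powr \<rho> * M powr - (7/8 + \<rho>/4) \<le> M powr (5/8 - \<rho>/4) * M powr \<rho> * M powr - (7/8 + \<rho>/4)"
    by (intro mult_right_mono mult_mono powr_mono2) (use assms in auto)
  also have "\<dots> = M powr - (1/4 - \<rho>/2)" by (simp add: algebra_simps flip: powr_add)
  also have "\<dots> \<le> N powr - (1/4 - \<rho>/2)" by (intro powr_mono2') (use assms in auto)
  finally have "K powr (5/8 - \<rho>/4) * J powr \<rho> * M powr - (7/8 + \<rho>/4) * N powr - (7/8 + \<rho>/4)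
      \<le> N powr - (1/4 - \<rho>/2) * N powr - (7/8 + \<rho>/4)"
    by (rule mult_right_mono) auto
  also have "\<dots> = N powr - (9/8 - \<rho>/4)" by (simp add: algebra_simps flip: powr_add)
  finally show ?thesis .
qed

text \<open>Here k + j dominates k and absorbs its weight. The factor M powr \<rho> is the price for
  using the weighted square summability of \<xi>, and J powr \<rho> is split between K and M. In
  each term the total decay exceeds 1/2.\<close>

lemma weight_bound_neg2:
  fixes K J M N \<rho> :: real
  assumes ge: "1 \<le> K" "1 \<le> J" "1 \<le> M" "1 \<le> N" and \<rho>: "0 \<le> \<rho>" "\<rho> < 1/2"
    and K: "K \<le> N" "J \<le> K + M"
  shows "K powr (5/8 - \<rho>/4) * J powr \<rho> * M powr \<rho> * M powr - (7/8 + \<rho>/4) * N powr - (7/8 + \<rho>/4)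
    \<le> 2 powr \<rho> * (M powr - (7/8 - 3/4 * \<rho>) + K powr - (1/4 + \<rho>/2) * M powr - (7/8 - 7/4 * \<rho>))"
proof -
  have "N powr - (7/8 + \<rho>/4) \<le> K powr - (7/8 + \<rho>/4)" by (intro powr_mono2') (use assms in auto)
  hence "K powr (5/8 - \<rho>/4) * N powr - (7/8 + \<rho>/4) \<le> K powr (5/8 - \<rho>/4) * K powr - (7/8 + \<rho>/4)"
    by (intro mult_left_mono) auto
  also have "\<dots> = K powr - (1/4 + \<rho>/2)" by (simp add: algebra_simps flip: powr_add)
  finally have 1: "K powr (5/8 - \<rho>/4) * N powr - (7/8 + \<rho>/4) \<le> K powr - (1/4 + \<rho>/2)" .
  have "J powr \<rho> \<le> (K + M) powr \<rho>" by (rule powr_mono2) (use assms in auto)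
  also have "\<dots> \<le> 2 powr \<rho> * (K powr \<rho> + M powr \<rho>)" by (rule powr_add_le) (use assms in auto)
  finally have 2: "J powr \<rho> \<le> 2 powr \<rho> * (K powr \<rho> + M powr \<rho>)" .
  have "K powr (5/8 - \<rho>/4) * J powr \<rho> * M powr \<rho> * M powr - (7/8 + \<rho>/4) * N powr - (7/8 + \<rho>/4)
     = (K powr (5/8 - \<rho>/4) * N powr - (7/8 + \<rho>/4)) * J powr \<rho> * (M powr \<rho> * M powr - (7/8 + \<rho>/4))"
    by (simp only: mult_ac)
  also have "M powr \<rho> * M powr - (7/8 + \<rho>/4) = M powr - (7/8 - 3/4 * \<rho>)"
    by (simp add: algebra_simps flip: powr_add)
  also have "(K powr (5/8 - \<rho>/4) * N powr - (7/8 + \<rho>/4)) * J powr \<rho> * M powr - (7/8 - 3/4 * \<rho>)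
     \<le> K powr - (1/4 + \<rho>/2) * (2 powr \<rho> * (K powr \<rho> + M powr \<rho>)) * M powr - (7/8 - 3/4 * \<rho>)"
    by (intro mult_right_mono mult_mono 1 2) auto
  also have "\<dots> = 2 powr \<rho> * (K powr - (1/4 + \<rho>/2) * K powr \<rho> * M powr - (7/8 - 3/4 * \<rho>)
       + K powr - (1/4 + \<rho>/2) * (M powr \<rho> * M powr - (7/8 - 3/4 * \<rho>)))"
    by (simp only: algebra_simps)
  also have "K powr - (1/4 + \<rho>/2) * K powr \<rho> = K powr - (1/4 - \<rho>/2)"
    by (simp add: algebra_simps flip: powr_add)
  also have "M powr \<rho> * M powr - (7/8 - 3/4 * \<rho>) = M powr - (7/8 - 7/4 * \<rho>)"
    by (simp add: algebra_simps flip: powr_add)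
  also have "2 powr \<rho> * (K powr - (1/4 - \<rho>/2) * M powr - (7/8 - 3/4 * \<rho>)
       + K powr - (1/4 + \<rho>/2) * M powr - (7/8 - 7/4 * \<rho>))
     \<le> 2 powr \<rho> * (1 * M powr - (7/8 - 3/4 * \<rho>)
       + K powr - (1/4 + \<rho>/2) * M powr - (7/8 - 7/4 * \<rho>))"
    by (intro mult_left_mono add_mono mult_right_mono powr_le_1 order_refl) (use assms in auto)
  finally show ?thesis by simp
qed

text \<open>The last two factors stand for \<open>\<bar>k\<^sup>2 - j\<^sup>2\<bar> powr - \<theta>\<close>. As \<open>\<theta> < 1\<close>, a positive power of the
  divisor \<open>k\<^sup>2 - j\<^sup>2\<close> is left over to make the normal form transformation small.\<close>

lemma resonance_weight_bounded:
  fixes \<xi> :: "int \<Rightarrow> complex"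
  assumes X: "l2_bounded (\<lambda>m. jb m powr \<tau> * norm (\<xi> m))" and \<tau>: "- 1/2 < \<tau>"
    and C0: "\<And>m. norm (\<xi> m) \<le> C0"
  shows "\<exists>a \<theta>. 1/2 < a \<and> \<tau> \<le> a \<and> a \<le> \<tau> + 1 \<and> 0 < \<theta> \<and> \<theta> < 1 \<and>
     ker_bounded (\<lambda>k j. jb k powr a * jb j powr - \<tau> * norm (\<xi> (k - j)) * jb (k - j) powr - \<theta> * jb (k + j) powr - \<theta>)"
proof (cases "0 \<le> \<tau>")
  case True
  let ?X = "\<lambda>m. jb m powr \<tau> * norm (\<xi> m)"
  have "ker_bounded (\<lambda>k j. jb k powr (\<tau> + 5/8) * jb j powr - \<tau> * norm (\<xi> (k - j)) * jb (k - j) powr - (7/8) * jb (k + j) powr - (7/8))"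
  proof (rule ker_bounded_add)
    show "ker_bounded (\<lambda>k j. ?X (k - j) * (jb k powr - 0 * jb (k + j) powr - (7/8)))"
      by (rule ker_bounded_diagonals(2)[OF X]) auto
    show "ker_bounded (\<lambda>k j. ?X (k - j) * (jb j powr - 0 * jb (k - j) powr - (7/8)))"
      by (rule ker_bounded_rows[OF X]) auto
    fix k j
    have "jb k powr (\<tau> + 5/8) * jb j powr - \<tau> * jb (k - j) powr - \<tau> * jb (k - j) powr - (7/8) * jb (k + j) powr - (7/8)
      \<le> 2 * 2 powr \<tau> * (jb (k + j) powr - (7/8) + jb (k - j) powr - (7/8))"
      by (rule weight_bound_nonneg) (use True jb_le_max jb_triangle[of "k - j" j] in auto)
    from mult_left_mono[OF this, of "?X (k - j)"]
    have le: "?X (k - j) * jb (k - j) powr - \<tau> * (jb k powr (\<tau> + 5/8) * jb j powr - \<tau> * jb (k - j) powr - (7/8) * jb (k + j) powr - (7/8))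
      \<le> 2 * 2 powr \<tau> * (?X (k - j) * jb (k + j) powr - (7/8) + ?X (k - j) * jb (k - j) powr - (7/8))"
      by (simp add: algebra_simps)
    have "norm (\<xi> (k - j)) * c = ?X (k - j) * jb (k - j) powr - \<tau> * c" for c
      by (simp add: powr_minus)
    from this[of "jb k powr (\<tau> + 5/8) * jb j powr - \<tau> * jb (k - j) powr - (7/8) * jb (k + j) powr - (7/8)"]
    have eq: "jb k powr (\<tau> + 5/8) * jb j powr - \<tau> * norm (\<xi> (k - j)) * jb (k - j) powr - (7/8) * jb (k + j) powr - (7/8)
      = ?X (k - j) * jb (k - j) powr - \<tau> * (jb k powr (\<tau> + 5/8) * jb j powr - \<tau> * jb (k - j) powr - (7/8) * jb (k + j) powr - (7/8))"
      by (simp only: mult_ac)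
    have nn: "0 \<le> jb k powr (\<tau> + 5/8) * jb j powr - \<tau> * norm (\<xi> (k - j)) * jb (k - j) powr - (7/8) * jb (k + j) powr - (7/8)"
      by simp
    show "\<bar>jb k powr (\<tau> + 5/8) * jb j powr - \<tau> * norm (\<xi> (k - j)) * jb (k - j) powr - (7/8) * jb (k + j) powr - (7/8)\<bar>
      \<le> 2 * 2 powr \<tau> * (\<bar>?X (k - j) * (jb k powr - 0 * jb (k + j) powr - (7/8))\<bar> + \<bar>?X (k - j) * (jb j powr - 0 * jb (k - j) powr - (7/8))\<bar>)"
      unfolding abs_of_nonneg[OF nn] using le unfolding eq by simp
  qed auto
  with True show ?thesis by (intro exI[of _ "\<tau> + 5/8"] exI[of _ "7/8"]) auto
next
  case False
  let ?X = "\<lambda>m. jb m powr \<tau> * norm (\<xi> m)"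
  define \<rho> where "\<rho> = - \<tau>"
  \<comment> \<open>The exponents interpolate between the values at \<rho> = 0 used above and \<rho>
    = 1/2, where all constraints become equalities at once: a = 1/2, \<theta> = 1, decay 1 in
    \<open>U1\<close>, and total decay 1/2 in \<open>U2\<close> and in \<open>U3\<close>.\<close>
  define \<theta> where "\<theta> = 7/8 + \<rho>/4"
  define a where "a = 5/8 - \<rho>/4"
  have \<rho>: "0 \<le> \<rho>" "\<rho> < 1/2" using False \<tau> by (auto simp: \<rho>_def)
  have C0': "0 \<le> C0" using C0[of 0] norm_ge_zero[of "\<xi> 0"] by linarith
  define U1 where "U1 = (\<lambda>k j. jb (k + j) powr - (9/8 - \<rho>/4))"
  define U2 where "U2 = (\<lambda>k j. ?X (k - j) * (jb j powr - 0 * jb (k - j) powr - (7/8 - 3/4 * \<rho>)))"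
  define U3 where "U3 = (\<lambda>k j. ?X (k - j) * (jb k powr - (1/4 + \<rho>/2) * jb (k - j) powr - (7/8 - 7/4 * \<rho>)))"
  have 1: "ker_bounded U1" unfolding U1_def by (rule ker_bounded_reflection) (use \<rho> in auto)
  have 2: "ker_bounded U2" unfolding U2_def by (rule ker_bounded_rows[OF X]) (use \<rho> in auto)
  have 3: "ker_bounded U3" unfolding U3_def by (rule ker_bounded_columns[OF X]) (use \<rho> in auto)
  have nn: "0 \<le> U1 k j" "0 \<le> U2 k j" "0 \<le> U3 k j" for k j by (auto simp: U1_def U2_def U3_def)
  have 23: "ker_bounded (\<lambda>k j. U2 k j + U3 k j)"
    by (rule ker_bounded_add[OF 2 3, of _ 1]) auto
  have "ker_bounded (\<lambda>k j. jb k powr a * jb j powr - \<tau> * norm (\<xi> (k - j)) * jb (k - j) powr - \<theta> * jb (k + j) powr - \<theta>)"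
  proof (rule ker_bounded_add[OF 1 23])
    fix k j
    let ?E = "jb k powr a * jb j powr - \<tau> * norm (\<xi> (k - j)) * jb (k - j) powr - \<theta> * jb (k + j) powr - \<theta>"
    \<comment> \<open>When k + j is the smaller factor, \<xi> is replaced by its supremum
      \<open>C0\<close> and the kernel depends on k + j only. In the other case the square
      summability of the weighted \<xi> is used.\<close>
    have "?E \<le> (C0 + 2 powr \<rho>) * (U1 k j + (U2 k j + U3 k j))"
    proof (cases "jb (k + j) \<le> jb (k - j)")
      case True
      have "?E = norm (\<xi> (k - j)) * (jb k powr a * jb j powr \<rho> * jb (k - j) powr - \<theta> * jb (k + j) powr - \<theta>)"
        by (simp add: \<rho>_def)
      also have "\<dots> \<le> C0 * U1 k j" unfolding U1_def a_def \<theta>_def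
        by (intro mult_mono C0 weight_bound_neg1) (use True jb_le_max[of k j] jb_le_max'[of j k] \<rho> C0' in auto)
      also have "\<dots> \<le> (C0 + 2 powr \<rho>) * (U1 k j + (U2 k j + U3 k j))"
        by (intro mult_mono) (use nn[of k j] C0' in auto)
      finally show ?thesis .
    next
      case False
      have "?X (k - j) * jb (k - j) powr \<rho> = norm (\<xi> (k - j))" by (simp add: \<rho>_def powr_minus)
      hence "?E = ?X (k - j) * (jb k powr a * jb j powr \<rho> * jb (k - j) powr \<rho> * jb (k - j) powr - \<theta> * jb (k + j) powr - \<theta>)"
        by (simp add: \<rho>_def mult_ac)
      also have "\<dots> \<le> ?X (k - j) * (2 powr \<rho> * (jb (k - j) powr - (7/8 - 3/4 * \<rho>) + jb k powr - (1/4 + \<rho>/2) * jb (k - j) powr - (7/8 - 7/4 * \<rho>)))"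
        unfolding a_def \<theta>_def
        by (intro mult_left_mono weight_bound_neg2)
           (use False jb_le_max[of k j] jb_triangle[of k "j - k"] \<rho> in \<open>auto simp: jb_diff_commute\<close>)
      also have "\<dots> = 2 powr \<rho> * (U2 k j + U3 k j)" by (simp add: U2_def U3_def algebra_simps)
      also have "\<dots> \<le> (C0 + 2 powr \<rho>) * (U1 k j + (U2 k j + U3 k j))"
        by (intro mult_mono) (use nn[of k j] C0' in auto)
      finally show ?thesis .
    qed
    moreover have "0 \<le> ?E" by auto
    ultimately show "\<bar>?E\<bar> \<le> (C0 + 2 powr \<rho>) * (\<bar>U1 k j\<bar> + \<bar>U2 k j + U3 k j\<bar>)"
      using nn[of k j] by simp
  qed (use C0' in auto)
  moreover have "1/2 < a" "\<tau> \<le> a" "a \<le> \<tau> + 1" "0 < \<theta>" "\<theta> < 1"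
    using \<rho> by (auto simp: a_def \<theta>_def \<rho>_def)
  ultimately show ?thesis by blast
qed

section \<open>Conjugation of the linear operator to a bounded perturbation of the free one\<close>

definition mult_op :: "('a \<Rightarrow> complex) \<Rightarrow> 'a ell2 \<Rightarrow> 'a ell2" where
  "mult_op d x = to_ell2 (\<lambda>k. d k * ell2_nth x k)"

lemma mult_op_nth:
  assumes "\<And>k. norm (d k) \<le> C"
  shows "ell2_nth (mult_op d x) k = d k * ell2_nth x k"
  unfolding mult_op_def
  by (subst ell2_nth_to_ell2, rule sq_summable_scale[OF ell2_nth_summable[of x], of _ C])
     (use assms in \<open>auto simp: norm_mult mult_right_mono\<close>)

lemma mult_op_norm_le:
  assumes "\<And>k. norm (d k) \<le> C"
  shows "norm (mult_op d x) \<le> C * norm x"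
proof (rule norm_ell2_leI)
  have C: "0 \<le> C" using assms norm_ge_zero order_trans by blast
  thus "0 \<le> C * norm x" by simp
  fix F :: "'a set" assume F: "finite F"
  have "(\<Sum>i\<in>F. (norm (ell2_nth (mult_op d x) i))\<^sup>2) \<le> (\<Sum>i\<in>F. C\<^sup>2 * (norm (ell2_nth x i))\<^sup>2)"
  proof (rule sum_mono)
    fix i
    show "(norm (ell2_nth (mult_op d x) i))\<^sup>2 \<le> C\<^sup>2 * (norm (ell2_nth x i))\<^sup>2"
      unfolding mult_op_nth[OF assms] norm_mult power_mult_distrib
      by (intro mult_right_mono power_mono assms) auto
  qed
  also have "\<dots> \<le> C\<^sup>2 * (norm x)\<^sup>2"
    unfolding sum_distrib_left[symmetric] by (intro mult_left_mono sum_le_norm_ell2_sq F) auto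
  finally show "(\<Sum>i\<in>F. (norm (ell2_nth (mult_op d x) i))\<^sup>2) \<le> (C * norm x)\<^sup>2"
    by (simp add: power_mult_distrib)
qed

lemma bounded_linear_mult_op:
  assumes "\<And>k. norm (d k) \<le> C"
  shows "bounded_linear (mult_op d)"
proof (rule bounded_linear_intro)
  show "mult_op d (x + y) = mult_op d x + mult_op d y" for x y
    by (rule ell2_eqI) (simp add: mult_op_nth[OF assms] algebra_simps)
  show "mult_op d (r *\<^sub>R x) = r *\<^sub>R mult_op d x" for r x
    by (rule ell2_eqI) (simp add: mult_op_nth[OF assms] algebra_simps)
  show "norm (mult_op d x) \<le> norm x * C" for x
    using mult_op_norm_le[OF assms] by (simp add: mult.commute)
qed

text \<open>\<open>ell2\<close> carries only a real vector space structure. Complex linearity of an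
  operator is therefore expressed as commuting with multiplication by the imaginary unit.\<close>

abbreviation ii :: "'a ell2 \<Rightarrow> 'a ell2" where "ii \<equiv> mult_op (\<lambda>_. \<i>)"

lemma ii_nth [simp]: "ell2_nth (ii x) k = \<i> * ell2_nth x k"
  by (rule mult_op_nth[where C = 1]) auto

lemma bounded_linear_ii: "bounded_linear ii"
  by (rule bounded_linear_mult_op[where C = 1]) auto

lemma mat_op_ii:
  assumes "mat_bounded A C"
  shows "mat_op A (ii x) = ii (mat_op A x)"
  by (rule ell2_eqI)
     (simp add: mat_op_nth[OF assms] mult.left_commute infsum_cmult_right')

lemma mult_op_ii:
  assumes "\<And>k. norm (d k) \<le> C"
  shows "mult_op d (ii x) = ii (mult_op d x)"
  by (rule ell2_eqI) (simp add: mult_op_nth[OF assms] mult_ac)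

lemma jb_powr_mono: "s \<le> t \<Longrightarrow> jb k powr s \<le> jb k powr t"
  by (rule powr_mono) auto

text \<open>The resolvent gains two derivatives. Giving up one of them buys the factor 1 / sqrt M,
  which makes the potential a small perturbation; this suffices because a \<le> \<tau> + 1.\<close>

lemma jb_le_sqrt_mult: "1 \<le> M \<Longrightarrow> sqrt M * jb k \<le> M + (of_int k)\<^sup>2"
proof -
  assume M: "1 \<le> M"
  have "M * (1 + x) \<le> (M + x)\<^sup>2" if "0 \<le> x" for x
  proof -
    have "M * 1 \<le> M * M" "0 \<le> M * x" "0 \<le> x * x"
      using M that by (auto simp del: mult_1_right intro: mult_left_mono)
    thus ?thesis by (simp add: power2_eq_square algebra_simps del: zero_le_square)
  qed
  from this[of "(of_int k)\<^sup>2"]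
  have "sqrt (M * (1 + (of_int k)\<^sup>2)) \<le> M + (of_int k)\<^sup>2" using M by (intro real_le_lsqrt) auto
  thus ?thesis by (simp add: jb_def real_sqrt_mult)
qed

text \<open>Away from k^2 = j^2 both k - j and k + j are nonzero integers, so each is comparable to
  its bracket with a factor 2.\<close>

lemma square_diff_powr_le:
  fixes k j :: int
  assumes "k\<^sup>2 \<noteq> j\<^sup>2" "0 < \<theta>"
  shows "\<bar>of_int (k\<^sup>2 - j\<^sup>2) :: real\<bar> powr - \<theta> \<le> 4 powr \<theta> * (jb (k - j) powr - \<theta> * jb (k + j) powr - \<theta>)"
proof -
  have nz: "k - j \<noteq> 0" "k + j \<noteq> 0"
    using assms(1) by (auto simp: power2_eq_square add_eq_0_iff)
  have "jb (k - j) * jb (k + j) \<le> (2 * \<bar>of_int (k - j)\<bar>) * (2 * \<bar>of_int (k + j)\<bar>)"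
    by (intro mult_mono jb_le_2abs nz) auto
  also have "\<dots> = 4 * \<bar>of_int (k\<^sup>2 - j\<^sup>2)\<bar>"
    by (simp add: power2_eq_square algebra_simps flip: abs_mult)
  finally have "jb (k - j) * jb (k + j) / 4 \<le> \<bar>of_int (k\<^sup>2 - j\<^sup>2)\<bar>" by simp
  hence "\<bar>of_int (k\<^sup>2 - j\<^sup>2) :: real\<bar> powr - \<theta> \<le> (jb (k - j) * jb (k + j) / 4) powr - \<theta>"
    by (intro powr_mono2') (use assms(2) in auto)
  also have "\<dots> = 4 powr \<theta> * (jb (k - j) powr - \<theta> * jb (k + j) powr - \<theta>)"
    by (simp add: powr_divide powr_mult powr_minus field_simps)
  finally show ?thesis .
qed

lemma has_sum_minus:
  fixes f g :: "'a \<Rightarrow> 'b::real_normed_vector"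
  assumes "(f has_sum a) A" "(g has_sum b) A"
  shows "((\<lambda>x. f x - g x) has_sum (a - b)) A"
  using has_sum_add[OF assms(1), of "\<lambda>x. - g x" "- b"] assms(2) by (simp add: has_sum_uminus)

lemma mat_bounded_weaken:
  fixes A :: "'a \<Rightarrow> 'a \<Rightarrow> complex"
  assumes "mat_bounded A C" "C \<le> D"
  shows "mat_bounded A D"
  unfolding mat_bounded_def
proof (intro conjI allI impI)
  show "0 \<le> D" using assms mat_bounded_nonneg by fastforce
  fix F :: "'a set" and x y :: "'a \<Rightarrow> real"
  assume *: "finite F" "\<forall>i. 0 \<le> x i" "\<forall>i. 0 \<le> y i"
  have "(\<Sum>k\<in>F. \<Sum>j\<in>F. norm (A k j) * x j * y k) \<le> C * L2_set x F * L2_set y F"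
    by (rule mat_boundedD[OF assms(1)]) (use * in auto)
  also have "\<dots> \<le> D * L2_set x F * L2_set y F"
    by (intro mult_right_mono assms(2)) auto
  finally show "(\<Sum>k\<in>F. \<Sum>j\<in>F. norm (A k j) * x j * y k) \<le> D * L2_set x F * L2_set y F" .
qed

text \<open>These are the entries with k^2 = j^2, where no division is possible. There are at most
  two of them in each row and column.\<close>

lemma mat_bounded_resonant:
  assumes "0 \<le> C"
  shows "mat_bounded (\<lambda>k j :: int. of_real (if j = k \<or> j = - k then C else 0)) (2 * C)"
proof (rule Schur_test)
  have *: "(\<Sum>j\<in>J. norm (complex_of_real (if j = k \<or> j = - k then C else 0))) \<le> 2 * C"
    if "finite J" for J and k :: int
  proof -
    have "(\<Sum>j\<in>J. norm (complex_of_real (if j = k \<or> j = - k then C else 0))) = (\<Sum>j\<in>J \<inter> {k, - k}. C)"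
      using that assms by (intro sum.mono_neutral_cong_right) auto
    also have "\<dots> = card (J \<inter> {k, - k}) * C" by simp
    also have "card (J \<inter> {k, - k}) \<le> card {k, - k}" by (intro card_mono) auto
    also have "card {k, - k} \<le> 2" by (simp add: card_insert_if)
    finally show ?thesis using assms by (simp add: mult_right_mono)
  qed
  show "(\<Sum>j\<in>J. norm (complex_of_real (if j = k \<or> j = - k then C else 0))) \<le> 2 * C"
    if "finite J" for k :: int and J by (rule *[OF that])
  have sym: "(j = k \<or> j = - k) = (k = j \<or> k = - j)" for j k :: int by auto
  show "(\<Sum>k\<in>K. norm (complex_of_real (if j = k \<or> j = - k then C else 0))) \<le> 2 * C"
    if "finite K" for j :: int and K
    unfolding sym[of j] by (rule *[OF that])
qed (use assms in auto)

text \<open>\<open>E\<close> is \<open>(M - \<partial>\<^sub>x\<^sub>x - \<xi>)\<^bsup>-1\<^esup> (1 + K)\<close> up to weights, where \<open>K\<close> divides the entries of \<open>\<xi>\<close> with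
  \<open>\<bar>k\<^sup>2 - j\<^sup>2\<bar> \<ge> L\<close> by \<open>k\<^sup>2 - j\<^sup>2\<close>; both factors are Neumann series for large \<open>L\<close> and \<open>M\<close>. The other
  entries of \<open>\<xi>\<close> form the bounded matrix \<open>R\<close>.\<close>

lemma conjugation:
  fixes \<xi> :: "int \<Rightarrow> complex"
  assumes X: "l2_bounded (\<lambda>m. jb m powr \<tau> * norm (\<xi> m))" and \<tau>: "- 1/2 < \<tau>"
    and C0: "\<And>m. norm (\<xi> m) \<le> C0"
  shows "\<exists>E E' B. bounded_linear E \<and> bounded_linear E' \<and> bounded_linear B \<and>
    (\<forall>x. E (E' x) = x) \<and> (\<forall>x. E' (E x) = x) \<and>
    (\<forall>h Y. (\<forall>k. ell2_nth h k = \<i> * (- of_real ((of_int k)\<^sup>2) * ell2_nth Y k + ell2_nth (B Y) k)) \<longrightarrow>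
       (\<forall>k. ell2_nth (E h) k = \<i> * (- of_real ((of_int k)\<^sup>2) * ell2_nth (E Y) k +
          of_real (jb k powr (\<tau> + 2)) * (\<Sum>\<^sub>\<infinity>j. \<xi> (k - j) * (of_real (jb j powr - (\<tau> + 2)) * ell2_nth (E Y) j)))))"
proof -
  have C0': "0 \<le> C0" using C0[of 0] norm_ge_zero[of "\<xi> 0"] by linarith
  from resonance_weight_bounded[OF X \<tau> C0] obtain a \<theta> CK where
    a: "1/2 < a" "\<tau> \<le> a" "a \<le> \<tau> + 1" and \<theta>: "0 < \<theta>" "\<theta> < 1" and
    CK': "mat_bounded (\<lambda>k j. of_real (jb k powr a * jb j powr - \<tau> * norm (\<xi> (k - j)) * jb (k - j) powr - \<theta> * jb (k + j) powr - \<theta>)) CK"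
    unfolding ker_bounded_def by (elim exE conjE)
  define w where "w k j = jb k powr a * jb j powr - \<tau> * norm (\<xi> (k - j)) * jb (k - j) powr - \<theta> * jb (k + j) powr - \<theta>" for k j
  have CK: "mat_bounded (\<lambda>k j. of_real (w k j)) CK" using CK' by (simp only: w_def)
  have w0: "0 \<le> w k j" for k j by (simp add: w_def)
  note CK0 = mat_bounded_nonneg[OF CK]
  \<comment> \<open>The threshold \<open>L\<close> is fixed by
    \<open>L powr (\<theta> - 1) = 1 / c\<close>, so that \<open>K\<close> gets norm at most (4 powr
    \<theta>) CK / c \<le> 1/2.\<close>
  define c where "c = 2 * 4 powr \<theta> * CK + 1"
  have c1: "1 \<le> c" using CK0 by (simp add: c_def)
  define L where "L = c powr (1 / (1 - \<theta>))"
  have L1: "1 \<le> L" unfolding L_def using c1 \<theta> by (intro ge_one_powr_ge_zero) auto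
  have L2: "L powr (\<theta> - 1) = 1 / c"
  proof -
    have "1 / (1 - \<theta>) * (\<theta> - 1) = - 1" using \<theta> by (simp add: field_simps)
    hence "L powr (\<theta> - 1) = c powr - 1" unfolding L_def powr_powr by simp
    thus ?thesis using c1 by (simp add: powr_minus divide_inverse)
  qed
  define D where "D k j = \<bar>of_int (k\<^sup>2 - j\<^sup>2) :: real\<bar>" for k j :: int
  \<comment> \<open>Coordinates at level r are Fourier coefficients times
    \<open>jb k powr r\<close>. In this sense \<open>K\<close> maps level \<tau> to the better level
    \<open>a\<close>, while \<open>\<Xi>\<close> is multiplication by \<xi> from level
    \<open>a\<close> back to level \<tau>.\<close>
  define K where "K k j = (if L \<le> D k j then of_real (jb k powr a * jb j powr - \<tau>) * \<xi> (k - j) / of_int (k\<^sup>2 - j\<^sup>2) else 0)" for k j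
  define R where "R k j = (if L \<le> D k j then 0 else of_real (jb k powr \<tau> * jb j powr - \<tau>) * \<xi> (k - j))" for k j
  define \<Xi> where "\<Xi> k j = of_real (jb k powr \<tau> * jb j powr - a) * \<xi> (k - j)" for k j
  have D0: "0 < D k j" if "k\<^sup>2 \<noteq> j\<^sup>2" for k j
  proof -
    have "k\<^sup>2 - j\<^sup>2 \<noteq> 0" using that by simp
    thus ?thesis unfolding D_def by (metis of_int_eq_0_iff zero_less_abs_iff)
  qed
  have wle: "jb k powr a * jb j powr - \<tau> * norm (\<xi> (k - j)) * D k j powr - \<theta> \<le> 4 powr \<theta> * w k j"
    if "k\<^sup>2 \<noteq> j\<^sup>2" for k j
  proof -
    have "(jb k powr a * jb j powr - \<tau> * norm (\<xi> (k - j))) * D k j powr - \<theta>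
      \<le> (jb k powr a * jb j powr - \<tau> * norm (\<xi> (k - j))) * (4 powr \<theta> * (jb (k - j) powr - \<theta> * jb (k + j) powr - \<theta>))"
      unfolding D_def by (intro mult_left_mono square_diff_powr_le that \<theta>) auto
    thus ?thesis by (simp only: mult_ac w_def)
  qed
  have Kb: "mat_bounded K (1/2)"
  proof (rule mat_bounded_weaken)
    show "mat_bounded K ((L powr (\<theta> - 1) * 4 powr \<theta>) * CK)"
    proof (rule mat_bounded_scale[OF CK])
      fix k j
      show "norm (K k j) \<le> L powr (\<theta> - 1) * 4 powr \<theta> * norm (complex_of_real (w k j))"
      proof (cases "L \<le> D k j")
        case True
        have ne: "k\<^sup>2 \<noteq> j\<^sup>2" using True L1 unfolding D_def by (metis abs_zero diff_self not_one_le_zero of_int_0 order_trans)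
        have "norm (K k j) = jb k powr a * jb j powr - \<tau> * norm (\<xi> (k - j)) / D k j"
          using True by (simp only: K_def if_True norm_mult norm_divide D_def norm_of_real norm_of_int) (simp add: abs_mult)
        also have "\<dots> = jb k powr a * jb j powr - \<tau> * norm (\<xi> (k - j)) * D k j powr - 1"
          using D0[OF ne] by (simp add: powr_minus divide_inverse)
        also have "D k j powr - 1 = D k j powr - \<theta> * D k j powr (\<theta> - 1)" by (simp flip: powr_add)
        also have "jb k powr a * jb j powr - \<tau> * norm (\<xi> (k - j)) * (D k j powr - \<theta> * D k j powr (\<theta> - 1))
          \<le> jb k powr a * jb j powr - \<tau> * norm (\<xi> (k - j)) * (D k j powr - \<theta> * L powr (\<theta> - 1))"
          by (intro mult_left_mono powr_mono2') (use True L1 \<theta> in auto)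
        also have "\<dots> = L powr (\<theta> - 1) * (jb k powr a * jb j powr - \<tau> * norm (\<xi> (k - j)) * D k j powr - \<theta>)" by (simp only: mult_ac)
        also have "\<dots> \<le> L powr (\<theta> - 1) * (4 powr \<theta> * w k j)" by (intro mult_left_mono wle ne) auto
        finally show ?thesis using w0[of k j] by (simp add: mult.assoc)
      qed (simp add: K_def w0)
    qed (use L1 in auto)
    have "1 / c * 4 powr \<theta> * CK = (4 powr \<theta> * CK) / c" by simp
    also have "\<dots> \<le> 1/2" using c1 by (simp add: divide_le_eq) (simp add: c_def)
    finally show "L powr (\<theta> - 1) * 4 powr \<theta> * CK \<le> 1/2" unfolding L2 .
  qed
  \<comment> \<open>Entries with k^2 = j^2 are bounded by \<open>C0\<close>. For the others D < L,
    so 1 \<le> L powr \<theta> * D powr - \<theta>, and as \<tau> \<le> a the kernel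
    \<open>w\<close> dominates.\<close>
  obtain CR where Rb: "mat_bounded R CR"
  proof -
    have Sb: "mat_bounded (\<lambda>k j. of_real (L powr \<theta> * 4 powr \<theta> * w k j)) (L powr \<theta> * 4 powr \<theta> * CK)"
      by (rule mat_bounded_scale[OF CK]) (auto simp: norm_mult)
    have "mat_bounded R (2 * C0 + (L powr \<theta> * 4 powr \<theta>) * CK)"
    proof (rule mat_bounded_add[OF mat_bounded_resonant[OF C0'] Sb])
      show "norm (R k j) \<le> norm (complex_of_real (if j = k \<or> j = - k then C0 else 0))
         + norm (complex_of_real (L powr \<theta> * 4 powr \<theta> * w k j))" for k j
      proof (cases "k\<^sup>2 = j\<^sup>2")
        case True
        hence kj: "j = k \<or> j = - k" by (auto simp: power2_eq_iff)
        hence "norm (R k j) \<le> norm (\<xi> (k - j))"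
          by (auto simp: R_def norm_mult norm_inverse powr_minus)
        also have "\<dots> \<le> C0" by (rule C0)
        finally show ?thesis using kj C0' w0[of k j] by (auto intro: add_increasing2)
      next
        case False
        show ?thesis
        proof (cases "L \<le> D k j")
          case True thus ?thesis by (simp add: R_def)
        next
          case F: False
          have "1 = D k j powr \<theta> * D k j powr - \<theta>" using D0[OF False] by (simp flip: powr_add)
          also have "\<dots> \<le> L powr \<theta> * D k j powr - \<theta>"
            by (intro mult_right_mono powr_mono2) (use F \<theta> in \<open>auto simp: D_def\<close>)
          finally have one: "1 \<le> L powr \<theta> * D k j powr - \<theta>" .
          have "norm (R k j) = jb k powr \<tau> * jb j powr - \<tau> * norm (\<xi> (k - j)) * 1"
            using F by (simp add: R_def norm_mult)
          also have "\<dots> \<le> jb k powr a * jb j powr - \<tau> * norm (\<xi> (k - j)) * (L powr \<theta> * D k j powr - \<theta>)"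
            by (intro mult_mono one jb_powr_mono a) auto
          also have "\<dots> = L powr \<theta> * (jb k powr a * jb j powr - \<tau> * norm (\<xi> (k - j)) * D k j powr - \<theta>)"
            by (simp only: mult_ac)
          also have "\<dots> \<le> L powr \<theta> * (4 powr \<theta> * w k j)" by (intro mult_left_mono wle False) auto
          finally have "norm (R k j) \<le> L powr \<theta> * 4 powr \<theta> * w k j" by (simp only: mult.assoc)
          thus ?thesis using w0[of k j] C0' unfolding norm_of_real by (simp add: abs_mult add_increasing)
        qed
      qed
    qed
    thus ?thesis by (rule that)
  qed
  obtain C\<Xi> where \<Xi>b: "mat_bounded \<Xi> C\<Xi>"
  proof -
    from mult_ker_bounded[OF X \<tau> a(1,2)] obtain C where
      C: "mat_bounded (\<lambda>k j. of_real (jb (k - j) powr \<tau> * norm (\<xi> (k - j)) * (jb k powr \<tau> * jb (k - j) powr - \<tau> * jb j powr - a))) C"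
      unfolding ker_bounded_def by (elim exE)
    have "mat_bounded \<Xi> C"
    proof (rule mat_bounded_mono[OF C])
      fix k j
      have "norm (complex_of_real (jb (k - j) powr \<tau> * norm (\<xi> (k - j)) * (jb k powr \<tau> * jb (k - j) powr - \<tau> * jb j powr - a)))
         = (jb (k - j) powr \<tau> * jb (k - j) powr - \<tau>) * (jb k powr \<tau> * jb j powr - a * norm (\<xi> (k - j)))"
        unfolding norm_of_real by (simp add: abs_mult mult_ac)
      also have "jb (k - j) powr \<tau> * jb (k - j) powr - \<tau> = 1" by (simp flip: powr_add)
      finally have e: "norm (complex_of_real (jb (k - j) powr \<tau> * norm (\<xi> (k - j)) * (jb k powr \<tau> * jb (k - j) powr - \<tau> * jb j powr - a)))
         = jb k powr \<tau> * jb j powr - a * norm (\<xi> (k - j))" by simp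
      show "norm (\<Xi> k j) \<le> norm (complex_of_real (jb (k - j) powr \<tau> * norm (\<xi> (k - j)) * (jb k powr \<tau> * jb (k - j) powr - \<tau> * jb j powr - a)))"
        unfolding e unfolding \<Xi>_def norm_mult norm_of_real by (simp add: abs_mult)
    qed
    thus ?thesis by (rule that)
  qed
  \<comment> \<open>Chosen so that \<open>C\<Xi> / sqrt M \<le> 1/2\<close>, which makes
    \<open>XG\<close> a contraction.\<close>
  define M where "M = (2 * C\<Xi> + 1)\<^sup>2"
  have C\<Xi>0: "0 \<le> C\<Xi>" by (rule mat_bounded_nonneg[OF \<Xi>b])
  have M1: "1 \<le> M" unfolding M_def using C\<Xi>0 by (intro one_le_power) auto
  have sqM: "sqrt M = 2 * C\<Xi> + 1" unfolding M_def using C\<Xi>0 by simp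
  have Mk: "0 < M + (of_int k)\<^sup>2" for k :: int using M1 by (simp add: add_pos_nonneg)
  \<comment> \<open>\<open>dJ\<close> is the inclusion of level \<open>a\<close> into level \<tau>.
    Both \<open>dG\<close> and \<open>dD\<close> are the resolvent of d^2/dx^2 at M, from level
    \<tau> to the levels \<open>a\<close> and \<tau> + 2; \<open>dD'\<close> inverts
    \<open>dD\<close>.\<close>
  define dJ where "dJ k = complex_of_real (jb k powr (\<tau> - a))" for k
  define dG where "dG k = complex_of_real (jb k powr (a - \<tau>) / (M + (of_int k)\<^sup>2))" for k
  define dD where "dD k = complex_of_real ((jb k)\<^sup>2 / (M + (of_int k)\<^sup>2))" for k
  define dD' where "dD' k = complex_of_real ((M + (of_int k)\<^sup>2) / (jb k)\<^sup>2)" for k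
  have J1: "norm (dJ k) \<le> 1" for k unfolding dJ_def using a by (auto intro: powr_le_1)
  have G1: "norm (dG k) \<le> 1 / sqrt M" for k
  proof -
    have "jb k powr (a - \<tau>) \<le> jb k powr 1" by (rule jb_powr_mono) (use a in auto)
    also have "\<dots> \<le> (M + (of_int k)\<^sup>2) / sqrt M"
      using jb_le_sqrt_mult[OF M1, of k] M1 by (simp add: field_simps)
    finally have "jb k powr (a - \<tau>) / (M + (of_int k)\<^sup>2) \<le> 1 / sqrt M"
      using Mk[of k] M1 by (simp add: field_simps)
    thus ?thesis using Mk[of k] unfolding dG_def norm_of_real by (simp add: abs_of_nonneg)
  qed
  have D1: "norm (dD k) \<le> 1" for k
    using Mk[of k] M1 unfolding dD_def norm_of_real by (simp add: jb_sq abs_of_nonneg)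
  have D'1: "norm (dD' k) \<le> M" for k
  proof -
    have "M + (of_int k)\<^sup>2 \<le> M * (1 + (of_int k)\<^sup>2)"
      using mult_right_mono[OF M1, of "(of_int k)\<^sup>2"] by (simp add: algebra_simps)
    hence "(M + (of_int k)\<^sup>2) / (jb k)\<^sup>2 \<le> M"
      by (simp add: divide_le_eq jb_sq add_pos_nonneg mult.commute)
    thus ?thesis unfolding dD'_def norm_of_real using Mk[of k] by (simp add: abs_of_pos)
  qed
  have dd: "dD k * dD' k = 1" for k
  proof -
    have "(jb k)\<^sup>2 / (M + (of_int k)\<^sup>2) * ((M + (of_int k)\<^sup>2) / (jb k)\<^sup>2) = 1" using Mk[of k] by simp
    thus ?thesis by (simp only: dD_def dD'_def of_real_mult[symmetric] of_real_1)
  qed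
  note Kl = bounded_linear_mat_op[OF Kb] and \<Xi>l = bounded_linear_mat_op[OF \<Xi>b]
    and Rl = bounded_linear_mat_op[OF Rb] and Jl = bounded_linear_mult_op[OF J1]
    and Gl = bounded_linear_mult_op[OF G1] and Dl = bounded_linear_mult_op[OF D1]
    and D'l = bounded_linear_mult_op[OF D'1]
  define JK where "JK x = mult_op dJ (mat_op K x)" for x
  define XG where "XG x = mat_op \<Xi> (mult_op dG x)" for x
  have JKl: "bounded_linear JK" unfolding JK_def by (rule bounded_linear_compose[OF Jl Kl])
  have XGl: "bounded_linear XG" unfolding XG_def by (rule bounded_linear_compose[OF \<Xi>l Gl])
  have JKn: "norm (- JK x) \<le> norm x / 2" for x
  proof -
    have "norm (mult_op dJ z) \<le> 1 * norm z" for z by (rule mult_op_norm_le[OF J1])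
    from this[of "mat_op K x"] show ?thesis
      using mat_op_norm_le[OF Kb, where x = x] by (simp add: JK_def)
  qed
  have XGn: "norm (XG x) \<le> norm x / 2" for x
  proof -
    have "norm (XG x) \<le> C\<Xi> * norm (mult_op dG x)" unfolding XG_def by (rule mat_op_norm_le[OF \<Xi>b])
    also have "\<dots> \<le> C\<Xi> * (1 / sqrt M * norm x)" by (intro mult_left_mono mult_op_norm_le G1 C\<Xi>0)
    also have "\<dots> = (C\<Xi> / sqrt M) * norm x" by simp
    also have "\<dots> \<le> 1/2 * norm x"
      unfolding sqM using C\<Xi>0 by (intro mult_right_mono) (auto simp: divide_simps)
    finally show ?thesis by simp
  qed
  \<comment> \<open>\<open>P\<close> is the normal form transformation from Y to v. \<open>Q\<close>
    is multiplication by 1 - \<xi> (M - d^2/dx^2)^(-1) at level \<tau>, so that (M - d^2/dx^2 -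
    \<xi>) u equals \<open>Q\<close> applied to (M - d^2/dx^2) u.\<close>
  define P where "P x = x + JK x" for x
  define Q where "Q x = x - XG x" for x
  obtain P' where P'l: "bounded_linear P'"
    and P': "\<And>x. P' (x - - JK x) = x" "\<And>x. P' x - - JK (P' x) = x"
    using Neumann_inverse[OF bounded_linear_minus[OF JKl] JKn] by blast
  have P'P: "P' (P x) = x" and PP': "P (P' x) = x" for x
    using P'[of x] by (simp_all add: P_def)
  obtain Q' where Q'l: "bounded_linear Q'" and Q'Q: "\<And>x. Q' (Q x) = x" and QQ': "\<And>x. Q (Q' x) = x"
    using Neumann_inverse[OF XGl XGn] unfolding Q_def by blast
  have Pl: "bounded_linear P" unfolding P_def by (intro bounded_linear_add bounded_linear_ident JKl)
  have Ql: "bounded_linear Q" unfolding Q_def by (intro bounded_linear_sub bounded_linear_ident XGl)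
  \<comment> \<open>After the transformation there remain the undivided entries \<open>R\<close> and
    the product of \<xi> with the correction \<open>K\<close>; the latter is bounded because
    \<open>K\<close> ends at level \<open>a\<close>.\<close>
  define B where "B x = P' (mat_op R x + mat_op \<Xi> (mat_op K x))" for x
  define E where "E x = mult_op dD (Q' (P x))" for x
  define E' where "E' x = P' (Q (mult_op dD' x))" for x
  have Bl: "bounded_linear B" unfolding B_def
    by (rule bounded_linear_compose[OF P'l bounded_linear_add[OF Rl bounded_linear_compose[OF \<Xi>l Kl]]])
  have El: "bounded_linear E" unfolding E_def
    by (rule bounded_linear_compose[OF Dl bounded_linear_compose[OF Q'l Pl]])
  have E'l: "bounded_linear E'" unfolding E'_def
    by (rule bounded_linear_compose[OF P'l bounded_linear_compose[OF Ql D'l]])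
  have DD': "mult_op dD (mult_op dD' x) = x" "mult_op dD' (mult_op dD x) = x" for x
    by (rule ell2_eqI; simp add: mult_op_nth[OF D1] mult_op_nth[OF D'1] dd mult.commute[of "dD' _"] flip: mult.assoc)+
  have EE': "E (E' x) = x" "E' (E x) = x" for x
    by (simp_all add: E_def E'_def PP' P'P QQ' Q'Q DD')
  have main: "ell2_nth (E h) k = \<i> * (- of_real ((of_int k)\<^sup>2) * ell2_nth (E Y) k +
          of_real (jb k powr (\<tau> + 2)) * (\<Sum>\<^sub>\<infinity>j. \<xi> (k - j) * (of_real (jb j powr - (\<tau> + 2)) * ell2_nth (E Y) j)))"
    if h: "\<forall>k. ell2_nth h k = \<i> * (- of_real ((of_int k)\<^sup>2) * ell2_nth Y k + ell2_nth (B Y) k)" for h Y k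
  proof -
    let ?k2 = "\<lambda>k::int. complex_of_real ((of_int k)\<^sup>2)"
    \<comment> \<open>\<open>y2\<close> has the coordinates k^2 Y. It is square summable because
      \<open>h\<close> and \<open>B Y\<close> are: the hypothesis on \<open>h\<close> replaces a
      domain condition on \<open>Y\<close>. Since a - \<tau> \<le> 1, it also gives the level
      \<open>a\<close> coordinates \<open>Ya\<close>.\<close>
    define y2 where "y2 = B Y + ii h"
    have y2: "ell2_nth y2 k = ?k2 k * ell2_nth Y k" for k
      by (simp add: y2_def h[rule_format, of k] flip: mult.assoc)
    define Ya where "Ya = to_ell2 (\<lambda>k. of_real (jb k powr (a - \<tau>)) * ell2_nth Y k)"
    have Ya: "ell2_nth Ya k = of_real (jb k powr (a - \<tau>)) * ell2_nth Y k" for k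
      unfolding Ya_def
    proof (subst ell2_nth_to_ell2)
      show "(\<lambda>k. (norm (of_real (jb k powr (a - \<tau>)) * ell2_nth Y k))\<^sup>2) summable_on UNIV"
      proof (rule sq_summable_scale[of "\<lambda>k. ell2_nth (Y + y2) k" _ 1])
        fix k
        have "jb k powr (a - \<tau>) \<le> jb k powr 1" by (rule jb_powr_mono) (use a in auto)
        also have "\<dots> \<le> (jb k)\<^sup>2" by (simp add: self_le_power)
        finally have "jb k powr (a - \<tau>) \<le> 1 + (of_int k)\<^sup>2" by (simp add: jb_sq)
        hence "norm (of_real (jb k powr (a - \<tau>)) * ell2_nth Y k) \<le> (1 + (of_int k)\<^sup>2) * norm (ell2_nth Y k)"
          by (simp add: norm_mult mult_right_mono)
        also have "\<dots> = norm (of_real (1 + (of_int k)\<^sup>2) * ell2_nth Y k)"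
          unfolding norm_mult norm_of_real by (simp add: abs_of_pos add_pos_nonneg)
        also have "of_real (1 + (of_int k)\<^sup>2) * ell2_nth Y k = ell2_nth (Y + y2) k"
          by (simp add: y2 algebra_simps)
        finally show "norm (of_real (jb k powr (a - \<tau>)) * ell2_nth Y k) \<le> 1 * norm (ell2_nth (Y + y2) k)" by simp
      qed (rule ell2_nth_summable)
    qed simp
    define V where "V = P Y"
    define Va where "Va = Ya + mat_op K Y"
    have aa: "of_real (jb k powr (\<tau> - a)) * of_real (jb k powr (a - \<tau>)) = (1 :: complex)" for k
    proof -
      have "jb k powr (\<tau> - a) * jb k powr (a - \<tau>) = 1" by (simp flip: powr_add)
      thus ?thesis by (metis of_real_1 of_real_mult)
    qed
    have VVa: "ell2_nth V k = of_real (jb k powr (\<tau> - a)) * ell2_nth Va k" for k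
      by (simp add: V_def P_def JK_def Va_def Ya mult_op_nth[OF J1] dJ_def distrib_left aa flip: mult.assoc)
    have VaV: "ell2_nth Va k = of_real (jb k powr (a - \<tau>)) * ell2_nth V k" for k
      by (simp add: VVa aa mult.commute[of "of_real (jb k powr (a - \<tau>))"] flip: mult.assoc)
    have PBY: "P (B Y) = mat_op R Y + mat_op \<Xi> (mat_op K Y)"
      by (simp add: B_def PP')
    have heq: "h = ii (B Y - y2)"
      by (rule ell2_eqI) (simp add: y2_def algebra_simps flip: mult.assoc)
    have Pii: "P (ii x) = ii (P x)" for x
      unfolding P_def JK_def mat_op_ii[OF Kb] mult_op_ii[OF J1]
      by (rule bounded_linear.linear[OF bounded_linear_ii, THEN linear_add, symmetric])
    \<comment> \<open>The commutator of k^2 with \<open>K\<close> multiplies its entries by k^2 -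
      j^2 and so restores the divided entries of \<xi>. Together with \<open>R\<close> they form the
      whole potential.\<close>
    have nonres: "ell2_nth (mat_op R Y) k + ?k2 k * ell2_nth (JK Y) k - ell2_nth (JK y2) k = ell2_nth (mat_op \<Xi> Ya) k" for k
    proof -
      note s = mat_row_summable[OF Rb, of k Y] mat_row_summable[OF Kb, of k Y] mat_row_summable[OF Kb, of k y2]
      let ?d = "of_real (jb k powr (\<tau> - a)) :: complex"
      have "ell2_nth (mat_op R Y) k + ?k2 k * ell2_nth (JK Y) k - ell2_nth (JK y2) k
         = (\<Sum>\<^sub>\<infinity>j. R k j * ell2_nth Y j) + (\<Sum>\<^sub>\<infinity>j. (?k2 k * ?d) * (K k j * ell2_nth Y j)) - (\<Sum>\<^sub>\<infinity>j. ?d * (K k j * ell2_nth y2 j))"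
        by (simp add: JK_def mult_op_nth[OF J1] dJ_def mat_op_nth[OF Rb] mat_op_nth[OF Kb] infsum_cmult_right' mult.assoc)
      also have "\<dots> = (\<Sum>\<^sub>\<infinity>j. R k j * ell2_nth Y j + (?k2 k * ?d) * (K k j * ell2_nth Y j) - ?d * (K k j * ell2_nth y2 j))"
      proof -
        have "((\<lambda>j. R k j * ell2_nth Y j + (?k2 k * ?d) * (K k j * ell2_nth Y j) - ?d * (K k j * ell2_nth y2 j)) has_sum
           ((\<Sum>\<^sub>\<infinity>j. R k j * ell2_nth Y j) + (\<Sum>\<^sub>\<infinity>j. (?k2 k * ?d) * (K k j * ell2_nth Y j)) - (\<Sum>\<^sub>\<infinity>j. ?d * (K k j * ell2_nth y2 j)))) UNIV"
          by (intro has_sum_add has_sum_minus has_sum_infsum summable_on_cmult_right s)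
        thus ?thesis by (rule infsumI[symmetric])
      qed
      also have "\<dots> = (\<Sum>\<^sub>\<infinity>j. \<Xi> k j * ell2_nth Ya j)"
      proof (rule infsum_cong)
        fix j
        have e1: "R k j + (?k2 k * ?d) * K k j - ?d * K k j * ?k2 j = of_real (jb k powr \<tau> * jb j powr - \<tau>) * \<xi> (k - j)"
        proof (cases "L \<le> D k j")
          case True
          have nz: "of_int (k\<^sup>2 - j\<^sup>2) \<noteq> (0 :: complex)" using True L1 unfolding D_def
            by (metis abs_zero not_one_le_zero of_int_0 of_int_eq_0_iff order_trans)
          have "?d * of_real (jb k powr a * jb j powr - \<tau>) = of_real (jb k powr \<tau> * jb j powr - \<tau>)"
          proof -
            have "jb k powr (\<tau> - a) * (jb k powr a * jb j powr - \<tau>) = jb k powr \<tau> * jb j powr - \<tau>"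
              by (simp flip: powr_add mult.assoc)
            thus ?thesis by (metis of_real_mult)
          qed
          moreover have "R k j + (?k2 k * ?d) * K k j - ?d * K k j * ?k2 j = (?d * K k j) * of_int (k\<^sup>2 - j\<^sup>2)"
            using True by (simp add: R_def algebra_simps)
          ultimately show ?thesis using True nz by (simp add: K_def flip: mult.assoc)
        next
          case False thus ?thesis by (simp add: R_def K_def)
        qed
        have "R k j * ell2_nth Y j + (?k2 k * ?d) * (K k j * ell2_nth Y j) - ?d * (K k j * ell2_nth y2 j)
          = (R k j + (?k2 k * ?d) * K k j - ?d * K k j * ?k2 j) * ell2_nth Y j"
          by (simp only: y2 ring_distribs left_diff_distrib mult_ac)
        also have "\<dots> = of_real (jb k powr \<tau> * jb j powr - \<tau>) * \<xi> (k - j) * ell2_nth Y j" by (simp only: e1)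
        also have "of_real (jb k powr \<tau> * jb j powr - \<tau>) = complex_of_real (jb k powr \<tau> * jb j powr - a) * of_real (jb j powr (a - \<tau>))"
        proof -
          have "jb k powr \<tau> * jb j powr - \<tau> = (jb k powr \<tau> * jb j powr - a) * jb j powr (a - \<tau>)"
            by (simp add: mult.assoc flip: powr_add)
          thus ?thesis by (metis of_real_mult)
        qed
        finally show "R k j * ell2_nth Y j + (?k2 k * ?d) * (K k j * ell2_nth Y j) - ?d * (K k j * ell2_nth y2 j) = \<Xi> k j * ell2_nth Ya j"
          by (simp only: \<Xi>_def Ya mult_ac)
      qed
      also have "\<dots> = ell2_nth (mat_op \<Xi> Ya) k" by (simp add: mat_op_nth[OF \<Xi>b])
      finally show ?thesis .
    qed
    have Ph: "ell2_nth (P h) k = \<i> * (ell2_nth (mat_op \<Xi> Va) k - ?k2 k * ell2_nth V k)" for k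
    proof -
      have "P h = ii (P (B Y) - P y2)"
        unfolding heq Pii by (simp add: linear_diff[OF bounded_linear.linear[OF Pl]])
      hence "ell2_nth (P h) k = \<i> * (ell2_nth (P (B Y)) k - ell2_nth (P y2) k)" by simp
      also have "ell2_nth (P (B Y)) k - ell2_nth (P y2) k
        = (ell2_nth (mat_op R Y) k + ?k2 k * ell2_nth (JK Y) k - ell2_nth (JK y2) k) + ell2_nth (mat_op \<Xi> (mat_op K Y)) k - ?k2 k * ell2_nth V k"
        unfolding PBY by (simp add: P_def V_def y2 algebra_simps)
      also have "\<dots> = ell2_nth (mat_op \<Xi> Va) k - ?k2 k * ell2_nth V k"
        unfolding nonres Va_def by (simp add: linear_add[OF bounded_linear.linear[OF \<Xi>l]])
      finally show ?thesis .
    qed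
    \<comment> \<open>The equation for \<open>P h\<close> shows that W = (M - d^2/dx^2) v is square
      summable, so v has two more derivatives at level \<tau> and \<open>Q W\<close> may be
      formed.\<close>
    define W where "W = M *\<^sub>R V + mat_op \<Xi> Va + ii (P h)"
    have W: "ell2_nth W k = of_real (M + (of_int k)\<^sup>2) * ell2_nth V k" for k
      unfolding W_def by (simp add: Ph algebra_simps scaleR_conv_of_real flip: mult.assoc)
    have nzM: "complex_of_real (M + (of_int k)\<^sup>2) \<noteq> 0" for k :: int
      using Mk[of k] by (metis less_irrefl of_real_eq_0_iff)
    have "mult_op dG W = Va"
      by (rule ell2_eqI) (use nzM in \<open>simp add: mult_op_nth[OF G1] W VaV dG_def del: of_real_add\<close>)
    hence QW: "Q W = M *\<^sub>R V + ii (P h)" by (simp add: Q_def XG_def W_def)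
    have Qii: "Q (ii x) = ii (Q x)" for x
      unfolding Q_def XG_def mult_op_ii[OF G1] mat_op_ii[OF \<Xi>b]
      by (rule bounded_linear.linear[OF bounded_linear_ii, THEN linear_diff, symmetric])
    have Q'ii: "Q' (ii x) = ii (Q' x)" for x
      by (metis Q'Q QQ' Qii)
    \<comment> \<open>As Q T = V, the vector \<open>T\<close> represents (M - d^2/dx^2) u for v = (M
      - d^2/dx^2 - \<xi>) u. Applying \<open>Q'\<close> to the equation for v turns it into the
      equation for u, and \<open>dD\<close> passes to level \<tau> + 2.\<close>
    define T where "T = Q' V"
    have "W = Q' (M *\<^sub>R V + ii (P h))" using Q'Q[of W] by (simp add: QW)
    hence WT: "W = M *\<^sub>R T + ii (Q' (P h))"
      by (simp add: linear_add[OF bounded_linear.linear[OF Q'l]] linear_scale[OF bounded_linear.linear[OF Q'l]] Q'ii T_def)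
    have EY: "ell2_nth (E Y) k = dD k * ell2_nth T k" for k
      by (simp add: E_def T_def V_def mult_op_nth[OF D1])
    have "ell2_nth (Q' (P h)) k = \<i> * (of_real M * ell2_nth T k - ell2_nth W k)"
      unfolding WT by (simp add: scaleR_conv_of_real flip: mult.assoc)
    hence "ell2_nth (E h) k = \<i> * (of_real M * ell2_nth (E Y) k - dD k * ell2_nth W k)"
      by (simp add: E_def mult_op_nth[OF D1] EY[unfolded E_def mult_op_nth[OF D1]] right_diff_distrib mult_ac)
    also have "dD k * ell2_nth W k = of_real ((jb k)\<^sup>2) * ell2_nth V k"
      unfolding W dD_def using nzM[of k] by (simp del: of_real_add)
    also have "V = Q T" by (simp add: T_def QQ')
    hence "ell2_nth V k = ell2_nth T k - ell2_nth (XG T) k" by (simp add: Q_def)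
    also have "of_real ((jb k)\<^sup>2) * (ell2_nth T k - ell2_nth (XG T) k)
      = of_real (M + (of_int k)\<^sup>2) * ell2_nth (E Y) k - of_real ((jb k)\<^sup>2) * ell2_nth (XG T) k"
      unfolding EY dD_def using nzM[of k] by (simp add: right_diff_distrib del: of_real_add)
    also have "of_real ((jb k)\<^sup>2) * ell2_nth (XG T) k
      = of_real (jb k powr (\<tau> + 2)) * (\<Sum>\<^sub>\<infinity>j. \<xi> (k - j) * (of_real (jb j powr - (\<tau> + 2)) * ell2_nth (E Y) j))"
    proof -
      have "ell2_nth (XG T) k = (\<Sum>\<^sub>\<infinity>j. \<Xi> k j * ell2_nth (mult_op dG T) j)"
        by (simp add: XG_def mat_op_nth[OF \<Xi>b])
      also have "\<dots> = (\<Sum>\<^sub>\<infinity>j. of_real (jb k powr \<tau>) * (\<xi> (k - j) * (of_real (jb j powr - (\<tau> + 2)) * ell2_nth (E Y) j)))"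
      proof (rule infsum_cong)
        fix j
        have "jb j powr - a * (jb j powr (a - \<tau>) / (M + (of_int j)\<^sup>2)) = jb j powr - (\<tau> + 2) * ((jb j)\<^sup>2 / (M + (of_int j)\<^sup>2))"
        proof -
          have "(jb j)\<^sup>2 = jb j powr 2" by simp
          thus ?thesis by (simp only: times_divide_eq_right powr_add[symmetric]) (simp add: algebra_simps)
        qed
        hence *: "of_real (jb j powr - a) * dG j = of_real (jb j powr - (\<tau> + 2)) * dD j"
          unfolding dG_def dD_def by (metis of_real_mult)
        have "\<Xi> k j * ell2_nth (mult_op dG T) j
          = of_real (jb k powr \<tau>) * (\<xi> (k - j) * ((of_real (jb j powr - a) * dG j) * ell2_nth T j))"
          by (simp add: \<Xi>_def mult_op_nth[OF G1])
        thus "\<Xi> k j * ell2_nth (mult_op dG T) j = of_real (jb k powr \<tau>) * (\<xi> (k - j) * (of_real (jb j powr - (\<tau> + 2)) * ell2_nth (E Y) j))"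
          unfolding * EY by (simp only: mult.assoc)
      qed
      also have "\<dots> = of_real (jb k powr \<tau>) * (\<Sum>\<^sub>\<infinity>j. \<xi> (k - j) * (of_real (jb j powr - (\<tau> + 2)) * ell2_nth (E Y) j))"
        by (rule infsum_cmult_right')
      finally show ?thesis by (simp add: powr_add)
    qed
    finally show ?thesis by (simp add: algebra_simps)
  qed
  show ?thesis
    by (rule exI[of _ E], rule exI[of _ E'], rule exI[of _ B], intro conjI allI impI)
       (fact El E'l Bl EE' | rule main, assumption)+
qed

section \<open>Semilinear evolution equations\<close>

definition schroedinger :: "real \<Rightarrow> int ell2 \<Rightarrow> int ell2" where
  "schroedinger t = mult_op (\<lambda>k. cis (- (t * (of_int k)\<^sup>2)))"

lemma schroedinger_nth: "ell2_nth (schroedinger t x) k = cis (- (t * (of_int k)\<^sup>2)) * ell2_nth x k"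
  unfolding schroedinger_def by (subst mult_op_nth[where C = 1]) (simp_all only: norm_cis order_refl)

lemma bounded_linear_schroedinger: "bounded_linear (schroedinger t)"
  unfolding schroedinger_def by (rule bounded_linear_mult_op[where C = 1]) simp

lemmas linear_schroedinger = bounded_linear.linear[OF bounded_linear_schroedinger]

lemma norm_schroedinger [simp]: "norm (schroedinger t x) = norm x"
proof -
  have "(norm (schroedinger t x))\<^sup>2 = (norm x)\<^sup>2"
    by (simp add: norm_ell2_sq schroedinger_nth norm_mult)
  thus ?thesis by simp
qed

lemma schroedinger_0 [simp]: "schroedinger 0 x = x"
  by (rule ell2_eqI) (simp add: schroedinger_nth)

lemma ell2_approx:
  assumes "0 < e"
  obtains F where "finite F" "norm (x - mult_op (\<lambda>i. if i \<in> F then 1 else 0) x) < e"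
proof -
  have lim: "(sum (\<lambda>i. (norm (ell2_nth x i))\<^sup>2) \<longlongrightarrow> (norm x)\<^sup>2) (finite_subsets_at_top UNIV)"
    unfolding norm_ell2_sq by (rule infsum_tendsto[OF ell2_nth_summable])
  have "\<forall>\<^sub>F F in finite_subsets_at_top UNIV. dist (\<Sum>i\<in>F. (norm (ell2_nth x i))\<^sup>2) ((norm x)\<^sup>2) < (e/2)\<^sup>2"
    using lim assms by (intro tendstoD) auto
  then obtain F where F: "finite F" "dist (\<Sum>i\<in>F. (norm (ell2_nth x i))\<^sup>2) ((norm x)\<^sup>2) < (e/2)\<^sup>2"
    unfolding eventually_finite_subsets_at_top by blast
  let ?z = "mult_op (\<lambda>i. if i \<in> F then 1 else 0) x"
  have z: "ell2_nth ?z i = (if i \<in> F then ell2_nth x i else 0)" for i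
    by (subst mult_op_nth[where C = 1]) auto
  have "norm (x - ?z) \<le> e/2"
  proof (rule norm_ell2_leI)
    fix G :: "'a set" assume G: "finite G"
    have "(\<Sum>i\<in>G. (norm (ell2_nth (x - ?z) i))\<^sup>2) = (\<Sum>i\<in>G - F. (norm (ell2_nth x i))\<^sup>2)"
      using G by (intro sum.mono_neutral_cong_right) (auto simp: z)
    also have "\<dots> = (\<Sum>i\<in>G \<union> F. (norm (ell2_nth x i))\<^sup>2) - (\<Sum>i\<in>F. (norm (ell2_nth x i))\<^sup>2)"
    proof -
      have "G \<union> F = (G - F) \<union> F" by blast
      hence "(\<Sum>i\<in>G \<union> F. (norm (ell2_nth x i))\<^sup>2) = (\<Sum>i\<in>G - F. (norm (ell2_nth x i))\<^sup>2) + (\<Sum>i\<in>F. (norm (ell2_nth x i))\<^sup>2)"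
        by (simp only:) (rule sum.union_disjoint, use G F(1) in auto)
      thus ?thesis by simp
    qed
    also have "\<dots> \<le> (norm x)\<^sup>2 - (\<Sum>i\<in>F. (norm (ell2_nth x i))\<^sup>2)"
      using sum_le_norm_ell2_sq[of "G \<union> F" x] G F(1) by simp
    also have "\<dots> \<le> (e/2)\<^sup>2" using F(2) by (simp add: dist_real_def abs_less_iff)
    finally show "(\<Sum>i\<in>G. (norm (ell2_nth (x - ?z) i))\<^sup>2) \<le> (e/2)\<^sup>2" .
  qed (use assms in auto)
  hence "norm (x - ?z) < e" using assms by linarith
  thus thesis by (rule that[OF F(1)])
qed

text \<open>The group is only strongly continuous. On finitely many modes continuity is elementary,
  and isometry of the group carries it over to the closure.\<close>

lemma tendsto_schroedinger: "((\<lambda>t. schroedinger t x) \<longlongrightarrow> schroedinger s x) (at s within A)"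
proof (rule tendstoI)
  fix e :: real assume e: "0 < e"
  hence "0 < e / 3" by simp
  then obtain F where F: "finite F" "norm (x - mult_op (\<lambda>i. if i \<in> F then 1 else 0) x) < e / 3"
    by (rule ell2_approx)
  define z where "z = mult_op (\<lambda>i. if i \<in> F then 1 else 0) x"
  have z: "ell2_nth z i = (if i \<in> F then ell2_nth x i else 0)" for i
    unfolding z_def by (subst mult_op_nth[where C = 1]) auto
  define f where "f t = (\<Sum>k\<in>F. (norm (cis (- (t * (of_int k)\<^sup>2)) - cis (- (s * (of_int k)\<^sup>2))))\<^sup>2 * (norm (ell2_nth x k))\<^sup>2)" for t
  have nz: "(norm (schroedinger t z - schroedinger s z))\<^sup>2 \<le> f t" for t
  proof -
    have "norm (schroedinger t z - schroedinger s z) \<le> sqrt (f t)"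
    proof (rule norm_ell2_leI)
      fix G :: "int set" assume G: "finite G"
      have "(\<Sum>k\<in>G. (norm (ell2_nth (schroedinger t z - schroedinger s z) k))\<^sup>2)
        = (\<Sum>k\<in>G. (norm (cis (- (t * (of_int k)\<^sup>2)) - cis (- (s * (of_int k)\<^sup>2))))\<^sup>2 * (norm (ell2_nth z k))\<^sup>2)"
        by (simp add: schroedinger_nth norm_mult power_mult_distrib flip: left_diff_distrib)
      also have "\<dots> = (\<Sum>k\<in>G \<inter> F. (norm (cis (- (t * (of_int k)\<^sup>2)) - cis (- (s * (of_int k)\<^sup>2))))\<^sup>2 * (norm (ell2_nth x k))\<^sup>2)"
        using G by (intro sum.mono_neutral_cong_right) (auto simp: z)
      also have "\<dots> \<le> f t" unfolding f_def by (rule sum_mono2) (use F in auto)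
      finally show "(\<Sum>k\<in>G. (norm (ell2_nth (schroedinger t z - schroedinger s z) k))\<^sup>2) \<le> (sqrt (f t))\<^sup>2"
        by (simp add: f_def sum_nonneg)
    qed (simp add: f_def sum_nonneg)
    hence "(norm (schroedinger t z - schroedinger s z))\<^sup>2 \<le> (sqrt (f t))\<^sup>2" by (intro power_mono) auto
    thus ?thesis by (simp add: f_def sum_nonneg)
  qed
  have "continuous (at s within A) f"
    unfolding f_def cis_conv_exp by (intro continuous_intros)
  hence "(f \<longlongrightarrow> f s) (at s within A)" by (simp add: continuous_within)
  moreover have "f s = 0" by (simp add: f_def)
  ultimately have "(f \<longlongrightarrow> 0) (at s within A)" by simp
  hence "\<forall>\<^sub>F t in at s within A. dist (f t) 0 < (e/3)\<^sup>2" using e by (intro tendstoD) auto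
  thus "\<forall>\<^sub>F t in at s within A. dist (schroedinger t x) (schroedinger s x) < e"
  proof eventually_elim
    case (elim t)
    hence sq: "(norm (schroedinger t z - schroedinger s z))\<^sup>2 < (e/3)\<^sup>2" using nz[of t] by (simp add: dist_real_def)
    have 1: "norm (schroedinger t z - schroedinger s z) < e/3"
      by (rule power2_less_imp_less[OF sq]) (use e in simp)
    have "schroedinger t x - schroedinger s x
      = schroedinger t (x - z) + (schroedinger t z - schroedinger s z) - schroedinger s (x - z)"
      by (simp add: linear_diff[OF linear_schroedinger])
    also have "norm \<dots> \<le> norm (schroedinger t (x - z)) + norm (schroedinger t z - schroedinger s z) + norm (schroedinger s (x - z))"
      using norm_triangle_ineq4[of "schroedinger t (x - z) + (schroedinger t z - schroedinger s z)" "schroedinger s (x - z)"]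
        norm_triangle_ineq[of "schroedinger t (x - z)" "schroedinger t z - schroedinger s z"] by linarith
    also have "\<dots> < e" using 1 F(2) unfolding z_def[symmetric] by simp
    finally show ?case by (simp add: dist_norm)
  qed
qed

lemma continuous_on_schroedinger:
  assumes f: "continuous_on A f" and g: "continuous_on A g"
  shows "continuous_on A (\<lambda>t. schroedinger (g t) (f t))"
  unfolding continuous_on_def
proof
  fix s assume s: "s \<in> A"
  have fl: "(f \<longlongrightarrow> f s) (at s within A)" and gl: "(g \<longlongrightarrow> g s) (at s within A)"
    using f g s by (auto simp: continuous_on_def)
  have nh: "((\<lambda>t. schroedinger t (f s)) \<longlongrightarrow> schroedinger (g s) (f s)) (nhds (g s))"
    unfolding tendsto_at_iff_tendsto_nhds[of "\<lambda>t. schroedinger t (f s)" "g s", symmetric]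
    by (rule tendsto_schroedinger)
  have 1: "((\<lambda>t. schroedinger (g t) (f s)) \<longlongrightarrow> schroedinger (g s) (f s)) (at s within A)"
    by (rule filterlim_compose[OF nh gl])
  have 2: "((\<lambda>t. schroedinger (g t) (f t - f s)) \<longlongrightarrow> 0) (at s within A)"
    by (rule tendsto_norm_zero_cancel) (use tendsto_norm_zero[OF LIM_zero[OF fl]] in simp)
  from tendsto_add[OF 1 2]
  show "((\<lambda>t. schroedinger (g t) (f t)) \<longlongrightarrow> schroedinger (g s) (f s)) (at s within A)"
    by (simp add: linear_diff[OF linear_schroedinger])
qed

text \<open>The function \<open>g\<close>, which is exp (- L t) times the right-hand side of the
  assumption, has nonpositive derivative.\<close>

lemma Gronwall:
  fixes f :: "real \<Rightarrow> real"
  assumes f: "continuous_on {0..T} f" and L: "0 \<le> L" and T: "0 \<le> T"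
    and le: "\<And>t. t \<in> {0..T} \<Longrightarrow> f t \<le> A + L * integral {0..t} f"
  shows "f T \<le> A * exp (L * T)"
proof -
  define F where "F t = integral {0..t} f" for t
  have dF: "(F has_real_derivative f t) (at t within {0..T})" if "t \<in> {0..T}" for t
    using integral_has_vector_derivative[OF f that] unfolding F_def has_real_derivative_iff_has_vector_derivative .
  define g where "g t = exp (- (L * t)) * (A + L * F t)" for t
  have dg: "(g has_real_derivative exp (- (L * t)) * (L * (f t - A - L * F t))) (at t within {0..T})" if "t \<in> {0..T}" for t
    unfolding g_def by (rule derivative_eq_intros dF[OF that] refl | simp add: algebra_simps)+
  have "g T \<le> g 0"
  proof (rule DERIV_nonpos_imp_decreasing_open[of 0 T g])
    show "0 \<le> T" by fact
    show "continuous_on {0..T} g"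
      by (rule DERIV_continuous_on[OF dg])
    fix t assume t: "0 < t" "t < T"
    show "\<exists>y. (g has_real_derivative y) (at t) \<and> y \<le> 0"
    proof (intro exI conjI)
      show "(g has_real_derivative exp (- (L * t)) * (L * (f t - A - L * F t))) (at t)"
        using dg[of t] t at_within_Icc_at[of 0 t T] by simp
      have "f t - A - L * F t \<le> 0" using le[of t] t by (simp add: F_def)
      thus "exp (- (L * t)) * (L * (f t - A - L * F t)) \<le> 0"
        using L by (simp add: mult_nonneg_nonpos)
    qed
  qed
  hence "exp (- (L * T)) * (A + L * F T) \<le> A" by (simp add: g_def F_def)
  from mult_right_mono[OF this, of "exp (L * T)"]
  have "exp (- (L * T)) * exp (L * T) * (A + L * F T) \<le> A * exp (L * T)" by (simp add: mult_ac)
  hence "A + L * F T \<le> A * exp (L * T)" by (simp flip: exp_add)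
  moreover have "f T \<le> A + L * F T" unfolding F_def by (rule le) (use T in simp)
  ultimately show ?thesis by linarith
qed

lemma integral_bounded_linear:
  fixes f :: "real \<Rightarrow> 'a::banach"
  assumes "bounded_linear h" "continuous_on {a..b} f"
  shows "integral {a..b} (\<lambda>x. h (f x)) = h (integral {a..b} f)"
  using integral_linear[OF integrable_continuous_real[OF assms(2)] assms(1)] by (simp add: o_def)

lemma continuous_on_atLeastI:
  fixes f :: "real \<Rightarrow> 'a::topological_space"
  assumes "\<And>b. continuous_on {a..b} f"
  shows "continuous_on {a..} f"
  unfolding continuous_on_def
proof
  fix t assume t: "t \<in> {a..}"
  have "(f \<longlongrightarrow> f t) (at t within {a..t+1})" using assms[of "t+1"] t by (auto simp: continuous_on_def)
  moreover have "at t within {a..t+1} = at t within {a..}"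
    by (rule at_within_nhd[of t "{..<t+1}"]) (use t in auto)
  ultimately show "(f \<longlongrightarrow> f t) (at t within {a..})" by simp
qed

lemma continuous_on_lipschitz:
  fixes \<Psi> :: "'a::real_normed_vector \<Rightarrow> 'b::real_normed_vector"
  assumes L: "\<And>x y. norm (\<Psi> x - \<Psi> y) \<le> L * norm (x - y)"
  shows "continuous_on A \<Psi>"
proof -
  have "0 \<le> L" if "x \<noteq> y" for x y :: 'a
  proof -
    have "0 \<le> L * norm (x - y)" using L[of x y] norm_ge_zero order_trans by blast
    thus ?thesis using that by (simp add: zero_le_mult_iff)
  qed
  hence "norm (\<Psi> x - \<Psi> y) \<le> max L 0 * norm (x - y)" for x y
    using L[of x y] by (cases "x = y") (auto simp: max_def)
  hence "(max L 0)-lipschitz_on A \<Psi>"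
    by (intro lipschitz_onI) (auto simp: dist_norm)
  thus ?thesis by (rule lipschitz_on_continuous_on)
qed

lemma has_integral_exp_mult:
  fixes c :: real
  assumes "0 < c" "0 \<le> s"
  shows "((\<lambda>\<rho>. exp (c * \<rho>)) has_integral (exp (c * s) - 1) / c) {0..s}"
proof -
  have "((\<lambda>\<rho>. exp (c * \<rho>)) has_integral exp (c * s) / c - exp (c * 0) / c) {0..s}"
  proof (rule fundamental_theorem_of_calculus[OF assms(2)])
    fix x assume "x \<in> {0..s}"
    have "((\<lambda>\<rho>. exp (c * \<rho>) / c) has_real_derivative exp (c * x)) (at x within {0..s})"
      using assms(1) by (auto intro!: derivative_eq_intros)
    thus "((\<lambda>\<rho>. exp (c * \<rho>) / c) has_vector_derivative exp (c * x)) (at x within {0..s})"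
      by (simp add: has_real_derivative_iff_has_vector_derivative)
  qed
  thus ?thesis by (simp add: diff_divide_distrib)
qed

text \<open>Duhamel's formula with the group factored out. The integrand then depends on the
  integration variable only, and the integral is an ordinary primitive.\<close>

definition mild_solution :: "(int ell2 \<Rightarrow> int ell2) \<Rightarrow> int ell2 \<Rightarrow> real set \<Rightarrow> (real \<Rightarrow> int ell2) \<Rightarrow> bool" where
  "mild_solution \<Psi> y0 I y \<longleftrightarrow> continuous_on I y \<and>
     (\<forall>t\<in>I. y t = schroedinger t (y0 + integral {0..t} (\<lambda>\<rho>. schroedinger (- \<rho>) (\<Psi> (y \<rho>)))))"

text \<open>Picard iteration on the whole half-line at once, in the norm sup exp (- c t) * norm (y
  t): for c \<ge> 2 L the integral operator contracts with factor 1/2, so no continuation of local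
  solutions is needed.\<close>

lemma mild_solution_exists:
  assumes L: "\<And>x y. norm (\<Psi> x - \<Psi> y) \<le> L * norm (x - y)" and L0: "0 \<le> L"
  shows "\<exists>y. mild_solution \<Psi> y0 {0..} y"
proof -
  \<comment> \<open>The summand 1 keeps \<open>c\<close> positive in the case L = 0, since the
    estimates divide by \<open>c\<close>.\<close>
  define c where "c = 2 * L + 1"
  have c: "0 < c" "2 * L \<le> c" using L0 by (auto simp: c_def)
  have \<Psi>c: "continuous_on A \<Psi>" for A by (rule continuous_on_lipschitz[OF L])
  define h where "h g \<rho> = schroedinger (- \<rho>) (\<Psi> (exp (c * \<rho>) *\<^sub>R apply_bcontfun g \<rho>))" for g \<rho>
  have hc: "continuous_on A (h g)" for A g
    unfolding h_def
    by (intro continuous_on_schroedinger continuous_on_compose2[OF \<Psi>c[of UNIV]] continuous_intros) auto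
  define F where "F g s = integral {0..s} (h g)" for g s
  have Fc: "continuous_on {0..} (F g)" for g
    unfolding F_def
    by (rule continuous_on_atLeastI, rule indefinite_integral_continuous_1, rule integrable_continuous_real, rule hc)
  \<comment> \<open>The unknown \<open>g\<close> is y damped by exp (- c t). Bounded continuous
    functions are taken on the whole line, so negative times are frozen at 0 by
    \<open>max 0 t\<close>.\<close>
  define \<Phi> where "\<Phi> g t = exp (- (c * max 0 t)) *\<^sub>R schroedinger (max 0 t) (y0 + F g (max 0 t))" for g t
  have \<Phi>c: "continuous_on UNIV (\<Phi> g)" for g
    unfolding \<Phi>_def
    by (intro continuous_intros continuous_on_schroedinger continuous_on_compose2[OF Fc]) auto
  have int_le: "norm (exp (- (c * s)) *\<^sub>R integral {0..s} f) \<le> b / c"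
    if s: "0 \<le> s" and f: "continuous_on {0..s} f" and b: "\<And>\<rho>. \<rho> \<in> {0..s} \<Longrightarrow> norm (f \<rho>) \<le> b * exp (c * \<rho>)" and b0: "0 \<le> b"
    for s b and f :: "real \<Rightarrow> int ell2"
  proof -
    have i: "((\<lambda>\<rho>. b * exp (c * \<rho>)) has_integral b * ((exp (c * s) - 1) / c)) {0..s}"
      by (rule has_integral_mult_right[OF has_integral_exp_mult[OF c(1) s]])
    have "norm (integral {0..s} f) \<le> integral {0..s} (\<lambda>\<rho>. b * exp (c * \<rho>))"
      by (rule integral_norm_bound_integral[OF integrable_continuous_real[OF f] has_integral_integrable[OF i] b])
    also have "\<dots> = b * ((exp (c * s) - 1) / c)" by (rule integral_unique[OF i])
    also have "\<dots> \<le> b * (exp (c * s) / c)"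
      using c b0 by (intro mult_left_mono divide_right_mono) auto
    finally have "exp (- (c * s)) * norm (integral {0..s} f) \<le> exp (- (c * s)) * (b * (exp (c * s) / c))"
      by (intro mult_left_mono) auto
    also have "\<dots> = (exp (- (c * s)) * exp (c * s)) * (b / c)" by simp
    also have "exp (- (c * s)) * exp (c * s) = 1" by (simp flip: exp_add)
    finally show ?thesis by simp
  qed
  have hb: "norm (h g \<rho>) \<le> (norm (\<Psi> 0) + L * norm g) * exp (c * \<rho>)" if "0 \<le> \<rho>" for g \<rho>
  proof -
    have e1: "1 \<le> exp (c * \<rho>)" using c that by simp
    have "norm (h g \<rho>) \<le> norm (\<Psi> 0) + norm (\<Psi> (exp (c * \<rho>) *\<^sub>R apply_bcontfun g \<rho>) - \<Psi> 0)"
      unfolding h_def norm_schroedinger by (metis add.commute diff_add_cancel norm_triangle_ineq)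
    also have "\<dots> \<le> norm (\<Psi> 0) * exp (c * \<rho>) + L * (exp (c * \<rho>) * norm g)"
    proof (rule add_mono)
      show "norm (\<Psi> 0) \<le> norm (\<Psi> 0) * exp (c * \<rho>)" using mult_left_mono[OF e1 norm_ge_zero[of "\<Psi> 0"]] by simp
      have "norm (\<Psi> (exp (c * \<rho>) *\<^sub>R apply_bcontfun g \<rho>) - \<Psi> 0) \<le> L * norm (exp (c * \<rho>) *\<^sub>R apply_bcontfun g \<rho> - 0)" by (rule L)
      also have "\<dots> \<le> L * (exp (c * \<rho>) * norm g)"
        using norm_bounded[of g \<rho>] L0 by (auto intro!: mult_left_mono)
      finally show "norm (\<Psi> (exp (c * \<rho>) *\<^sub>R apply_bcontfun g \<rho>) - \<Psi> 0) \<le> L * (exp (c * \<rho>) * norm g)" .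
    qed
    finally show ?thesis by (simp add: algebra_simps)
  qed
  have \<Phi>b: "\<Phi> g \<in> bcontfun" for g
  proof (rule bcontfun_normI[OF \<Phi>c, of _ "norm y0 + (norm (\<Psi> 0) + L * norm g) / c"])
    fix t :: real
    define s where "s = max 0 t"
    have s: "0 \<le> s" by (simp add: s_def)
    have "norm (\<Phi> g t) = norm (exp (- (c * s)) *\<^sub>R y0 + exp (- (c * s)) *\<^sub>R F g s)"
      by (simp add: \<Phi>_def s_def flip: scaleR_add_right)
    also have "\<dots> \<le> norm (exp (- (c * s)) *\<^sub>R y0) + norm (exp (- (c * s)) *\<^sub>R F g s)"
      by (rule norm_triangle_ineq)
    also have "\<dots> \<le> norm y0 + (norm (\<Psi> 0) + L * norm g) / c"
    proof (rule add_mono)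
      have "exp (- (c * s)) \<le> 1" using c s by simp
      thus "norm (exp (- (c * s)) *\<^sub>R y0) \<le> norm y0" by (simp add: mult_left_le_one_le)
      show "norm (exp (- (c * s)) *\<^sub>R F g s) \<le> (norm (\<Psi> 0) + L * norm g) / c"
        unfolding F_def by (rule int_le[OF s hc hb]) (use L0 in auto)
    qed
    finally show "norm (\<Phi> g t) \<le> norm y0 + (norm (\<Psi> 0) + L * norm g) / c" .
  qed
  have "\<exists>!g. Bcontfun (\<Phi> g) = g"
  proof (rule banach_fix_type[of "1/2"])
    have "dist (Bcontfun (\<Phi> f)) (Bcontfun (\<Phi> g)) \<le> 1/2 * dist f g" for f g
    proof (rule dist_bound)
      fix t :: real
      define s where "s = max 0 t"
      have s: "0 \<le> s" by (simp add: s_def)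
      have "dist (apply_bcontfun (Bcontfun (\<Phi> f)) t) (apply_bcontfun (Bcontfun (\<Phi> g)) t) = norm (\<Phi> f t - \<Phi> g t)"
        by (simp add: Bcontfun_inverse[OF \<Phi>b] dist_norm)
      also have "\<Phi> f t - \<Phi> g t = exp (- (c * s)) *\<^sub>R schroedinger s (F f s - F g s)"
        by (simp add: \<Phi>_def linear_diff[OF linear_schroedinger] linear_add[OF linear_schroedinger] flip: s_def scaleR_diff_right)
      also have "norm \<dots> = norm (exp (- (c * s)) *\<^sub>R (F f s - F g s))" by simp
      also have "F f s - F g s = integral {0..s} (\<lambda>\<rho>. h f \<rho> - h g \<rho>)"
        unfolding F_def by (rule integral_diff[symmetric]; rule integrable_continuous_real[OF hc])
      also have "norm (exp (- (c * s)) *\<^sub>R integral {0..s} (\<lambda>\<rho>. h f \<rho> - h g \<rho>)) \<le> (L * dist f g) / c"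
      proof (rule int_le[OF s])
        show "continuous_on {0..s} (\<lambda>\<rho>. h f \<rho> - h g \<rho>)" by (intro continuous_intros hc)
        fix \<rho> assume "\<rho> \<in> {0..s}"
        have "norm (h f \<rho> - h g \<rho>) = norm (\<Psi> (exp (c * \<rho>) *\<^sub>R apply_bcontfun f \<rho>) - \<Psi> (exp (c * \<rho>) *\<^sub>R apply_bcontfun g \<rho>))"
          by (simp add: h_def flip: linear_diff[OF linear_schroedinger])
        also have "\<dots> \<le> L * norm (exp (c * \<rho>) *\<^sub>R apply_bcontfun f \<rho> - exp (c * \<rho>) *\<^sub>R apply_bcontfun g \<rho>)" by (rule L)
        also have "\<dots> = L * (exp (c * \<rho>) * dist (apply_bcontfun f \<rho>) (apply_bcontfun g \<rho>))"
          by (simp add: dist_norm flip: scaleR_diff_right)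
        also have "\<dots> \<le> L * (exp (c * \<rho>) * dist f g)"
          by (intro mult_left_mono dist_bounded L0) auto
        finally show "norm (h f \<rho> - h g \<rho>) \<le> L * dist f g * exp (c * \<rho>)" by (simp add: mult_ac)
      qed (use L0 in auto)
      also have "\<dots> \<le> 1/2 * dist f g"
      proof -
        have "L * dist f g * 2 \<le> c * dist f g" using mult_right_mono[OF c(2), of "dist f g"] by (simp add: mult_ac)
        thus ?thesis using c(1) by (simp add: divide_le_eq mult_ac)
      qed
      finally show "dist (apply_bcontfun (Bcontfun (\<Phi> f)) t) (apply_bcontfun (Bcontfun (\<Phi> g)) t) \<le> 1/2 * dist f g" .
    qed
    thus "\<forall>f g. dist (Bcontfun (\<Phi> f)) (Bcontfun (\<Phi> g)) \<le> 1/2 * dist f g" by blast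
  qed auto
  then obtain g where "Bcontfun (\<Phi> g) = g" by blast
  hence g: "apply_bcontfun g t = \<Phi> g t" for t using Bcontfun_inverse[OF \<Phi>b, of g] by simp
  define y where "y t = exp (c * t) *\<^sub>R apply_bcontfun g t" for t
  have "continuous_on {0..} y" unfolding y_def by (intro continuous_intros) auto
  moreover have "y t = schroedinger t (y0 + integral {0..t} (\<lambda>\<rho>. schroedinger (- \<rho>) (\<Psi> (y \<rho>))))" if "t \<in> {0..}" for t
  proof -
    have "y t = (exp (c * t) * exp (- (c * t))) *\<^sub>R schroedinger t (y0 + F g t)"
      using that by (simp add: y_def g \<Phi>_def max_def)
    also have "exp (c * t) * exp (- (c * t)) = 1" by (simp flip: exp_add)
    finally show ?thesis by (simp add: F_def h_def[abs_def] y_def)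
  qed
  ultimately show ?thesis unfolding mild_solution_def by blast
qed

lemma mild_solution_dependence:
  assumes L: "\<And>x y. norm (\<Psi> x - \<Psi> y) \<le> L * norm (x - y)" and L0: "0 \<le> L" and T: "0 \<le> T"
    and y: "mild_solution \<Psi> y0 {0..T} y" and z: "mild_solution \<Psi> z0 {0..T} z"
  shows "norm (y T - z T) \<le> norm (y0 - z0) * exp (L * T)"
proof (rule Gronwall[OF _ L0 T])
  have yc: "continuous_on {0..T} y" and zc: "continuous_on {0..T} z"
    using y z by (auto simp: mild_solution_def)
  show d: "continuous_on {0..T} (\<lambda>t. norm (y t - z t))" by (intro continuous_intros yc zc)
  fix t assume t: "t \<in> {0..T}"
  have sub: "{0..t} \<subseteq> {0..T}" using t by auto
  let ?h = "\<lambda>w \<rho>. schroedinger (- \<rho>) (\<Psi> (w \<rho>))"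
  have hc: "continuous_on {0..t} (?h w)" if "continuous_on {0..T} w" for w
    by (intro continuous_on_schroedinger continuous_on_compose2[OF continuous_on_lipschitz[OF L, of UNIV]]
          continuous_on_subset[OF that sub] continuous_intros) auto
  have "y t - z t = schroedinger t (y0 + integral {0..t} (?h y) - (z0 + integral {0..t} (?h z)))"
    using y z t unfolding mild_solution_def by (simp add: linear_diff[OF linear_schroedinger])
  also have "norm \<dots> = norm ((y0 - z0) + (integral {0..t} (?h y) - integral {0..t} (?h z)))"
    unfolding norm_schroedinger by (simp add: algebra_simps)
  also have "\<dots> \<le> norm (y0 - z0) + norm (integral {0..t} (?h y) - integral {0..t} (?h z))"
    by (rule norm_triangle_ineq)
  also have "integral {0..t} (?h y) - integral {0..t} (?h z) = integral {0..t} (\<lambda>\<rho>. ?h y \<rho> - ?h z \<rho>)"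
    by (rule integral_diff[symmetric]; rule integrable_continuous_real; rule hc; fact)
  also have "norm (integral {0..t} (\<lambda>\<rho>. ?h y \<rho> - ?h z \<rho>)) \<le> integral {0..t} (\<lambda>\<rho>. L * norm (y \<rho> - z \<rho>))"
  proof (rule integral_norm_bound_integral)
    show "(\<lambda>\<rho>. ?h y \<rho> - ?h z \<rho>) integrable_on {0..t}"
      by (rule integrable_continuous_real) (intro continuous_on_diff hc yc zc)
    show "(\<lambda>\<rho>. L * norm (y \<rho> - z \<rho>)) integrable_on {0..t}"
      by (rule integrable_continuous_real) (intro continuous_intros continuous_on_subset[OF yc sub] continuous_on_subset[OF zc sub])
    show "norm (?h y \<rho> - ?h z \<rho>) \<le> L * norm (y \<rho> - z \<rho>)" for \<rho>
      using L[of "y \<rho>" "z \<rho>"] by (simp flip: linear_diff[OF linear_schroedinger])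
  qed
  also have "integral {0..t} (\<lambda>\<rho>. L * norm (y \<rho> - z \<rho>)) = L * integral {0..t} (\<lambda>\<rho>. norm (y \<rho> - z \<rho>))"
    by (rule integral_mult_right)
  finally show "norm (y t - z t) \<le> norm (y0 - z0) + L * integral {0..t} (\<lambda>\<rho>. norm (y \<rho> - z \<rho>))"
    by simp
qed

text \<open>On a single mode Duhamel's formula is variation of constants for f' = h - \<i> \<omega>
  f. Here the formula is differentiated; the converse is the next lemma.\<close>

lemma Duhamel_iff_integrated:
  fixes h f :: "real \<Rightarrow> complex"
  assumes h: "continuous_on {0..T} h" and T: "0 \<le> T"
    and f: "\<And>t. t \<in> {0..T} \<Longrightarrow> f t = cis (- (t * \<omega>)) * (c + integral {0..t} (\<lambda>\<rho>. cis (\<rho> * \<omega>) * h \<rho>))"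
  shows "((\<lambda>t. h t - \<i> * of_real \<omega> * f t) has_integral (f T - c)) {0..T}"
proof -
  define G where "G t = c + integral {0..t} (\<lambda>\<rho>. cis (\<rho> * \<omega>) * h \<rho>)" for t
  have hc: "continuous_on {0..T} (\<lambda>\<rho>. cis (\<rho> * \<omega>) * h \<rho>)" by (intro continuous_intros h)
  have dG: "(G has_vector_derivative cis (t * \<omega>) * h t) (at t within {0..T})" if "t \<in> {0..T}" for t
    using has_vector_derivative_add[OF has_vector_derivative_const[of c] integral_has_vector_derivative[OF hc that]]
    unfolding G_def by simp
  have dc: "((\<lambda>t. cis (- (t * \<omega>))) has_vector_derivative - \<i> * of_real \<omega> * cis (- (t * \<omega>))) (at t within {0..T})" for t
    unfolding has_vector_derivative_def
    by (rule derivative_eq_intros refl)+ (simp add: fun_eq_iff scaleR_conv_of_real mult_ac)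
  have df: "((\<lambda>t. cis (- (t * \<omega>)) * G t) has_vector_derivative h t - \<i> * of_real \<omega> * f t) (at t within {0..T})" if "t \<in> {0..T}" for t
  proof -
    have "cis (- (t * \<omega>)) * (cis (t * \<omega>) * h t) + - \<i> * of_real \<omega> * cis (- (t * \<omega>)) * G t = h t - \<i> * of_real \<omega> * f t"
      unfolding f[OF that] G_def[symmetric] by (simp add: cis_mult mult.assoc flip: mult.assoc[of "cis _" "cis _"])
    with has_vector_derivative_mult[OF dc dG[OF that]] show ?thesis by simp
  qed
  have "((\<lambda>t. h t - \<i> * of_real \<omega> * f t) has_integral cis (- (T * \<omega>)) * G T - cis (- (0 * \<omega>)) * G 0) {0..T}"
    by (rule fundamental_theorem_of_calculus[OF T df])
  thus ?thesis using f[of T] T by (simp add: G_def)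
qed

text \<open>The factor cis (- (T - t) \<omega>) is integrating: its derivative cancels the term -
  \<i> \<omega> f, so the product of both has derivative cis (- (T - t) \<omega>) h.\<close>

lemma integrated_imp_Duhamel:
  fixes h f :: "real \<Rightarrow> complex"
  assumes h: "continuous_on {0..T} h" and f: "continuous_on {0..T} f" and T: "0 \<le> T"
    and eq: "\<And>t. t \<in> {0..T} \<Longrightarrow> f t = c + integral {0..t} (\<lambda>\<rho>. h \<rho> - \<i> * of_real \<omega> * f \<rho>)"
  shows "f T = cis (- (T * \<omega>)) * c + integral {0..T} (\<lambda>\<rho>. cis (- ((T - \<rho>) * \<omega>)) * h \<rho>)"
proof -
  define G where "G t = c + integral {0..t} (\<lambda>\<rho>. h \<rho> - \<i> * of_real \<omega> * f \<rho>)" for t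
  have hc: "continuous_on {0..T} (\<lambda>\<rho>. h \<rho> - \<i> * of_real \<omega> * f \<rho>)" by (intro continuous_intros h f)
  have dG: "(G has_vector_derivative h t - \<i> * of_real \<omega> * f t) (at t within {0..T})" if "t \<in> {0..T}" for t
    using has_vector_derivative_add[OF has_vector_derivative_const[of c] integral_has_vector_derivative[OF hc that]]
    unfolding G_def by simp
  have dc: "((\<lambda>t. cis (- ((T - t) * \<omega>))) has_vector_derivative \<i> * of_real \<omega> * cis (- ((T - t) * \<omega>))) (at t within {0..T})" for t
    unfolding has_vector_derivative_def
    by (rule derivative_eq_intros refl)+ (simp add: fun_eq_iff scaleR_conv_of_real mult_ac)
  have "((\<lambda>t. cis (- ((T - t) * \<omega>)) * G t) has_vector_derivative cis (- ((T - t) * \<omega>)) * h t) (at t within {0..T})" if "t \<in> {0..T}" for t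
  proof -
    have "cis (- ((T - t) * \<omega>)) * (h t - \<i> * of_real \<omega> * f t) + \<i> * of_real \<omega> * cis (- ((T - t) * \<omega>)) * G t = cis (- ((T - t) * \<omega>)) * h t"
      unfolding eq[OF that] G_def[symmetric] by (simp add: algebra_simps)
    with has_vector_derivative_mult[OF dc dG[OF that]] show ?thesis by simp
  qed
  from fundamental_theorem_of_calculus[OF T this]
  have "((\<lambda>t. cis (- ((T - t) * \<omega>)) * h t) has_integral G T - cis (- (T * \<omega>)) * c) {0..T}"
    by (simp add: G_def)
  hence "integral {0..T} (\<lambda>t. cis (- ((T - t) * \<omega>)) * h t) = G T - cis (- (T * \<omega>)) * c"
    by (rule integral_unique)
  thus ?thesis using eq[of T] T by (simp add: G_def)
qed

section \<open>Truncated flows and the maximal flow of the conjugated equation\<close>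

definition radial :: "real \<Rightarrow> 'a::real_normed_vector \<Rightarrow> 'a" where
  "radial R x = (if norm x \<le> R then x else (R / norm x) *\<^sub>R x)"

lemma radial_norm_le: "0 \<le> R \<Longrightarrow> norm (radial R x) \<le> R"
  by (auto simp: radial_def)

text \<open>The triangle inequality alone gives the constant 2: one part comes from rescaling x - y,
  the other from the difference of the norms. The retraction makes locally Lipschitz nonlinearities
  globally Lipschitz.\<close>

lemma radial_lipschitz:
  assumes R: "0 \<le> R"
  shows "norm (radial R x - radial R y) \<le> 2 * norm (x - y)"
proof -
  have one: "norm (x - (R / norm y) *\<^sub>R y) \<le> 2 * norm (x - y)" if "norm x \<le> R" "R < norm y" for x y :: 'a
  proof -
    have y0: "0 < norm y" using that R by linarith
    have "x - (R / norm y) *\<^sub>R y = (x - y) + (1 - R / norm y) *\<^sub>R y" by (simp add: algebra_simps)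
    also have "norm \<dots> \<le> norm (x - y) + norm ((1 - R / norm y) *\<^sub>R y)" by (rule norm_triangle_ineq)
    also have "norm ((1 - R / norm y) *\<^sub>R y) = norm y - R"
    proof -
      have "R / norm y \<le> 1" using y0 that by simp
      hence "norm ((1 - R / norm y) *\<^sub>R y) = (1 - R / norm y) * norm y" by simp
      also have "\<dots> = norm y - R" using y0 by (simp add: algebra_simps)
      finally show ?thesis .
    qed
    also have "norm (x - y) + (norm y - R) \<le> norm (x - y) + norm (x - y)"
      using norm_triangle_ineq2[of y x] that by (simp add: norm_minus_commute)
    finally show ?thesis by simp
  qed
  consider "norm x \<le> R" "norm y \<le> R" | "norm x \<le> R" "R < norm y" | "R < norm x" "norm y \<le> R" | "R < norm x" "R < norm y"
    by linarith
  thus ?thesis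
  proof cases
    case 1 thus ?thesis by (simp add: radial_def)
  next
    case 2 thus ?thesis using one[of x y] by (simp add: radial_def)
  next
    case 3 thus ?thesis using one[of y x] by (simp add: radial_def norm_minus_commute)
  next
    case 4
    have x0: "0 < norm x" and y0: "0 < norm y" using 4 R by linarith+
    have "radial R x - radial R y = (R / norm x) *\<^sub>R (x - y) + (R / norm x - R / norm y) *\<^sub>R y"
      using 4 by (simp add: radial_def algebra_simps)
    also have "norm \<dots> \<le> norm ((R / norm x) *\<^sub>R (x - y)) + norm ((R / norm x - R / norm y) *\<^sub>R y)"
      by (rule norm_triangle_ineq)
    also have "norm ((R / norm x) *\<^sub>R (x - y)) = R / norm x * norm (x - y)" using R by simp
    also have "norm ((R / norm x - R / norm y) *\<^sub>R y) = R / norm x * \<bar>norm y - norm x\<bar>"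
    proof -
      have "(R / norm x - R / norm y) * norm y = R / norm x * (norm y - norm x)"
        using x0 y0 by (simp add: field_simps)
      hence "\<bar>R / norm x - R / norm y\<bar> * norm y = \<bar>R / norm x * (norm y - norm x)\<bar>"
        by (metis abs_mult abs_norm_cancel)
      thus ?thesis using R by (simp add: abs_mult)
    qed
    also have "R / norm x * norm (x - y) + R / norm x * \<bar>norm y - norm x\<bar> \<le> 1 * norm (x - y) + 1 * norm (x - y)"
    proof (intro add_mono mult_mono)
      show "R / norm x \<le> 1" using 4 x0 by simp
      show "R / norm x \<le> 1" using 4 x0 by simp
      show "\<bar>norm y - norm x\<bar> \<le> norm (x - y)" using norm_triangle_ineq3[of y x] by (simp add: norm_minus_commute)
    qed (use R in auto)
    finally show ?thesis by simp
  qed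
qed

text \<open>The entries of \<open>z\<close> are Fourier coefficients weighted to the level of the
  solution space. k^2 z and the potential term need not be square summable in k, so the equation is
  imposed on each mode and after integration in time.\<close>

definition mode_solution :: "(int \<Rightarrow> int ell2 \<Rightarrow> complex) \<Rightarrow> (int ell2 \<Rightarrow> int ell2) \<Rightarrow> int ell2 \<Rightarrow> real set \<Rightarrow> (real \<Rightarrow> int ell2) \<Rightarrow> bool" where
  "mode_solution X N z0 I z \<longleftrightarrow> continuous_on I z \<and>
     (\<forall>t\<in>I. \<forall>k. ell2_nth (z t) k = ell2_nth z0 k + integral {0..t} (\<lambda>\<rho>.
        \<i> * (- of_real ((of_int k)\<^sup>2) * ell2_nth (z \<rho>) k + X k (z \<rho>)) + ell2_nth (N (z \<rho>)) k))"

lemma mode_solution_subset: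
  "mode_solution X N z0 I z \<Longrightarrow> J \<subseteq> I \<Longrightarrow> mode_solution X N z0 J z"
  unfolding mode_solution_def by (blast intro: continuous_on_subset)

lemma mild_solution_subset:
  "mild_solution \<Psi> y0 I y \<Longrightarrow> J \<subseteq> I \<Longrightarrow> mild_solution \<Psi> y0 J y"
  unfolding mild_solution_def by (blast intro: continuous_on_subset)

text \<open>The identity \<open>conj\<close> speaks of pairs \<open>h\<close>, \<open>Y\<close>
  instead of operators, since k^2 is unbounded: that a square summable \<open>h\<close> exists is
  the domain condition. \<open>uniq\<close> is assumed for the original equation, not for the
  transformed one, and is supplied later by the energy argument.\<close>

locale conjugated_evolution =
  fixes E E' B N :: "int ell2 \<Rightarrow> int ell2" and X :: "int \<Rightarrow> int ell2 \<Rightarrow> complex"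
  assumes El: "bounded_linear E" and E'l: "bounded_linear E'" and Bl: "bounded_linear B"
    and EE' [simp]: "\<And>x. E (E' x) = x" and E'E [simp]: "\<And>x. E' (E x) = x"
    and conj: "\<And>h Y k. (\<And>k. ell2_nth h k = \<i> * (- of_real ((of_int k)\<^sup>2) * ell2_nth Y k + ell2_nth (B Y) k)) \<Longrightarrow>
        ell2_nth (E h) k = \<i> * (- of_real ((of_int k)\<^sup>2) * ell2_nth (E Y) k + X k (E Y))"
    and Xl: "\<And>k. bounded_linear (X k)"
    and N_lip: "\<And>R. \<exists>L\<ge>0. \<forall>x y. norm x \<le> R \<longrightarrow> norm y \<le> R \<longrightarrow> norm (N x - N y) \<le> L * norm (x - y)"
    and uniq: "\<And>T z0 z w. 0 \<le> T \<Longrightarrow> mode_solution X N z0 {0..T} z \<Longrightarrow> mode_solution X N z0 {0..T} w \<Longrightarrow> z T = w T"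
begin

lemma N_cont: "continuous_on A N"
  unfolding continuous_on_def
proof
  fix x :: "int ell2"
  obtain L where L: "\<And>y z. norm y \<le> norm x + 1 \<Longrightarrow> norm z \<le> norm x + 1 \<Longrightarrow> norm (N y - N z) \<le> L * norm (y - z)"
    using N_lip[of "norm x + 1"] by blast
  have lim0: "((\<lambda>y. L * norm (y - x)) \<longlongrightarrow> 0) (at x within A)"
    by (rule tendsto_eq_intros | simp)+
  have "\<forall>\<^sub>F y in at x within A. dist y x < 1"
    using tendstoD[OF tendsto_ident_at, of 1 x A] by simp
  hence "\<forall>\<^sub>F y in at x within A. norm (N y - N x) \<le> L * norm (y - x)"
  proof eventually_elim
    case (elim y)
    hence "norm y \<le> norm x + 1" using norm_triangle_ineq2[of y x] by (simp add: dist_norm)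
    thus ?case by (intro L) auto
  qed
  from Lim_null_comparison[OF this lim0] show "(N \<longlongrightarrow> N x) (at x within A)" by (rule LIM_zero_cancel)
qed

text \<open>The bounded part of the equation for Y = E' z. Only the nonlinear part is cut off; the
  linear part must stay intact for \<open>conj\<close> to apply.\<close>

definition truncated :: "real \<Rightarrow> int ell2 \<Rightarrow> int ell2" where
  "truncated R y = ii (B y) + E' (N (E (radial R y)))"

lemma truncated_lipschitz:
  assumes R: "0 \<le> R"
  shows "\<exists>L\<ge>0. \<forall>x y. norm (truncated R x - truncated R y) \<le> L * norm (x - y)"
proof -
  obtain CE where CE: "\<And>x. norm (E x) \<le> norm x * CE" "0 \<le> CE" using bounded_linear.nonneg_bounded[OF El] by blast
  obtain CE' where CE': "\<And>x. norm (E' x) \<le> norm x * CE'" "0 \<le> CE'" using bounded_linear.nonneg_bounded[OF E'l] by blast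
  obtain CB where CB: "\<And>x. norm (B x) \<le> norm x * CB" "0 \<le> CB" using bounded_linear.nonneg_bounded[OF Bl] by blast
  obtain L where L: "0 \<le> L" "\<And>x y. norm x \<le> R * CE \<Longrightarrow> norm y \<le> R * CE \<Longrightarrow> norm (N x - N y) \<le> L * norm (x - y)"
    using N_lip[of "R * CE"] by blast
  have ball: "norm (E (radial R x)) \<le> R * CE" for x
    using CE(1)[of "radial R x"] radial_norm_le[OF R, of x] CE(2) by (meson mult_right_mono order_trans)
  have iin: "norm (ii x) \<le> norm x" for x :: "int ell2" using mult_op_norm_le[of "\<lambda>_. \<i>" 1 x] by simp
  have "norm (truncated R x - truncated R y) \<le> (CB + L * 2 * CE * CE') * norm (x - y)" for x y
  proof -
    have "truncated R x - truncated R y = ii (B (x - y)) + E' (N (E (radial R x)) - N (E (radial R y)))"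
      by (simp add: truncated_def bounded_linear.linear[OF Bl, THEN linear_diff]
            bounded_linear.linear[OF E'l, THEN linear_diff] bounded_linear.linear[OF bounded_linear_ii, THEN linear_diff])
    also have "norm \<dots> \<le> norm (ii (B (x - y))) + norm (E' (N (E (radial R x)) - N (E (radial R y))))"
      by (rule norm_triangle_ineq)
    also have "norm (ii (B (x - y))) \<le> norm (x - y) * CB" using iin CB(1) order_trans by blast
    also have "norm (E' (N (E (radial R x)) - N (E (radial R y)))) \<le> norm (N (E (radial R x)) - N (E (radial R y))) * CE'"
      by (rule CE')
    also have "\<dots> \<le> (L * norm (E (radial R x) - E (radial R y))) * CE'"
      by (intro mult_right_mono L CE' ball)
    also have "norm (E (radial R x) - E (radial R y)) \<le> norm (radial R x - radial R y) * CE"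
      using CE(1)[of "radial R x - radial R y"] by (simp add: bounded_linear.linear[OF El, THEN linear_diff])
    also have "norm (radial R x - radial R y) \<le> 2 * norm (x - y)" by (rule radial_lipschitz[OF R])
    finally show ?thesis using CE CE' CB L by (simp add: algebra_simps mult_left_mono mult_right_mono)
  qed
  thus ?thesis using CE CE' CB L by (intro exI[of _ "CB + L * 2 * CE * CE'"]) auto
qed

definition trunc_flow :: "real \<Rightarrow> int ell2 \<Rightarrow> real \<Rightarrow> int ell2" where
  "trunc_flow R y0 = (SOME y. mild_solution (truncated R) y0 {0..} y)"

lemma trunc_flow:
  assumes R: "0 \<le> R"
  shows "mild_solution (truncated R) y0 {0..} (trunc_flow R y0)"
proof -
  obtain L where "0 \<le> L" "\<And>x y. norm (truncated R x - truncated R y) \<le> L * norm (x - y)"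
    using truncated_lipschitz[OF R] by blast
  hence "\<exists>y. mild_solution (truncated R) y0 {0..} y" by (intro mild_solution_exists)
  thus ?thesis unfolding trunc_flow_def by (rule someI_ex)
qed

lemma trunc_flow_cont: "0 \<le> R \<Longrightarrow> continuous_on {0..} (trunc_flow R y0)"
  using trunc_flow by (auto simp: mild_solution_def)

text \<open>Inside the ball the truncation is the identity. A mild solution need not have its values
  in the domain of d^2/dx^2, but its time integral does, and to this integral \<open>conj\<close> is
  applied.\<close>

lemma mild_imp_mode:
  assumes R: "0 \<le> R" and T: "0 \<le> T"
    and y: "mild_solution (truncated R) y0 {0..T} y"
    and small: "\<And>t. t \<in> {0..T} \<Longrightarrow> norm (y t) \<le> R"
  shows "mode_solution X N (E y0) {0..T} (\<lambda>t. E (y t))"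
  unfolding mode_solution_def
proof (intro conjI ballI allI)
  have yc: "continuous_on {0..T} y" using y by (simp add: mild_solution_def)
  show Ec: "continuous_on {0..T} (\<lambda>t. E (y t))" by (rule bounded_linear.continuous_on[OF El yc])
  fix t k assume t: "t \<in> {0..T}"
  have sub: "{0..t} \<subseteq> {0..T}" and t0: "0 \<le> t" using t by auto
  have yct: "continuous_on {0..t} y" and Ect: "continuous_on {0..t} (\<lambda>t. E (y t))"
    using continuous_on_subset[OF yc sub] continuous_on_subset[OF Ec sub] by auto
  have Nc: "continuous_on {0..t} (\<lambda>\<rho>. N (E (y \<rho>)))"
    by (rule continuous_on_compose2[OF N_cont[of UNIV] Ect]) auto
  define h where "h \<rho> = ii (B (y \<rho>)) + E' (N (E (y \<rho>)))" for \<rho>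
  have hc: "continuous_on {0..t} h"
    unfolding h_def by (intro continuous_intros bounded_linear.continuous_on[OF E'l Nc]
        bounded_linear.continuous_on[OF bounded_linear_ii] bounded_linear.continuous_on[OF Bl] yct)
  have trh: "truncated R (y \<rho>) = h \<rho>" if "\<rho> \<in> {0..t}" for \<rho>
    using small[of \<rho>] that t by (simp add: truncated_def h_def radial_def)
  have yt: "y r = schroedinger r (y0 + integral {0..r} (\<lambda>\<rho>. schroedinger (- \<rho>) (h \<rho>)))" if "r \<in> {0..t}" for r
  proof -
    have "y r = schroedinger r (y0 + integral {0..r} (\<lambda>\<rho>. schroedinger (- \<rho>) (truncated R (y \<rho>))))"
      using y that t by (auto simp: mild_solution_def)
    also have "integral {0..r} (\<lambda>\<rho>. schroedinger (- \<rho>) (truncated R (y \<rho>))) = integral {0..r} (\<lambda>\<rho>. schroedinger (- \<rho>) (h \<rho>))"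
      by (rule integral_cong) (use that in \<open>simp add: trh\<close>)
    finally show ?thesis .
  qed
  define Y where "Y = integral {0..t} y"
  define F where "F = integral {0..t} (\<lambda>\<rho>. E' (N (E (y \<rho>))))"
  have E'Nc: "continuous_on {0..t} (\<lambda>\<rho>. E' (N (E (y \<rho>))))" by (rule bounded_linear.continuous_on[OF E'l Nc])
  have iBc: "continuous_on {0..t} (\<lambda>\<rho>. ii (B (y \<rho>)))"
    by (intro bounded_linear.continuous_on[OF bounded_linear_ii] bounded_linear.continuous_on[OF Bl] yct)
  have Hint: "integral {0..t} h = ii (B Y) + F"
  proof -
    have "integral {0..t} h = integral {0..t} (\<lambda>\<rho>. ii (B (y \<rho>))) + F"
      unfolding h_def F_def by (rule integral_add; rule integrable_continuous_real; fact)
    also have "integral {0..t} (\<lambda>\<rho>. ii (B (y \<rho>))) = ii (B Y)"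
      unfolding Y_def by (rule integral_bounded_linear[OF bounded_linear_compose[OF bounded_linear_ii Bl] yct])
    finally show ?thesis .
  qed
  have modes: "ell2_nth (y t) j - ell2_nth y0 j
     = ell2_nth (integral {0..t} h) j - \<i> * of_real ((of_int j)\<^sup>2) * ell2_nth Y j" for j
  proof -
    let ?w = "(of_int j :: real)\<^sup>2"
    have hj: "continuous_on {0..t} (\<lambda>\<rho>. ell2_nth (h \<rho>) j)" by (rule bounded_linear.continuous_on[OF bounded_linear_ell2_nth hc])
    have yj: "continuous_on {0..t} (\<lambda>\<rho>. ell2_nth (y \<rho>) j)" by (rule bounded_linear.continuous_on[OF bounded_linear_ell2_nth yct])
    have "((\<lambda>r. ell2_nth (h r) j - \<i> * of_real ?w * ell2_nth (y r) j) has_integral (ell2_nth (y t) j - ell2_nth y0 j)) {0..t}"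
    proof (rule Duhamel_iff_integrated[OF hj t0])
      fix r assume r: "r \<in> {0..t}"
      have rsub: "{0..r} \<subseteq> {0..t}" using r by auto
      have c: "continuous_on {0..r} (\<lambda>\<rho>. schroedinger (- \<rho>) (h \<rho>))"
        by (intro continuous_on_schroedinger continuous_intros continuous_on_subset[OF hc rsub])
      show "ell2_nth (y r) j = cis (- (r * ?w)) * (ell2_nth y0 j + integral {0..r} (\<lambda>\<rho>. cis (\<rho> * ?w) * ell2_nth (h \<rho>) j))"
        using integral_bounded_linear[OF bounded_linear_ell2_nth[of j] c]
        by (subst yt[OF r]) (simp add: schroedinger_nth)
    qed
    moreover have "integral {0..t} (\<lambda>r. ell2_nth (h r) j - \<i> * of_real ?w * ell2_nth (y r) j)
       = ell2_nth (integral {0..t} h) j - \<i> * of_real ?w * ell2_nth Y j"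
    proof -
      have "integral {0..t} (\<lambda>r. ell2_nth (h r) j - \<i> * of_real ?w * ell2_nth (y r) j)
         = integral {0..t} (\<lambda>r. ell2_nth (h r) j) - integral {0..t} (\<lambda>r. \<i> * of_real ?w * ell2_nth (y r) j)"
        by (rule integral_diff; rule integrable_continuous_real; intro continuous_intros hj yj)
      thus ?thesis
        using integral_bounded_linear[OF bounded_linear_ell2_nth[of j] hc] integral_bounded_linear[OF bounded_linear_ell2_nth[of j] yct]
        by (simp add: Y_def integral_mult_right)
    qed
    ultimately show ?thesis by (simp add: integral_unique)
  qed
  \<comment> \<open>The increment of y minus the nonlinear contribution equals \<i> (- k^2 + B)
    applied to the integral \<open>Y\<close>. It is square summable by construction, so it can play
    the role of \<open>h\<close> in \<open>conj\<close>.\<close>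
  define g where "g = y t - y0 - F"
  have "ell2_nth g j = \<i> * (- of_real ((of_int j)\<^sup>2) * ell2_nth Y j + ell2_nth (B Y) j)" for j
    using modes[of j] unfolding g_def Hint by (simp add: algebra_simps)
  hence "ell2_nth (E g) k = \<i> * (- of_real ((of_int k)\<^sup>2) * ell2_nth (E Y) k + X k (E Y))"
    by (rule conj)
  moreover have "E g = E (y t) - E y0 - integral {0..t} (\<lambda>\<rho>. N (E (y \<rho>)))"
  proof -
    have "E F = integral {0..t} (\<lambda>\<rho>. E (E' (N (E (y \<rho>)))))"
      unfolding F_def by (rule integral_bounded_linear[OF El E'Nc, symmetric])
    thus ?thesis by (simp add: g_def bounded_linear.linear[OF El, THEN linear_diff])
  qed
  moreover have EY: "E Y = integral {0..t} (\<lambda>\<rho>. E (y \<rho>))"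
    unfolding Y_def by (rule integral_bounded_linear[OF El yct, symmetric])
  ultimately have "ell2_nth (E (y t)) k = ell2_nth (E y0) k + (ell2_nth (integral {0..t} (\<lambda>\<rho>. N (E (y \<rho>)))) k
     + \<i> * (- of_real ((of_int k)\<^sup>2) * ell2_nth (integral {0..t} (\<lambda>\<rho>. E (y \<rho>))) k + X k (integral {0..t} (\<lambda>\<rho>. E (y \<rho>)))))"
    by (simp add: diff_eq_eq add_ac)
  also have "ell2_nth (integral {0..t} (\<lambda>\<rho>. N (E (y \<rho>)))) k
     + \<i> * (- of_real ((of_int k)\<^sup>2) * ell2_nth (integral {0..t} (\<lambda>\<rho>. E (y \<rho>))) k + X k (integral {0..t} (\<lambda>\<rho>. E (y \<rho>))))
    = integral {0..t} (\<lambda>\<rho>. \<i> * (- of_real ((of_int k)\<^sup>2) * ell2_nth (E (y \<rho>)) k + X k (E (y \<rho>))) + ell2_nth (N (E (y \<rho>))) k)"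
  proof -
    note i1 = has_integral_linear[OF integrable_integral[OF integrable_continuous_real[OF Nc]] bounded_linear_ell2_nth[of k]]
      and i2 = has_integral_linear[OF integrable_integral[OF integrable_continuous_real[OF Ect]] bounded_linear_ell2_nth[of k]]
      and i3 = has_integral_linear[OF integrable_integral[OF integrable_continuous_real[OF Ect]] Xl[of k]]
    have "((\<lambda>\<rho>. \<i> * (- of_real ((of_int k)\<^sup>2) * ell2_nth (E (y \<rho>)) k + X k (E (y \<rho>))) + ell2_nth (N (E (y \<rho>))) k) has_integral
       (\<i> * (- of_real ((of_int k)\<^sup>2) * ell2_nth (integral {0..t} (\<lambda>\<rho>. E (y \<rho>))) k + X k (integral {0..t} (\<lambda>\<rho>. E (y \<rho>)))) +
        ell2_nth (integral {0..t} (\<lambda>\<rho>. N (E (y \<rho>)))) k)) {0..t}"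
      using i1 i2 i3 unfolding o_def by (intro has_integral_add has_integral_mult_right)
    thus ?thesis by (simp add: integral_unique add.commute)
  qed
  finally show "ell2_nth (E (y t)) k = ell2_nth (E y0) k +
    integral {0..t} (\<lambda>\<rho>. \<i> * (- of_real ((of_int k)\<^sup>2) * ell2_nth (E (y \<rho>)) k + X k (E (y \<rho>))) + ell2_nth (N (E (y \<rho>))) k)" .
qed

text \<open>Up to time \<open>t\<close> the truncation at radius \<open>R\<close> is not active.\<close>

definition good_time :: "int ell2 \<Rightarrow> real \<Rightarrow> real \<Rightarrow> bool" where
  "good_time z0 t R \<longleftrightarrow> 0 \<le> R \<and> (\<forall>\<tau>\<in>{0..t}. norm (trunc_flow R (E' z0) \<tau>) < R)"

definition life_span :: "int ell2 \<Rightarrow> ereal" where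
  "life_span z0 = (SUP t \<in> {t. 0 \<le> t \<and> (\<exists>R. good_time z0 t R)}. ereal t)"

text \<open>The radius is chosen anew for each time. By \<open>uniq\<close> all admissible radii
  give the same value, see \<open>flow_eq\<close>.\<close>

definition flow :: "int ell2 \<Rightarrow> real \<Rightarrow> int ell2" where
  "flow z0 t = E (trunc_flow (SOME R. good_time z0 t R) (E' z0) t)"

lemma good_time_mono: "good_time z0 t R \<Longrightarrow> s \<le> t \<Longrightarrow> good_time z0 s R"
  by (auto simp: good_time_def)

lemma good_time_mode:
  assumes "good_time z0 t R" "0 \<le> t"
  shows "mode_solution X N z0 {0..t} (\<lambda>\<tau>. E (trunc_flow R (E' z0) \<tau>))"
proof -
  have "mode_solution X N (E (E' z0)) {0..t} (\<lambda>\<tau>. E (trunc_flow R (E' z0) \<tau>))"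
    by (rule mild_imp_mode[OF _ assms(2) mild_solution_subset[OF trunc_flow]])
       (use assms in \<open>auto simp: good_time_def less_imp_le\<close>)
  thus ?thesis by simp
qed

lemma flow_eq:
  assumes "good_time z0 t R" "0 \<le> t"
  shows "flow z0 t = E (trunc_flow R (E' z0) t)"
proof -
  have "good_time z0 t (SOME R. good_time z0 t R)" using assms(1) by (rule someI)
  from uniq[OF assms(2) good_time_mode[OF this assms(2)] good_time_mode[OF assms]]
  show ?thesis by (simp add: flow_def)
qed

lemma good_time_extend:
  assumes g: "good_time z0 t R" and t: "0 \<le> t"
  shows "\<exists>t'>t. good_time z0 t' R"
proof -
  have R: "0 \<le> R" using g by (simp add: good_time_def)
  have c: "continuous_on {0..} (\<lambda>\<tau>. norm (trunc_flow R (E' z0) \<tau>))"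
    by (intro continuous_intros trunc_flow_cont R)
  have "((\<lambda>\<tau>. norm (trunc_flow R (E' z0) \<tau>)) \<longlongrightarrow> norm (trunc_flow R (E' z0) t)) (at t within {0..})"
    using c t by (auto simp: continuous_on_def)
  hence "\<forall>\<^sub>F \<tau> in at t within {0..}. norm (trunc_flow R (E' z0) \<tau>) < R"
    by (rule order_tendstoD(2)) (use g t in \<open>auto simp: good_time_def\<close>)
  then obtain d where d: "0 < d" "\<And>\<tau>. 0 \<le> \<tau> \<Longrightarrow> \<tau> \<noteq> t \<Longrightarrow> dist \<tau> t < d \<Longrightarrow> norm (trunc_flow R (E' z0) \<tau>) < R"
    unfolding eventually_at by auto
  have "good_time z0 (t + d/2) R"
    unfolding good_time_def
  proof (intro conjI ballI R)
    fix \<tau> assume \<tau>: "\<tau> \<in> {0..t + d/2}"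
    show "norm (trunc_flow R (E' z0) \<tau>) < R"
    proof (cases "\<tau> \<le> t")
      case True thus ?thesis using g \<tau> by (auto simp: good_time_def)
    next
      case False thus ?thesis using \<tau> d(1) by (intro d(2)) (auto simp: dist_real_def)
    qed
  qed
  thus ?thesis using d(1) by (intro exI[of _ "t + d/2"]) auto
qed

lemma good_time_0: "\<exists>R. good_time z0 0 R"
proof -
  define R where "R = norm (E' z0) + 1"
  have R: "0 \<le> R" by (simp add: R_def add_nonneg_nonneg)
  have "trunc_flow R (E' z0) 0 = E' z0"
    using trunc_flow[OF R, of "E' z0"] by (simp add: mild_solution_def)
  hence "good_time z0 0 R" using R by (simp add: good_time_def R_def)
  thus ?thesis by blast
qed

text \<open>Good times form a set that is open to the right by \<open>good_time_extend\<close>, so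
  the supremum is not attained and the half-open interval consists exactly of the good
  times.\<close>

lemma existence_interval_life_span:
  "t \<in> existence_interval (life_span z0) \<longleftrightarrow> 0 \<le> t \<and> (\<exists>R. good_time z0 t R)"
proof
  assume "t \<in> existence_interval (life_span z0)"
  hence t: "0 \<le> t" "ereal t < life_span z0" by (auto simp: existence_interval_def)
  then obtain t' R where "good_time z0 t' R" "t < t'"
    unfolding life_span_def less_SUP_iff by auto
  thus "0 \<le> t \<and> (\<exists>R. good_time z0 t R)" using t(1) good_time_mono less_imp_le by blast
next
  assume t: "0 \<le> t \<and> (\<exists>R. good_time z0 t R)"
  then obtain R t' where t': "t < t'" "good_time z0 t' R" using good_time_extend by blast
  have "ereal t < ereal t'" using t' by simp
  also have "ereal t' \<le> life_span z0" unfolding life_span_def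
    by (rule SUP_upper) (use t t' in auto)
  finally show "t \<in> existence_interval (life_span z0)" using t by (simp add: existence_interval_def)
qed

lemma life_span_pos: "0 < life_span z0"
proof -
  have "0 \<in> existence_interval (life_span z0)"
    using good_time_0 by (simp add: existence_interval_life_span)
  thus ?thesis by (simp add: existence_interval_def zero_ereal_def)
qed

lemma flow_mode_solution: "mode_solution X N z0 (existence_interval (life_span z0)) (flow z0)"
proof -
  let ?I = "existence_interval (life_span z0)"
  have eq: "flow z0 \<tau> = E (trunc_flow R (E' z0) \<tau>)" if "good_time z0 t R" "\<tau> \<in> {0..t}" for t R \<tau>
    by (rule flow_eq[OF good_time_mono[OF that(1)]]) (use that in auto)
  show ?thesis unfolding mode_solution_def
  proof (intro conjI ballI)
    show "continuous_on ?I (flow z0)"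
      unfolding continuous_on_def
    proof
      fix t assume t: "t \<in> ?I"
      then obtain R t' where t': "t < t'" "good_time z0 t' R" and t0: "0 \<le> t"
        using good_time_extend unfolding existence_interval_life_span by blast
      have "continuous_on {0..t'} (\<lambda>\<tau>. E (trunc_flow R (E' z0) \<tau>))"
        using good_time_mode[OF t'(2)] t0 t'(1) by (auto simp: mode_solution_def)
      hence "continuous_on {0..t'} (flow z0)"
        by (rule continuous_on_eq) (use eq[OF t'(2)] in auto)
      hence "(flow z0 \<longlongrightarrow> flow z0 t) (at t within {0..t'})" using t0 t'(1) by (auto simp: continuous_on_def)
      moreover have "at t within {0..t'} = at t within ?I"
      proof (rule at_within_nhd[of t "{..<t'}"])
        show "{0..t'} \<inter> {..<t'} - {t} = ?I \<inter> {..<t'} - {t}"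
          using t' good_time_mono[OF t'(2)] by (auto simp: existence_interval_life_span intro!: exI[of _ R])
      qed (use t'(1) in auto)
      ultimately show "(flow z0 \<longlongrightarrow> flow z0 t) (at t within ?I)" by simp
    qed
    fix t assume t: "t \<in> ?I"
    then obtain R where R: "good_time z0 t R" and t0: "0 \<le> t" unfolding existence_interval_life_span by blast
    show "\<forall>k. ell2_nth (flow z0 t) k = ell2_nth z0 k + integral {0..t} (\<lambda>\<rho>.
        \<i> * (- of_real ((of_int k)\<^sup>2) * ell2_nth (flow z0 \<rho>) k + X k (flow z0 \<rho>)) + ell2_nth (N (flow z0 \<rho>)) k)"
    proof
      fix k
      have "integral {0..t} (\<lambda>\<rho>. \<i> * (- of_real ((of_int k)\<^sup>2) * ell2_nth (flow z0 \<rho>) k + X k (flow z0 \<rho>)) + ell2_nth (N (flow z0 \<rho>)) k)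
        = integral {0..t} (\<lambda>\<rho>. \<i> * (- of_real ((of_int k)\<^sup>2) * ell2_nth (E (trunc_flow R (E' z0) \<rho>)) k + X k (E (trunc_flow R (E' z0) \<rho>)))
             + ell2_nth (N (E (trunc_flow R (E' z0) \<rho>))) k)"
        by (rule integral_cong) (simp add: eq[OF R])
      thus "ell2_nth (flow z0 t) k = ell2_nth z0 k + integral {0..t} (\<lambda>\<rho>.
        \<i> * (- of_real ((of_int k)\<^sup>2) * ell2_nth (flow z0 \<rho>) k + X k (flow z0 \<rho>)) + ell2_nth (N (flow z0 \<rho>)) k)"
        using good_time_mode[OF R t0] t0 eq[OF R, of t] by (auto simp: mode_solution_def)
    qed
  qed
qed

text \<open>A solution on [0, t] is bounded there. The flow truncated at a larger radius agrees with
  it up to its first exit from the ball, and by continuity also at that time, so the exit never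
  happens and t is a good time.\<close>

lemma mode_solution_within_life_span:
  assumes I: "time_interval I" and z: "mode_solution X N z0 I z"
  shows "I \<subseteq> existence_interval (life_span z0)"
proof
  fix t assume tI: "t \<in> I"
  have t0: "0 \<le> t" and sub: "{0..t} \<subseteq> I"
    using I tI unfolding time_interval_def is_interval_1 by auto
  have zt: "mode_solution X N z0 {0..t} z" by (rule mode_solution_subset[OF z sub])
  hence zc: "continuous_on {0..t} z" by (simp add: mode_solution_def)
  hence E'c: "continuous_on {0..t} (\<lambda>\<tau>. E' (z \<tau>))" by (rule bounded_linear.continuous_on[OF E'l])
  have "compact ((\<lambda>\<tau>. E' (z \<tau>)) ` {0..t})" by (rule compact_continuous_image[OF E'c]) simp
  then obtain M where M: "\<And>\<tau>. \<tau> \<in> {0..t} \<Longrightarrow> norm (E' (z \<tau>)) \<le> M"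
    using compact_imp_bounded bounded_iff by (metis (no_types, lifting) image_eqI)
  \<comment> \<open>The bound is enlarged by 1, so that the transformed solution stays strictly
    inside the ball.\<close>
  define R where "R = \<bar>M\<bar> + 1"
  have R: "0 \<le> R" and small: "norm (E' (z \<tau>)) < R" if "\<tau> \<in> {0..t}" for \<tau>
    using M[of \<tau>] that by (auto simp: R_def)
  have R0: "0 \<le> R" by (simp add: R_def)
  let ?y = "trunc_flow R (E' z0)"
  have yc: "continuous_on {0..t} ?y" by (rule continuous_on_subset[OF trunc_flow_cont[OF R0]]) auto
  have z0: "z 0 = z0"
    by (rule ell2_eqI) (use zt t0 in \<open>auto simp: mode_solution_def\<close>)
  have y0: "?y 0 = E' z0" using trunc_flow[OF R0, of "E' z0"] by (simp add: mild_solution_def)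
  have agree: "?y \<tau> = E' (z \<tau>)" if "good_time z0 \<tau> R" "\<tau> \<in> {0..t}" for \<tau>
  proof -
    have "E (?y \<tau>) = z \<tau>"
      by (rule uniq[OF _ good_time_mode[OF that(1)] mode_solution_subset[OF zt]]) (use that in auto)
    hence "E' (E (?y \<tau>)) = E' (z \<tau>)" by simp
    thus ?thesis by simp
  qed
  define Bad where "Bad = {\<tau>\<in>{0..t}. R \<le> norm (?y \<tau>)}"
  have "closed Bad"
  proof -
    have "closed ({0..t} \<inter> (\<lambda>\<tau>. norm (?y \<tau>)) -` {R..})"
      by (rule continuous_closed_preimage) (auto intro!: continuous_intros yc)
    moreover have "Bad = {0..t} \<inter> (\<lambda>\<tau>. norm (?y \<tau>)) -` {R..}" by (auto simp: Bad_def)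
    ultimately show ?thesis by simp
  qed
  have "Bad = {}"
  proof (rule ccontr)
    assume ne: "Bad \<noteq> {}"
    have bdd: "bdd_below Bad" by (auto simp: Bad_def bdd_below_def)
    \<comment> \<open>The first exit time. \<open>Bad\<close> is closed, so the infimum belongs to
      it; strictly before it \<open>uniq\<close> applies, and continuity extends the agreement to
      the exit time itself.\<close>
    define \<tau> where "\<tau> = Inf Bad"
    have \<tau>: "\<tau> \<in> Bad" unfolding \<tau>_def by (rule closed_contains_Inf[OF ne bdd \<open>closed Bad\<close>])
    hence \<tau>t: "\<tau> \<in> {0..t}" and big: "R \<le> norm (?y \<tau>)" by (auto simp: Bad_def)
    have before: "s \<notin> Bad" if "s < \<tau>" for s using cInf_lower[OF _ bdd, of s] that by (auto simp: \<tau>_def)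
    have eqb: "?y s = E' (z s)" if "s \<in> {0..<\<tau>}" for s
    proof (rule agree)
      show "good_time z0 s R" unfolding good_time_def
      proof (intro conjI ballI R0)
        fix r assume "r \<in> {0..s}"
        thus "norm (?y r) < R" using before[of r] that \<tau>t by (auto simp: Bad_def)
      qed
    qed (use that \<tau>t in auto)
    have "?y \<tau> = E' (z \<tau>)"
    proof (cases "\<tau> = 0")
      case True thus ?thesis by (simp add: y0 z0)
    next
      case False
      hence pos: "0 < \<tau>" using \<tau>t by auto
      have cd: "continuous_on {0..\<tau>} (\<lambda>s. ?y s - E' (z s))"
        by (intro continuous_intros continuous_on_subset[OF yc] continuous_on_subset[OF E'c]) (use \<tau>t in auto)
      have "(\<lambda>s. ?y s - E' (z s)) \<tau> = 0"
      proof (rule continuous_constant_on_closure[of "{0..<\<tau>}"])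
        show "continuous_on (closure {0..<\<tau>}) (\<lambda>s. ?y s - E' (z s))" using cd pos by simp
      qed (use eqb pos in auto)
      thus ?thesis by simp
    qed
    thus False using small[OF \<tau>t] big by simp
  qed
  hence "good_time z0 t R" using R0 by (force simp: good_time_def Bad_def)
  thus "t \<in> existence_interval (life_span z0)" using t0 by (auto simp: existence_interval_life_span)
qed

text \<open>On the compact interval [0, t] the truncated flow keeps a positive distance
  \<open>m\<close> from the sphere of radius R. Flows of nearby data, truncated at the same radius,
  differ by less than \<open>m\<close>, so t is a good time for them as well.\<close>

lemma flow_continuous:
  assumes t: "t \<in> existence_interval (life_span z0)" and e: "0 < e"
  shows "\<exists>d>0. \<forall>w0. norm (w0 - z0) < d \<longrightarrow> t \<in> existence_interval (life_span w0) \<and> norm (flow w0 t - flow z0 t) < e"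
proof -
  obtain R where g: "good_time z0 t R" and t0: "0 \<le> t" using t by (auto simp: existence_interval_life_span)
  have R: "0 \<le> R" using g by (simp add: good_time_def)
  obtain L where L: "0 \<le> L" "\<And>x y. norm (truncated R x - truncated R y) \<le> L * norm (x - y)"
    using truncated_lipschitz[OF R] by blast
  obtain CE where CE: "\<And>x. norm (E x) \<le> norm x * CE" "0 < CE" using bounded_linear.pos_bounded[OF El] by blast
  obtain CE' where CE': "\<And>x. norm (E' x) \<le> norm x * CE'" "0 < CE'" using bounded_linear.pos_bounded[OF E'l] by blast
  have "continuous_on {0..t} (\<lambda>\<tau>. norm (trunc_flow R (E' z0) \<tau>))"
    by (intro continuous_intros continuous_on_subset[OF trunc_flow_cont[OF R]]) auto
  from continuous_attains_sup[OF _ _ this] obtain \<tau>m where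
    \<tau>m: "\<tau>m \<in> {0..t}" "\<And>\<tau>. \<tau> \<in> {0..t} \<Longrightarrow> norm (trunc_flow R (E' z0) \<tau>) \<le> norm (trunc_flow R (E' z0) \<tau>m)"
    using t0 by auto
  define m where "m = R - norm (trunc_flow R (E' z0) \<tau>m)"
  have m: "0 < m" using g \<tau>m(1) by (auto simp: m_def good_time_def)
  define \<eta> where "\<eta> = min m (e / CE)"
  have \<eta>: "0 < \<eta>" "\<eta> \<le> m" "\<eta> * CE \<le> e" using m e CE(2) by (auto simp: \<eta>_def min_def field_simps)
  \<comment> \<open>\<open>CE'\<close> passes from data to transformed data and exp (L t) is the
    Lipschitz constant of the truncated flow; the way back through \<open>E\<close> is accounted for
    in \<open>\<eta>\<close>.\<close>
  define d where "d = \<eta> / (CE' * exp (L * t))"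
  have d: "0 < d" using \<eta> CE' by (simp add: d_def)
  have close: "norm (trunc_flow R (E' w0) \<tau> - trunc_flow R (E' z0) \<tau>) < \<eta>" if w: "norm (w0 - z0) < d" and \<tau>: "\<tau> \<in> {0..t}" for w0 \<tau>
  proof -
    have "norm (trunc_flow R (E' w0) \<tau> - trunc_flow R (E' z0) \<tau>) \<le> norm (E' w0 - E' z0) * exp (L * \<tau>)"
      by (rule mild_solution_dependence[OF L(2,1) _ mild_solution_subset[OF trunc_flow[OF R]] mild_solution_subset[OF trunc_flow[OF R]]])
         (use \<tau> in auto)
    also have "norm (E' w0 - E' z0) \<le> norm (w0 - z0) * CE'"
      using CE'(1)[of "w0 - z0"] by (simp add: bounded_linear.linear[OF E'l, THEN linear_diff])
    also have "norm (w0 - z0) * CE' * exp (L * \<tau>) \<le> norm (w0 - z0) * CE' * exp (L * t)"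
      using \<tau> L(1) CE'(2) by (intro mult_left_mono) (auto intro: mult_left_mono)
    also have "\<dots> < d * CE' * exp (L * t)" using w CE'(2) by simp
    also have "\<dots> = \<eta>" using CE'(2) by (simp add: d_def)
    finally show ?thesis by (simp add: mult_right_mono)
  qed
  have "t \<in> existence_interval (life_span w0) \<and> norm (flow w0 t - flow z0 t) < e" if w: "norm (w0 - z0) < d" for w0
  proof -
    have gw: "good_time w0 t R" unfolding good_time_def
    proof (intro conjI ballI R)
      fix \<tau> assume \<tau>: "\<tau> \<in> {0..t}"
      have "norm (trunc_flow R (E' w0) \<tau>) \<le> norm (trunc_flow R (E' z0) \<tau>) + norm (trunc_flow R (E' w0) \<tau> - trunc_flow R (E' z0) \<tau>)"
        using norm_triangle_ineq[of "trunc_flow R (E' z0) \<tau>" "trunc_flow R (E' w0) \<tau> - trunc_flow R (E' z0) \<tau>"] by simp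
      thus "norm (trunc_flow R (E' w0) \<tau>) < R" using close[OF w \<tau>] \<tau>m(2)[OF \<tau>] \<eta>(2) by (simp add: m_def)
    qed
    have "norm (flow w0 t - flow z0 t) = norm (E (trunc_flow R (E' w0) t - trunc_flow R (E' z0) t))"
      by (simp add: flow_eq[OF gw t0] flow_eq[OF g t0] bounded_linear.linear[OF El, THEN linear_diff])
    also have "\<dots> \<le> norm (trunc_flow R (E' w0) t - trunc_flow R (E' z0) t) * CE" by (rule CE)
    also have "\<dots> < \<eta> * CE" using close[OF w, of t] t0 CE(2) by simp
    finally show ?thesis using gw t0 \<eta>(3) by (auto simp: existence_interval_life_span)
  qed
  thus ?thesis using d by blast
qed

end

section \<open>Fourier series on the torus\<close>

lemma torus_measurable: "continuous_on UNIV f \<Longrightarrow> f \<in> borel_measurable torus"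
  by (rule continuous_imp_measurable_on_sets_lebesgue[OF continuous_on_subset]) auto

lemma emeasure_torus: "emeasure torus {-pi<..<pi} = ennreal (2 * pi)"
  by (simp add: emeasure_restrict_space)

interpretation torus: finite_measure torus
  by standard (simp add: emeasure_torus)

lemma measure_torus: "measure torus {-pi<..<pi} = 2 * pi"
  by (simp add: measure_def emeasure_torus)

lemma integrable_mult_bounded:
  fixes f g :: "real \<Rightarrow> complex"
  assumes "integrable torus f" "g \<in> borel_measurable torus" "\<And>x. norm (g x) \<le> C"
  shows "integrable torus (\<lambda>x. f x * g x)"
proof (rule Bochner_Integration.integrable_bound)
  show "integrable torus (\<lambda>x. C * norm (f x))" using assms(1) by simp
  show "(\<lambda>x. f x * g x) \<in> borel_measurable torus"
    using assms by (intro borel_measurable_times) auto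
  show "AE x in torus. norm (f x * g x) \<le> norm (C * norm (f x))"
  proof (rule AE_I2)
    fix x
    have "norm (f x * g x) \<le> norm (f x) * C" unfolding norm_mult by (intro mult_left_mono assms) auto
    also have "\<dots> \<le> norm (C * norm (f x))" by (simp add: mult.commute)
    finally show "norm (f x * g x) \<le> norm (C * norm (f x))" .
  qed
qed

lemma integrable_torus_bounded:
  fixes g :: "real \<Rightarrow> complex"
  assumes "g \<in> borel_measurable torus" "\<And>x. norm (g x) \<le> C"
  shows "integrable torus g"
  using integrable_mult_bounded[of "\<lambda>_. 1" g C] assms by simp

lemma cis_measurable: "(\<lambda>x. cis (c * x)) \<in> borel_measurable torus"
  by (rule torus_measurable) (intro continuous_intros)

lemma integrable_mult_cis: "integrable torus f \<Longrightarrow> integrable torus (\<lambda>x. f x * cis (c * x))"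
  by (rule integrable_mult_bounded[where C = 1]) (auto intro: cis_measurable)

lemma integral_cis: "(\<integral>x. cis (of_int m * x) \<partial>torus) = (if m = 0 then 2 * pi else 0)"
proof (cases "m = 0")
  case True thus ?thesis by (simp add: measure_torus scaleR_conv_of_real)
next
  case False
  have i: "integrable torus (\<lambda>x. cis (of_int m * x))"
    by (rule integrable_torus_bounded[OF cis_measurable, where C = 1]) simp
  have "((\<lambda>x. cis (of_int m * x)) has_integral
      (cis (of_int m * pi) / (\<i> * of_int m) - cis (of_int m * (- pi)) / (\<i> * of_int m))) {- pi..pi}"
  proof (rule fundamental_theorem_of_calculus)
    fix x assume "x \<in> {- pi..pi}"
    have "((\<lambda>x. cis (of_int m * x)) has_vector_derivative of_int m * \<i> * cis (of_int m * x)) (at x within {- pi..pi})"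
      unfolding has_vector_derivative_def
      by (rule derivative_eq_intros refl)+ (simp add: fun_eq_iff scaleR_conv_of_real mult_ac)
    from has_vector_derivative_mult_left[OF this, of "1 / (\<i> * of_int m)"] False
    show "((\<lambda>x. cis (of_int m * x) / (\<i> * of_int m)) has_vector_derivative cis (of_int m * x)) (at x within {- pi..pi})"
      by simp
  qed simp
  moreover have "cis (of_int m * pi) = cis (of_int m * (- pi))"
  proof -
    have "cis (of_int m * pi) = cis (of_int m * (- pi)) * cis (2 * pi * of_int m)"
      by (simp add: cis_mult algebra_simps)
    also have "cis (2 * pi * of_int m) = 1" by (rule cis_multiple_2pi) simp
    finally show ?thesis by simp
  qed
  ultimately have "integral {- pi..pi} (\<lambda>x. cis (of_int m * x)) = 0" by (simp add: integral_unique)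
  thus ?thesis
    using lebesgue_integral_eq_integral[OF i] False by (simp add: integral_open_interval_real)
qed

lemma fourier_coeff_alt: "fourier_coeff f k = (1 / (2 * pi)) * (\<integral>x. f x * cis (of_int (- k) * x) \<partial>torus)"
  by (simp add: fourier_coeff_def)

lemma fourier_coeff_cong_AE:
  assumes "AE x in torus. f x = g x" "f \<in> borel_measurable torus" "g \<in> borel_measurable torus"
  shows "fourier_coeff f = fourier_coeff g"
proof
  fix k
  have "(\<integral>x. f x * cis (of_int (- k) * x) \<partial>torus) = (\<integral>x. g x * cis (of_int (- k) * x) \<partial>torus)"
  proof (rule integral_cong_AE)
    show "AE x in torus. f x * cis (of_int (- k) * x) = g x * cis (of_int (- k) * x)"
      using assms(1) by eventually_elim simp
  qed (intro borel_measurable_times assms cis_measurable)+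
  thus "fourier_coeff f k = fourier_coeff g k" by (simp add: fourier_coeff_alt)
qed

lemma fourier_coeff_diff:
  assumes "integrable torus f" "integrable torus g"
  shows "fourier_coeff (\<lambda>x. f x - g x) k = fourier_coeff f k - fourier_coeff g k"
  unfolding fourier_coeff_alt left_diff_distrib
  by (subst Bochner_Integration.integral_diff[OF integrable_mult_cis[OF assms(1)] integrable_mult_cis[OF assms(2)]])
     (simp add: right_diff_distrib)

lemma fourier_coeff_cmult: "fourier_coeff (\<lambda>x. c * f x) k = c * fourier_coeff f k"
  by (simp add: fourier_coeff_def mult.assoc)

lemma fourier_coeff_cnj: "fourier_coeff (\<lambda>x. cnj (f x)) k = cnj (fourier_coeff f (- k))"
proof -
  have "cnj (\<integral>x. f x * cis (of_int k * x) \<partial>torus) = (\<integral>x. cnj (f x * cis (of_int k * x)) \<partial>torus)"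
    by (rule Bochner_Integration.integral_cnj[symmetric])
  also have "\<dots> = (\<integral>x. cnj (f x) * cis (of_int (- k) * x) \<partial>torus)"
    by (simp add: cis_cnj)
  finally show ?thesis by (simp add: fourier_coeff_alt)
qed

lemma norm_fourier_coeff_le: "norm (fourier_coeff f k) \<le> (1 / (2 * pi)) * (\<integral>x. norm (f x) \<partial>torus)"
proof -
  have "norm (\<integral>x. f x * cis (of_int (- k) * x) \<partial>torus) \<le> (\<integral>x. norm (f x * cis (of_int (- k) * x)) \<partial>torus)"
    by (rule integral_norm_bound)
  thus ?thesis unfolding fourier_coeff_alt by (simp add: norm_mult norm_divide divide_right_mono)
qed

definition fourier_sum :: "(int \<Rightarrow> complex) \<Rightarrow> real \<Rightarrow> complex" where
  "fourier_sum a x = (\<Sum>\<^sub>\<infinity>k. a k * cis (of_int k * x))"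

text \<open>Unordered sums over the integers become limits of symmetric partial sums, which makes
  the convergence theorems for sequences available.\<close>

lemma filterlim_int_intervals: "filterlim (\<lambda>n. {- int n..int n}) (finite_subsets_at_top UNIV) sequentially"
  unfolding filterlim_finite_subsets_at_top
proof (intro allI impI)
  fix F :: "int set" assume F: "finite F \<and> F \<subseteq> UNIV"
  define m where "m = (\<Sum>k\<in>F. nat \<bar>k\<bar>)"
  have le: "nat \<bar>k\<bar> \<le> m" if "k \<in> F" for k
    unfolding m_def by (rule member_le_sum) (use that F in auto)
  have sub: "F \<subseteq> {- int n..int n}" if "m \<le> n" for n
  proof (rule subsetI)
    fix k assume "k \<in> F"
    hence "nat \<bar>k\<bar> \<le> n" using le[of k] that by linarith
    thus "k \<in> {- int n..int n}" by auto
  qed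
  show "\<forall>\<^sub>F n in sequentially. finite {- int n..int n} \<and> F \<subseteq> {- int n..int n} \<and> {- int n..int n} \<subseteq> UNIV"
    using eventually_ge_at_top[of m] by eventually_elim (use sub in auto)
qed

lemma abs_summable_mult_bounded:
  fixes a b :: "int \<Rightarrow> complex"
  assumes "(\<lambda>k. norm (a k)) summable_on UNIV" "\<And>k. norm (b k) \<le> C"
  shows "(\<lambda>k. norm (a k * b k)) summable_on UNIV"
proof (rule summable_on_comparison_test)
  show "(\<lambda>k. C * norm (a k)) summable_on UNIV" by (intro summable_on_cmult_right assms)
  show "norm (a k * b k) \<le> C * norm (a k)" for k
    using mult_left_mono[OF assms(2)[of k] norm_ge_zero[of "a k"]] by (simp add: norm_mult mult.commute)
qed auto

lemma fourier_sum_lim: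
  assumes "(\<lambda>k. norm (a k)) summable_on UNIV"
  shows "(\<lambda>n. \<Sum>k\<in>{- int n..int n}. a k * cis (of_int k * x)) \<longlonglongrightarrow> fourier_sum a x"
proof -
  have s: "(\<lambda>k. a k * cis (of_int k * x)) summable_on UNIV"
    by (rule abs_summable_summable, rule abs_summable_mult_bounded[OF assms, where C = 1]) simp
  show ?thesis unfolding fourier_sum_def
    by (rule filterlim_compose[OF infsum_tendsto[OF s] filterlim_int_intervals])
qed

lemma partial_fourier_sum_bound:
  assumes "(\<lambda>k. norm (a k)) summable_on UNIV"
  shows "norm (\<Sum>k\<in>{- int n..int n}. a k * cis (of_int k * x)) \<le> (\<Sum>\<^sub>\<infinity>k. norm (a k))"
proof -
  have "norm (\<Sum>k\<in>{- int n..int n}. a k * cis (of_int k * x)) \<le> (\<Sum>k\<in>{- int n..int n}. norm (a k))"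
    by (rule order_trans[OF norm_sum]) (simp add: norm_mult)
  also have "\<dots> \<le> (\<Sum>\<^sub>\<infinity>k. norm (a k))" by (rule finite_sum_le_infsum[OF assms]) auto
  finally show ?thesis .
qed

lemma fourier_sum_bound:
  assumes "(\<lambda>k. norm (a k)) summable_on UNIV"
  shows "norm (fourier_sum a x) \<le> (\<Sum>\<^sub>\<infinity>k. norm (a k))"
  by (rule LIMSEQ_le_const2[OF tendsto_norm[OF fourier_sum_lim[OF assms]]])
     (use partial_fourier_sum_bound[OF assms] in auto)

lemma fourier_sum_measurable:
  assumes "(\<lambda>k. norm (a k)) summable_on UNIV"
  shows "fourier_sum a \<in> borel_measurable torus"
  by (rule borel_measurable_LIMSEQ_metric[OF _ fourier_sum_lim[OF assms]])
     (intro borel_measurable_sum borel_measurable_times cis_measurable borel_measurable_const)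

text \<open>Dominated convergence with the majorant norm f times the sum of the norms of the
  coefficients. It covers an f that is merely integrable, as the potential may be.\<close>

lemma integral_mult_fourier_sum:
  assumes f: "integrable torus f" and a: "(\<lambda>k. norm (a k)) summable_on UNIV"
  shows "(\<integral>x. f x * fourier_sum a x \<partial>torus) = (\<Sum>\<^sub>\<infinity>k. a k * (\<integral>x. f x * cis (of_int k * x) \<partial>torus))"
proof -
  let ?s = "\<lambda>n x. f x * (\<Sum>k\<in>{- int n..int n}. a k * cis (of_int k * x))"
  let ?I = "\<lambda>k. \<integral>x. f x * cis (of_int k * x) \<partial>torus"
  have fm: "f \<in> borel_measurable torus" using f by simp
  have "(\<lambda>n. integral\<^sup>L torus (?s n)) \<longlonglongrightarrow> (\<integral>x. f x * fourier_sum a x \<partial>torus)"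
  proof (rule integral_dominated_convergence)
    show "(\<lambda>x. f x * fourier_sum a x) \<in> borel_measurable torus"
      by (intro borel_measurable_times fm fourier_sum_measurable a)
    show "?s n \<in> borel_measurable torus" for n
      by (intro borel_measurable_times fm borel_measurable_sum cis_measurable borel_measurable_const)
    show "integrable torus (\<lambda>x. norm (f x) * (\<Sum>\<^sub>\<infinity>k. norm (a k)))" using f by simp
    show "AE x in torus. (\<lambda>n. ?s n x) \<longlonglongrightarrow> f x * fourier_sum a x"
      by (intro AE_I2 tendsto_intros fourier_sum_lim a)
    show "AE x in torus. norm (?s n x) \<le> norm (f x) * (\<Sum>\<^sub>\<infinity>k. norm (a k))" for n
      unfolding norm_mult by (intro AE_I2 mult_left_mono partial_fourier_sum_bound a) auto
  qed
  moreover have "integral\<^sup>L torus (?s n) = (\<Sum>k\<in>{- int n..int n}. a k * ?I k)" for n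
  proof -
    have "integral\<^sup>L torus (?s n) = (\<integral>x. (\<Sum>k\<in>{- int n..int n}. a k * (f x * cis (of_int k * x))) \<partial>torus)"
      by (simp add: sum_distrib_left mult_ac)
    also have "\<dots> = (\<Sum>k\<in>{- int n..int n}. \<integral>x. a k * (f x * cis (of_int k * x)) \<partial>torus)"
      by (rule Bochner_Integration.integral_sum) (intro integrable_mult_right integrable_mult_cis f)
    finally show ?thesis by simp
  qed
  moreover have "(\<lambda>n. \<Sum>k\<in>{- int n..int n}. a k * ?I k) \<longlonglongrightarrow> (\<Sum>\<^sub>\<infinity>k. a k * ?I k)"
  proof -
    have b: "norm (?I k) \<le> (\<integral>x. norm (f x) \<partial>torus)" for k
      using integral_norm_bound[of torus "\<lambda>x. f x * cis (of_int k * x)"] by (simp add: norm_mult)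
    have "(\<lambda>k. a k * ?I k) summable_on UNIV"
      by (rule abs_summable_summable, rule abs_summable_mult_bounded[OF a b])
    thus ?thesis by (rule filterlim_compose[OF infsum_tendsto filterlim_int_intervals])
  qed
  ultimately show ?thesis using LIMSEQ_unique by simp
qed

lemma fourier_coeff_mult_fourier_sum:
  assumes f: "integrable torus f" and a: "(\<lambda>k. norm (a k)) summable_on UNIV"
  shows "fourier_coeff (\<lambda>x. f x * fourier_sum a x) k = (\<Sum>\<^sub>\<infinity>j. fourier_coeff f (k - j) * a j)"
proof -
  have "(\<integral>x. f x * fourier_sum a x * cis (of_int (- k) * x) \<partial>torus)
      = (\<integral>x. (f x * cis (of_int (- k) * x)) * fourier_sum a x \<partial>torus)"
    by (simp only: mult_ac)
  also have "\<dots> = (\<Sum>\<^sub>\<infinity>j. a j * (\<integral>x. f x * cis (of_int (- k) * x) * cis (of_int j * x) \<partial>torus))"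
    by (rule integral_mult_fourier_sum[OF integrable_mult_cis[OF f] a])
  also have "\<dots> = (\<Sum>\<^sub>\<infinity>j. (2 * pi) * (fourier_coeff f (k - j) * a j))"
  proof (rule infsum_cong)
    fix j
    have "(\<integral>x. f x * cis (of_int (- k) * x) * cis (of_int j * x) \<partial>torus) = (\<integral>x. f x * cis (of_int (- (k - j)) * x) \<partial>torus)"
      by (rule Bochner_Integration.integral_cong) (auto simp: cis_mult algebra_simps)
    thus "a j * (\<integral>x. f x * cis (of_int (- k) * x) * cis (of_int j * x) \<partial>torus) = (2 * pi) * (fourier_coeff f (k - j) * a j)"
      by (simp add: fourier_coeff_alt)
  qed
  also have "\<dots> = (2 * pi) * (\<Sum>\<^sub>\<infinity>j. fourier_coeff f (k - j) * a j)" by (rule infsum_cmult_right')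
  finally show ?thesis by (simp add: fourier_coeff_alt)
qed

text \<open>The product formula with f = 1, whose coefficients are those of the unit of
  convolution.\<close>

lemma fourier_coeff_fourier_sum:
  assumes a: "(\<lambda>k. norm (a k)) summable_on UNIV"
  shows "fourier_coeff (fourier_sum a) k = a k"
proof -
  have one: "integrable torus (\<lambda>_. 1 :: complex)" by simp
  have c: "fourier_coeff (\<lambda>_. 1) m = (if m = 0 then 1 else 0)" for m
    using integral_cis[of "- m"] by (simp add: fourier_coeff_alt)
  have "fourier_coeff (fourier_sum a) k = (\<Sum>\<^sub>\<infinity>j. fourier_coeff (\<lambda>_. 1) (k - j) * a j)"
    using fourier_coeff_mult_fourier_sum[OF one a, of k] by simp
  also have "\<dots> = (\<Sum>\<^sub>\<infinity>j. if j = k then a j else 0)"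
    by (rule infsum_cong) (simp add: c)
  also have "\<dots> = (\<Sum>\<^sub>\<infinity>j\<in>{k}. a j)"
    by (rule infsum_cong_neutral) auto
  finally show ?thesis by simp
qed

text \<open>Real polynomials restricted to the circle are trigonometric polynomials. This connects
  the approximation theorem of Stone and Weierstrass with Fourier coefficients.\<close>

lemma real_polynomial_cis:
  assumes "real_polynomial_function p"
  shows "\<exists>F c. finite F \<and> (\<forall>x. complex_of_real (p (cis x)) = (\<Sum>k\<in>F. c k * cis (of_int k * x)))"
  using assms
proof induction
  case (linear p)
  interpret bounded_linear p by fact
  \<comment> \<open>The linear functional takes the value cos x p(1) + sin x p(\<i>) at
    \<open>cis x\<close>; \<open>d\<close> and \<open>d'\<close> are its coefficients at the
    frequencies 1 and -1.\<close>
  define d where "d = (p 1 - \<i> * p \<i>) / 2"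
  define d' where "d' = (p 1 + \<i> * p \<i>) / 2"
  have "complex_of_real (p (cis x)) = (\<Sum>k\<in>{1, -1::int}. (if k = 1 then d else d') * cis (of_int k * x))" for x
  proof -
    have "cis x = cos x *\<^sub>R 1 + sin x *\<^sub>R \<i>" by (simp add: complex_eq_iff)
    hence "p (cis x) = cos x * p 1 + sin x * p \<i>" by (simp add: add scaleR)
    thus ?thesis by (simp add: d_def d'_def complex_eq_iff field_simps)
  qed
  thus ?case by (intro exI[of _ "{1, -1}"] exI[of _ "\<lambda>k. if k = 1 then d else d'"]) auto
next
  case (const c)
  show ?case by (rule exI[of _ "{0}"], rule exI[of _ "\<lambda>_. of_real c"]) simp
next
  case (add p q)
  then obtain F c G d where p: "finite F" "\<And>x. complex_of_real (p (cis x)) = (\<Sum>k\<in>F. c k * cis (of_int k * x))"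
    and q: "finite G" "\<And>x. complex_of_real (q (cis x)) = (\<Sum>k\<in>G. d k * cis (of_int k * x))" by blast
  have "complex_of_real (p (cis x) + q (cis x)) = (\<Sum>k\<in>F \<union> G. ((if k \<in> F then c k else 0) + (if k \<in> G then d k else 0)) * cis (of_int k * x))" for x
  proof -
    have "(\<Sum>k\<in>F. c k * cis (of_int k * x)) = (\<Sum>k\<in>F \<union> G. (if k \<in> F then c k else 0) * cis (of_int k * x))"
      using p q by (intro sum.mono_neutral_cong_left) auto
    moreover have "(\<Sum>k\<in>G. d k * cis (of_int k * x)) = (\<Sum>k\<in>F \<union> G. (if k \<in> G then d k else 0) * cis (of_int k * x))"
      using p q by (intro sum.mono_neutral_cong_left) auto
    ultimately show ?thesis by (simp add: p q distrib_right sum.distrib)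
  qed
  thus ?case using p q by (intro exI[of _ "F \<union> G"]) (auto intro!: exI)
next
  case (mult p q)
  then obtain F c G d where p: "finite F" "\<And>x. complex_of_real (p (cis x)) = (\<Sum>k\<in>F. c k * cis (of_int k * x))"
    and q: "finite G" "\<And>x. complex_of_real (q (cis x)) = (\<Sum>k\<in>G. d k * cis (of_int k * x))" by blast
  let ?H = "(\<lambda>(i, j). i + j) ` (F \<times> G)"
  define e where "e m = (\<Sum>z\<in>{z \<in> F \<times> G. fst z + snd z = m}. c (fst z) * d (snd z))" for m
  have "complex_of_real (p (cis x) * q (cis x)) = (\<Sum>m\<in>?H. e m * cis (of_int m * x))" for x
  proof -
    have "complex_of_real (p (cis x) * q (cis x)) = (\<Sum>z\<in>F \<times> G. c (fst z) * d (snd z) * cis (of_int (fst z + snd z) * x))"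
      unfolding of_real_mult p q sum_product sum.cartesian_product
      by (rule sum.cong) (auto simp: cis_mult[symmetric] algebra_simps)
    also have "\<dots> = (\<Sum>m\<in>?H. \<Sum>z\<in>{z \<in> F \<times> G. fst z + snd z = m}. c (fst z) * d (snd z) * cis (of_int (fst z + snd z) * x))"
      using p q by (intro sum.group[symmetric]) auto
    also have "\<dots> = (\<Sum>m\<in>?H. e m * cis (of_int m * x))"
      by (rule sum.cong) (auto simp: e_def sum_distrib_right)
    finally show ?thesis .
  qed
  thus ?case using p q by (intro exI[of _ ?H]) (auto intro!: exI)
qed

text \<open>Integration against f annihilates trigonometric polynomials, hence by uniform
  approximation all continuous functions on the circle.\<close>

lemma fourier_zero_continuous:
  assumes f: "integrable torus f" and zero: "\<And>k. fourier_coeff f k = 0"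
    and h: "continuous_on (sphere 0 1) (h :: complex \<Rightarrow> complex)"
  shows "(\<integral>x. f x * h (cis x) \<partial>torus) = 0"
proof -
  have cis0: "(\<integral>x. f x * cis (of_int k * x) \<partial>torus) = 0" for k
    using zero[of "- k"] by (simp add: fourier_coeff_alt)
  have poly0: "(\<integral>x. f x * complex_of_real (q (cis x)) \<partial>torus) = 0" if q: "real_polynomial_function q" for q
  proof -
    obtain F c where F: "finite F" "\<And>x. complex_of_real (q (cis x)) = (\<Sum>k\<in>F. c k * cis (of_int k * x))"
      using real_polynomial_cis[OF q] by blast
    have "(\<integral>x. f x * complex_of_real (q (cis x)) \<partial>torus) = (\<integral>x. (\<Sum>k\<in>F. c k * (f x * cis (of_int k * x))) \<partial>torus)"
      unfolding F(2) by (simp add: sum_distrib_left mult_ac)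
    also have "\<dots> = (\<Sum>k\<in>F. \<integral>x. c k * (f x * cis (of_int k * x)) \<partial>torus)"
      by (rule Bochner_Integration.integral_sum) (intro integrable_mult_right integrable_mult_cis f)
    finally show ?thesis by (simp add: cis0)
  qed
  have hm: "(\<lambda>x. h (cis x)) \<in> borel_measurable torus"
    by (rule torus_measurable, rule continuous_on_compose2[OF h]) (auto intro: continuous_intros)
  obtain Ch where "\<forall>w\<in>h ` sphere 0 1. norm w \<le> Ch"
    using compact_imp_bounded[OF compact_continuous_image[OF h compact_sphere]] unfolding bounded_iff by (elim exE)
  hence Ch: "norm (h z) \<le> Ch" if "z \<in> sphere 0 1" for z using that by blast
  define N where "N = (\<integral>x. norm (f x) \<partial>torus)"
  have "norm (\<integral>x. f x * h (cis x) \<partial>torus) \<le> e * N" if e: "0 < e" for e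
  proof -
    obtain g where g: "polynomial_function g" "\<And>z. z \<in> sphere 0 1 \<Longrightarrow> norm (h z - g z) < e"
      using Stone_Weierstrass_polynomial_function[OF compact_sphere h e] by blast
    have gr: "real_polynomial_function (\<lambda>z. Re (g z))" "real_polynomial_function (\<lambda>z. Im (g z))"
      using g(1) bounded_linear_Re bounded_linear_Im unfolding polynomial_function_def o_def by blast+
    have gc: "continuous_on UNIV (\<lambda>x. complex_of_real (Re (g (cis x))))" "continuous_on UNIV (\<lambda>x. complex_of_real (Im (g (cis x))))"
      by (intro continuous_intros continuous_on_compose2[OF continuous_on_polymonial_function[OF g(1), of UNIV]]; simp)+
    have gb: "norm (g (cis x)) \<le> Ch + e" for x
    proof -
      have "norm (g (cis x)) \<le> norm (h (cis x)) + norm (h (cis x) - g (cis x))"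
        using norm_triangle_ineq4[of "h (cis x)" "h (cis x) - g (cis x)"] by simp
      thus ?thesis using Ch[of "cis x"] g(2)[of "cis x"] by simp
    qed
    have gi: "integrable torus (\<lambda>x. f x * complex_of_real (Re (g (cis x))))" "integrable torus (\<lambda>x. f x * complex_of_real (Im (g (cis x))))"
      using gb abs_Re_le_cmod abs_Im_le_cmod
      by (intro integrable_mult_bounded[OF f torus_measurable[OF gc(1)], of "Ch + e"] integrable_mult_bounded[OF f torus_measurable[OF gc(2)], of "Ch + e"];
          metis norm_of_real order_trans)+
    have g0: "(\<integral>x. f x * g (cis x) \<partial>torus) = 0"
    proof -
      have "(\<integral>x. f x * g (cis x) \<partial>torus) = (\<integral>x. f x * complex_of_real (Re (g (cis x))) + \<i> * (f x * complex_of_real (Im (g (cis x)))) \<partial>torus)"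
        by (rule Bochner_Integration.integral_cong) (auto simp: complex_eq_iff algebra_simps)
      also have "\<dots> = (\<integral>x. f x * complex_of_real (Re (g (cis x))) \<partial>torus) + (\<integral>x. \<i> * (f x * complex_of_real (Im (g (cis x)))) \<partial>torus)"
        by (intro Bochner_Integration.integral_add integrable_mult_right gi)
      finally show ?thesis using poly0[OF gr(1)] poly0[OF gr(2)] by simp
    qed
    have gint: "integrable torus (\<lambda>x. f x * g (cis x))"
      by (rule integrable_mult_bounded[OF f torus_measurable gb], rule continuous_on_compose2[OF continuous_on_polymonial_function[OF g(1), of UNIV]])
         (auto intro: continuous_intros)
    have hint: "integrable torus (\<lambda>x. f x * h (cis x))"
      by (rule integrable_mult_bounded[OF f hm, of Ch]) (use Ch in auto)
    have "(\<integral>x. f x * h (cis x) \<partial>torus) = (\<integral>x. f x * h (cis x) - f x * g (cis x) \<partial>torus)"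
      using g0 by (simp add: Bochner_Integration.integral_diff[OF hint gint])
    also have "norm \<dots> \<le> (\<integral>x. norm (f x * h (cis x) - f x * g (cis x)) \<partial>torus)" by (rule integral_norm_bound)
    also have "\<dots> \<le> (\<integral>x. e * norm (f x) \<partial>torus)"
    proof (rule integral_mono)
      show "integrable torus (\<lambda>x. norm (f x * h (cis x) - f x * g (cis x)))" using hint gint by simp
      show "integrable torus (\<lambda>x. e * norm (f x))" using f by simp
      fix x
      have "norm (f x * h (cis x) - f x * g (cis x)) = norm (f x) * norm (h (cis x) - g (cis x))"
        by (simp add: norm_mult flip: right_diff_distrib)
      also have "\<dots> \<le> norm (f x) * e" using g(2)[of "cis x"] by (intro mult_left_mono) auto
      finally show "norm (f x * h (cis x) - f x * g (cis x)) \<le> e * norm (f x)" by (simp add: mult.commute)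
    qed
    finally show ?thesis by (simp add: N_def)
  qed
  hence "norm (\<integral>x. f x * h (cis x) \<partial>torus) \<le> e" if "0 < e" for e
  proof -
    have N0: "0 \<le> N" by (simp add: N_def)
    have "norm (\<integral>x. f x * h (cis x) \<partial>torus) \<le> (e / (N + 1)) * N"
      using \<open>\<And>e. 0 < e \<Longrightarrow> norm (\<integral>x. f x * h (cis x) \<partial>torus) \<le> e * N\<close>[of "e / (N + 1)"] that N0 by simp
    also have "\<dots> \<le> e" using that N0 by (simp add: field_simps)
    finally show ?thesis .
  qed
  hence "norm (\<integral>x. f x * h (cis x) \<partial>torus) \<le> 0" by (rule field_le_epsilon[of _ 0, simplified])
  thus ?thesis by simp
qed

theorem fourier_unique:
  assumes f: "integrable torus f" and zero: "\<And>k. fourier_coeff f k = 0"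
  shows "AE x in torus. f x = 0"
proof -
  \<comment> \<open>Testing against the conjugate sign would give the integral of
    \<open>norm (f x)\<close>. The sign is only measurable, so it is approximated by continuous
    functions on the circle that stay bounded by 1.\<close>
  define \<psi> where "\<psi> x = cnj (sgn (f x))" for x
  have fm: "f \<in> borel_measurable torus" using f by simp
  have "(\<lambda>x. cnj (f x)) \<in> borel_measurable torus"
    by (rule measurable_compose[OF fm borel_measurable_continuous_onI]) (intro continuous_intros)
  moreover have "(\<lambda>x. complex_of_real (norm (f x))) \<in> borel_measurable torus"
    using fm by measurable
  ultimately have "(\<lambda>x. cnj (f x) / complex_of_real (norm (f x))) \<in> borel_measurable torus"
    by (rule borel_measurable_divide)
  moreover have "\<psi> = (\<lambda>x. cnj (f x) / complex_of_real (norm (f x)))"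
    by (rule ext) (simp add: \<psi>_def sgn_div_norm scaleR_conv_of_real divide_inverse)
  ultimately have \<psi>m: "\<psi> \<in> borel_measurable torus" by (simp only:)
  hence "\<psi> measurable_on {-pi<..<pi}" by (simp add: measurable_on_iff_borel_measurable)
  then obtain Z g where Z: "negligible Z" and gc: "\<And>n. continuous_on UNIV (g n)"
    and gl: "\<And>x. x \<notin> Z \<Longrightarrow> (\<lambda>n. g n x) \<longlonglongrightarrow> (if x \<in> {-pi<..<pi} then \<psi> x else 0)"
    unfolding measurable_on_def by blast
  \<comment> \<open>The division enforces the bound 1 for dominated convergence and does not change
    the limit, since \<open>\<psi>\<close> is bounded by 1.\<close>
  define G where "G n x = g n x / of_real (max 1 (norm (g n x)))" for n :: nat and x :: real
  have Gc: "continuous_on UNIV (G n)" for n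
    unfolding G_def by (intro continuous_intros gc) (auto simp: max_def)
  have G1: "norm (G n x) \<le> 1" for n x
    by (auto simp: G_def norm_divide max_def divide_le_eq)
  \<comment> \<open>\<open>G n\<close> need not take equal values at the ends of the period, so
    composing it with \<open>Arg\<close> can jump at -1. The factor \<open>cut n\<close> vanishes
    there and tends to 1 at every other point of the circle.\<close>
  define cut where "cut n z = min 1 (real n * (Re z + 1))" for n :: nat and z :: complex
  have cutc: "continuous_on A (cut n)" for A n unfolding cut_def by (intro continuous_intros)
  have cut01: "0 \<le> cut n z" "cut n z \<le> 1" if "norm z = 1" for n z
    using complex_Re_le_cmod[of "- z"] that by (auto simp: cut_def)
  define h where "h n z = of_real (cut n z) * G n (Arg z)" for n z
  have hc: "continuous_on (sphere 0 1) (h n)" for n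
    unfolding continuous_on_eq_continuous_within
  proof
    fix z :: complex assume z: "z \<in> sphere 0 1"
    show "continuous (at z within sphere 0 1) (h n)"
    proof (cases "z = - 1")
      case False
      have "z \<notin> \<real>\<^sub>\<le>\<^sub>0"
      proof
        assume "z \<in> \<real>\<^sub>\<le>\<^sub>0"
        then obtain r where "z = of_real r" "r \<le> 0" by (auto elim: nonpos_Reals_cases)
        with z False show False by auto
      qed
      hence "continuous (at z within sphere 0 1) Arg" by (rule continuous_within_Arg)
      moreover have "isCont (G n) (Arg z)" using Gc[of n] by (simp add: continuous_on_eq_continuous_at)
      ultimately have "continuous (at z within sphere 0 1) (\<lambda>z. G n (Arg z))"
        by (rule continuous_within_compose3[rotated])
      moreover have "continuous (at z within sphere 0 1) (cut n)"
        using cutc[of "sphere 0 1" n] z by (simp add: continuous_on_eq_continuous_within)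
      ultimately show ?thesis unfolding h_def by (intro continuous_intros)
    next
      case True
      have "h n z = 0" by (simp add: True h_def cut_def)
      moreover have "(h n \<longlongrightarrow> 0) (at z within sphere 0 1)"
      proof (rule Lim_null_comparison)
        show "\<forall>\<^sub>F w in at z within sphere 0 1. norm (h n w) \<le> cut n w"
          unfolding eventually_at
        proof (intro exI[of _ 1] conjI ballI impI)
          fix w :: complex assume "w \<in> sphere 0 1"
          hence w: "norm w = 1" by simp
          have "norm (h n w) = cut n w * norm (G n (Arg w))" using cut01[OF w, of n] by (simp add: h_def norm_mult)
          also have "\<dots> \<le> cut n w * 1" using cut01[OF w, of n] by (intro mult_left_mono G1)
          finally show "norm (h n w) \<le> cut n w" by simp
        qed simp
        have "(cut n \<longlongrightarrow> cut n z) (at z within sphere 0 1)"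
          using cutc[of "sphere 0 1" n] z by (auto simp: continuous_on_def)
        thus "(cut n \<longlongrightarrow> 0) (at z within sphere 0 1)" by (simp add: True cut_def)
      qed
      ultimately show ?thesis by (simp add: continuous_within)
    qed
  qed
  have h1: "norm (h n (cis x)) \<le> 1" for n x
    using G1[of n "Arg (cis x)"] cut01[of "cis x" n] by (simp add: h_def norm_mult mult_le_one)
  have "(\<lambda>n. \<integral>x. f x * h n (cis x) \<partial>torus) \<longlonglongrightarrow> (\<integral>x. f x * \<psi> x \<partial>torus)"
  proof (rule integral_dominated_convergence)
    show "(\<lambda>x. f x * \<psi> x) \<in> borel_measurable torus" by (intro borel_measurable_times fm \<psi>m)
    show "(\<lambda>x. f x * h n (cis x)) \<in> borel_measurable torus" for n
      by (intro borel_measurable_times fm torus_measurable continuous_on_compose2[OF hc]) (auto intro: continuous_intros)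
    show "integrable torus (\<lambda>x. norm (f x))" using f by simp
    show "AE x in torus. norm (f x * h n (cis x)) \<le> norm (f x)" for n
      using h1 by (intro AE_I2) (simp add: norm_mult mult_left_le)
    have "AE x in torus. x \<notin> Z"
      using Z by (simp add: AE_restrict_space_iff negligible_iff_null_sets AE_not_in[THEN AE_mp])
    thus "AE x in torus. (\<lambda>n. f x * h n (cis x)) \<longlonglongrightarrow> f x * \<psi> x"
    proof (rule AE_mp, intro AE_I2 impI)
      fix x assume x: "x \<in> space torus" and xZ: "x \<notin> Z"
      have xt: "x \<in> {-pi<..<pi}" using x by simp
      have lim: "(\<lambda>n. g n x) \<longlonglongrightarrow> \<psi> x" using gl[OF xZ] xt by simp
      have n\<psi>: "max 1 (norm (\<psi> x)) = 1" by (simp add: \<psi>_def norm_sgn)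
      have "(\<lambda>n. G n x) \<longlonglongrightarrow> \<psi> x / of_real (max 1 (norm (\<psi> x)))"
        unfolding G_def by (intro tendsto_intros lim) (simp add: n\<psi>)
      hence Gl: "(\<lambda>n. G n x) \<longlonglongrightarrow> \<psi> x" by (simp add: n\<psi>)
      have pos: "0 < cos x + 1"
      proof -
        have "cos x \<noteq> - 1"
        proof
          assume "cos x = - 1"
          hence "cos \<bar>x\<bar> = cos pi" by simp
          moreover have "\<bar>x\<bar> \<in> {0..pi}" "pi \<in> {0..pi}" "\<bar>x\<bar> \<noteq> pi" using xt by auto
          ultimately show False using cos_inj_pi[of "\<bar>x\<bar>" pi] by auto
        qed
        thus ?thesis using cos_ge_minus_one[of x] by linarith
      qed
      obtain n0 where "1 / (cos x + 1) < real n0" using reals_Archimedean2 by blast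
      hence "cut n (cis x) = 1" if "n \<ge> n0" for n
      proof -
        have "1 / (cos x + 1) \<le> real n" using that \<open>1 / (cos x + 1) < real n0\<close> by linarith
        thus ?thesis using pos by (simp add: cut_def divide_le_eq min_def)
      qed
      hence "\<forall>\<^sub>F n in sequentially. h n (cis x) = G n x"
        unfolding eventually_sequentially using xt by (intro exI[of _ n0]) (auto simp: h_def Arg_cis)
      with Gl have "(\<lambda>n. h n (cis x)) \<longlonglongrightarrow> \<psi> x" by (simp add: tendsto_cong)
      thus "(\<lambda>n. f x * h n (cis x)) \<longlonglongrightarrow> f x * \<psi> x" by (intro tendsto_intros)
    qed
  qed
  moreover have "(\<integral>x. f x * h n (cis x) \<partial>torus) = 0" for n
    by (rule fourier_zero_continuous[OF f zero hc])
  ultimately have "(\<integral>x. f x * \<psi> x \<partial>torus) = 0" by (simp add: LIMSEQ_const_iff)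
  moreover have "f x * \<psi> x = complex_of_real (norm (f x))" for x
  proof (cases "f x = 0")
    case False
    have "f x * cnj (f x) = of_real ((norm (f x))\<^sup>2)" by (metis complex_norm_square)
    thus ?thesis using False
      by (simp add: \<psi>_def sgn_div_norm power2_eq_square scaleR_conv_of_real field_simps)
  qed (simp add: \<psi>_def)
  ultimately have "(\<integral>x. norm (f x) \<partial>torus) = 0" by simp
  hence "AE x in torus. norm (f x) = 0"
    using integral_nonneg_eq_0_iff_AE[of torus "\<lambda>x. norm (f x)"] f by simp
  thus ?thesis by simp
qed

section \<open>The cubic nonlinearity and uniqueness\<close>

text \<open>The pointwise product of two functions in weighted coordinates: convolution of the
  coefficients, conjugated with the weights of level \<sigma>.\<close>

definition ell2_product :: "real \<Rightarrow> int ell2 \<Rightarrow> int ell2 \<Rightarrow> int ell2" where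
  "ell2_product \<sigma> x = mat_op (\<lambda>k j. of_real (jb k powr \<sigma> * jb (k - j) powr - \<sigma> * jb j powr - \<sigma>) * ell2_nth x (k - j))"

lemma jb_cancel: "jb k powr s * jb k powr - s = 1" "jb k powr - s * jb k powr s = 1"
  by (simp_all flip: powr_add)

lemma l1_weight_bound:
  assumes \<sigma>: "1/2 < \<sigma>"
  shows "\<exists>Z\<ge>0. (\<forall>F. finite F \<longrightarrow> (\<Sum>k\<in>F. (jb k powr - \<sigma>)\<^sup>2) \<le> Z\<^sup>2) \<and>
     (\<forall>x F. finite F \<longrightarrow> (\<Sum>k\<in>F. jb k powr - \<sigma> * norm (ell2_nth x k)) \<le> Z * norm x)"
proof -
  obtain Z where Z: "0 \<le> Z" "\<And>F. finite F \<Longrightarrow> (\<Sum>k\<in>F. jb k powr - (2 * \<sigma>)) \<le> Z"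
    using jb_sum_bound[of "2 * \<sigma>"] \<sigma> by auto
  have sq: "(\<Sum>k\<in>F. (jb k powr - \<sigma>)\<^sup>2) \<le> (sqrt Z)\<^sup>2" if "finite F" for F
    using Z(2)[OF that] Z(1) by (simp add: powr_sq)
  have "(\<Sum>k\<in>F. jb k powr - \<sigma> * norm (ell2_nth x k)) \<le> sqrt Z * norm x" if F: "finite F" for x F
  proof -
    have "(\<Sum>k\<in>F. jb k powr - \<sigma> * norm (ell2_nth x k)) = (\<Sum>k\<in>F. \<bar>jb k powr - \<sigma>\<bar> * \<bar>norm (ell2_nth x k)\<bar>)" by simp
    also have "\<dots> \<le> L2_set (\<lambda>k. jb k powr - \<sigma>) F * L2_set (\<lambda>k. norm (ell2_nth x k)) F"
      by (rule L2_set_mult_ineq)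
    also have "\<dots> \<le> sqrt Z * norm x"
    proof (rule mult_mono)
      show "L2_set (\<lambda>k. jb k powr - \<sigma>) F \<le> sqrt Z"
        unfolding L2_set_def using sq[OF F] Z(1) by simp
    qed (use L2_set_le_norm_ell2[OF F] Z(1) in auto)
    finally show ?thesis .
  qed
  with sq Z(1) show ?thesis by (intro exI[of _ "sqrt Z"]) auto
qed

text \<open>The first matrix expresses the algebra property of H^\<sigma>, with the output weight
  distributed over k - j and j. The second is multiplication by a function of H^\<sigma> on L^2,
  bounded because the coefficients of that function are absolutely summable for \<sigma> >
  1/2.\<close>

lemma ell2_product_matrix_bounded:
  assumes \<sigma>: "1/2 < \<sigma>"
  shows "\<exists>C\<ge>0. \<forall>x. mat_bounded (\<lambda>k j. of_real (jb k powr \<sigma> * jb (k - j) powr - \<sigma> * jb j powr - \<sigma>) * ell2_nth x (k - j)) (C * norm x)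
     \<and> mat_bounded (\<lambda>k j. of_real (jb (k - j) powr - \<sigma>) * ell2_nth x (k - j)) (C * norm x)"
proof -
  obtain Z where Z: "0 \<le> Z" "\<And>F. finite F \<Longrightarrow> (\<Sum>k\<in>F. (jb k powr - \<sigma>)\<^sup>2) \<le> Z\<^sup>2"
    "\<And>x F. finite F \<Longrightarrow> (\<Sum>k\<in>F. jb k powr - \<sigma> * norm (ell2_nth x k)) \<le> Z * norm x"
    using l1_weight_bound[OF \<sigma>] by blast
  have S: "mat_bounded (\<lambda>k j. of_real (jb (k - j) powr - \<sigma>) * ell2_nth x (k - j)) (Z * norm x)" for x
  proof (rule Schur_test)
    show "(\<Sum>j\<in>J. norm (of_real (jb (k - j) powr - \<sigma>) * ell2_nth x (k - j))) \<le> Z * norm x" if "finite J" for k J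
      using sum_shift_le[where X = "\<lambda>k. jb k powr - \<sigma> * norm (ell2_nth x k)", OF Z(3) that, of "\<lambda>j. k - j"]
      by (simp add: norm_mult inj_on_def)
    show "(\<Sum>k\<in>K. norm (of_real (jb (k - j) powr - \<sigma>) * ell2_nth x (k - j))) \<le> Z * norm x" if "finite K" for j K
      using sum_shift_le[where X = "\<lambda>k. jb k powr - \<sigma> * norm (ell2_nth x k)", OF Z(3) that, of "\<lambda>k. k - j"]
      by (simp add: norm_mult inj_on_def)
  qed (use Z in auto)
  have R: "mat_bounded (\<lambda>k j. ell2_nth x (k - j) * of_real (jb j powr - \<sigma>)) (norm x * Z)" for x
  proof (rule mat_bounded_rows)
    show "norm (ell2_nth x (k - j) * of_real (jb j powr - \<sigma>)) \<le> norm (ell2_nth x (k - j)) * jb j powr - \<sigma>" for k j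
      by (simp add: norm_mult)
    show "finite G \<Longrightarrow> (\<Sum>m\<in>G. (norm (ell2_nth x m))\<^sup>2) \<le> (norm x)\<^sup>2" for G by (rule sum_le_norm_ell2_sq)
    show "finite J \<Longrightarrow> (\<Sum>j\<in>J. (jb j powr - \<sigma>)\<^sup>2) \<le> Z\<^sup>2" for J by (rule Z)
  qed (use Z in auto)
  have "mat_bounded (\<lambda>k j. of_real (jb k powr \<sigma> * jb (k - j) powr - \<sigma> * jb j powr - \<sigma>) * ell2_nth x (k - j)) (2 powr \<sigma> * (2 * Z) * norm x)" for x
  proof -
    have "mat_bounded (\<lambda>k j. of_real (norm (ell2_nth x (k - j)) * jb j powr - \<sigma> + jb (k - j) powr - \<sigma> * norm (ell2_nth x (k - j)))) (norm x * Z + Z * norm x)"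
    proof (rule mat_bounded_add[OF R[of x] S[of x]])
      fix k j
      have "0 \<le> norm (ell2_nth x (k - j)) * jb j powr - \<sigma> + jb (k - j) powr - \<sigma> * norm (ell2_nth x (k - j))" by simp
      thus "norm (complex_of_real (norm (ell2_nth x (k - j)) * jb j powr - \<sigma> + jb (k - j) powr - \<sigma> * norm (ell2_nth x (k - j))))
        \<le> norm (ell2_nth x (k - j) * of_real (jb j powr - \<sigma>)) + norm (of_real (jb (k - j) powr - \<sigma>) * ell2_nth x (k - j))"
        unfolding norm_of_real by (simp add: norm_mult)
    qed
    hence "mat_bounded (\<lambda>k j. of_real (jb k powr \<sigma> * jb (k - j) powr - \<sigma> * jb j powr - \<sigma>) * ell2_nth x (k - j)) (2 powr \<sigma> * (norm x * Z + Z * norm x))"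
    proof (rule mat_bounded_scale)
      fix k j
      have "jb k powr \<sigma> * (jb (k - j) powr - \<sigma> * jb j powr - \<sigma>) \<le> 2 powr \<sigma> * (jb (k - j) powr \<sigma> + jb j powr \<sigma>) * (jb (k - j) powr - \<sigma> * jb j powr - \<sigma>)"
        by (intro mult_right_mono jb_powr_add_le) (use \<sigma> in auto)
      also have "\<dots> = 2 powr \<sigma> * ((jb (k - j) powr \<sigma> * jb (k - j) powr - \<sigma>) * jb j powr - \<sigma> + (jb j powr \<sigma> * jb j powr - \<sigma>) * jb (k - j) powr - \<sigma>)"
        by (simp only: algebra_simps)
      also have "\<dots> = 2 powr \<sigma> * (jb j powr - \<sigma> + jb (k - j) powr - \<sigma>)" by (simp only: jb_cancel mult_1)
      finally have le: "jb k powr \<sigma> * jb (k - j) powr - \<sigma> * jb j powr - \<sigma> \<le> 2 powr \<sigma> * (jb j powr - \<sigma> + jb (k - j) powr - \<sigma>)"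
        by (simp only: mult.assoc)
      have nn: "0 \<le> norm (ell2_nth x (k - j)) * jb j powr - \<sigma> + jb (k - j) powr - \<sigma> * norm (ell2_nth x (k - j))" by simp
      from mult_right_mono[OF le norm_ge_zero[of "ell2_nth x (k - j)"]]
      show "norm (of_real (jb k powr \<sigma> * jb (k - j) powr - \<sigma> * jb j powr - \<sigma>) * ell2_nth x (k - j))
        \<le> 2 powr \<sigma> * norm (complex_of_real (norm (ell2_nth x (k - j)) * jb j powr - \<sigma> + jb (k - j) powr - \<sigma> * norm (ell2_nth x (k - j))))"
        unfolding norm_mult norm_of_real abs_of_nonneg[OF nn] by (simp add: algebra_simps)
    qed auto
    thus ?thesis by (simp add: algebra_simps)
  qed
  moreover have "mat_bounded (\<lambda>k j. of_real (jb (k - j) powr - \<sigma>) * ell2_nth x (k - j)) (2 powr \<sigma> * (2 * Z) * norm x)" for x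
  proof (rule mat_bounded_weaken[OF S])
    have "1 \<le> 2 powr \<sigma>" using \<sigma> by (intro ge_one_powr_ge_zero) auto
    hence "1 * Z \<le> 2 powr \<sigma> * (2 * Z)" using Z(1) by (intro mult_mono) auto
    thus "Z * norm x \<le> 2 powr \<sigma> * (2 * Z) * norm x" by (intro mult_right_mono) auto
  qed
  ultimately show ?thesis using Z(1) by (intro exI[of _ "2 powr \<sigma> * (2 * Z)"]) auto
qed

text \<open>This removes the weights, so \<open>low \<sigma> x\<close> consists of plain Fourier
  coefficients and its norm is the L^2 norm up to a constant.\<close>

definition low :: "real \<Rightarrow> int ell2 \<Rightarrow> int ell2" where
  "low \<sigma> = mult_op (\<lambda>k. of_real (jb k powr - \<sigma>))"

lemma jb_powr_neg_le_1: "0 \<le> \<sigma> \<Longrightarrow> norm (complex_of_real (jb k powr - \<sigma>)) \<le> 1"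
  by (auto intro: powr_le_1)

lemma low_nth: "0 \<le> \<sigma> \<Longrightarrow> ell2_nth (low \<sigma> x) k = of_real (jb k powr - \<sigma>) * ell2_nth x k"
  unfolding low_def by (rule mult_op_nth[OF jb_powr_neg_le_1])

lemma bounded_linear_low: "0 \<le> \<sigma> \<Longrightarrow> bounded_linear (low \<sigma>)"
  unfolding low_def by (rule bounded_linear_mult_op[OF jb_powr_neg_le_1])

lemma low_eq_0D: "0 \<le> \<sigma> \<Longrightarrow> low \<sigma> x = 0 \<Longrightarrow> x = 0"
proof (rule ell2_eqI)
  fix k assume \<sigma>: "0 \<le> \<sigma>" and 0: "low \<sigma> x = 0"
  have "of_real (jb k powr - \<sigma>) * ell2_nth x k = 0" using low_nth[OF \<sigma>, of x k] 0 by simp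
  thus "ell2_nth x k = ell2_nth 0 k" by (simp add: order_less_imp_not_eq2)
qed

lemma ell2_product_nth:
  assumes \<sigma>: "1/2 < \<sigma>"
  shows "ell2_nth (ell2_product \<sigma> x y) k = of_real (jb k powr \<sigma>) * (\<Sum>\<^sub>\<infinity>j. ell2_nth (low \<sigma> x) (k - j) * ell2_nth (low \<sigma> y) j)"
proof -
  obtain C where C: "mat_bounded (\<lambda>k j. of_real (jb k powr \<sigma> * jb (k - j) powr - \<sigma> * jb j powr - \<sigma>) * ell2_nth x (k - j)) (C * norm x)"
    using ell2_product_matrix_bounded[OF \<sigma>] by blast
  have "ell2_nth (ell2_product \<sigma> x y) k = (\<Sum>\<^sub>\<infinity>j. of_real (jb k powr \<sigma>) * (ell2_nth (low \<sigma> x) (k - j) * ell2_nth (low \<sigma> y) j))"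
    unfolding ell2_product_def mat_op_nth[OF C] by (rule infsum_cong) (use \<sigma> in \<open>simp add: low_nth mult_ac\<close>)
  also have "\<dots> = of_real (jb k powr \<sigma>) * (\<Sum>\<^sub>\<infinity>j. ell2_nth (low \<sigma> x) (k - j) * ell2_nth (low \<sigma> y) j)"
    by (rule infsum_cmult_right')
  finally show ?thesis .
qed

lemma ell2_product_commute:
  assumes \<sigma>: "1/2 < \<sigma>"
  shows "ell2_product \<sigma> x y = ell2_product \<sigma> y x"
proof (rule ell2_eqI)
  fix k :: int
  have "bij (\<lambda>j. k - j)" by (rule bij_betw_byWitness[where f' = "\<lambda>j. k - j"]) auto
  hence "(\<Sum>\<^sub>\<infinity>j. ell2_nth (low \<sigma> x) (k - j) * ell2_nth (low \<sigma> y) j)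
      = (\<Sum>\<^sub>\<infinity>j. ell2_nth (low \<sigma> x) (k - (k - j)) * ell2_nth (low \<sigma> y) (k - j))"
    by (rule infsum_reindex_bij_betw[symmetric])
  thus "ell2_nth (ell2_product \<sigma> x y) k = ell2_nth (ell2_product \<sigma> y x) k"
    by (simp add: ell2_product_nth[OF \<sigma>] mult.commute)
qed

lemma low_ell2_product:
  assumes \<sigma>: "1/2 < \<sigma>" and C: "mat_bounded (\<lambda>k j. of_real (jb (k - j) powr - \<sigma>) * ell2_nth x (k - j)) C"
  shows "low \<sigma> (ell2_product \<sigma> x y) = mat_op (\<lambda>k j. of_real (jb (k - j) powr - \<sigma>) * ell2_nth x (k - j)) (low \<sigma> y)"
proof (rule ell2_eqI)
  fix k :: int
  have s0: "0 \<le> \<sigma>" using \<sigma> by simp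
  have "complex_of_real (jb k powr - \<sigma>) * of_real (jb k powr \<sigma>) = 1"
    by (simp only: of_real_mult[symmetric] jb_cancel of_real_1)
  thus "ell2_nth (low \<sigma> (ell2_product \<sigma> x y)) k = ell2_nth (mat_op (\<lambda>k j. of_real (jb (k - j) powr - \<sigma>) * ell2_nth x (k - j)) (low \<sigma> y)) k"
    by (simp add: low_nth[OF s0] ell2_product_nth[OF \<sigma>] mat_op_nth[OF C] flip: mult.assoc)
qed

text \<open>Besides the algebra property, products with one factor measured in L^2 are estimated.
  These bounds carry the energy argument for uniqueness.\<close>

lemma ell2_product_bounds:
  assumes \<sigma>: "1/2 < \<sigma>"
  shows "\<exists>C\<ge>0. \<forall>x y. norm (ell2_product \<sigma> x y) \<le> C * norm x * norm y \<and>
     norm (low \<sigma> (ell2_product \<sigma> x y)) \<le> C * norm x * norm (low \<sigma> y) \<and>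
     norm (low \<sigma> (ell2_product \<sigma> x y)) \<le> C * norm (low \<sigma> x) * norm y"
proof -
  obtain C where C0: "0 \<le> C"
    and C1: "\<And>x. mat_bounded (\<lambda>k j. of_real (jb k powr \<sigma> * jb (k - j) powr - \<sigma> * jb j powr - \<sigma>) * ell2_nth x (k - j)) (C * norm x)"
    and C2: "\<And>x. mat_bounded (\<lambda>k j. of_real (jb (k - j) powr - \<sigma>) * ell2_nth x (k - j)) (C * norm x)"
    using ell2_product_matrix_bounded[OF \<sigma>] by blast
  have 1: "norm (ell2_product \<sigma> x y) \<le> C * norm x * norm y" for x y
    unfolding ell2_product_def by (rule mat_op_norm_le[OF C1])
  have 2: "norm (low \<sigma> (ell2_product \<sigma> x y)) \<le> C * norm x * norm (low \<sigma> y)" for x y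
    unfolding low_ell2_product[OF \<sigma> C2] by (rule mat_op_norm_le[OF C2])
  have 3: "norm (low \<sigma> (ell2_product \<sigma> x y)) \<le> C * norm (low \<sigma> x) * norm y" for x y
    using 2[of y x] ell2_product_commute[OF \<sigma>, of x y] by (simp add: mult_ac)
  show ?thesis using C0 1 2 3 by blast
qed

lemma ell2_product_diff_right:
  assumes \<sigma>: "1/2 < \<sigma>"
  shows "ell2_product \<sigma> x (y - z) = ell2_product \<sigma> x y - ell2_product \<sigma> x z"
proof -
  obtain C where C: "mat_bounded (\<lambda>k j. of_real (jb k powr \<sigma> * jb (k - j) powr - \<sigma> * jb j powr - \<sigma>) * ell2_nth x (k - j)) (C * norm x)"
    using ell2_product_matrix_bounded[OF \<sigma>] by blast
  show ?thesis unfolding ell2_product_def by (rule linear_diff[OF bounded_linear.linear[OF bounded_linear_mat_op[OF C]]])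
qed

lemma ell2_product_diff_left:
  assumes \<sigma>: "1/2 < \<sigma>"
  shows "ell2_product \<sigma> (y - z) x = ell2_product \<sigma> y x - ell2_product \<sigma> z x"
  using ell2_product_diff_right[OF \<sigma>, of x y z] by (simp add: ell2_product_commute[OF \<sigma>, of _ x])

text \<open>Coordinates of the complex conjugate function.\<close>

definition star :: "int ell2 \<Rightarrow> int ell2" where
  "star x = to_ell2 (\<lambda>k. cnj (ell2_nth x (- k)))"

lemma star_nth: "ell2_nth (star x) k = cnj (ell2_nth x (- k))"
proof -
  have "(\<lambda>k. (norm (ell2_nth x (- k)))\<^sup>2) summable_on UNIV"
    using summable_on_reindex_bij_betw[of uminus UNIV UNIV "\<lambda>k. (norm (ell2_nth x k))\<^sup>2"] ell2_nth_summable[of x]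
    by (simp add: bij_uminus)
  thus ?thesis unfolding star_def by (subst ell2_nth_to_ell2) auto
qed

lemma norm_star [simp]: "norm (star x) = norm x"
proof -
  have "(norm (star x))\<^sup>2 = (norm x)\<^sup>2"
    unfolding norm_ell2_sq star_nth complex_mod_cnj
    using infsum_reindex_bij_betw[of uminus UNIV UNIV "\<lambda>k. (norm (ell2_nth x k))\<^sup>2"] by (simp add: bij_uminus)
  thus ?thesis by simp
qed

lemma star_diff: "star (x - y) = star x - star y"
  by (rule ell2_eqI) (simp add: star_nth)

lemma low_star: "0 \<le> \<sigma> \<Longrightarrow> low \<sigma> (star x) = star (low \<sigma> x)"
  by (rule ell2_eqI) (simp add: star_nth low_nth)

definition cubic :: "real \<Rightarrow> int ell2 \<Rightarrow> int ell2" where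
  "cubic \<sigma> z = ell2_product \<sigma> (ell2_product \<sigma> z (star z)) z"

text \<open>The first bound serves the construction of the flow. The second measures differences in
  L^2 while the solutions stay bounded in H^\<sigma>, as the uniqueness proof requires.\<close>

lemma cubic_lipschitz:
  assumes \<sigma>: "1/2 < \<sigma>"
  shows "\<exists>L\<ge>0. \<forall>x y. norm x \<le> R \<longrightarrow> norm y \<le> R \<longrightarrow>
      norm (cubic \<sigma> x - cubic \<sigma> y) \<le> L * norm (x - y) \<and>
      norm (low \<sigma> (cubic \<sigma> x - cubic \<sigma> y)) \<le> L * norm (low \<sigma> (x - y))"
proof -
  have s0: "0 \<le> \<sigma>" using \<sigma> by simp
  note low_lin = bounded_linear.linear[OF bounded_linear_low[OF s0]]
  obtain C where C0: "0 \<le> C" and C1: "\<And>x y. norm (ell2_product \<sigma> x y) \<le> C * norm x * norm y"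
    and C2: "\<And>x y. norm (low \<sigma> (ell2_product \<sigma> x y)) \<le> C * norm x * norm (low \<sigma> y)"
    and C3: "\<And>x y. norm (low \<sigma> (ell2_product \<sigma> x y)) \<le> C * norm (low \<sigma> x) * norm y"
    using ell2_product_bounds[OF \<sigma>] by blast
  have main: "norm (cubic \<sigma> x - cubic \<sigma> y) \<le> (3 * C\<^sup>2 * R\<^sup>2) * norm (x - y) \<and>
      norm (low \<sigma> (cubic \<sigma> x - cubic \<sigma> y)) \<le> (3 * C\<^sup>2 * R\<^sup>2) * norm (low \<sigma> (x - y))"
    if x: "norm x \<le> R" and y: "norm y \<le> R" for x y
  proof -
    have R: "0 \<le> R" using x norm_ge_zero order_trans by blast
    let ?p = "ell2_product \<sigma>"
    let ?d = "x - y"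
    \<comment> \<open>Telescoping: one factor is exchanged at a time, so each of the three terms
      contains the difference exactly once. Hence the constant 3 \<open>C\<^sup>2\<close>
      \<open>R\<^sup>2\<close>.\<close>
    have dec: "cubic \<sigma> x - cubic \<sigma> y = ?p (?p ?d (star x)) x + ?p (?p y (star ?d)) x + ?p (?p y (star y)) ?d"
      by (simp add: cubic_def ell2_product_diff_left[OF \<sigma>] ell2_product_diff_right[OF \<sigma>] star_diff)
    have tri: "norm (u + v + w) \<le> a + b + c" if "norm u \<le> a" "norm v \<le> b" "norm w \<le> c" for u v w :: "int ell2" and a b c
      using norm_triangle_ineq[of "u + v" w] norm_triangle_ineq[of u v] that by linarith
    have n1: "norm (?p (?p ?d (star x)) x) \<le> C * (C * norm ?d * R) * R"
      using C1[of "?p ?d (star x)" x] C1[of ?d "star x"] x R C0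
      by (intro order_trans[OF C1] mult_mono order_trans[OF C1[of ?d "star x"]]) auto
    have n2: "norm (?p (?p y (star ?d)) x) \<le> C * (C * R * norm ?d) * R"
      using x y R C0 by (intro order_trans[OF C1] mult_mono order_trans[OF C1[of y "star ?d"]]) auto
    have n3: "norm (?p (?p y (star y)) ?d) \<le> C * (C * R * R) * norm ?d"
      using x y R C0 by (intro order_trans[OF C1] mult_mono order_trans[OF C1[of y "star y"]]) auto
    have l1: "norm (low \<sigma> (?p (?p ?d (star x)) x)) \<le> C * (C * norm (low \<sigma> ?d) * R) * R"
      using x R C0 by (intro order_trans[OF C3] mult_mono order_trans[OF C3[of ?d "star x"]]) auto
    have l2: "norm (low \<sigma> (?p (?p y (star ?d)) x)) \<le> C * (C * R * norm (low \<sigma> ?d)) * R"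
      using x y R C0 C2[of y "star ?d"] by (intro order_trans[OF C3] mult_mono order_trans[OF C2[of y "star ?d"]]) (auto simp: low_star[OF s0])
    have l3: "norm (low \<sigma> (?p (?p y (star y)) ?d)) \<le> C * (C * R * R) * norm (low \<sigma> ?d)"
      using x y R C0 by (intro order_trans[OF C2] mult_mono order_trans[OF C1[of y "star y"]]) auto
    have "norm (cubic \<sigma> x - cubic \<sigma> y) \<le> C * (C * norm ?d * R) * R + C * (C * R * norm ?d) * R + C * (C * R * R) * norm ?d"
      unfolding dec by (rule tri[OF n1 n2 n3])
    moreover have "norm (low \<sigma> (cubic \<sigma> x - cubic \<sigma> y)) \<le> C * (C * norm (low \<sigma> ?d) * R) * R + C * (C * R * norm (low \<sigma> ?d)) * R + C * (C * R * R) * norm (low \<sigma> ?d)"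
      unfolding dec linear_add[OF low_lin] by (rule tri[OF l1 l2 l3])
    ultimately show ?thesis by (simp add: power2_eq_square algebra_simps)
  qed
  show ?thesis by (rule exI[of _ "3 * C\<^sup>2 * R\<^sup>2"]) (use main in auto)
qed

text \<open>Absolute convergence of the double series permits to exchange the summations.\<close>

lemma hermitian_form_real:
  fixes A :: "int \<Rightarrow> int \<Rightarrow> complex"
  assumes A: "mat_bounded A C" and herm: "\<And>k j. A j k = cnj (A k j)"
  shows "Re (\<i> * (\<Sum>\<^sub>\<infinity>k. cnj (ell2_nth x k) * ell2_nth (mat_op A x) k)) = 0"
proof -
  let ?f = "\<lambda>k j. cnj (ell2_nth x k) * (A k j * ell2_nth x j)"
  have "(\<lambda>z. norm (case z of (k, j) \<Rightarrow> ?f k j)) summable_on UNIV"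
  proof (rule nonneg_bounded_partial_sums_imp_summable_on)
    show "\<forall>\<^sub>F G in finite_subsets_at_top UNIV. (\<Sum>z\<in>G. norm (case z of (k, j) \<Rightarrow> ?f k j)) \<le> C * norm x * norm x"
    proof (rule eventually_finite_subsets_at_top_weakI)
      fix G :: "(int \<times> int) set" assume G: "finite G"
      let ?F = "fst ` G \<union> snd ` G"
      have F: "finite ?F" using G by simp
      have "(\<Sum>z\<in>G. norm (case z of (k, j) \<Rightarrow> ?f k j)) \<le> (\<Sum>z\<in>?F \<times> ?F. norm (case z of (k, j) \<Rightarrow> ?f k j))"
        by (rule sum_mono2) (use F in force)+
      also have "\<dots> = (\<Sum>k\<in>?F. \<Sum>j\<in>?F. norm (A k j) * norm (ell2_nth x j) * norm (ell2_nth x k))"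
        by (simp add: sum.cartesian_product norm_mult mult_ac case_prod_unfold)
      also have "\<dots> \<le> C * L2_set (\<lambda>j. norm (ell2_nth x j)) ?F * L2_set (\<lambda>j. norm (ell2_nth x j)) ?F"
        by (rule mat_boundedD[OF A F]) auto
      also have "\<dots> \<le> C * norm x * norm x"
        using mat_bounded_nonneg[OF A] by (intro mult_mono L2_set_le_norm_ell2 F) auto
      finally show "(\<Sum>z\<in>G. norm (case z of (k, j) \<Rightarrow> ?f k j)) \<le> C * norm x * norm x" .
    qed
  qed auto
  hence "(\<lambda>(k, j). ?f k j) summable_on UNIV \<times> UNIV"
    by (simp add: abs_summable_summable)
  hence swap: "(\<Sum>\<^sub>\<infinity>k. \<Sum>\<^sub>\<infinity>j. ?f k j) = (\<Sum>\<^sub>\<infinity>j. \<Sum>\<^sub>\<infinity>k. ?f k j)" by (rule infsum_swap_banach)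
  define S where "S = (\<Sum>\<^sub>\<infinity>k. cnj (ell2_nth x k) * ell2_nth (mat_op A x) k)"
  have S: "S = (\<Sum>\<^sub>\<infinity>k. \<Sum>\<^sub>\<infinity>j. ?f k j)"
    unfolding S_def mat_op_nth[OF A] by (simp add: infsum_cmult_right')
  have "cnj S = (\<Sum>\<^sub>\<infinity>k. \<Sum>\<^sub>\<infinity>j. cnj (?f k j))" unfolding S by (simp only: infsum_cnj)
  also have "\<dots> = (\<Sum>\<^sub>\<infinity>k. \<Sum>\<^sub>\<infinity>j. ?f j k)"
    by (intro infsum_cong) (simp add: herm[symmetric] mult_ac)
  also have "\<dots> = S" unfolding S by (rule swap[symmetric])
  finally have "Im S = 0" by (simp add: complex_eq_iff)
  thus ?thesis by (simp add: S_def[symmetric])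
qed

section \<open>The equation in weighted coordinates: linear estimates and uniqueness\<close>

locale potential =
  fixes \<xi> :: "int \<Rightarrow> complex" and \<tau> C0 lam :: real
  assumes X: "l2_bounded (\<lambda>m. jb m powr \<tau> * norm (\<xi> m))" and \<tau>: "- 1/2 < \<tau>"
    and C0: "\<And>m. norm (\<xi> m) \<le> C0" and herm: "\<And>m. \<xi> (- m) = cnj (\<xi> m)"
begin

text \<open>The k-th Fourier coefficient of \<xi> u, where \<open>z\<close> holds the coordinates of
  u at level \<tau> + 2.\<close>

definition conv :: "int ell2 \<Rightarrow> int \<Rightarrow> complex" where
  "conv z k = (\<Sum>\<^sub>\<infinity>j. \<xi> (k - j) * (of_real (jb j powr - (\<tau> + 2)) * ell2_nth z j))"

definition pot_mode :: "int \<Rightarrow> int ell2 \<Rightarrow> complex" where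
  "pot_mode k z = of_real (jb k powr (\<tau> + 2)) * conv z k"

definition nonlin :: "int ell2 \<Rightarrow> int ell2" where
  "nonlin z = (- lam) *\<^sub>R ii (cubic (\<tau> + 2) z)"

text \<open>Multiplication by \<xi> from level \<tau> + 2 to level \<tau>. Its boundedness makes the
  series in \<open>conv\<close> converge and shows that each mode depends continuously on
  \<open>z\<close>.\<close>

definition pot_mat :: "int \<Rightarrow> int \<Rightarrow> complex" where
  "pot_mat k j = of_real (jb k powr \<tau> * jb j powr - (\<tau> + 2)) * \<xi> (k - j)"

lemma sigma: "1/2 < \<tau> + 2" "0 \<le> \<tau> + 2" using \<tau> by auto

lemma pot_mat_bounded: "\<exists>C. mat_bounded pot_mat C"
proof -
  from mult_ker_bounded[OF X \<tau>, of "\<tau> + 2"] \<tau> obtain C where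
    C: "mat_bounded (\<lambda>k j. of_real (jb (k - j) powr \<tau> * norm (\<xi> (k - j)) * (jb k powr \<tau> * jb (k - j) powr - \<tau> * jb j powr - (\<tau> + 2)))) C"
    unfolding ker_bounded_def by auto
  have "mat_bounded pot_mat C"
  proof (rule mat_bounded_mono[OF C])
    fix k j
    have nn: "0 \<le> jb (k - j) powr \<tau> * norm (\<xi> (k - j)) * (jb k powr \<tau> * jb (k - j) powr - \<tau> * jb j powr - (\<tau> + 2))" by simp
    have "jb (k - j) powr \<tau> * norm (\<xi> (k - j)) * (jb k powr \<tau> * jb (k - j) powr - \<tau> * jb j powr - (\<tau> + 2))
      = (jb (k - j) powr \<tau> * jb (k - j) powr - \<tau>) * (jb k powr \<tau> * jb j powr - (\<tau> + 2)) * norm (\<xi> (k - j))"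
      by (simp only: mult_ac)
    also have "\<dots> = jb k powr \<tau> * jb j powr - (\<tau> + 2) * norm (\<xi> (k - j))" by (simp only: jb_cancel mult_1)
    finally have e: "jb (k - j) powr \<tau> * norm (\<xi> (k - j)) * (jb k powr \<tau> * jb (k - j) powr - \<tau> * jb j powr - (\<tau> + 2))
      = jb k powr \<tau> * jb j powr - (\<tau> + 2) * norm (\<xi> (k - j))" .
    show "norm (pot_mat k j) \<le> norm (complex_of_real (jb (k - j) powr \<tau> * norm (\<xi> (k - j)) * (jb k powr \<tau> * jb (k - j) powr - \<tau> * jb j powr - (\<tau> + 2))))"
      unfolding norm_of_real abs_of_nonneg[OF nn] unfolding e pot_mat_def norm_mult norm_of_real by (simp add: abs_mult)
  qed
  thus ?thesis by blast
qed

lemma pot_mat_nth: "ell2_nth (mat_op pot_mat z) k = of_real (jb k powr \<tau>) * conv z k"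
proof -
  obtain C where C: "mat_bounded pot_mat C" using pot_mat_bounded by blast
  have "ell2_nth (mat_op pot_mat z) k = (\<Sum>\<^sub>\<infinity>j. of_real (jb k powr \<tau>) * (\<xi> (k - j) * (of_real (jb j powr - (\<tau> + 2)) * ell2_nth z j)))"
    unfolding mat_op_nth[OF C] by (rule infsum_cong) (simp add: pot_mat_def mult_ac)
  thus ?thesis by (simp add: conv_def infsum_cmult_right')
qed

lemma conv_conv: "conv z k = of_real (jb k powr - \<tau>) * ell2_nth (mat_op pot_mat z) k"
proof -
  have "complex_of_real (jb k powr - \<tau>) * of_real (jb k powr \<tau>) = 1"
    by (simp only: of_real_mult[symmetric] jb_cancel of_real_1)
  thus ?thesis by (simp add: pot_mat_nth flip: mult.assoc)
qed

lemma bounded_linear_mat_pot: "bounded_linear (mat_op pot_mat)"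
  using pot_mat_bounded bounded_linear_mat_op by blast

lemma bounded_linear_conv: "bounded_linear (\<lambda>z. conv z k)"
  unfolding conv_conv
  by (rule bounded_linear_compose[OF bounded_linear_mult_right bounded_linear_compose[OF bounded_linear_ell2_nth bounded_linear_mat_pot]])

lemma bounded_linear_pot_mode: "bounded_linear (pot_mode k)"
  unfolding pot_mode_def[abs_def] by (rule bounded_linear_compose[OF bounded_linear_mult_right bounded_linear_conv])

lemma ii_norm: "norm (ii x) = norm (x :: int ell2)"
proof -
  have "(norm (ii x))\<^sup>2 = (norm x)\<^sup>2" by (simp add: norm_ell2_sq norm_mult)
  thus ?thesis by simp
qed

lemma nonlin_lipschitz:
  "\<exists>L\<ge>0. \<forall>x y. norm x \<le> R \<longrightarrow> norm y \<le> R \<longrightarrow>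
      norm (nonlin x - nonlin y) \<le> L * norm (x - y) \<and>
      norm (low (\<tau> + 2) (nonlin x - nonlin y)) \<le> L * norm (low (\<tau> + 2) (x - y))"
proof -
  obtain L where L: "0 \<le> L" "\<And>x y. norm x \<le> R \<Longrightarrow> norm y \<le> R \<Longrightarrow>
      norm (cubic (\<tau> + 2) x - cubic (\<tau> + 2) y) \<le> L * norm (x - y)"
      "\<And>x y. norm x \<le> R \<Longrightarrow> norm y \<le> R \<Longrightarrow>
      norm (low (\<tau> + 2) (cubic (\<tau> + 2) x - cubic (\<tau> + 2) y)) \<le> L * norm (low (\<tau> + 2) (x - y))"
    using cubic_lipschitz[OF sigma(1), of R] by blast
  have d: "nonlin x - nonlin y = (- lam) *\<^sub>R ii (cubic (\<tau> + 2) x - cubic (\<tau> + 2) y)" for x y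
    by (rule ell2_eqI) (simp add: nonlin_def algebra_simps)
  have lo: "low (\<tau> + 2) (nonlin x - nonlin y) = (- lam) *\<^sub>R ii (low (\<tau> + 2) (cubic (\<tau> + 2) x - cubic (\<tau> + 2) y))" for x y
    unfolding d by (rule ell2_eqI) (simp add: low_nth[OF sigma(2)] algebra_simps)
  have "norm (nonlin x - nonlin y) \<le> (\<bar>lam\<bar> * L) * norm (x - y) \<and>
      norm (low (\<tau> + 2) (nonlin x - nonlin y)) \<le> (\<bar>lam\<bar> * L) * norm (low (\<tau> + 2) (x - y))"
    if "norm x \<le> R" "norm y \<le> R" for x y
    unfolding lo unfolding d using mult_left_mono[OF L(2)[OF that], of "\<bar>lam\<bar>"] mult_left_mono[OF L(3)[OF that], of "\<bar>lam\<bar>"]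
    by (simp add: ii_norm mult.assoc)
  thus ?thesis using L(1) by (intro exI[of _ "\<bar>lam\<bar> * L"]) auto
qed

text \<open>Symmetric weights on both sides turn the potential into a matrix that is hermitian
  because \<xi> is real. It is bounded since - (\<tau> + 2) \<le> \<tau>, which allows a comparison
  with \<open>pot_mat\<close>.\<close>

lemma potential_form_real:
  "Re (\<i> * (\<Sum>\<^sub>\<infinity>k. cnj (ell2_nth (low (\<tau> + 2) v) k) * conv v k)) = 0"
proof -
  define A where "A k j = of_real (jb k powr - (\<tau> + 2)) * of_real (jb j powr - (\<tau> + 2)) * \<xi> (k - j)" for k j
  obtain C where C: "mat_bounded pot_mat C" using pot_mat_bounded by blast
  have A: "mat_bounded A C"
  proof (rule mat_bounded_mono[OF C])
    fix k j
    have "jb k powr - (\<tau> + 2) \<le> jb k powr \<tau>" by (rule jb_powr_mono) (use \<tau> in auto)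
    thus "norm (A k j) \<le> norm (pot_mat k j)"
      by (simp add: A_def pot_mat_def norm_mult mult_right_mono)
  qed
  have hermA: "A j k = cnj (A k j)" for k j using herm[of "k - j"] by (simp add: A_def mult_ac)
  have "Re (\<i> * (\<Sum>\<^sub>\<infinity>k. cnj (ell2_nth v k) * ell2_nth (mat_op A v) k)) = 0"
    by (rule hermitian_form_real[OF A hermA])
  moreover have "cnj (ell2_nth v k) * ell2_nth (mat_op A v) k = cnj (ell2_nth (low (\<tau> + 2) v) k) * conv v k" for k
  proof -
    have "ell2_nth (mat_op A v) k = (\<Sum>\<^sub>\<infinity>j. of_real (jb k powr - (\<tau> + 2)) * (\<xi> (k - j) * (of_real (jb j powr - (\<tau> + 2)) * ell2_nth v j)))"
      unfolding mat_op_nth[OF A] by (rule infsum_cong) (simp add: A_def mult_ac)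
    also have "\<dots> = of_real (jb k powr - (\<tau> + 2)) * conv v k" by (simp add: conv_def infsum_cmult_right')
    finally show ?thesis by (simp add: low_nth[OF sigma(2)] mult_ac)
  qed
  ultimately show ?thesis by simp
qed

text \<open>The pairing of u in H^(\<tau> + 2) with \<xi> u in H^\<tau> converges absolutely,
  because the two levels have nonnegative sum.\<close>

lemma form_bound:
  assumes F: "finite F"
  shows "(\<Sum>k\<in>F. norm (ell2_nth (low (\<tau> + 2) v) k) * norm (conv v k)) \<le> norm v * norm (mat_op pot_mat v)"
proof -
  have "(\<Sum>k\<in>F. norm (ell2_nth (low (\<tau> + 2) v) k) * norm (conv v k))
     \<le> (\<Sum>k\<in>F. \<bar>norm (ell2_nth v k)\<bar> * \<bar>norm (ell2_nth (mat_op pot_mat v) k)\<bar>)"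
  proof (rule sum_mono)
    fix k
    have "jb k powr - (\<tau> + 2) * jb k powr - \<tau> \<le> 1"
      unfolding powr_add[symmetric] by (rule powr_le_1) (use \<tau> in auto)
    hence "(jb k powr - (\<tau> + 2) * jb k powr - \<tau>) * (norm (ell2_nth v k) * norm (ell2_nth (mat_op pot_mat v) k))
      \<le> 1 * (norm (ell2_nth v k) * norm (ell2_nth (mat_op pot_mat v) k))"
      by (intro mult_right_mono) auto
    thus "norm (ell2_nth (low (\<tau> + 2) v) k) * norm (conv v k) \<le> \<bar>norm (ell2_nth v k)\<bar> * \<bar>norm (ell2_nth (mat_op pot_mat v) k)\<bar>"
      by (simp add: low_nth[OF sigma(2)] conv_conv norm_mult mult_ac)
  qed
  also have "\<dots> \<le> L2_set (\<lambda>k. norm (ell2_nth v k)) F * L2_set (\<lambda>k. norm (ell2_nth (mat_op pot_mat v) k)) F"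
    by (rule L2_set_mult_ineq)
  also have "\<dots> \<le> norm v * norm (mat_op pot_mat v)"
    by (intro mult_mono L2_set_le_norm_ell2 F) auto
  finally show ?thesis .
qed

lemma form_summable: "(\<lambda>k. cnj (ell2_nth (low (\<tau> + 2) v) k) * conv v k) summable_on UNIV"
  by (rule abs_summable_summable, rule nonneg_bounded_partial_sums_imp_summable_on[of _ _ "norm v * norm (mat_op pot_mat v)"])
     (auto simp: norm_mult intro!: eventually_finite_subsets_at_top_weakI form_bound)

lemma square_integral:
  fixes f :: "real \<Rightarrow> complex"
  assumes g: "continuous_on {0..T} g" and T: "0 \<le> T"
    and f: "\<And>t. t \<in> {0..T} \<Longrightarrow> f t = integral {0..t} g"
  shows "((\<lambda>t. 2 * Re (cnj (f t) * g t)) has_integral (norm (f T))\<^sup>2) {0..T}"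
proof -
  let ?F = "\<lambda>t. integral {0..t} g"
  have dF: "(?F has_vector_derivative g t) (at t within {0..T})" if "t \<in> {0..T}" for t
    by (rule integral_has_vector_derivative[OF g that])
  have d: "((\<lambda>t. cnj (?F t) * ?F t) has_vector_derivative (cnj (f t) * g t + cnj (g t) * f t)) (at t within {0..T})" if "t \<in> {0..T}" for t
    using has_vector_derivative_mult[OF bounded_linear.has_vector_derivative[OF bounded_linear_cnj dF[OF that]] dF[OF that]] f[OF that] by simp
  have "((\<lambda>t. cnj (f t) * g t + cnj (g t) * f t) has_integral cnj (?F T) * ?F T - cnj (?F 0) * ?F 0) {0..T}"
    by (rule fundamental_theorem_of_calculus[OF T d])
  from has_integral_linear[OF this bounded_linear_Re]
  have "((\<lambda>t. Re (cnj (f t) * g t + cnj (g t) * f t)) has_integral Re (cnj (f T) * f T)) {0..T}"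
    using f[of T] T by (simp add: o_def)
  moreover have "Re (cnj a * b + cnj b * a) = 2 * Re (cnj a * b)" for a b by simp
  moreover have "Re (cnj a * a) = (norm a)\<^sup>2" for a
    unfolding cmod_power2 by (simp add: power2_eq_square)
  ultimately show ?thesis by simp
qed

text \<open>In the energy identity for the \<open>L\<^sup>2\<close> norm of the difference the potential drops out, its
  quadratic form being real.\<close>

theorem mode_solution_unique:
  assumes T: "0 \<le> T" and z: "mode_solution pot_mode nonlin z0 {0..T} z"
    and w: "mode_solution pot_mode nonlin z0 {0..T} w"
  shows "z T = w T"
proof -
  let ?\<sigma> = "\<tau> + 2"
  note low_bl = bounded_linear_low[OF sigma(2)]
  define v where "v t = z t - w t" for t
  define n where "n t = nonlin (z t) - nonlin (w t)" for t
  have zc: "continuous_on {0..T} z" and wc: "continuous_on {0..T} w" using z w by (auto simp: mode_solution_def)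
  have vc: "continuous_on {0..T} v" unfolding v_def by (intro continuous_intros zc wc)
  obtain M where M: "\<And>t. t \<in> {0..T} \<Longrightarrow> norm (z t) \<le> M" "\<And>t. t \<in> {0..T} \<Longrightarrow> norm (w t) \<le> M" "0 \<le> M"
  proof -
    have "bounded (z ` {0..T})" "bounded (w ` {0..T})"
      using compact_imp_bounded[OF compact_continuous_image[OF zc compact_Icc]]
        compact_imp_bounded[OF compact_continuous_image[OF wc compact_Icc]] by auto
    then obtain a b where "\<forall>x\<in>z ` {0..T}. norm x \<le> a" "\<forall>x\<in>w ` {0..T}. norm x \<le> b"
      unfolding bounded_iff by (elim exE)
    hence a: "norm (z t) \<le> a" and b: "norm (w t) \<le> b" if "t \<in> {0..T}" for t
      using that by auto
    show thesis
    proof (rule that[of "\<bar>a\<bar> + \<bar>b\<bar>"])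
      show "norm (z t) \<le> \<bar>a\<bar> + \<bar>b\<bar>" "norm (w t) \<le> \<bar>a\<bar> + \<bar>b\<bar>" if "t \<in> {0..T}" for t
        using a[OF that] b[OF that] by linarith+
    qed simp
  qed
  obtain L where L: "0 \<le> L" "\<And>x y. norm x \<le> M \<Longrightarrow> norm y \<le> M \<Longrightarrow> norm (nonlin x - nonlin y) \<le> L * norm (x - y)"
    "\<And>x y. norm x \<le> M \<Longrightarrow> norm y \<le> M \<Longrightarrow> norm (low ?\<sigma> (nonlin x - nonlin y)) \<le> L * norm (low ?\<sigma> (x - y))"
    using nonlin_lipschitz[of M] by blast
  have Nc: "continuous_on {0..T} (\<lambda>t. nonlin (u t))" if u: "continuous_on {0..T} u" "\<And>t. t \<in> {0..T} \<Longrightarrow> norm (u t) \<le> M" for u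
  proof -
    have "L-lipschitz_on {x. norm x \<le> M} nonlin"
      by (rule lipschitz_onI) (use L(1,2) in \<open>auto simp: dist_norm\<close>)
    hence "continuous_on {x. norm x \<le> M} nonlin" by (rule lipschitz_on_continuous_on)
    thus ?thesis by (rule continuous_on_compose2[OF _ u(1)]) (use u(2) in auto)
  qed
  have nc: "continuous_on {0..T} n" unfolding n_def by (intro continuous_intros Nc zc wc M)
  \<comment> \<open>Fourier coefficients of the difference of the two solutions, with
    \<open>g\<close> as their time derivative.\<close>
  define e where "e k t = ell2_nth (low ?\<sigma> (v t)) k" for k t
  define g where "g k t = \<i> * (- of_real ((of_int k)\<^sup>2) * e k t + conv (v t) k) + ell2_nth (low ?\<sigma> (n t)) k" for k t
  have ec: "continuous_on {0..T} (e k)" for k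
    unfolding e_def by (rule bounded_linear.continuous_on[OF bounded_linear_ell2_nth bounded_linear.continuous_on[OF low_bl vc]])
  have gc: "continuous_on {0..T} (g k)" for k
    unfolding g_def
    by (intro continuous_intros ec bounded_linear.continuous_on[OF bounded_linear_conv vc]
          bounded_linear.continuous_on[OF bounded_linear_ell2_nth bounded_linear.continuous_on[OF low_bl nc]])
  have eg: "e k t = integral {0..t} (g k)" if t: "t \<in> {0..T}" for k t
  proof -
    have sub: "{0..t} \<subseteq> {0..T}" using t by auto
    let ?h = "\<lambda>u \<rho>. \<i> * (- of_real ((of_int k)\<^sup>2) * ell2_nth (u \<rho>) k + pot_mode k (u \<rho>)) + ell2_nth (nonlin (u \<rho>)) k"
    have hc: "?h u integrable_on {0..t}" if u: "continuous_on {0..T} u" "\<And>t. t \<in> {0..T} \<Longrightarrow> norm (u t) \<le> M" for u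
      by (rule integrable_continuous_real, rule continuous_on_subset[OF _ sub])
         (intro continuous_intros bounded_linear.continuous_on[OF bounded_linear_pot_mode u(1)]
          bounded_linear.continuous_on[OF bounded_linear_ell2_nth u(1)] bounded_linear.continuous_on[OF bounded_linear_ell2_nth Nc[OF u]])
    have "ell2_nth (v t) k = integral {0..t} (?h z) - integral {0..t} (?h w)"
      using z w t by (simp add: v_def mode_solution_def)
    also have "\<dots> = integral {0..t} (\<lambda>\<rho>. ?h z \<rho> - ?h w \<rho>)"
      by (rule integral_diff[symmetric]; rule hc) (use zc wc M in auto)
    finally have "e k t = of_real (jb k powr - ?\<sigma>) * integral {0..t} (\<lambda>\<rho>. ?h z \<rho> - ?h w \<rho>)"
      by (simp add: e_def low_nth[OF sigma(2)])
    also have "\<dots> = integral {0..t} (\<lambda>\<rho>. of_real (jb k powr - ?\<sigma>) * (?h z \<rho> - ?h w \<rho>))"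
      by (rule integral_mult_right[symmetric])
    also have "\<dots> = integral {0..t} (g k)"
    proof (rule integral_cong)
      fix \<rho>
      have pm: "of_real (jb k powr - ?\<sigma>) * (pot_mode k (z \<rho>) - pot_mode k (w \<rho>)) = conv (v \<rho>) k"
      proof -
        have "complex_of_real (jb k powr - ?\<sigma>) * of_real (jb k powr ?\<sigma>) = 1"
          by (simp only: of_real_mult[symmetric] jb_cancel of_real_1)
        hence "of_real (jb k powr - ?\<sigma>) * pot_mode k (v \<rho>) = conv (v \<rho>) k"
          by (simp add: pot_mode_def flip: mult.assoc)
        thus ?thesis by (simp add: v_def linear_diff[OF bounded_linear.linear[OF bounded_linear_pot_mode]])
      qed
      have "of_real (jb k powr - ?\<sigma>) * (?h z \<rho> - ?h w \<rho>)
        = \<i> * (- of_real ((of_int k)\<^sup>2) * (of_real (jb k powr - ?\<sigma>) * ell2_nth (v \<rho>) k) + of_real (jb k powr - ?\<sigma>) * (pot_mode k (z \<rho>) - pot_mode k (w \<rho>)))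
          + of_real (jb k powr - ?\<sigma>) * ell2_nth (n \<rho>) k"
        by (simp add: v_def n_def algebra_simps)
      thus "of_real (jb k powr - ?\<sigma>) * (?h z \<rho> - ?h w \<rho>) = g k \<rho>"
        unfolding pm by (simp add: g_def e_def low_nth[OF sigma(2)])
    qed
    finally show ?thesis .
  qed
  \<comment> \<open>The time derivative of the energy in the modes up to \<open>m\<close>. The term
    with k^2 is already dropped, being imaginary in each mode.\<close>
  define f where "f m t = 2 * Re (\<Sum>k\<in>{- int m..int m}. cnj (e k t) * (\<i> * conv (v t) k + ell2_nth (low ?\<sigma> (n t)) k))" for m t
  obtain Mb where Mb: "0 \<le> Mb" "\<And>x. norm (mat_op pot_mat x) \<le> norm x * Mb"
    using bounded_linear.nonneg_bounded[OF bounded_linear_mat_pot] by blast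
  have low_le: "norm (low ?\<sigma> x) \<le> norm x" for x
  proof -
    have "norm (mult_op (\<lambda>k. complex_of_real (jb k powr - ?\<sigma>)) x) \<le> 1 * norm x"
      by (rule mult_op_norm_le[OF jb_powr_neg_le_1[OF sigma(2)]])
    thus ?thesis by (simp only: low_def mult_1)
  qed
  have v_le: "norm (v t) \<le> 2 * M" if "t \<in> {0..T}" for t
    using M(1,2)[OF that] norm_triangle_ineq4[of "z t" "w t"] by (simp add: v_def)
  have n_le: "norm (low ?\<sigma> (n t)) \<le> L * norm (low ?\<sigma> (v t))" if "t \<in> {0..T}" for t
    unfolding n_def v_def by (rule L(3)) (use M that in auto)
  define H where "H = 2 * ((2 * M) * (2 * M * Mb) + (2 * M) * (L * (2 * M)))"
  have f_le: "norm (f m t) \<le> H" if t: "t \<in> {0..T}" for m t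
  proof -
    let ?F = "{- int m..int m}"
    have "norm (f m t) \<le> 2 * norm (\<Sum>k\<in>?F. cnj (e k t) * (\<i> * conv (v t) k + ell2_nth (low ?\<sigma> (n t)) k))"
    proof -
      have "\<bar>2 * Re S\<bar> \<le> 2 * norm S" for S using abs_Re_le_cmod[of S] by simp
      thus ?thesis unfolding f_def real_norm_def .
    qed
    also have "norm (\<Sum>k\<in>?F. cnj (e k t) * (\<i> * conv (v t) k + ell2_nth (low ?\<sigma> (n t)) k))
      \<le> (\<Sum>k\<in>?F. norm (e k t) * norm (conv (v t) k) + norm (e k t) * norm (ell2_nth (low ?\<sigma> (n t)) k))"
    proof (rule order_trans[OF norm_sum sum_mono])
      fix k
      have "norm (\<i> * conv (v t) k + ell2_nth (low ?\<sigma> (n t)) k) \<le> norm (conv (v t) k) + norm (ell2_nth (low ?\<sigma> (n t)) k)"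
        using norm_triangle_ineq[of "\<i> * conv (v t) k"] by (simp add: norm_mult)
      from mult_left_mono[OF this norm_ge_zero[of "e k t"]]
      have "norm (e k t) * norm (\<i> * conv (v t) k + ell2_nth (low ?\<sigma> (n t)) k) \<le> norm (e k t) * norm (conv (v t) k) + norm (e k t) * norm (ell2_nth (low ?\<sigma> (n t)) k)"
        by (simp only: distrib_left)
      thus "norm (cnj (e k t) * (\<i> * conv (v t) k + ell2_nth (low ?\<sigma> (n t)) k)) \<le> norm (e k t) * norm (conv (v t) k) + norm (e k t) * norm (ell2_nth (low ?\<sigma> (n t)) k)"
        by (simp only: norm_mult complex_mod_cnj)
    qed
    also have "\<dots> \<le> (2 * M) * (2 * M * Mb) + (2 * M) * (L * (2 * M))"
      unfolding sum.distrib
    proof (rule add_mono)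
      have "(\<Sum>k\<in>?F. norm (e k t) * norm (conv (v t) k)) \<le> norm (v t) * norm (mat_op pot_mat (v t))"
        unfolding e_def by (rule form_bound) simp
      also have "\<dots> \<le> (2 * M) * (2 * M * Mb)"
        using Mb v_le[OF t] M(3) by (intro mult_mono order_trans[OF Mb(2)] mult_right_mono) auto
      finally show "(\<Sum>k\<in>?F. norm (e k t) * norm (conv (v t) k)) \<le> (2 * M) * (2 * M * Mb)" .
      have "(\<Sum>k\<in>?F. norm (e k t) * norm (ell2_nth (low ?\<sigma> (n t)) k)) = (\<Sum>k\<in>?F. \<bar>norm (e k t)\<bar> * \<bar>norm (ell2_nth (low ?\<sigma> (n t)) k)\<bar>)" by simp
      also have "\<dots> \<le> L2_set (\<lambda>k. norm (e k t)) ?F * L2_set (\<lambda>k. norm (ell2_nth (low ?\<sigma> (n t)) k)) ?F"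
        by (rule L2_set_mult_ineq)
      also have "\<dots> \<le> norm (low ?\<sigma> (v t)) * norm (low ?\<sigma> (n t))"
        unfolding e_def by (intro mult_mono L2_set_le_norm_ell2) auto
      also have "\<dots> \<le> (2 * M) * (L * (2 * M))"
      proof (rule mult_mono)
        show 1: "norm (low ?\<sigma> (v t)) \<le> 2 * M" using low_le[of "v t"] v_le[OF t] by linarith
        show "norm (low ?\<sigma> (n t)) \<le> L * (2 * M)" using n_le[OF t] mult_left_mono[OF 1 L(1)] by linarith
      qed (use M(3) in auto)
      finally show "(\<Sum>k\<in>?F. norm (e k t) * norm (ell2_nth (low ?\<sigma> (n t)) k)) \<le> (2 * M) * (L * (2 * M))" .
    qed
    finally show ?thesis by (simp add: H_def)
  qed
  define F where "F t = 2 * inner (low ?\<sigma> (v t)) (low ?\<sigma> (n t))" for t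
  \<comment> \<open>The truncated potential term need not vanish, as the sum over j is not truncated
    with k. Only the full form is real, so the potential disappears in the limit, and the uniform
    bound \<open>H\<close> lets the limit pass through the time integral.\<close>
  have f_lim: "(\<lambda>m. f m t) \<longlonglongrightarrow> F t" for t
  proof -
    let ?a = "\<lambda>k. \<i> * (cnj (e k t) * conv (v t) k)" and ?b = "\<lambda>k. cnj (e k t) * ell2_nth (low ?\<sigma> (n t)) k"
    have s1: "?a summable_on UNIV" unfolding e_def by (intro summable_on_cmult_right form_summable)
    have s2: "?b summable_on UNIV" unfolding e_def by (rule ell2_mult_summable)
    have "(\<lambda>m. \<Sum>k\<in>{- int m..int m}. ?a k + ?b k) \<longlonglongrightarrow> (\<Sum>\<^sub>\<infinity>k. ?a k + ?b k)"
      by (rule filterlim_compose[OF infsum_tendsto[OF summable_on_add[OF s1 s2]] filterlim_int_intervals])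
    hence "(\<lambda>m. 2 * Re (\<Sum>k\<in>{- int m..int m}. ?a k + ?b k)) \<longlonglongrightarrow> 2 * Re (\<Sum>\<^sub>\<infinity>k. ?a k + ?b k)"
      by (intro tendsto_intros)
    moreover have "(\<Sum>k\<in>{- int m..int m}. ?a k + ?b k) = (\<Sum>k\<in>{- int m..int m}. cnj (e k t) * (\<i> * conv (v t) k + ell2_nth (low ?\<sigma> (n t)) k))" for m
      by (simp add: algebra_simps)
    moreover have "2 * Re (\<Sum>\<^sub>\<infinity>k. ?a k + ?b k) = F t"
    proof -
      have "(\<Sum>\<^sub>\<infinity>k. ?a k + ?b k) = \<i> * (\<Sum>\<^sub>\<infinity>k. cnj (e k t) * conv (v t) k) + (\<Sum>\<^sub>\<infinity>k. ?b k)"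
        by (simp only: infsum_add[OF s1 s2] infsum_cmult_right')
      thus ?thesis using potential_form_real[of "v t"] unfolding F_def inner_ell2.rep_eq e_def by simp
    qed
    ultimately show ?thesis by (simp add: f_def)
  qed
  have energy: "(norm (low ?\<sigma> (v t)))\<^sup>2 = integral {0..t} F" if t: "t \<in> {0..T}" for t
  proof -
    have sub: "{0..t} \<subseteq> {0..T}" and t0: "0 \<le> t" using t by auto
    have fi: "(f m has_integral (\<Sum>k\<in>{- int m..int m}. (norm (e k t))\<^sup>2)) {0..t}" for m
    proof -
      have "((\<lambda>r. \<Sum>k\<in>{- int m..int m}. 2 * Re (cnj (e k r) * g k r)) has_integral (\<Sum>k\<in>{- int m..int m}. (norm (e k t))\<^sup>2)) {0..t}"
        by (rule has_integral_sum, simp, rule square_integral[OF continuous_on_subset[OF gc sub] t0 eg]) (use sub in auto)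
      moreover have reid: "Re (cnj (e k r) * g k r) = Re (cnj (e k r) * (\<i> * conv (v r) k + ell2_nth (low ?\<sigma> (n r)) k))" for k r
      proof -
        have "cnj (e k r) * g k r = - \<i> * of_real ((of_int k)\<^sup>2) * (cnj (e k r) * e k r) + cnj (e k r) * (\<i> * conv (v r) k + ell2_nth (low ?\<sigma> (n r)) k)"
          by (simp add: g_def algebra_simps)
        moreover have "cnj (e k r) * e k r = of_real ((norm (e k r))\<^sup>2)"
          by (subst mult.commute) (rule complex_norm_square[symmetric])
        ultimately show ?thesis by simp
      qed
      have "(\<lambda>r. \<Sum>k\<in>{- int m..int m}. 2 * Re (cnj (e k r) * g k r)) = f m"
        by (rule ext) (simp only: f_def Re_sum sum_distrib_left reid)
      ultimately show ?thesis by (simp only:)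
    qed
    have "(\<lambda>m. integral {0..t} (f m)) \<longlonglongrightarrow> integral {0..t} F"
    proof (rule dominated_convergence(2))
      show "f m integrable_on {0..t}" for m by (rule has_integral_integrable[OF fi])
      show "(\<lambda>_. H) integrable_on {0..t}" by (rule integrable_continuous_real) simp
      show "norm (f m r) \<le> H" if "r \<in> {0..t}" for m r using f_le that sub by blast
      show "(\<lambda>m. f m r) \<longlonglongrightarrow> F r" for r by (rule f_lim)
    qed
    moreover have "(\<lambda>m. integral {0..t} (f m)) \<longlonglongrightarrow> (norm (low ?\<sigma> (v t)))\<^sup>2"
      unfolding integral_unique[OF fi] norm_ell2_sq e_def
      by (rule filterlim_compose[OF infsum_tendsto[OF ell2_nth_summable] filterlim_int_intervals])
    ultimately show ?thesis by (rule LIMSEQ_unique[symmetric])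
  qed
  have lvc: "continuous_on {0..T} (\<lambda>t. low ?\<sigma> (v t))" and lnc: "continuous_on {0..T} (\<lambda>t. low ?\<sigma> (n t))"
    by (rule bounded_linear.continuous_on[OF low_bl]; fact)+
  have "(norm (low ?\<sigma> (v T)))\<^sup>2 \<le> 0 * exp (2 * L * T)"
  proof (rule Gronwall)
    show "continuous_on {0..T} (\<lambda>t. (norm (low ?\<sigma> (v t)))\<^sup>2)" by (intro continuous_intros lvc)
    fix t assume t: "t \<in> {0..T}"
    have sub: "{0..t} \<subseteq> {0..T}" using t by auto
    have "(norm (low ?\<sigma> (v t)))\<^sup>2 = integral {0..t} F" by (rule energy[OF t])
    also have "\<dots> \<le> integral {0..t} (\<lambda>\<rho>. 2 * L * (norm (low ?\<sigma> (v \<rho>)))\<^sup>2)"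
    proof (rule integral_le)
      show "F integrable_on {0..t}" unfolding F_def
        by (intro integrable_continuous_real continuous_intros continuous_on_subset[OF lvc sub] continuous_on_subset[OF lnc sub])
      show "(\<lambda>\<rho>. 2 * L * (norm (low ?\<sigma> (v \<rho>)))\<^sup>2) integrable_on {0..t}"
        by (intro integrable_continuous_real continuous_intros continuous_on_subset[OF lvc sub])
      fix \<rho> assume "\<rho> \<in> {0..t}"
      hence \<rho>: "\<rho> \<in> {0..T}" using sub by blast
      have "inner (low ?\<sigma> (v \<rho>)) (low ?\<sigma> (n \<rho>)) \<le> norm (low ?\<sigma> (v \<rho>)) * norm (low ?\<sigma> (n \<rho>))" by (rule norm_cauchy_schwarz)
      also have "\<dots> \<le> norm (low ?\<sigma> (v \<rho>)) * (L * norm (low ?\<sigma> (v \<rho>)))" by (intro mult_left_mono n_le[OF \<rho>]) auto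
      finally show "F \<rho> \<le> 2 * L * (norm (low ?\<sigma> (v \<rho>)))\<^sup>2" by (simp add: F_def power2_eq_square mult_ac)
    qed
    also have "\<dots> = 0 + 2 * L * integral {0..t} (\<lambda>\<rho>. (norm (low ?\<sigma> (v \<rho>)))\<^sup>2)"
      by (simp only: integral_mult_right add_0)
    finally show "(norm (low ?\<sigma> (v t)))\<^sup>2 \<le> 0 + 2 * L * integral {0..t} (\<lambda>\<rho>. (norm (low ?\<sigma> (v \<rho>)))\<^sup>2)" .
  qed (use L(1) T in auto)
  hence "low ?\<sigma> (v T) = 0" by simp
  hence "v T = 0" by (rule low_eq_0D[OF sigma(2)])
  thus ?thesis by (simp add: v_def)
qed

lemma conjugated: "\<exists>E E' B. conjugated_evolution E E' B nonlin pot_mode"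
proof -
  from conjugation[OF X \<tau> C0] obtain E E' B where
    EEB: "bounded_linear E \<and> bounded_linear E' \<and> bounded_linear B \<and>
    (\<forall>x. E (E' x) = x) \<and> (\<forall>x. E' (E x) = x) \<and>
    (\<forall>h Y. (\<forall>k. ell2_nth h k = \<i> * (- of_real ((of_int k)\<^sup>2) * ell2_nth Y k + ell2_nth (B Y) k)) \<longrightarrow>
       (\<forall>k. ell2_nth (E h) k = \<i> * (- of_real ((of_int k)\<^sup>2) * ell2_nth (E Y) k +
          of_real (jb k powr (\<tau> + 2)) * (\<Sum>\<^sub>\<infinity>j. \<xi> (k - j) * (of_real (jb j powr - (\<tau> + 2)) * ell2_nth (E Y) j)))))"
    by (elim exE)
  show ?thesis
  proof (intro exI, rule conjugated_evolution.intro)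
    show "bounded_linear E" "bounded_linear E'" "bounded_linear B" "E (E' x) = x" "E' (E x) = x" for x
      using EEB by simp_all
    show "\<exists>L\<ge>0. \<forall>x y. norm x \<le> R \<longrightarrow> norm y \<le> R \<longrightarrow> norm (nonlin x - nonlin y) \<le> L * norm (x - y)" for R
      using nonlin_lipschitz[of R] by blast
    show "bounded_linear (pot_mode k)" for k by (rule bounded_linear_pot_mode)
    fix h Y k
    assume h: "\<And>k. ell2_nth h k = \<i> * (- of_real ((of_int k)\<^sup>2) * ell2_nth Y k + ell2_nth (B Y) k)"
    show "ell2_nth (E h) k = \<i> * (- of_real ((of_int k)\<^sup>2) * ell2_nth (E Y) k + pot_mode k (E Y))"
      unfolding pot_mode_def conv_def
      by (rule EEB[THEN conjunct2, THEN conjunct2, THEN conjunct2, THEN conjunct2, THEN conjunct2, rule_format]) (rule h)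
  next
    show "z T = w T" if "0 \<le> T" "mode_solution pot_mode nonlin z0 {0..T} z" "mode_solution pot_mode nonlin z0 {0..T} w" for T z0 z w
      by (rule mode_solution_unique[OF that])
  qed
qed

end

section \<open>The dual Sobolev embedding\<close>

text \<open>Comparison with the integral of x powr - \<beta>, done by induction: the increment of
  the primitive over one step dominates the new term, by concavity.\<close>

lemma sum_powr_le:
  fixes \<beta> :: real
  assumes "0 < \<beta>" "\<beta> < 1"
  shows "(\<Sum>n=1..N. real n powr - \<beta>) \<le> real N powr (1 - \<beta>) / (1 - \<beta>)"
proof (induction N)
  case (Suc N)
  let ?a = "1 - \<beta>" and ?M = "real (Suc N)"
  have step: "real N powr ?a \<le> ?M powr ?a - ?a * ?M powr - \<beta>"
  proof (cases "N = 0")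
    case True thus ?thesis using assms by simp
  next
    case False
    define x where "x = real N / ?M"
    have x: "0 < x" using False by (simp add: x_def)
    \<comment> \<open>Weighted arithmetic-geometric mean with weights 1 - \<beta> and \<beta>; it
      states that the concave power lies below its tangent at 1.\<close>
    have "x powr ?a * 1 powr \<beta> \<le> ?a * x + \<beta> * 1"
      by (rule Youngs_inequality_0) (use assms x in auto)
    hence le: "x powr ?a \<le> ?a * x + \<beta>" by simp
    have "real N powr ?a = ?M powr ?a * x powr ?a"
      using False by (simp add: x_def powr_divide)
    also have "\<dots> \<le> ?M powr ?a * (?a * x + \<beta>)" by (intro mult_left_mono le) auto
    also have "?a * x + \<beta> = 1 - ?a / ?M" by (simp add: x_def field_simps)
    also have "?M powr ?a * (1 - ?a / ?M) = ?M powr ?a - ?a * (?M powr ?a / ?M)" by (simp add: algebra_simps)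
    also have "?M powr ?a / ?M = ?M powr - \<beta>"
    proof -
      have "?M powr ?a / ?M = ?M powr ?a * ?M powr - 1" by (simp add: powr_minus divide_inverse)
      also have "\<dots> = ?M powr (?a + - 1)" by (simp only: powr_add)
      also have "?a + - 1 = - \<beta>" by simp
      finally show ?thesis .
    qed
    finally show ?thesis .
  qed
  have "(\<Sum>n=1..Suc N. real n powr - \<beta>) = (\<Sum>n=1..N. real n powr - \<beta>) + ?M powr - \<beta>" by simp
  also have "\<dots> \<le> real N powr ?a / ?a + ?M powr - \<beta>" using Suc by simp
  also have "\<dots> \<le> ?M powr ?a / ?a"
  proof -
    have "real N powr ?a / ?a \<le> (?M powr ?a - ?a * ?M powr - \<beta>) / ?a" using step assms by (intro divide_right_mono) auto
    also have "\<dots> = ?M powr ?a / ?a - ?M powr - \<beta>" using assms by (simp add: diff_divide_distrib)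
    finally show ?thesis by simp
  qed
  finally show ?case .
qed (use assms in simp)

lemma jb_low_sum:
  fixes \<beta> :: real
  assumes \<beta>: "0 < \<beta>" "\<beta> < 1"
  shows "\<exists>C>0. \<forall>A>0. \<forall>F. finite F \<longrightarrow> (\<forall>k\<in>F. jb k \<le> A) \<longrightarrow> (\<Sum>k\<in>F. jb k powr - \<beta>) \<le> C * A powr (1 - \<beta>)"
proof -
  \<comment> \<open>1 accounts for the mode 0, and each sign of k contributes 1 / (1 -
    \<beta>).\<close>
  define C where "C = 1 + 2 / (1 - \<beta>)"
  have C: "0 < C" using \<beta> by (simp add: C_def add_pos_pos)
  have "(\<Sum>k\<in>F. jb k powr - \<beta>) \<le> C * A powr (1 - \<beta>)" if A: "0 < A" and F: "finite F" "\<forall>k\<in>F. jb k \<le> A" for A F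
  proof (cases "F = {}")
    case True thus ?thesis using C by simp
  next
    case False
    then obtain k0 where "k0 \<in> F" by blast
    hence A1: "1 \<le> A" using F(2) jb_ge1[of k0] order_trans by blast
    define N where "N = nat \<lfloor>A\<rfloor>"
    have NA: "real N \<le> A" using A by (simp add: N_def)
    let ?P = "{1..N}"
    have sub: "F \<subseteq> insert 0 (int ` ?P \<union> (\<lambda>n. - int n) ` ?P)"
    proof
      fix k assume k: "k \<in> F"
      have "\<bar>of_int k :: real\<bar> \<le> A" using abs_le_jb[of k] F(2) k order_trans by blast
      hence "\<bar>k\<bar> \<le> \<lfloor>A\<rfloor>" by (simp add: le_floor_iff)
      hence n: "nat \<bar>k\<bar> \<le> N" by (simp add: N_def nat_mono)
      show "k \<in> insert 0 (int ` ?P \<union> (\<lambda>n. - int n) ` ?P)"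
      proof (cases "k = 0")
        case False
        hence "nat \<bar>k\<bar> \<in> ?P" using n by auto
        moreover have "k = int (nat \<bar>k\<bar>) \<or> k = - int (nat \<bar>k\<bar>)" by linarith
        ultimately show ?thesis by blast
      qed simp
    qed
    have le: "jb (int n) powr - \<beta> \<le> real n powr - \<beta>" if "n \<in> ?P" for n
      using abs_le_jb[of "int n"] that \<beta> by (intro powr_mono2') auto
    have "(\<Sum>k\<in>F. jb k powr - \<beta>) \<le> (\<Sum>k\<in>insert 0 (int ` ?P \<union> (\<lambda>n. - int n) ` ?P). jb k powr - \<beta>)"
      by (rule sum_mono2) (use sub in auto)
    also have "\<dots> = 1 + ((\<Sum>n\<in>?P. jb (int n) powr - \<beta>) + (\<Sum>n\<in>?P. jb (- int n) powr - \<beta>))"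
    proof -
      have "(\<Sum>k\<in>int ` ?P \<union> (\<lambda>n. - int n) ` ?P. jb k powr - \<beta>) = (\<Sum>k\<in>int ` ?P. jb k powr - \<beta>) + (\<Sum>k\<in>(\<lambda>n. - int n) ` ?P. jb k powr - \<beta>)"
        by (rule sum.union_disjoint) auto
      also have "\<dots> = (\<Sum>n\<in>?P. jb (int n) powr - \<beta>) + (\<Sum>n\<in>?P. jb (- int n) powr - \<beta>)"
        by (simp add: sum.reindex inj_on_def)
      finally show ?thesis by (subst sum.insert) (auto simp: jb_def)
    qed
    also have "\<dots> \<le> 1 + ((\<Sum>n\<in>?P. real n powr - \<beta>) + (\<Sum>n\<in>?P. real n powr - \<beta>))"
      by (intro add_left_mono add_mono sum_mono) (auto simp: le)
    also have "\<dots> \<le> 1 + 2 * (A powr (1 - \<beta>) / (1 - \<beta>))"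
    proof -
      have "(\<Sum>n\<in>?P. real n powr - \<beta>) \<le> real N powr (1 - \<beta>) / (1 - \<beta>)" by (rule sum_powr_le[OF \<beta>])
      also have "\<dots> \<le> A powr (1 - \<beta>) / (1 - \<beta>)"
        using \<beta> NA by (intro divide_right_mono powr_mono2) auto
      finally show ?thesis by simp
    qed
    also have "\<dots> \<le> A powr (1 - \<beta>) + 2 * (A powr (1 - \<beta>) / (1 - \<beta>))"
      using ge_one_powr_ge_zero[OF A1, of "1 - \<beta>"] \<beta> by simp
    also have "\<dots> = C * A powr (1 - \<beta>)" by (simp add: C_def algebra_simps)
    finally show ?thesis .
  qed
  thus ?thesis using C by blast
qed

text \<open>A growing geometric sum is comparable to its last term, and that term is below y powr q.
  The cap \<open>J\<close> only keeps the index set visibly finite.\<close>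

lemma geometric_sum_below:
  fixes q :: real
  assumes q: "0 < q"
  shows "\<exists>C\<ge>0. \<forall>y>0. \<forall>J. (\<Sum>j | j \<le> J \<and> 2 ^ j < y. (2 ^ j) powr q) \<le> C * y powr q"
proof -
  define r where "r = 2 powr q"
  have r1: "1 < r" using q by (simp add: r_def)
  have pw: "((2::real) ^ j) powr q = r ^ j" for j :: nat
    by (simp add: r_def powr_powr powr_power mult.commute flip: powr_realpow)
  have "(\<Sum>j | j \<le> J \<and> 2 ^ j < y. (2 ^ j) powr q) \<le> r / (r - 1) * y powr q" if y: "0 < y" for y :: real and J :: nat
  proof (induction J)
    case 0
    show ?case
    proof (cases "1 < y")
      case True
      have "{j::nat. j \<le> 0 \<and> 2 ^ j < y} = {0}" using True by auto
      moreover have "1 * 1 \<le> r / (r - 1) * y powr q"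
        using r1 ge_one_powr_ge_zero[of y q] True q by (intro mult_mono) auto
      ultimately show ?thesis by simp
    next
      case False
      hence empty: "{j::nat. j \<le> 0 \<and> 2 ^ j < y} = {}" by auto
      show ?thesis unfolding empty using r1 by simp
    qed
  next
    case (Suc J)
    show ?case
    proof (cases "2 ^ Suc J < y")
      case False
      hence "{j. j \<le> Suc J \<and> 2 ^ j < y} = {j. j \<le> J \<and> 2 ^ j < y}" using le_Suc_eq by auto
      thus ?thesis using Suc by simp
    next
      case True
      have "(\<Sum>j | j \<le> Suc J \<and> 2 ^ j < y. (2 ^ j) powr q) \<le> (\<Sum>j\<le>Suc J. (2 ^ j) powr q)"
        by (rule sum_mono2) auto
      also have "\<dots> = (\<Sum>j\<le>Suc J. r ^ j)" by (simp only: pw)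
      also have "\<dots> = (r ^ Suc (Suc J) - 1) / (r - 1)"
        using geometric_sum[of r "Suc (Suc J)"] r1 by (simp add: lessThan_Suc_atMost del: power_Suc)
      also have "\<dots> \<le> r ^ Suc (Suc J) / (r - 1)" using r1 by (intro divide_right_mono) auto
      also have "\<dots> = r / (r - 1) * (2 ^ Suc J) powr q" by (simp only: pw) simp
      also have "\<dots> \<le> r / (r - 1) * y powr q"
        using r1 True q by (intro mult_left_mono powr_mono2) auto
      finally show ?thesis .
    qed
  qed
  thus ?thesis using r1 by (intro exI[of _ "r / (r - 1)"]) auto
qed

definition trig_poly :: "int set \<Rightarrow> (int \<Rightarrow> complex) \<Rightarrow> real \<Rightarrow> complex" where
  "trig_poly F c x = (\<Sum>k\<in>F. c k * cis (of_int k * x))"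

lemma trig_poly_measurable: "trig_poly F c \<in> borel_measurable torus"
  unfolding trig_poly_def[abs_def]
  by (intro borel_measurable_sum borel_measurable_times cis_measurable borel_measurable_const)

lemma trig_poly_bound: "norm (trig_poly F c x) \<le> (\<Sum>k\<in>F. norm (c k))"
  unfolding trig_poly_def by (rule order_trans[OF norm_sum]) (simp add: norm_mult)

lemma integrable_mult_trig_poly: "integrable torus f \<Longrightarrow> integrable torus (\<lambda>x. f x * cnj (trig_poly F c x))"
proof (rule integrable_mult_bounded)
  show "(\<lambda>x. cnj (trig_poly F c x)) \<in> borel_measurable torus"
    by (rule measurable_compose[OF trig_poly_measurable borel_measurable_continuous_onI]) (intro continuous_intros)
  show "norm (cnj (trig_poly F c x)) \<le> (\<Sum>k\<in>F. norm (c k))" for x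
    using trig_poly_bound by simp
qed

lemma integral_mult_trig_poly:
  assumes f: "integrable torus f"
  shows "(\<integral>x. f x * cnj (trig_poly F c x) \<partial>torus) = 2 * pi * (\<Sum>k\<in>F. cnj (c k) * fourier_coeff f k)"
proof -
  have "(\<integral>x. f x * cnj (trig_poly F c x) \<partial>torus) = (\<integral>x. (\<Sum>k\<in>F. cnj (c k) * (f x * cis (of_int (- k) * x))) \<partial>torus)"
    by (simp add: trig_poly_def sum_distrib_left cis_cnj mult_ac)
  also have "\<dots> = (\<Sum>k\<in>F. \<integral>x. cnj (c k) * (f x * cis (of_int (- k) * x)) \<partial>torus)"
    by (rule Bochner_Integration.integral_sum) (intro integrable_mult_right integrable_mult_cis f)
  also have "\<dots> = (\<Sum>k\<in>F. 2 * pi * (cnj (c k) * fourier_coeff f k))"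
    by (rule sum.cong) (auto simp: fourier_coeff_alt)
  finally show ?thesis by (simp add: sum_distrib_left)
qed

lemma fourier_coeff_trig_poly:
  assumes F: "finite F"
  shows "fourier_coeff (trig_poly F c) k = (if k \<in> F then c k else 0)"
proof -
  have "trig_poly F c x * cis (of_int (- k) * x) = (\<Sum>j\<in>F. c j * cis (of_int (j - k) * x))" for x
    unfolding trig_poly_def sum_distrib_right
    by (rule sum.cong[OF refl]) (simp add: mult.assoc cis_mult left_diff_distrib)
  hence "(\<integral>x. trig_poly F c x * cis (of_int (- k) * x) \<partial>torus) = (\<integral>x. (\<Sum>j\<in>F. c j * cis (of_int (j - k) * x)) \<partial>torus)"
    by (simp only:)
  also have "\<dots> = (\<Sum>j\<in>F. \<integral>x. c j * cis (of_int (j - k) * x) \<partial>torus)"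
    by (rule Bochner_Integration.integral_sum, rule integrable_mult_right, rule integrable_torus_bounded[OF cis_measurable, where C = 1]) simp
  also have "\<dots> = (\<Sum>j\<in>F. if j = k then 2 * pi * c j else 0)"
    by (rule sum.cong) (auto simp: integral_cis simp del: of_int_diff)
  also have "\<dots> = (if k \<in> F then 2 * pi * c k else 0)" using F by simp
  finally show ?thesis by (simp add: fourier_coeff_alt)
qed

lemma trig_poly_integrable: "integrable torus (trig_poly F c)"
  by (rule integrable_torus_bounded[OF trig_poly_measurable trig_poly_bound])

lemma integrable_trig_poly_powr: "0 \<le> p \<Longrightarrow> integrable torus (\<lambda>x. norm (trig_poly F c x) powr p)"
proof -
  assume p: "0 \<le> p"
  have m: "(\<lambda>x. norm (trig_poly F c x) powr p) \<in> borel_measurable torus"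
    using trig_poly_measurable by measurable
  show ?thesis
  proof (rule Bochner_Integration.integrable_bound[of _ "\<lambda>_. (\<Sum>k\<in>F. norm (c k)) powr p"])
    show "AE x in torus. norm (norm (trig_poly F c x) powr p) \<le> norm ((\<Sum>k\<in>F. norm (c k)) powr p)"
      using p by (intro AE_I2) (auto intro!: powr_mono2 trig_poly_bound)
  qed (use m in auto)
qed

lemma trig_poly_Parseval:
  assumes F: "finite F"
  shows "(\<integral>x. (norm (trig_poly F c x))\<^sup>2 \<partial>torus) = 2 * pi * (\<Sum>k\<in>F. (norm (c k))\<^sup>2)"
proof -
  have "complex_of_real (\<integral>x. (norm (trig_poly F c x))\<^sup>2 \<partial>torus) = (\<integral>x. complex_of_real ((norm (trig_poly F c x))\<^sup>2) \<partial>torus)"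
    by (rule integral_complex_of_real[symmetric])
  also have "\<dots> = (\<integral>x. trig_poly F c x * cnj (trig_poly F c x) \<partial>torus)"
    by (simp only: complex_norm_square)
  also have "\<dots> = 2 * pi * (\<Sum>k\<in>F. cnj (c k) * c k)"
    unfolding integral_mult_trig_poly[OF trig_poly_integrable] by (simp add: fourier_coeff_trig_poly[OF F])
  also have "(\<Sum>k\<in>F. cnj (c k) * c k) = complex_of_real (\<Sum>k\<in>F. (norm (c k))\<^sup>2)"
    by (simp add: complex_norm_square mult.commute del: of_real_power)
  finally have "complex_of_real (\<integral>x. (norm (trig_poly F c x))\<^sup>2 \<partial>torus) = complex_of_real (2 * pi * (\<Sum>k\<in>F. (norm (c k))\<^sup>2))"
    by (simp only: of_real_mult)
  thus ?thesis by (simp only: of_real_eq_iff)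
qed

text \<open>At height \<open>2\<^sup>j\<close> the polynomial is split at the frequency \<open>A j\<close> for which the low frequency
  part is at most \<open>2\<^sup>j / 2\<close>; the high frequency part is measured in \<open>L\<^sup>2\<close>.\<close>

lemma Sobolev_embedding_trig_poly:
  assumes p: "2 \<le> p"
  shows "\<exists>C. \<forall>F c. finite F \<longrightarrow> (\<Sum>k\<in>F. jb k powr (1 - 2 / p) * (norm (c k))\<^sup>2) \<le> 1 \<longrightarrow>
     (\<integral>x. norm (trig_poly F c x) powr p \<partial>torus) \<le> C"
\<comment> \<open>For p = 2 the weight exponent is 0 and Parseval's identity suffices. The splitting
  below needs a positive exponent \<beta>.\<close>
proof (cases "p = 2")
  case True
  have "(\<integral>x. norm (trig_poly F c x) powr p \<partial>torus) \<le> 2 * pi" if F: "finite F" and c: "(\<Sum>k\<in>F. jb k powr (1 - 2 / p) * (norm (c k))\<^sup>2) \<le> 1" for F c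
    using trig_poly_Parseval[OF F, of c] c True by simp
  thus ?thesis by blast
next
  case False
  hence p2: "2 < p" using p by simp
  define \<beta> where "\<beta> = 1 - 2 / p"
  have \<beta>: "0 < \<beta>" "\<beta> < 1" using p2 by (auto simp: \<beta>_def)
  obtain C0 where "0 < C0 \<and> (\<forall>A>0. \<forall>F. finite F \<longrightarrow> (\<forall>k\<in>F. jb k \<le> A) \<longrightarrow> (\<Sum>k\<in>F. jb k powr - \<beta>) \<le> C0 * A powr (1 - \<beta>))"
    using jb_low_sum[OF \<beta>] by (elim exE) (rule that)
  hence C0: "0 < C0" and low_sum: "\<forall>A>0. \<forall>F. finite F \<longrightarrow> (\<forall>k\<in>F. jb k \<le> A) \<longrightarrow> (\<Sum>k\<in>F. jb k powr - \<beta>) \<le> C0 * A powr (1 - \<beta>)"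
    by (rule conjunct1, rule conjunct2)
  have "0 < p - 2" using p2 by simp
  from geometric_sum_below[OF this] obtain C1 where "0 \<le> C1 \<and> (\<forall>y>0. \<forall>J. (\<Sum>j | j \<le> J \<and> 2 ^ j < y. (2 ^ j) powr (p - 2)) \<le> C1 * y powr (p - 2))"
    by (elim exE) (rule that)
  hence C1: "0 \<le> C1" and geo: "\<forall>y>0. \<forall>J. (\<Sum>j | j \<le> J \<and> 2 ^ j < y. (2 ^ j) powr (p - 2)) \<le> C1 * y powr (p - 2)"
    by (rule conjunct1, rule conjunct2)
  \<comment> \<open>Since p (1 - \<beta>) = 2, this choice gives C0 * A j powr (1 - \<beta>) = (2^j
    / 2)^2, exactly the square of the bound 2^j / 2 wanted for the low part.\<close>
  define s where "s = 2 * sqrt C0"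
  have s: "0 < s" using C0 by (simp add: s_def)
  define A where "A j = (2 ^ j / s) powr p" for j :: nat
  have A0: "0 < A j" for j using s by (simp add: A_def)
  \<comment> \<open>2 powr p comes from g \<le> 2 * 2^j, and the 4 from the lower bound 2^j / 2 for
    the high frequency part.\<close>
  define Kp where "Kp = 4 * 2 powr p"
  have main: "(\<integral>x. norm (trig_poly F c x) powr p \<partial>torus) \<le> 2 * pi + Kp * (2 * pi * (C1 * s powr (p - 2)))"
    if F: "finite F" and c: "(\<Sum>k\<in>F. jb k powr \<beta> * (norm (c k))\<^sup>2) \<le> 1" for F c
  proof -
    let ?L = "\<lambda>j. {k\<in>F. jb k \<le> A j}" and ?H = "\<lambda>j. {k\<in>F. A j < jb k}"
    have low: "norm (trig_poly (?L j) c x) \<le> 2 ^ j / 2" for j x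
    proof -
      have "norm (trig_poly (?L j) c x) \<le> (\<Sum>k\<in>?L j. norm (c k))" by (rule trig_poly_bound)
      also have "\<dots> = (\<Sum>k\<in>?L j. \<bar>jb k powr - (\<beta>/2)\<bar> * \<bar>jb k powr (\<beta>/2) * norm (c k)\<bar>)"
        by (rule sum.cong) (auto simp: abs_mult simp flip: mult.assoc powr_add)
      also have "\<dots> \<le> L2_set (\<lambda>k. jb k powr - (\<beta>/2)) (?L j) * L2_set (\<lambda>k. jb k powr (\<beta>/2) * norm (c k)) (?L j)"
        by (rule L2_set_mult_ineq)
      also have "\<dots> \<le> sqrt (C0 * A j powr (1 - \<beta>)) * sqrt 1"
      proof (rule mult_mono)
        have "(\<Sum>k\<in>?L j. (jb k powr - (\<beta>/2))\<^sup>2) \<le> C0 * A j powr (1 - \<beta>)"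
        proof -
          have "(jb k powr - (\<beta>/2))\<^sup>2 = jb k powr - \<beta>" for k by (simp add: powr_sq)
          moreover have "(\<Sum>k\<in>?L j. jb k powr - \<beta>) \<le> C0 * A j powr (1 - \<beta>)"
          proof (rule low_sum[rule_format, OF A0[of j]])
            show "finite (?L j)" using F by (rule finite_subset[rotated]) blast
          qed blast
          ultimately show ?thesis by (simp only:)
        qed
        thus "L2_set (\<lambda>k. jb k powr - (\<beta>/2)) (?L j) \<le> sqrt (C0 * A j powr (1 - \<beta>))"
          unfolding L2_set_def by (rule real_sqrt_le_mono)
        have "(\<Sum>k\<in>?L j. (jb k powr (\<beta>/2) * norm (c k))\<^sup>2) = (\<Sum>k\<in>?L j. jb k powr \<beta> * (norm (c k))\<^sup>2)"
          by (simp add: power_mult_distrib powr_sq)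
        also have "\<dots> \<le> (\<Sum>k\<in>F. jb k powr \<beta> * (norm (c k))\<^sup>2)" by (rule sum_mono2) (use F in auto)
        finally have "(\<Sum>k\<in>?L j. (jb k powr (\<beta>/2) * norm (c k))\<^sup>2) \<le> 1" using c by linarith
        thus "L2_set (\<lambda>k. jb k powr (\<beta>/2) * norm (c k)) (?L j) \<le> sqrt 1"
          unfolding L2_set_def by (rule real_sqrt_le_mono)
      qed (use C0 in auto)
      also have "\<dots> = 2 ^ j / 2"
      proof -
        have "A j powr (1 - \<beta>) = (2 ^ j / s)\<^sup>2"
          using s p2 by (simp add: A_def powr_powr \<beta>_def)
        thus ?thesis using C0 s by (simp add: real_sqrt_mult s_def)
      qed
      finally show ?thesis .
    qed
    have split: "trig_poly F c x = trig_poly (?L j) c x + trig_poly (?H j) c x" for j x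
    proof -
      have Fe: "?L j \<union> ?H j = F" by auto
      have "trig_poly (?L j \<union> ?H j) c x = trig_poly (?L j) c x + trig_poly (?H j) c x"
        unfolding trig_poly_def by (rule sum.union_disjoint) (use F in auto)
      thus ?thesis unfolding Fe .
    qed
    obtain J where J: "(\<Sum>k\<in>F. norm (c k)) < 2 ^ J"
      using real_arch_pow[of 2 "\<Sum>k\<in>F. norm (c k)"] by auto
    \<comment> \<open>A pointwise form of the layer cake formula: at height between 2^j and 2^(j +
      1) only the term of index j is needed, and the others are added for free because they are
      nonnegative.\<close>
    have pw: "norm (trig_poly F c x) powr p \<le> 1 + (\<Sum>j\<le>J. Kp * ((2 ^ j) powr (p - 2) * (norm (trig_poly (?H j) c x))\<^sup>2))" for x
    proof (cases "norm (trig_poly F c x) \<le> 1")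
      case True
      hence "norm (trig_poly F c x) powr p \<le> 1 powr p" using p2 by (intro powr_mono2) auto
      thus ?thesis by (auto intro!: add_increasing2 sum_nonneg simp: Kp_def)
    next
      case False
      define g where "g = norm (trig_poly F c x)"
      have g1: "1 < g" using False by (simp add: g_def)
      have "(2::real) ^ J \<le> 2 ^ Suc J" by simp
      hence gJ: "g \<le> 2 ^ Suc J" using trig_poly_bound[of F c x] J unfolding g_def by linarith
      define j where "j = (LEAST j. g \<le> 2 ^ Suc j)"
      have j1: "g \<le> 2 ^ Suc j" unfolding j_def by (rule LeastI[of "\<lambda>j. g \<le> 2 ^ Suc j", OF gJ])
      have jJ: "j \<le> J" unfolding j_def by (rule Least_le[of "\<lambda>j. g \<le> 2 ^ Suc j", OF gJ])
      have j2: "2 ^ j < g"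
      proof (cases j)
        case 0 thus ?thesis using g1 by simp
      next
        case (Suc i)
        hence "\<not> g \<le> 2 ^ Suc i" using not_less_Least[of i "\<lambda>j. g \<le> 2 ^ Suc j"] by (simp add: j_def)
        thus ?thesis by (simp add: Suc)
      qed
      have "g \<le> norm (trig_poly (?L j) c x) + norm (trig_poly (?H j) c x)"
        unfolding g_def split[of x j] by (rule norm_triangle_ineq)
      hence high: "2 ^ j / 2 < norm (trig_poly (?H j) c x)" using low[of j x] j2 by linarith
      have "(2 ^ j / 2)\<^sup>2 \<le> (norm (trig_poly (?H j) c x))\<^sup>2" using high by (intro power_mono) auto
      hence sq: "(2 ^ j)\<^sup>2 \<le> 4 * (norm (trig_poly (?H j) c x))\<^sup>2" by (simp add: power_divide)
      have "g powr p \<le> (2 * 2 ^ j) powr p" using j1 g1 p2 by (intro powr_mono2) auto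
      also have "\<dots> = 2 powr p * ((2 ^ j) powr (p - 2) * (2 ^ j)\<^sup>2)"
      proof -
        have "((2::real) ^ j)\<^sup>2 = (2 ^ j) powr 2" by simp
        hence "((2::real) ^ j) powr (p - 2) * (2 ^ j)\<^sup>2 = (2 ^ j) powr p" by (simp only: powr_add[symmetric]) simp
        thus ?thesis by (simp add: powr_mult)
      qed
      also have "\<dots> \<le> 2 powr p * ((2 ^ j) powr (p - 2) * (4 * (norm (trig_poly (?H j) c x))\<^sup>2))"
        by (intro mult_left_mono sq) auto
      also have "\<dots> = Kp * ((2 ^ j) powr (p - 2) * (norm (trig_poly (?H j) c x))\<^sup>2)" by (simp add: Kp_def)
      also have "\<dots> \<le> (\<Sum>j\<le>J. Kp * ((2 ^ j) powr (p - 2) * (norm (trig_poly (?H j) c x))\<^sup>2))"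
        by (rule member_le_sum[of j "{..J}"]) (use jJ in \<open>auto simp: Kp_def\<close>)
      finally show ?thesis by (simp add: g_def)
    qed
    have i2: "integrable torus (\<lambda>x. (norm (trig_poly G c x))\<^sup>2)" for G
      using integrable_trig_poly_powr[of 2 G c] by simp
    have "(\<integral>x. norm (trig_poly F c x) powr p \<partial>torus)
       \<le> (\<integral>x. 1 + (\<Sum>j\<le>J. Kp * ((2 ^ j) powr (p - 2) * (norm (trig_poly (?H j) c x))\<^sup>2)) \<partial>torus)"
    proof (rule integral_mono)
      show "integrable torus (\<lambda>x. norm (trig_poly F c x) powr p)" by (rule integrable_trig_poly_powr) (use p2 in simp)
      show "integrable torus (\<lambda>x. 1 + (\<Sum>j\<le>J. Kp * ((2 ^ j) powr (p - 2) * (norm (trig_poly (?H j) c x))\<^sup>2)))"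
        by (intro Bochner_Integration.integrable_add Bochner_Integration.integrable_sum integrable_mult_right i2) simp
    qed (rule pw)
    also have "\<dots> = 2 * pi + (\<Sum>j\<le>J. Kp * ((2 ^ j) powr (p - 2) * (2 * pi * (\<Sum>k\<in>?H j. (norm (c k))\<^sup>2))))"
      by (subst Bochner_Integration.integral_add, simp, intro Bochner_Integration.integrable_sum integrable_mult_right i2,
          subst Bochner_Integration.integral_sum, intro integrable_mult_right i2)
         (use F in \<open>simp add: measure_torus trig_poly_Parseval\<close>)
    also have "(\<Sum>j\<le>J. Kp * ((2 ^ j) powr (p - 2) * (2 * pi * (\<Sum>k\<in>?H j. (norm (c k))\<^sup>2))))
       = Kp * (2 * pi * (\<Sum>j\<le>J. (2 ^ j) powr (p - 2) * (\<Sum>k\<in>?H j. (norm (c k))\<^sup>2)))"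
      by (simp add: sum_distrib_left mult_ac)
    also have "(\<Sum>j\<le>J. (2 ^ j) powr (p - 2) * (\<Sum>k\<in>?H j. (norm (c k))\<^sup>2)) \<le> C1 * s powr (p - 2)"
    proof -
      have "(\<Sum>j\<le>J. (2 ^ j) powr (p - 2) * (\<Sum>k\<in>?H j. (norm (c k))\<^sup>2))
         = (\<Sum>j\<le>J. \<Sum>k\<in>F. if A j < jb k then (2 ^ j) powr (p - 2) * (norm (c k))\<^sup>2 else 0)"
      proof (rule sum.cong[OF refl])
        fix j
        show "(2 ^ j) powr (p - 2) * (\<Sum>k\<in>?H j. (norm (c k))\<^sup>2) = (\<Sum>k\<in>F. if A j < jb k then (2 ^ j) powr (p - 2) * (norm (c k))\<^sup>2 else 0)"
          unfolding sum_distrib_left by (rule sum.inter_filter[OF F])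
      qed
      also have "\<dots> = (\<Sum>k\<in>F. \<Sum>j\<le>J. if A j < jb k then (2 ^ j) powr (p - 2) * (norm (c k))\<^sup>2 else 0)"
        by (rule sum.swap)
      also have "\<dots> = (\<Sum>k\<in>F. (\<Sum>j | j \<le> J \<and> A j < jb k. (2 ^ j) powr (p - 2)) * (norm (c k))\<^sup>2)"
      proof (rule sum.cong[OF refl])
        fix k
        have *: "{j. j \<le> J \<and> A j < jb k} = {j\<in>{..J}. A j < jb k}" by auto
        show "(\<Sum>j\<le>J. if A j < jb k then (2 ^ j) powr (p - 2) * (norm (c k))\<^sup>2 else 0) = (\<Sum>j | j \<le> J \<and> A j < jb k. (2 ^ j) powr (p - 2)) * (norm (c k))\<^sup>2"
          unfolding sum_distrib_right * by (rule sum.inter_filter[OF finite_atMost, symmetric])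
      qed
      also have "\<dots> \<le> (\<Sum>k\<in>F. (C1 * s powr (p - 2) * jb k powr \<beta>) * (norm (c k))\<^sup>2)"
      proof (rule sum_mono, rule mult_right_mono)
        fix k
        \<comment> \<open>The condition \<open>A j < jb k\<close> solved for 2^j. For fixed k the
          heights then form a geometric sum of order \<open>y powr (p - 2)\<close>, which produces
          exactly the weight \<open>jb k powr \<beta>\<close>.\<close>
        define y where "y = s * jb k powr (1 / p)"
        have y: "0 < y" using s by (simp add: y_def)
        have "A j < jb k \<longleftrightarrow> 2 ^ j < y" for j
        proof -
          have b0: "0 < 2 ^ j / s" using s by simp
          have jk: "(jb k powr (1 / p)) powr p = jb k" using p2 by (simp add: powr_powr)
          have "A j < jb k \<longleftrightarrow> 2 ^ j / s < jb k powr (1 / p)"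
          proof
            assume "A j < jb k"
            show "2 ^ j / s < jb k powr (1 / p)"
            proof (rule ccontr)
              assume "\<not> 2 ^ j / s < jb k powr (1 / p)"
              hence "(jb k powr (1 / p)) powr p \<le> A j" unfolding A_def using p2 by (intro powr_mono2) auto
              thus False using \<open>A j < jb k\<close> jk by simp
            qed
          next
            assume "2 ^ j / s < jb k powr (1 / p)"
            hence "A j < (jb k powr (1 / p)) powr p" unfolding A_def using p2 b0 by (intro powr_less_mono2) auto
            thus "A j < jb k" using jk by simp
          qed
          thus ?thesis using s by (simp add: y_def divide_less_eq mult.commute)
        qed
        hence "(\<Sum>j | j \<le> J \<and> A j < jb k. (2 ^ j) powr (p - 2)) \<le> C1 * y powr (p - 2)" using geo[rule_format, OF y, of J] by simp
        also have "y powr (p - 2) = s powr (p - 2) * jb k powr \<beta>"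
        proof -
          have "1 / p * (p - 2) = \<beta>" using p2 by (simp add: \<beta>_def field_simps)
          thus ?thesis using s by (simp add: y_def powr_mult powr_powr)
        qed
        finally show "(\<Sum>j | j \<le> J \<and> A j < jb k. (2 ^ j) powr (p - 2)) \<le> C1 * s powr (p - 2) * jb k powr \<beta>" by simp
      qed simp
      also have "\<dots> = C1 * s powr (p - 2) * (\<Sum>k\<in>F. jb k powr \<beta> * (norm (c k))\<^sup>2)"
        by (simp add: sum_distrib_left mult.assoc)
      also have "\<dots> \<le> C1 * s powr (p - 2) * 1" using c C1 by (intro mult_left_mono) auto
      finally show ?thesis by simp
    qed
    finally show ?thesis by (simp add: Kp_def mult_left_mono)
  qed
  show ?thesis by (rule exI[of _ "2 * pi + Kp * (2 * pi * (C1 * s powr (p - 2)))"]) (use main in \<open>auto simp: \<beta>_def\<close>)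
qed

lemma Lebesgue_space_integrable:
  assumes f: "f \<in> Lebesgue_space q" and q: "1 \<le> q"
  shows "integrable torus f"
proof (rule Bochner_Integration.integrable_bound)
  show "integrable torus (\<lambda>x. 1 + norm (f x) powr q)"
    using f by (auto simp: Lebesgue_space_def)
  show "f \<in> borel_measurable torus" using f by (simp add: Lebesgue_space_def)
  show "AE x in torus. norm (f x) \<le> norm (1 + norm (f x) powr q)"
  proof (rule AE_I2)
    fix x
    have "norm (f x) \<le> 1 + norm (f x) powr q"
    proof (cases "norm (f x) \<le> 1")
      case False
      hence "norm (f x) powr 1 \<le> norm (f x) powr q" by (intro powr_mono) (use q in auto)
      thus ?thesis using False by simp
    qed (simp add: add_increasing2)
    thus "norm (f x) \<le> norm (1 + norm (f x) powr q)" by (simp add: abs_of_nonneg)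
  qed
qed

text \<open>Duality with \<open>Sobolev_embedding_trig_poly\<close>: test \<open>f\<close> against the normalised polynomial with
  coefficients proportional to \<open>jb k powr - (1 - 2 / p) * fourier_coeff f k\<close>.\<close>

lemma dual_Sobolev_embedding:
  assumes p: "2 \<le> p" and pq: "1 / p + 1 / q = 1" and f: "f \<in> Lebesgue_space q"
  shows "\<exists>C\<ge>0. \<forall>F. finite F \<longrightarrow> (\<Sum>k\<in>F. (jb k powr - (1/2 - 1/p) * norm (fourier_coeff f k))\<^sup>2) \<le> C\<^sup>2"
proof -
  have p0: "0 < p" using p by simp
  have "1 / q = 1 - 1 / p" using pq by simp
  moreover have "1 / p \<le> 1/2" using p by (simp add: field_simps)
  ultimately have q': "1/2 \<le> 1 / q" "1 / q < 1" using p0 by auto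
  hence "0 < 1 / q" by linarith
  hence q0: "0 < q" by simp
  have q1: "1 < q" using q' q0 by (simp add: divide_less_eq)
  note fi = Lebesgue_space_integrable[OF f less_imp_le[OF q1]]
  have fq: "integrable torus (\<lambda>x. norm (f x) powr q)" using f by (simp add: Lebesgue_space_def)
  define \<beta> where "\<beta> = 1 - 2 / p"
  obtain Cp where Cp: "\<forall>F c. finite F \<longrightarrow> (\<Sum>k\<in>F. jb k powr \<beta> * (norm (c k))\<^sup>2) \<le> 1 \<longrightarrow> (\<integral>x. norm (trig_poly F c x) powr p \<partial>torus) \<le> Cp"
    using Sobolev_embedding_trig_poly[OF p, folded \<beta>_def] by (elim exE) (rule that)
  define D where "D = (\<integral>x. norm (f x) powr q \<partial>torus)"
  define C where "C = \<bar>(D / q + Cp / p) / (2 * pi)\<bar>"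
  have "(\<Sum>k\<in>F. (jb k powr - (1/2 - 1/p) * norm (fourier_coeff f k))\<^sup>2) \<le> C\<^sup>2" if F: "finite F" for F
  proof -
    define S where "S = (\<Sum>k\<in>F. jb k powr - \<beta> * (norm (fourier_coeff f k))\<^sup>2)"
    have SS: "(\<Sum>k\<in>F. (jb k powr - (1/2 - 1/p) * norm (fourier_coeff f k))\<^sup>2) = S"
      unfolding S_def by (rule sum.cong) (auto simp: power_mult_distrib powr_sq \<beta>_def algebra_simps)
    have S0: "0 \<le> S" unfolding S_def by (intro sum_nonneg) auto
    show ?thesis
    proof (cases "S = 0")
      case False
      hence Spos: "0 < S" using S0 by simp
      \<comment> \<open>The factor 1 / sqrt S normalises the polynomial in H^(\<beta>/2), and its
        pairing with f becomes 2 pi sqrt S, the quantity to be bounded.\<close>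
      define c where "c k = of_real (jb k powr - \<beta> / sqrt S) * fourier_coeff f k" for k
      have nc: "norm (c k) = jb k powr - \<beta> / sqrt S * norm (fourier_coeff f k)" for k
        using Spos by (simp add: c_def norm_mult norm_divide)
      have "(\<Sum>k\<in>F. jb k powr \<beta> * (norm (c k))\<^sup>2) = (\<Sum>k\<in>F. (jb k powr - \<beta> * (norm (fourier_coeff f k))\<^sup>2) / S)"
      proof (rule sum.cong[OF refl])
        fix k
        have "(norm (c k))\<^sup>2 = jb k powr - \<beta> * jb k powr - \<beta> * (norm (fourier_coeff f k))\<^sup>2 / S"
          unfolding nc using Spos by (simp add: power_mult_distrib power_divide power2_eq_square)
        moreover have "jb k powr \<beta> * jb k powr - \<beta> = 1" by (simp flip: powr_add)
        ultimately show "jb k powr \<beta> * (norm (c k))\<^sup>2 = (jb k powr - \<beta> * (norm (fourier_coeff f k))\<^sup>2) / S"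
          by (simp flip: mult.assoc)
      qed
      also have "\<dots> = 1" using Spos by (simp add: S_def flip: sum_divide_distrib)
      finally have gp: "(\<integral>x. norm (trig_poly F c x) powr p \<partial>torus) \<le> Cp" by (intro Cp[rule_format, OF F]) simp
      have "(\<Sum>k\<in>F. cnj (c k) * fourier_coeff f k) = complex_of_real (sqrt S)"
      proof -
        have "cnj (c k) * fourier_coeff f k = complex_of_real (jb k powr - \<beta> * (norm (fourier_coeff f k))\<^sup>2 / sqrt S)" for k
        proof -
          have "cnj (fourier_coeff f k) * fourier_coeff f k = complex_of_real ((norm (fourier_coeff f k))\<^sup>2)"
            by (subst mult.commute) (rule complex_norm_square[symmetric])
          thus ?thesis by (simp add: c_def)
        qed
        hence "(\<Sum>k\<in>F. cnj (c k) * fourier_coeff f k) = complex_of_real (\<Sum>k\<in>F. jb k powr - \<beta> * (norm (fourier_coeff f k))\<^sup>2 / sqrt S)"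
          by simp
        also have "(\<Sum>k\<in>F. jb k powr - \<beta> * (norm (fourier_coeff f k))\<^sup>2 / sqrt S) = S / sqrt S"
          by (simp only: S_def sum_divide_distrib)
        also have "S / sqrt S = sqrt S" using Spos by (simp add: real_div_sqrt)
        finally show ?thesis .
      qed
      hence "2 * pi * sqrt S = norm (\<integral>x. f x * cnj (trig_poly F c x) \<partial>torus)"
        unfolding integral_mult_trig_poly[OF fi] using S0 by (simp add: norm_mult)
      also have "\<dots> \<le> (\<integral>x. norm (f x * cnj (trig_poly F c x)) \<partial>torus)" by (rule integral_norm_bound)
      \<comment> \<open>Young's inequality takes the place of Hoelder's. The polynomial is
        normalised and the constant may depend on f, so homogeneity is not at stake.\<close>
      also have "\<dots> \<le> (\<integral>x. norm (f x) powr q / q + norm (trig_poly F c x) powr p / p \<partial>torus)"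
      proof (rule integral_mono)
        show "integrable torus (\<lambda>x. norm (f x * cnj (trig_poly F c x)))"
          using integrable_mult_trig_poly[OF fi] by simp
        show "integrable torus (\<lambda>x. norm (f x) powr q / q + norm (trig_poly F c x) powr p / p)"
          using fq integrable_trig_poly_powr[of p F c] p0 by simp
        show "norm (f x * cnj (trig_poly F c x)) \<le> norm (f x) powr q / q + norm (trig_poly F c x) powr p / p" for x
          unfolding norm_mult complex_mod_cnj
          by (rule Youngs_inequality) (use p q1 pq in auto)
      qed
      also have "\<dots> = D / q + (\<integral>x. norm (trig_poly F c x) powr p \<partial>torus) / p"
        using fq integrable_trig_poly_powr[of p F c] p0 by (simp add: D_def)
      also have "\<dots> \<le> D / q + Cp / p" using gp p0 by (simp add: divide_right_mono)
      finally have "sqrt S \<le> (D / q + Cp / p) / (2 * pi)" by (simp add: field_simps)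
      also have "\<dots> \<le> C" unfolding C_def by (rule abs_ge_self)
      finally have "(sqrt S)\<^sup>2 \<le> C\<^sup>2" using S0 by (intro power_mono) auto
      thus ?thesis using S0 SS by simp
    next
      case True
      show ?thesis unfolding SS True by simp
    qed
  qed
  thus ?thesis by (intro exI[of _ C]) (auto simp: C_def)
qed

text \<open>The dual embedding is applied to the s-th derivative g of f, whose symbol is comparable
  to \<open>jb k powr s\<close> for k \<noteq> 0. The symbol vanishes at 0 for s > 0, so this mode
  is added separately.\<close>

lemma Sobolev_Lr_coeff_l2_bounded:
  assumes p: "2 \<le> p" and pq: "1 / p + 1 / q = 1" and s: "0 \<le> s" and f: "f \<in> Sobolev_space_Lr s q"
  shows "l2_bounded (\<lambda>m. jb m powr (s - (1/2 - 1/p)) * norm (fourier_coeff f m))"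
proof -
  obtain g where g: "g \<in> Lebesgue_space q" and gk: "\<And>k. fourier_coeff g k = of_real (frac_laplace_symbol s k) * fourier_coeff f k"
    using f by (auto simp: Sobolev_space_Lr_def)
  obtain C where "0 \<le> C \<and> (\<forall>F. finite F \<longrightarrow> (\<Sum>k\<in>F. (jb k powr - (1/2 - 1/p) * norm (fourier_coeff g k))\<^sup>2) \<le> C\<^sup>2)"
    using dual_Sobolev_embedding[OF p pq g] by (elim exE) (rule that)
  hence C: "0 \<le> C" "\<forall>F. finite F \<longrightarrow> (\<Sum>k\<in>F. (jb k powr - (1/2 - 1/p) * norm (fourier_coeff g k))\<^sup>2) \<le> C\<^sup>2"
    by (rule conjunct1, rule conjunct2)
  define w where "w m = jb m powr (s - (1/2 - 1/p)) * norm (fourier_coeff f m)" for m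
  have sym: "jb k powr s \<le> 2 powr s * frac_laplace_symbol s k" if "k \<noteq> 0" for k
  proof (cases "s = 0")
    case False
    have "jb k powr s \<le> (2 * \<bar>of_int k\<bar>) powr s"
      by (rule powr_mono2) (use s jb_le_2abs[OF that] in auto)
    thus ?thesis using False by (simp add: frac_laplace_symbol_def powr_mult)
  qed (simp add: frac_laplace_symbol_def)
  have fl: "0 \<le> frac_laplace_symbol s k" for k by (simp add: frac_laplace_symbol_def)
  have wle: "w k \<le> 2 powr s * (jb k powr - (1/2 - 1/p) * norm (fourier_coeff g k))" if "k \<noteq> 0" for k
  proof -
    have "w k = jb k powr s * (jb k powr - (1/2 - 1/p) * norm (fourier_coeff f k))"
    proof -
      have "jb k powr (s - a) = jb k powr s * jb k powr - a" for a by (simp flip: powr_add)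
      thus ?thesis by (simp only: w_def mult.assoc)
    qed
    also have "\<dots> \<le> (2 powr s * frac_laplace_symbol s k) * (jb k powr - (1/2 - 1/p) * norm (fourier_coeff f k))"
      by (rule mult_right_mono[OF sym[OF that]]) simp
    also have "\<dots> = 2 powr s * (jb k powr - (1/2 - 1/p) * norm (fourier_coeff g k))"
      using fl[of k] by (simp add: gk norm_mult)
    finally show ?thesis .
  qed
  have w0: "0 \<le> w k" for k by (simp add: w_def)
  define D where "D = w 0 + 2 powr s * C"
  have "(\<Sum>m\<in>G. (w m)\<^sup>2) \<le> D\<^sup>2" if G: "finite G" for G
  proof -
    have "(\<Sum>m\<in>G. (w m)\<^sup>2) \<le> (\<Sum>m\<in>insert 0 G. (w m)\<^sup>2)" by (rule sum_mono2) (use G in auto)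
    also have "\<dots> = (w 0)\<^sup>2 + (\<Sum>m\<in>G - {0}. (w m)\<^sup>2)" using G by (simp add: sum.insert_remove)
    also have "(\<Sum>m\<in>G - {0}. (w m)\<^sup>2) \<le> (\<Sum>m\<in>G - {0}. (2 powr s * (jb m powr - (1/2 - 1/p) * norm (fourier_coeff g m)))\<^sup>2)"
      by (rule sum_mono, rule power_mono[OF wle w0]) simp
    also have "\<dots> = (2 powr s)\<^sup>2 * (\<Sum>m\<in>G - {0}. (jb m powr - (1/2 - 1/p) * norm (fourier_coeff g m))\<^sup>2)"
      by (simp only: power_mult_distrib[of "2 powr s"] sum_distrib_left)
    also have "\<dots> \<le> (2 powr s)\<^sup>2 * C\<^sup>2" by (intro mult_left_mono C(2)[rule_format]) (use G in auto)
    also have "(w 0)\<^sup>2 + (2 powr s)\<^sup>2 * C\<^sup>2 \<le> D\<^sup>2"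
      using w0[of 0] C(1) by (simp add: D_def power2_sum power_mult_distrib)
    finally show ?thesis by simp
  qed
  moreover have "0 \<le> D" using w0[of 0] C(1) by (simp add: D_def)
  ultimately show ?thesis unfolding l2_bounded_def w_def[symmetric] using w0 by blast
qed

section \<open>From Fourier coefficients back to functions\<close>

definition coord :: "real \<Rightarrow> (real \<Rightarrow> complex) \<Rightarrow> int ell2" where
  "coord \<sigma> f = to_ell2 (\<lambda>k. of_real (jb k powr \<sigma>) * fourier_coeff f k)"

text \<open>The representative given by the absolutely convergent Fourier series, hence bounded at
  every point. Products with integrable functions then cause no difficulty.\<close>

definition of_coord :: "real \<Rightarrow> int ell2 \<Rightarrow> real \<Rightarrow> complex" where
  "of_coord \<sigma> z = fourier_sum (ell2_nth (low \<sigma> z))"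

lemma Sobolev_weight: "(1 + (of_int k)\<^sup>2) powr \<sigma> * (norm c)\<^sup>2 = (norm (complex_of_real (jb k powr \<sigma>) * c))\<^sup>2"
  unfolding jb_powr2 norm_mult norm_of_real by (simp add: power_mult_distrib)

lemma coord_nth:
  assumes "f \<in> Sobolev_space \<sigma>"
  shows "ell2_nth (coord \<sigma> f) k = of_real (jb k powr \<sigma>) * fourier_coeff f k"
  unfolding coord_def
  by (subst ell2_nth_to_ell2) (use assms in \<open>simp_all only: Sobolev_space_def mem_Collect_eq Sobolev_weight\<close>)

lemma Sobolev_space_integrable: "f \<in> Sobolev_space \<sigma> \<Longrightarrow> integrable torus f"
  by (rule Lebesgue_space_integrable[where q = 2]) (auto simp: Sobolev_space_def)

lemma Sobolev_space_measurable: "f \<in> Sobolev_space \<sigma> \<Longrightarrow> f \<in> borel_measurable torus"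
  by (rule borel_measurable_integrable[OF Sobolev_space_integrable])

lemma fourier_coeff_eq_low_coord:
  assumes "0 \<le> \<sigma>" "f \<in> Sobolev_space \<sigma>"
  shows "fourier_coeff f k = ell2_nth (low \<sigma> (coord \<sigma> f)) k"
proof -
  have "complex_of_real (jb k powr - \<sigma>) * of_real (jb k powr \<sigma>) = 1"
    by (simp only: of_real_mult[symmetric] jb_cancel of_real_1)
  thus ?thesis by (simp add: low_nth[OF assms(1)] coord_nth[OF assms(2)] flip: mult.assoc)
qed

lemma Sobolev_dist_coord:
  assumes "f \<in> Sobolev_space \<sigma>" "g \<in> Sobolev_space \<sigma>"
  shows "Sobolev_dist \<sigma> f g = norm (coord \<sigma> f - coord \<sigma> g)"
proof -
  have "(norm (coord \<sigma> f - coord \<sigma> g))\<^sup>2 = (\<Sum>\<^sub>\<infinity>k. (norm (of_real (jb k powr \<sigma>) * fourier_coeff (\<lambda>x. f x - g x) k))\<^sup>2)"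
    unfolding norm_ell2_sq
    by (simp add: coord_nth assms fourier_coeff_diff Sobolev_space_integrable[OF assms(1)] Sobolev_space_integrable[OF assms(2)] flip: right_diff_distrib)
  hence "Sobolev_dist \<sigma> f g = sqrt ((norm (coord \<sigma> f - coord \<sigma> g))\<^sup>2)"
    unfolding Sobolev_norm_def Sobolev_weight by simp
  thus ?thesis by simp
qed

lemma low_abs_summable:
  assumes "1/2 < \<sigma>"
  shows "(\<lambda>k. norm (ell2_nth (low \<sigma> z) k)) summable_on UNIV"
proof -
  obtain Z where Z: "\<And>x F. finite F \<Longrightarrow> (\<Sum>k\<in>F. jb k powr - \<sigma> * norm (ell2_nth x k)) \<le> Z * norm x"
    using l1_weight_bound[OF assms] by blast
  show ?thesis
  proof (rule nonneg_bounded_partial_sums_imp_summable_on[where C = "Z * norm z"])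
    show "\<forall>\<^sub>F F in finite_subsets_at_top UNIV. (\<Sum>k\<in>F. norm (ell2_nth (low \<sigma> z) k)) \<le> Z * norm z"
      by (rule eventually_finite_subsets_at_top_weakI) (use Z assms in \<open>simp add: low_nth norm_mult\<close>)
  qed auto
qed

lemma of_coord_in_Sobolev_space:
  assumes \<sigma>: "1/2 < \<sigma>"
  shows "of_coord \<sigma> z \<in> Sobolev_space \<sigma>" "coord \<sigma> (of_coord \<sigma> z) = z"
proof -
  note s = low_abs_summable[OF \<sigma>, of z]
  have s0: "0 \<le> \<sigma>" using \<sigma> by simp
  have m: "of_coord \<sigma> z \<in> borel_measurable torus"
    unfolding of_coord_def by (rule fourier_sum_measurable[OF s])
  have c: "of_real (jb k powr \<sigma>) * fourier_coeff (of_coord \<sigma> z) k = ell2_nth z k" for k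
  proof -
    have "complex_of_real (jb k powr \<sigma>) * of_real (jb k powr - \<sigma>) = 1"
      by (simp only: of_real_mult[symmetric] jb_cancel of_real_1)
    thus ?thesis by (simp add: of_coord_def fourier_coeff_fourier_sum[OF s] low_nth[OF s0] flip: mult.assoc)
  qed
  have "integrable torus (\<lambda>x. norm (of_coord \<sigma> z x) powr 2)"
  proof (rule Bochner_Integration.integrable_bound[of _ "\<lambda>_. (\<Sum>\<^sub>\<infinity>k. norm (ell2_nth (low \<sigma> z) k)) powr 2"])
    show "(\<lambda>x. norm (of_coord \<sigma> z x) powr 2) \<in> borel_measurable torus" using m by measurable
    show "AE x in torus. norm (norm (of_coord \<sigma> z x) powr 2) \<le> norm ((\<Sum>\<^sub>\<infinity>k. norm (ell2_nth (low \<sigma> z) k)) powr 2)"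
      unfolding of_coord_def real_norm_def abs_of_nonneg[OF powr_ge_zero]
      by (intro AE_I2 powr_mono2 fourier_sum_bound[OF s]) auto
  qed simp
  thus *: "of_coord \<sigma> z \<in> Sobolev_space \<sigma>"
    using m by (simp add: Sobolev_space_def Lebesgue_space_def Sobolev_weight c ell2_nth_summable)
  show "coord \<sigma> (of_coord \<sigma> z) = z" by (rule ell2_eqI) (simp add: coord_nth[OF *] c)
qed

lemma AE_eq_of_coeff_eq:
  assumes "integrable torus f" "integrable torus g" "\<And>k. fourier_coeff f k = fourier_coeff g k"
  shows "AE x in torus. f x = g x"
proof -
  have "AE x in torus. f x - g x = 0"
    by (rule fourier_unique) (use assms in \<open>auto simp: fourier_coeff_diff\<close>)
  thus ?thesis by simp
qed

lemma AE_eq_of_coord: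
  assumes "1/2 < \<sigma>" "f \<in> Sobolev_space \<sigma>"
  shows "AE x in torus. f x = of_coord \<sigma> (coord \<sigma> f) x"
proof (rule AE_eq_of_coeff_eq)
  show "fourier_coeff f k = fourier_coeff (of_coord \<sigma> (coord \<sigma> f)) k" for k
    using assms fourier_coeff_eq_low_coord[of \<sigma> f k] of_coord_in_Sobolev_space[OF assms(1), of "coord \<sigma> f"]
      fourier_coeff_eq_low_coord[of \<sigma> "of_coord \<sigma> (coord \<sigma> f)" k] by simp
qed (use assms of_coord_in_Sobolev_space Sobolev_space_integrable in blast)+

lemma fourier_coeff_mult_of_coord:
  assumes "integrable torus f" "1/2 < \<sigma>"
  shows "fourier_coeff (\<lambda>x. f x * of_coord \<sigma> z x) k = (\<Sum>\<^sub>\<infinity>j. fourier_coeff f (k - j) * ell2_nth (low \<sigma> z) j)"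
  unfolding of_coord_def by (rule fourier_coeff_mult_fourier_sum[OF assms(1) low_abs_summable[OF assms(2)]])

lemma integrable_mult_of_coord:
  assumes "integrable torus f" "1/2 < \<sigma>"
  shows "integrable torus (\<lambda>x. f x * of_coord \<sigma> z x)"
  unfolding of_coord_def
  by (rule integrable_mult_bounded[OF assms(1) fourier_sum_measurable fourier_sum_bound]; rule low_abs_summable[OF assms(2)])

text \<open>The function is built up as (cnj w * w) * w. In each step an integrable function is
  multiplied by the absolutely convergent series \<open>w\<close>, so the convolution formula
  applies twice.\<close>

lemma fourier_coeff_cubic:
  fixes z :: "int ell2"
  assumes \<sigma>: "1/2 < \<sigma>"
  defines "w \<equiv> of_coord \<sigma> z"
  shows "integrable torus (\<lambda>x. of_real ((norm (w x))\<^sup>2) * w x)"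
    and "fourier_coeff (\<lambda>x. of_real ((norm (w x))\<^sup>2) * w x) k = ell2_nth (low \<sigma> (cubic \<sigma> z)) k"
proof -
  have s0: "0 \<le> \<sigma>" using \<sigma> by simp
  have wS: "w \<in> Sobolev_space \<sigma>" "coord \<sigma> w = z" unfolding w_def by (rule of_coord_in_Sobolev_space[OF \<sigma>])+
  have wc: "fourier_coeff w k = ell2_nth (low \<sigma> z) k" for k
    using fourier_coeff_eq_low_coord[OF s0 wS(1)] wS(2) by simp
  have cint: "integrable torus (\<lambda>x. cnj (w x))" using Sobolev_space_integrable[OF wS(1)] by simp
  have cc: "fourier_coeff (\<lambda>x. cnj (w x)) k = ell2_nth (low \<sigma> (star z)) k" for k
    by (simp add: fourier_coeff_cnj wc low_star[OF s0] star_nth)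
  have prod: "ell2_nth (low \<sigma> (ell2_product \<sigma> x y)) k = (\<Sum>\<^sub>\<infinity>j. ell2_nth (low \<sigma> x) (k - j) * ell2_nth (low \<sigma> y) j)" for x y k
  proof -
    have "complex_of_real (jb k powr - \<sigma>) * of_real (jb k powr \<sigma>) = 1"
      by (simp only: of_real_mult[symmetric] jb_cancel of_real_1)
    thus ?thesis by (simp add: low_nth[OF s0, of "ell2_product \<sigma> x y"] ell2_product_nth[OF \<sigma>] flip: mult.assoc)
  qed
  have sq: "of_real ((norm (w x))\<^sup>2) = cnj (w x) * w x" for x
    by (subst mult.commute) (rule complex_norm_square)
  have i2: "integrable torus (\<lambda>x. cnj (w x) * w x)"
    using integrable_mult_of_coord[OF cint \<sigma>, of z] by (simp add: w_def)
  have c2: "fourier_coeff (\<lambda>x. cnj (w x) * w x) k = ell2_nth (low \<sigma> (ell2_product \<sigma> z (star z))) k" for k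
    using fourier_coeff_mult_of_coord[OF cint \<sigma>, of z k]
    by (simp add: cc prod ell2_product_commute[OF \<sigma>, of z "star z"] flip: w_def)
  show "integrable torus (\<lambda>x. of_real ((norm (w x))\<^sup>2) * w x)"
    unfolding sq using integrable_mult_of_coord[OF i2 \<sigma>, of z] by (simp only: w_def)
  show "fourier_coeff (\<lambda>x. of_real ((norm (w x))\<^sup>2) * w x) k = ell2_nth (low \<sigma> (cubic \<sigma> z)) k"
    unfolding sq using fourier_coeff_mult_of_coord[OF i2 \<sigma>, of z k]
    by (simp add: c2 prod cubic_def flip: w_def)
qed

section \<open>Translation of the Cauchy problem into mode equations\<close>

locale nls_potential =
  fixes \<xi> :: "real \<Rightarrow> real" and \<tau> lam :: real
  assumes \<xi>int: "integrable torus (\<lambda>x. complex_of_real (\<xi> x))"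
    and \<xi>l2: "l2_bounded (\<lambda>m. jb m powr \<tau> * norm (fourier_coeff (\<lambda>x. complex_of_real (\<xi> x)) m))"
    and \<tau>: "- 1/2 < \<tau>"
begin

abbreviation "\<xi>c \<equiv> fourier_coeff (\<lambda>x. complex_of_real (\<xi> x))"

sublocale potential \<xi>c \<tau> "(1 / (2 * pi)) * (\<integral>x. norm (complex_of_real (\<xi> x)) \<partial>torus)" lam
proof
  show "\<xi>c (- m) = cnj (\<xi>c m)" for m
    using fourier_coeff_cnj[of "\<lambda>x. complex_of_real (\<xi> x)" "- m"] by simp
qed (rule \<xi>l2 \<tau> norm_fourier_coeff_le)+

abbreviation "\<sigma> \<equiv> \<tau> + 2"

text \<open>An element of the Sobolev space agrees almost everywhere with its series representative,
  for which both products have computable coefficients.\<close>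

lemma fourier_coeff_nls_rhs:
  assumes f: "f \<in> Sobolev_space \<sigma>"
  shows "fourier_coeff (nls_rhs \<xi> lam f) k = conv (coord \<sigma> f) k - of_real lam * ell2_nth (low \<sigma> (cubic \<sigma> (coord \<sigma> f))) k"
proof -
  define w where "w = of_coord \<sigma> (coord \<sigma> f)"
  note fw = AE_eq_of_coord[OF sigma(1) f, folded w_def]
  have wm: "w \<in> borel_measurable torus" unfolding w_def
    by (rule Sobolev_space_measurable[OF of_coord_in_Sobolev_space(1)[OF sigma(1)]])
  have fm: "f \<in> borel_measurable torus" by (rule Sobolev_space_measurable[OF f])
  have xm: "(\<lambda>x. complex_of_real (\<xi> x)) \<in> borel_measurable torus" by (rule borel_measurable_integrable[OF \<xi>int])
  have rhs_m: "nls_rhs \<xi> lam g \<in> borel_measurable torus" if g: "g \<in> borel_measurable torus" for g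
  proof -
    have n: "(\<lambda>x. complex_of_real ((norm (g x))\<^sup>2)) \<in> borel_measurable torus" using g by measurable
    show ?thesis unfolding nls_rhs_def[abs_def]
      by (intro borel_measurable_diff borel_measurable_times xm g n borel_measurable_const)
  qed
  have "AE x in torus. nls_rhs \<xi> lam f x = nls_rhs \<xi> lam w x"
    using fw by eventually_elim (simp add: nls_rhs_def)
  hence "fourier_coeff (nls_rhs \<xi> lam f) = fourier_coeff (nls_rhs \<xi> lam w)"
    by (rule fourier_coeff_cong_AE) (intro rhs_m fm wm)+
  hence "fourier_coeff (nls_rhs \<xi> lam f) k = fourier_coeff (nls_rhs \<xi> lam w) k" by (rule fun_cong)
  also have "\<dots>
     = fourier_coeff (\<lambda>x. of_real (\<xi> x) * w x) k - fourier_coeff (\<lambda>x. of_real lam * (of_real ((norm (w x))\<^sup>2) * w x)) k"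
  proof -
    have "nls_rhs \<xi> lam w = (\<lambda>x. of_real (\<xi> x) * w x - of_real lam * (of_real ((norm (w x))\<^sup>2) * w x))"
      by (rule ext) (simp add: nls_rhs_def mult.assoc)
    moreover have "integrable torus (\<lambda>x. of_real (\<xi> x) * w x)" unfolding w_def
      by (rule integrable_mult_of_coord[OF \<xi>int sigma(1)])
    moreover have "integrable torus (\<lambda>x. of_real lam * (of_real ((norm (w x))\<^sup>2) * w x))" unfolding w_def
      by (intro integrable_mult_right fourier_coeff_cubic(1) sigma)
    ultimately show ?thesis using fourier_coeff_diff by simp
  qed
  also have "fourier_coeff (\<lambda>x. of_real (\<xi> x) * w x) k = conv (coord \<sigma> f) k"
    unfolding w_def conv_def fourier_coeff_mult_of_coord[OF \<xi>int sigma(1)] low_nth[OF sigma(2)] ..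
  also have "fourier_coeff (\<lambda>x. of_real lam * (of_real ((norm (w x))\<^sup>2) * w x)) k = of_real lam * ell2_nth (low \<sigma> (cubic \<sigma> (coord \<sigma> f))) k"
    unfolding w_def fourier_coeff_cmult fourier_coeff_cubic(2)[OF sigma(1)] ..
  finally show ?thesis .
qed

definition rhs_mode :: "int ell2 \<Rightarrow> int \<Rightarrow> complex" where
  "rhs_mode z k = conv z k - of_real lam * ell2_nth (low \<sigma> (cubic \<sigma> z)) k"

lemma rhs_mode_eq: "of_real (jb k powr \<sigma>) * (\<i> * rhs_mode z k) = \<i> * pot_mode k z + ell2_nth (nonlin z) k"
proof -
  have "complex_of_real (jb k powr \<sigma>) * of_real (jb k powr - \<sigma>) = 1"
    by (simp only: of_real_mult[symmetric] jb_cancel of_real_1)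
  hence "of_real (jb k powr \<sigma>) * ell2_nth (low \<sigma> (cubic \<sigma> z)) k = ell2_nth (cubic \<sigma> z) k"
    by (simp add: low_nth[OF sigma(2)] flip: mult.assoc)
  hence "of_real (jb k powr \<sigma>) * (\<i> * rhs_mode z k) = \<i> * (of_real (jb k powr \<sigma>) * conv z k) - \<i> * of_real lam * ell2_nth (cubic \<sigma> z) k"
    by (simp add: rhs_mode_def right_diff_distrib mult_ac)
  thus ?thesis by (simp add: pot_mode_def nonlin_def scaleR_conv_of_real mult_ac)
qed

lemma nonlin_continuous: "continuous_on A nonlin"
proof -
  obtain E E' B where "conjugated_evolution E E' B nonlin pot_mode" using conjugated by (elim exE)
  thus ?thesis by (rule conjugated_evolution.N_cont)
qed

lemma rhs_mode_alt: "\<i> * rhs_mode z k = of_real (jb k powr - \<sigma>) * (\<i> * pot_mode k z + ell2_nth (nonlin z) k)"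
proof -
  have "complex_of_real (jb k powr - \<sigma>) * of_real (jb k powr \<sigma>) = 1"
    by (simp only: of_real_mult[symmetric] jb_cancel of_real_1)
  thus ?thesis unfolding rhs_mode_eq[symmetric] by (simp flip: mult.assoc)
qed

lemma rhs_mode_continuous:
  assumes z: "continuous_on A z"
  shows "continuous_on A (\<lambda>t. \<i> * rhs_mode (z t) k)"
  unfolding rhs_mode_alt
  by (intro continuous_intros bounded_linear.continuous_on[OF bounded_linear_pot_mode z]
      bounded_linear.continuous_on[OF bounded_linear_ell2_nth continuous_on_compose2[OF nonlin_continuous[of UNIV] z]]) auto

lemma Ct_Sobolev_iff: "u \<in> Ct_Sobolev I \<sigma> \<longleftrightarrow> (\<forall>t\<in>I. u t \<in> Sobolev_space \<sigma>) \<and> continuous_on I (\<lambda>t. coord \<sigma> (u t))"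
proof -
  have "((\<lambda>r. Sobolev_dist \<sigma> (u r) (u t)) \<longlongrightarrow> 0) (at t within I) \<longleftrightarrow> ((\<lambda>r. coord \<sigma> (u r)) \<longlongrightarrow> coord \<sigma> (u t)) (at t within I)"
    if S: "\<forall>t\<in>I. u t \<in> Sobolev_space \<sigma>" and t: "t \<in> I" for t
  proof -
    have "\<forall>\<^sub>F r in at t within I. Sobolev_dist \<sigma> (u r) (u t) = norm (coord \<sigma> (u r) - coord \<sigma> (u t))"
      unfolding eventually_at_filter using S t by (intro always_eventually) (auto simp: Sobolev_dist_coord)
    hence "((\<lambda>r. Sobolev_dist \<sigma> (u r) (u t)) \<longlongrightarrow> 0) (at t within I) \<longleftrightarrow> ((\<lambda>r. norm (coord \<sigma> (u r) - coord \<sigma> (u t))) \<longlongrightarrow> 0) (at t within I)"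
      by (rule tendsto_cong)
    also have "\<dots> \<longleftrightarrow> ((\<lambda>r. coord \<sigma> (u r)) \<longlongrightarrow> coord \<sigma> (u t)) (at t within I)"
      by (simp add: tendsto_norm_zero_iff LIM_zero_iff)
    finally show ?thesis .
  qed
  thus ?thesis unfolding Ct_Sobolev_def continuous_on_def by blast
qed

text \<open>Along a continuous curve in H^\<sigma> every mode of the right-hand side is continuous
  in time, which yields the integrability clause of \<open>duhamel\<close>. The factor \<i> is moved
  under the integral.\<close>

lemma duhamel_iff:
  assumes S: "\<And>\<rho>. \<rho> \<in> {0..t} \<Longrightarrow> u \<rho> \<in> Sobolev_space \<sigma>" and u0: "u0 \<in> Sobolev_space \<sigma>"
    and c: "continuous_on {0..t} (\<lambda>\<rho>. coord \<sigma> (u \<rho>))"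
  shows "duhamel \<xi> lam u0 u t \<longleftrightarrow>
     (\<forall>k. fourier_coeff (u t) k = cis (- (t * (of_int k)\<^sup>2)) * fourier_coeff u0 k +
        integral {0..t} (\<lambda>\<rho>. cis (- ((t - \<rho>) * (of_int k)\<^sup>2)) * (\<i> * rhs_mode (coord \<sigma> (u \<rho>)) k)))"
proof -
  have eq: "schroedinger_group (t - \<rho>) (fourier_coeff (nls_rhs \<xi> lam (u \<rho>))) k
      = - \<i> * (cis (- ((t - \<rho>) * (of_int k)\<^sup>2)) * (\<i> * rhs_mode (coord \<sigma> (u \<rho>)) k))" if "\<rho> \<in> {0..t}" for \<rho> k
  proof -
    have "c * y = - \<i> * (c * (\<i> * y))" for c y by (simp add: complex_eq_iff algebra_simps)
    thus ?thesis unfolding schroedinger_group_def fourier_coeff_nls_rhs[OF S[OF that]] rhs_mode_def .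
  qed
  have cont: "continuous_on {0..t} (\<lambda>\<rho>. cis (- ((t - \<rho>) * (of_int k)\<^sup>2)) * (\<i> * rhs_mode (coord \<sigma> (u \<rho>)) k))" for k
    by (intro continuous_intros rhs_mode_continuous[OF c])
  have ai: "(\<lambda>\<rho>. schroedinger_group (t - \<rho>) (fourier_coeff (nls_rhs \<xi> lam (u \<rho>))) k) absolutely_integrable_on {0..t}" for k
  proof -
    have "continuous_on {0..t} (\<lambda>\<rho>. - \<i> * (cis (- ((t - \<rho>) * (of_int k)\<^sup>2)) * (\<i> * rhs_mode (coord \<sigma> (u \<rho>)) k)))"
      by (intro continuous_intros cont)
    hence "continuous_on {0..t} (\<lambda>\<rho>. schroedinger_group (t - \<rho>) (fourier_coeff (nls_rhs \<xi> lam (u \<rho>))) k)"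
      by (rule continuous_on_eq) (simp add: eq)
    thus ?thesis by (rule absolutely_integrable_continuous_real)
  qed
  have "\<i> * integral {0..t} (\<lambda>\<rho>. schroedinger_group (t - \<rho>) (fourier_coeff (nls_rhs \<xi> lam (u \<rho>))) k)
     = integral {0..t} (\<lambda>\<rho>. cis (- ((t - \<rho>) * (of_int k)\<^sup>2)) * (\<i> * rhs_mode (coord \<sigma> (u \<rho>)) k))" for k
  proof -
    have "integral {0..t} (\<lambda>\<rho>. schroedinger_group (t - \<rho>) (fourier_coeff (nls_rhs \<xi> lam (u \<rho>))) k)
       = integral {0..t} (\<lambda>\<rho>. - \<i> * (cis (- ((t - \<rho>) * (of_int k)\<^sup>2)) * (\<i> * rhs_mode (coord \<sigma> (u \<rho>)) k)))"
      by (rule integral_cong) (rule eq)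
    also have "\<dots> = - \<i> * integral {0..t} (\<lambda>\<rho>. cis (- ((t - \<rho>) * (of_int k)\<^sup>2)) * (\<i> * rhs_mode (coord \<sigma> (u \<rho>)) k))"
      by (rule integral_mult_right)
    finally show ?thesis by (simp flip: mult.assoc)
  qed
  thus ?thesis unfolding duhamel_def using ai by (simp add: schroedinger_group_def)
qed

text \<open>Change of weights between plain Fourier coefficients, in which Duhamel's formula is
  stated, and coordinates at level \<sigma>, in which \<open>mode_solution\<close> is
  stated.\<close>

lemma mode_integral:
  assumes c: "continuous_on {0..t} z"
  shows "of_real (jb k powr \<sigma>) * integral {0..t} (\<lambda>\<rho>. \<i> * rhs_mode (z \<rho>) k - \<i> * of_real ((of_int k)\<^sup>2) * ell2_nth (low \<sigma> (z \<rho>)) k)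
    = integral {0..t} (\<lambda>\<rho>. \<i> * (- of_real ((of_int k)\<^sup>2) * ell2_nth (z \<rho>) k + pot_mode k (z \<rho>)) + ell2_nth (nonlin (z \<rho>)) k)"
proof -
  have one: "complex_of_real (jb k powr \<sigma>) * of_real (jb k powr - \<sigma>) = 1"
    by (simp only: of_real_mult[symmetric] jb_cancel of_real_1)
  have "of_real (jb k powr \<sigma>) * integral {0..t} (\<lambda>\<rho>. \<i> * rhs_mode (z \<rho>) k - \<i> * of_real ((of_int k)\<^sup>2) * ell2_nth (low \<sigma> (z \<rho>)) k)
     = integral {0..t} (\<lambda>\<rho>. of_real (jb k powr \<sigma>) * (\<i> * rhs_mode (z \<rho>) k - \<i> * of_real ((of_int k)\<^sup>2) * ell2_nth (low \<sigma> (z \<rho>)) k))"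
    by (rule integral_mult_right[symmetric])
  also have "\<dots> = integral {0..t} (\<lambda>\<rho>. \<i> * (- of_real ((of_int k)\<^sup>2) * ell2_nth (z \<rho>) k + pot_mode k (z \<rho>)) + ell2_nth (nonlin (z \<rho>)) k)"
  proof (rule integral_cong)
    fix \<rho>
    have "of_real (jb k powr \<sigma>) * (\<i> * rhs_mode (z \<rho>) k - \<i> * of_real ((of_int k)\<^sup>2) * ell2_nth (low \<sigma> (z \<rho>)) k)
      = of_real (jb k powr \<sigma>) * (\<i> * rhs_mode (z \<rho>) k) - \<i> * of_real ((of_int k)\<^sup>2) * ((of_real (jb k powr \<sigma>) * of_real (jb k powr - \<sigma>)) * ell2_nth (z \<rho>) k)"
      by (simp only: low_nth[OF sigma(2)] right_diff_distrib mult_ac)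
    thus "of_real (jb k powr \<sigma>) * (\<i> * rhs_mode (z \<rho>) k - \<i> * of_real ((of_int k)\<^sup>2) * ell2_nth (low \<sigma> (z \<rho>)) k)
      = \<i> * (- of_real ((of_int k)\<^sup>2) * ell2_nth (z \<rho>) k + pot_mode k (z \<rho>)) + ell2_nth (nonlin (z \<rho>)) k"
      unfolding one rhs_mode_eq by (simp add: algebra_simps)
  qed
  finally show ?thesis .
qed

text \<open>Every strong solution, not only a constructed one, satisfies the integrated mode
  equations. Uniqueness and maximality are reduced to these.\<close>

lemma strong_imp_mode:
  assumes I: "time_interval I" and u0: "u0 \<in> Sobolev_space \<sigma>" and u: "strong_solution \<xi> lam \<sigma> u0 I u"
  shows "mode_solution pot_mode nonlin (coord \<sigma> u0) I (\<lambda>t. coord \<sigma> (u t))"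
proof -
  have S: "\<And>t. t \<in> I \<Longrightarrow> u t \<in> Sobolev_space \<sigma>" and c: "continuous_on I (\<lambda>t. coord \<sigma> (u t))"
    and d: "\<And>t. t \<in> I \<Longrightarrow> duhamel \<xi> lam u0 u t"
    using u by (auto simp: strong_solution_def Ct_Sobolev_iff)
  have sub: "{0..t} \<subseteq> I" "0 \<le> t" if "t \<in> I" for t
    using I that unfolding time_interval_def is_interval_1 by auto
  show ?thesis unfolding mode_solution_def
  proof (intro conjI c ballI allI)
    fix t k assume t: "t \<in> I"
    let ?w = "(of_int k :: real)\<^sup>2"
    have ct: "continuous_on {0..t} (\<lambda>t. coord \<sigma> (u t))" by (rule continuous_on_subset[OF c sub(1)[OF t]])
    have f: "fourier_coeff (u r) k = cis (- (r * ?w)) * (fourier_coeff u0 k + integral {0..r} (\<lambda>\<rho>. cis (\<rho> * ?w) * (\<i> * rhs_mode (coord \<sigma> (u \<rho>)) k)))"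
      if r: "r \<in> {0..t}" for r
    proof -
      have rI: "r \<in> I" using r sub(1)[OF t] by blast
      have "fourier_coeff (u r) k = cis (- (r * ?w)) * fourier_coeff u0 k +
        integral {0..r} (\<lambda>\<rho>. cis (- ((r - \<rho>) * ?w)) * (\<i> * rhs_mode (coord \<sigma> (u \<rho>)) k))"
        by (rule duhamel_iff[THEN iffD1, rule_format, OF _ u0 _ d[OF rI]])
           (use S sub(1)[OF rI] continuous_on_subset[OF c sub(1)[OF rI]] in auto)
      also have "integral {0..r} (\<lambda>\<rho>. cis (- ((r - \<rho>) * ?w)) * (\<i> * rhs_mode (coord \<sigma> (u \<rho>)) k))
        = integral {0..r} (\<lambda>\<rho>. cis (- (r * ?w)) * (cis (\<rho> * ?w) * (\<i> * rhs_mode (coord \<sigma> (u \<rho>)) k)))"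
      proof (rule integral_cong)
        fix \<rho>
        have "cis (- ((r - \<rho>) * ?w)) = cis (- (r * ?w)) * cis (\<rho> * ?w)" by (simp add: cis_mult algebra_simps)
        thus "cis (- ((r - \<rho>) * ?w)) * (\<i> * rhs_mode (coord \<sigma> (u \<rho>)) k) = cis (- (r * ?w)) * (cis (\<rho> * ?w) * (\<i> * rhs_mode (coord \<sigma> (u \<rho>)) k))"
          by (simp only: mult.assoc)
      qed
      also have "\<dots> = cis (- (r * ?w)) * integral {0..r} (\<lambda>\<rho>. cis (\<rho> * ?w) * (\<i> * rhs_mode (coord \<sigma> (u \<rho>)) k))"
        by (rule integral_mult_right)
      finally show ?thesis by (simp only: distrib_left)
    qed
    have "((\<lambda>\<rho>. \<i> * rhs_mode (coord \<sigma> (u \<rho>)) k - \<i> * of_real ?w * fourier_coeff (u \<rho>) k) has_integral (fourier_coeff (u t) k - fourier_coeff u0 k)) {0..t}"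
      by (rule Duhamel_iff_integrated[OF rhs_mode_continuous[OF ct] sub(2)[OF t] f])
    hence "fourier_coeff (u t) k - fourier_coeff u0 k = integral {0..t} (\<lambda>\<rho>. \<i> * rhs_mode (coord \<sigma> (u \<rho>)) k - \<i> * of_real ?w * fourier_coeff (u \<rho>) k)"
      by (rule integral_unique[symmetric])
    also have "\<dots> = integral {0..t} (\<lambda>\<rho>. \<i> * rhs_mode (coord \<sigma> (u \<rho>)) k - \<i> * of_real ?w * ell2_nth (low \<sigma> (coord \<sigma> (u \<rho>))) k)"
      by (rule integral_cong) (use S sub(1)[OF t] in \<open>auto simp: fourier_coeff_eq_low_coord[OF sigma(2)]\<close>)
    finally have "of_real (jb k powr \<sigma>) * (fourier_coeff (u t) k - fourier_coeff u0 k)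
       = integral {0..t} (\<lambda>\<rho>. \<i> * (- of_real ((of_int k)\<^sup>2) * ell2_nth (coord \<sigma> (u \<rho>)) k + pot_mode k (coord \<sigma> (u \<rho>))) + ell2_nth (nonlin (coord \<sigma> (u \<rho>))) k)"
      by (simp only: mode_integral[OF ct])
    thus "ell2_nth (coord \<sigma> (u t)) k = ell2_nth (coord \<sigma> u0) k + integral {0..t} (\<lambda>\<rho>. \<i> * (- of_real ((of_int k)\<^sup>2) * ell2_nth (coord \<sigma> (u \<rho>)) k + pot_mode k (coord \<sigma> (u \<rho>))) + ell2_nth (nonlin (coord \<sigma> (u \<rho>))) k)"
      by (simp only: coord_nth[OF S[OF t]] coord_nth[OF u0] right_diff_distrib diff_eq_eq add.commute)
  qed
qed

lemma mode_imp_strong: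
  assumes I: "time_interval I" and u0: "u0 \<in> Sobolev_space \<sigma>" and z: "mode_solution pot_mode nonlin (coord \<sigma> u0) I z"
  shows "strong_solution \<xi> lam \<sigma> u0 I (\<lambda>t. of_coord \<sigma> (z t))"
proof -
  note oc = of_coord_in_Sobolev_space[OF sigma(1)]
  have c: "continuous_on I z" using z by (simp add: mode_solution_def)
  have sub: "{0..t} \<subseteq> I" "0 \<le> t" if "t \<in> I" for t
    using I that unfolding time_interval_def is_interval_1 by auto
  have coeff: "fourier_coeff (of_coord \<sigma> y) k = ell2_nth (low \<sigma> y) k" for y k
    using fourier_coeff_eq_low_coord[OF sigma(2) oc(1)[of y], of k] oc(2)[of y] by simp
  have "duhamel \<xi> lam u0 (\<lambda>t. of_coord \<sigma> (z t)) t" if t: "t \<in> I" for t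
  proof -
    have ct: "continuous_on {0..t} z" by (rule continuous_on_subset[OF c sub(1)[OF t]])
    have lc: "continuous_on {0..t} (\<lambda>t. ell2_nth (low \<sigma> (z t)) k)" for k
      by (rule bounded_linear.continuous_on[OF bounded_linear_ell2_nth bounded_linear.continuous_on[OF bounded_linear_low[OF sigma(2)] ct]])
    have eq: "ell2_nth (low \<sigma> (z r)) k = fourier_coeff u0 k + integral {0..r} (\<lambda>\<rho>. \<i> * rhs_mode (z \<rho>) k - \<i> * of_real ((of_int k)\<^sup>2) * ell2_nth (low \<sigma> (z \<rho>)) k)"
      if r: "r \<in> {0..t}" for r k
    proof -
      have rI: "r \<in> I" using r sub(1)[OF t] by blast
      have cr: "continuous_on {0..r} z" by (rule continuous_on_subset[OF c sub(1)[OF rI]])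
      have one: "complex_of_real (jb k powr - \<sigma>) * of_real (jb k powr \<sigma>) = 1"
        by (simp only: of_real_mult[symmetric] jb_cancel of_real_1)
      have "ell2_nth (z r) k = ell2_nth (coord \<sigma> u0) k + of_real (jb k powr \<sigma>) * integral {0..r} (\<lambda>\<rho>. \<i> * rhs_mode (z \<rho>) k - \<i> * of_real ((of_int k)\<^sup>2) * ell2_nth (low \<sigma> (z \<rho>)) k)"
        unfolding mode_integral[OF cr] using z rI by (simp add: mode_solution_def)
      hence "ell2_nth (low \<sigma> (z r)) k = (of_real (jb k powr - \<sigma>) * of_real (jb k powr \<sigma>)) * (fourier_coeff u0 k + integral {0..r} (\<lambda>\<rho>. \<i> * rhs_mode (z \<rho>) k - \<i> * of_real ((of_int k)\<^sup>2) * ell2_nth (low \<sigma> (z \<rho>)) k))"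
        by (simp only: low_nth[OF sigma(2), of "z r"] coord_nth[OF u0] distrib_left mult.assoc)
      thus ?thesis by (simp only: one mult_1)
    qed
    show ?thesis
    proof (rule duhamel_iff[THEN iffD2])
      show "\<forall>k. fourier_coeff (of_coord \<sigma> (z t)) k = cis (- (t * (of_int k)\<^sup>2)) * fourier_coeff u0 k +
        integral {0..t} (\<lambda>\<rho>. cis (- ((t - \<rho>) * (of_int k)\<^sup>2)) * (\<i> * rhs_mode (coord \<sigma> (of_coord \<sigma> (z \<rho>))) k))"
        unfolding oc(2) coeff
        by (intro allI integrated_imp_Duhamel[OF rhs_mode_continuous[OF ct] lc sub(2)[OF t]] eq)
    qed (use oc u0 ct in auto)
  qed
  thus ?thesis unfolding strong_solution_def Ct_Sobolev_iff using oc c by simp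
qed

theorem well_posed: "locally_well_posed \<xi> lam \<sigma>"
proof -
  obtain E E' B where "conjugated_evolution E E' B nonlin pot_mode" using conjugated by (elim exE)
  then interpret conjugated_evolution E E' B nonlin pot_mode .
  note oc = of_coord_in_Sobolev_space[OF sigma(1)]
  have ti: "time_interval (existence_interval (life_span z))" for z
    unfolding time_interval_def is_interval_1 existence_interval_def
    using life_span_pos[of z] by (auto simp: zero_ereal_def order_le_less_trans[of "ereal _" "ereal _"])
  have "unconditional_uniqueness \<xi> lam \<sigma>"
    unfolding unconditional_uniqueness_def
  proof (intro ballI allI impI, elim conjE)
    fix u0 I u v t
    assume u0: "u0 \<in> Sobolev_space \<sigma>" and I: "time_interval I" and u: "strong_solution \<xi> lam \<sigma> u0 I u"
      and v: "strong_solution \<xi> lam \<sigma> u0 I v" and t: "t \<in> I"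
    have sub: "{0..t} \<subseteq> I" "0 \<le> t" using I t unfolding time_interval_def is_interval_1 by auto
    have "coord \<sigma> (u t) = coord \<sigma> (v t)"
      by (rule mode_solution_unique[OF sub(2) mode_solution_subset[OF strong_imp_mode[OF I u0 u] sub(1)] mode_solution_subset[OF strong_imp_mode[OF I u0 v] sub(1)]])
    moreover have "u t \<in> Sobolev_space \<sigma>" "v t \<in> Sobolev_space \<sigma>"
      using u v t by (auto simp: strong_solution_def Ct_Sobolev_iff)
    ultimately show "AE x in torus. u t x = v t x"
      by (intro AE_eq_of_coeff_eq Sobolev_space_integrable) (auto simp: fourier_coeff_eq_low_coord[OF sigma(2)])
  qed
  moreover have "maximal_solution_map \<xi> lam \<sigma> (\<lambda>u0. life_span (coord \<sigma> u0)) (\<lambda>u0 t. of_coord \<sigma> (flow (coord \<sigma> u0) t))"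
    unfolding maximal_solution_map_def
  proof (intro ballI conjI allI impI, goal_cases)
    case (1 u0)
    show ?case by (rule life_span_pos)
  next
    case (2 u0)
    show ?case by (rule mode_imp_strong[OF ti 2 flow_mode_solution])
  next
    case (3 u0 I v)
    show ?case by (rule mode_solution_within_life_span) (use 3 strong_imp_mode in auto)
  qed
  moreover have "continuous_solution_map \<sigma> (\<lambda>u0. life_span (coord \<sigma> u0)) (\<lambda>u0 t. of_coord \<sigma> (flow (coord \<sigma> u0) t))"
    unfolding continuous_solution_map_def
  proof (intro ballI allI impI)
    fix u0 t and e :: real
    assume u0: "u0 \<in> Sobolev_space \<sigma>" and t: "t \<in> existence_interval (life_span (coord \<sigma> u0))" and e: "0 < e"
    obtain d where d: "0 < d" "\<And>w0. norm (w0 - coord \<sigma> u0) < d \<Longrightarrow> t \<in> existence_interval (life_span w0) \<and> norm (flow w0 t - flow (coord \<sigma> u0) t) < e"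
      using flow_continuous[OF t e] by blast
    show "\<exists>\<delta>>0. \<forall>v0\<in>Sobolev_space \<sigma>. Sobolev_dist \<sigma> v0 u0 < \<delta> \<longrightarrow> t \<in> existence_interval (life_span (coord \<sigma> v0)) \<and>
        Sobolev_dist \<sigma> (of_coord \<sigma> (flow (coord \<sigma> v0) t)) (of_coord \<sigma> (flow (coord \<sigma> u0) t)) < e"
    proof (intro exI[of _ d] conjI ballI impI d(1), goal_cases)
      case (1 v0)
      thus ?case using d(2)[of "coord \<sigma> v0"] u0 by (simp add: Sobolev_dist_coord)
    next
      case (2 v0)
      have "norm (coord \<sigma> v0 - coord \<sigma> u0) < d" using 2 u0 by (simp add: Sobolev_dist_coord)
      thus ?case unfolding Sobolev_dist_coord[OF oc(1) oc(1)] oc(2) using d(2) by blast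
    qed
  qed
  ultimately show ?thesis unfolding locally_well_posed_def by blast
qed

end

theorem theorem1p2:
  fixes lam s p p' \<gamma> :: real and \<xi> :: "real \<Rightarrow> real"
  assumes "0 \<le> s"
    and "2 \<le> p"
    and "1 / p + 1 / p' = 1"
    and "\<gamma> = 3 / 2 + 1 / p"
    and "(\<lambda>x. complex_of_real (\<xi> x)) \<in> Sobolev_space_Lr s p'"
  shows "locally_well_posed \<xi> lam (s + \<gamma>)"
proof -
  have inv: "1 / p \<le> 1/2" "0 < 1 / p" using assms(2) by (auto simp: field_simps)
  have q1: "1 / p' < 1" "0 < 1 / p'" using inv assms(3) by linarith+
  hence "0 < p'" by (simp only: zero_less_divide_1_iff)
  with q1 have q: "1 \<le> p'" by (simp add: divide_less_eq)
  \<comment> \<open>The level \<tau> = s - (1/2 - 1/p) exceeds - 1/2 strictly because p is finite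
    and s \<ge> 0.\<close>
  interpret nls_potential \<xi> "s - (1/2 - 1/p)" lam
  proof
    show "integrable torus (\<lambda>x. complex_of_real (\<xi> x))"
      by (rule Lebesgue_space_integrable[OF _ q]) (use assms(5) in \<open>simp add: Sobolev_space_Lr_def\<close>)
    show "l2_bounded (\<lambda>m. jb m powr (s - (1/2 - 1/p)) * norm (fourier_coeff (\<lambda>x. complex_of_real (\<xi> x)) m))"
      by (rule Sobolev_Lr_coeff_l2_bounded[OF assms(2,3,1,5)])
    show "- 1/2 < s - (1/2 - 1/p)" using assms(1) inv by linarith
  qed
  have "s - (1/2 - 1/p) + 2 = s + \<gamma>" by (simp add: assms(4))
  with well_posed show ?thesis by (simp only:)
qed

end
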